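(* Let $m,n$ be positive integers and $\check G=\mathrm{GL}_n\times\mathrm{GL}_m$. Let $\mathrm{Wh}_{\check G}=\mathrm{GL}_n\times\mathrm{GL}_m\times\mathcal S_n\times\mathcal S_m$, let $\sigma_\rho:\mathrm{Wh}_{\check G}\dashrightarrow\mathrm{Wh}_{\check G}$ be the birational automorphism $$\sigma_\rho(g,h,C_p,C_q)=\bigl(g\,q(C_p),\ (-1)^n h\,p(C_q)^{-1},\ C_p,\ C_q\bigr),$$ and let $$\mathcal A_\sigma=\{f\in\mathcal O(\mathrm{Wh}_{\check G}) : \sigma_\rho^*(f)\in\mathcal O(\mathrm{Wh}_{\check G})\}.$$ Then there is an isomorphism of $\check G$-schemes $\mathrm{Spec}(\mathcal A_\sigma)\cong\mathcal M_{(m,n)}$.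
   Context: All varieties are over $\mathbb C$. For a monic polynomial $p=t^n+p_{n-1}t^{n-1}+\dots+p_0\in\mathbb C[t]$, the companion matrix $C_p$ is the $n\times n$ matrix of multiplication by $t$ on $\mathbb C[t]/(p(t))$ in the basis $1,t,\dots,t^{n-1}$ (ones on the subdiagonal, last column $(-p_0,\dots,-p_{n-1})^T$). $\mathcal S_n\subseteq\mathfrak{gl}_n$ denotes the affine space of all companion matrices of monic polynomials of degree $n$; similarly $\mathcal S_m\subseteq\mathfrak{gl}_m$. Points of $\mathrm{Wh}_{\check G}$ are written $(g,h,C_p,C_q)$ with $p,q$ monic of degrees $n$ and $m$; this variety is identified with the Whittaker-twisted cotangent bundle of $\check G/\check U$. The group $\check G$ acts on $\mathrm{Wh}_{\check G}$ by $(g,h)\cdot(g',h',a,b)=(gg',hh',a,b)$; $\sigma_\rho$ is $\check G$-equivariant, and $\mathcal A_\sigma$ carries the induced $\check G$-action. $\mathcal M_{(m,n)}$ (the triangle part) is the set of quintuples of linear maps $(x,y_1,y_2,v,u)$ with $x\in\mathrm{Hom}(\mathbb C^m,\mathbb C^n)$, $y_1\in\mathrm{End}(\mathbb C^n)$, $y_2\in\mathrm{End}(\mathbb C^m)$, $v\in\mathbb C^n$, $u\in(\mathbb C^m)^*$, satisfying $y_1x-xy_2+vu=0$ and: (i) there is no $y_1$-invariant proper subspace $S\subsetneq\mathbb C^n$ with $S\supseteq\mathrm{im}(x)+\mathrm{im}(v)$; (ii) there is no $y_2$-invariant non-zero subspace $S\subseteq\mathbb C^m$ with $S\subseteq\ker(x)\cap\ker(u)$.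 It is known to be a smooth affine symplectic algebraic variety of dimension $m^2+n^2+m+n$. The group $\check G$ acts on it by $$(g,h)\cdot(x,y_1,y_2,v,u)=(gxh^T,\ gy_1g^{-1},\ (h^T)^{-1}y_2h^T,\ gv,\ uh^T),$$ where $(-)^T$ is matrix transposition. *)

theory Defs
  imports
    "HOL-Analysis.Abstract_Topology"
    "HOL-Algebra.QuotRing"
    "Jordan_Normal_Form.Gauss_Jordan_Elimination"
    "Jordan_Normal_Form.Matrix_Kernel"
begin

section \<open>Schemes over the complex numbers\<close>

text \<open>
  A commutative \<open>\<complex>\<close>-algebra is a record of type \<open>(complex, 'a) module\<close>, the type on which
  HOL-Algebra states its locale \<open>algebra\<close>.

  A space ringed in \<open>\<complex>\<close>-algebras consists of a topology, the algebra of sections over each open set,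
  and the restriction maps: \<open>res X U V\<close> takes sections over \<open>U\<close> to sections over \<open>V \<subseteq> U\<close>.
\<close>

record ('p, 's) ringed_space =
  top_of :: "'p topology"
  sect :: "'p set \<Rightarrow> (complex, 's) module"
  res :: "'p set \<Rightarrow> 'p set \<Rightarrow> 's \<Rightarrow> 's"

definition preim :: "('p, 's) ringed_space \<Rightarrow> ('p \<Rightarrow> 'q) \<Rightarrow> 'q set \<Rightarrow> 'p set" where
  "preim X \<phi> V = {x \<in> topspace (top_of X). \<phi> x \<in> V}"

text \<open>
  A map from \<open>X\<close> to \<open>Y\<close> is a pair of a map of points and, for each open \<open>V\<close> of \<open>Y\<close>, a map from the
  sections of \<open>Y\<close> over \<open>V\<close> to the sections of \<open>X\<close> over the preimage of \<open>V\<close>.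
\<close>

type_synonym ('p, 's, 'q, 't) rs_map = "('p \<Rightarrow> 'q) \<times> ('q set \<Rightarrow> 't \<Rightarrow> 's)"

definition rs_comp ::
  "('q, 't) ringed_space \<Rightarrow> ('q, 't, 'r, 'u) rs_map \<Rightarrow> ('p, 's, 'q, 't) rs_map
    \<Rightarrow> ('p, 's, 'r, 'u) rs_map" where
  "rs_comp Y \<Psi> \<Phi> =
     (\<lambda>x. fst \<Psi> (fst \<Phi> x), \<lambda>W s. snd \<Phi> (preim Y (fst \<Psi>) W) (snd \<Psi> W s))"

definition rs_map_eq ::
  "('p, 's) ringed_space \<Rightarrow> ('q, 't) ringed_space \<Rightarrow> ('p, 's, 'q, 't) rs_map
    \<Rightarrow> ('p, 's, 'q, 't) rs_map \<Rightarrow> bool" where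
  "rs_map_eq X Y \<Phi> \<Psi> \<longleftrightarrow>
     (\<forall>x\<in>topspace (top_of X). fst \<Phi> x = fst \<Psi> x) \<and>
     (\<forall>V s. openin (top_of Y) V \<longrightarrow> s \<in> carrier (sect Y V) \<longrightarrow> snd \<Phi> V s = snd \<Psi> V s)"

definition alg_iso :: "(complex, 'a) module \<Rightarrow> (complex, 'b) module \<Rightarrow> ('a \<Rightarrow> 'b) set" where
  "alg_iso A B =
     {h \<in> ring_iso A B. \<forall>c. \<forall>a\<in>carrier A. h (c \<odot>\<^bsub>A\<^esub> a) = c \<odot>\<^bsub>B\<^esub> h a}"

text \<open>
  Isomorphisms of schemes over \<open>\<complex>\<close>: a homeomorphism together with an isomorphism of sheaves of
  \<open>\<complex>\<close>-algebras. The maps which such an isomorphism induces on stalks are isomorphisms, hence local.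
\<close>

definition rs_iso ::
  "('p, 's) ringed_space \<Rightarrow> ('q, 't) ringed_space \<Rightarrow> ('p, 's, 'q, 't) rs_map \<Rightarrow> bool" where
  "rs_iso X Y \<Phi> \<longleftrightarrow>
     homeomorphic_map (top_of X) (top_of Y) (fst \<Phi>) \<and>
     (\<forall>V. openin (top_of Y) V \<longrightarrow> snd \<Phi> V \<in> alg_iso (sect Y V) (sect X (preim X (fst \<Phi>) V))) \<and>
     (\<forall>V W s. openin (top_of Y) V \<longrightarrow> openin (top_of Y) W \<longrightarrow> W \<subseteq> V \<longrightarrow> s \<in> carrier (sect Y V) \<longrightarrow>
        snd \<Phi> W (res Y V W s) = res X (preim X (fst \<Phi>) V) (preim X (fst \<Phi>) W) (snd \<Phi> V s))"

text \<open>
  \<open>\<alpha>\<close> and \<open>\<beta>\<close> give, for each element of the (complex) algebraic group \<open>G\<close>, the automorphism by which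
  it acts.
\<close>

definition equivariantly_isomorphic ::
  "'g set \<Rightarrow> ('p, 's) ringed_space \<Rightarrow> ('g \<Rightarrow> ('p, 's, 'p, 's) rs_map)
    \<Rightarrow> ('q, 't) ringed_space \<Rightarrow> ('g \<Rightarrow> ('q, 't, 'q, 't) rs_map) \<Rightarrow> bool" where
  "equivariantly_isomorphic G X \<alpha> Y \<beta> \<longleftrightarrow>
     (\<exists>\<Phi>. rs_iso X Y \<Phi> \<and>
       (\<forall>g\<in>G. rs_map_eq X Y (rs_comp X \<Phi> (\<alpha> g)) (rs_comp Y (\<beta> g) \<Phi>)))"


section \<open>The spectrum of an algebra\<close>

definition fraction_rel :: "(complex, 'a) module \<Rightarrow> 'a set \<Rightarrow> (('a \<times> 'a) \<times> ('a \<times> 'a)) set" where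
  "fraction_rel A P =
     {((a, s), (b, t)). a \<in> carrier A \<and> b \<in> carrier A \<and> s \<in> carrier A - P \<and> t \<in> carrier A - P \<and>
       (\<exists>u\<in>carrier A - P. u \<otimes>\<^bsub>A\<^esub> (a \<otimes>\<^bsub>A\<^esub> t \<ominus>\<^bsub>A\<^esub> b \<otimes>\<^bsub>A\<^esub> s) = \<zero>\<^bsub>A\<^esub>)}"

definition fraction :: "(complex, 'a) module \<Rightarrow> 'a set \<Rightarrow> 'a \<Rightarrow> 'a \<Rightarrow> ('a \<times> 'a) set" where
  "fraction A P a s = fraction_rel A P `` {(a, s)}"

definition localization ::
  "(complex, 'a) module \<Rightarrow> 'a set \<Rightarrow> (complex, ('a \<times> 'a) set) module" where
  "localization A P =
     \<lparr>carrier = (carrier A \<times> (carrier A - P)) // fraction_rel A P,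
      mult = \<lambda>c d. \<Union>(a, s)\<in>c. \<Union>(b, t)\<in>d. fraction A P (a \<otimes>\<^bsub>A\<^esub> b) (s \<otimes>\<^bsub>A\<^esub> t),
      one = fraction A P \<one>\<^bsub>A\<^esub> \<one>\<^bsub>A\<^esub>,
      zero = fraction A P \<zero>\<^bsub>A\<^esub> \<one>\<^bsub>A\<^esub>,
      add = \<lambda>c d. \<Union>(a, s)\<in>c. \<Union>(b, t)\<in>d.
              fraction A P (a \<otimes>\<^bsub>A\<^esub> t \<oplus>\<^bsub>A\<^esub> b \<otimes>\<^bsub>A\<^esub> s) (s \<otimes>\<^bsub>A\<^esub> t),
      smult = \<lambda>z c. \<Union>(a, s)\<in>c. fraction A P (z \<odot>\<^bsub>A\<^esub> a) s\<rparr>"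

definition spec_topology :: "(complex, 'a) module \<Rightarrow> 'a set topology" where
  "spec_topology A = topology (\<lambda>U. \<exists>S\<subseteq>carrier A. U = {P. primeideal P A \<and> \<not> S \<subseteq> P})"

definition spec_sections :: "(complex, 'a) module \<Rightarrow> 'a set set \<Rightarrow> ('a set \<Rightarrow> ('a \<times> 'a) set) set" where
  "spec_sections A U =
     {s \<in> (\<Pi>\<^sub>E P\<in>U. carrier (localization A P)).
        \<forall>P\<in>U. \<exists>V a f. openin (spec_topology A) V \<and> P \<in> V \<and> V \<subseteq> U \<and> a \<in> carrier A \<and> f \<in> carrier A \<and>
          (\<forall>Q\<in>V. f \<notin> Q \<and> s Q = fraction A Q a f)}"

definition Spec :: "(complex, 'a) module \<Rightarrow> ('a set, 'a set \<Rightarrow> ('a \<times> 'a) set) ringed_space" where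
  "Spec A =
     \<lparr>top_of = spec_topology A,
      sect = \<lambda>U.
        \<lparr>carrier = spec_sections A U,
         mult = \<lambda>s t. \<lambda>P\<in>U. s P \<otimes>\<^bsub>localization A P\<^esub> t P,
         one = \<lambda>P\<in>U. \<one>\<^bsub>localization A P\<^esub>,
         zero = \<lambda>P\<in>U. \<zero>\<^bsub>localization A P\<^esub>,
         add = \<lambda>s t. \<lambda>P\<in>U. s P \<oplus>\<^bsub>localization A P\<^esub> t P,
         smult = \<lambda>z s. \<lambda>P\<in>U. z \<odot>\<^bsub>localization A P\<^esub> s P\<rparr>,
      res = \<lambda>U V s. restrict s V\<rparr>"

text \<open>The map \<open>Spec B \<rightarrow> Spec A\<close> induced by an algebra homomorphism \<open>\<theta> : A \<rightarrow> B\<close>.\<close>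

definition Spec_map ::
  "(complex, 'a) module \<Rightarrow> (complex, 'b) module \<Rightarrow> ('a \<Rightarrow> 'b)
    \<Rightarrow> ('b set, 'b set \<Rightarrow> ('b \<times> 'b) set, 'a set, 'a set \<Rightarrow> ('a \<times> 'a) set) rs_map" where
  "Spec_map A B \<theta> =
     (let \<phi> = (\<lambda>Q. {a \<in> carrier A. \<theta> a \<in> Q}) in
       (\<phi>, \<lambda>V s. \<lambda>Q\<in>preim (Spec B) \<phi> V. \<Union>(a, t)\<in>s (\<phi> Q). fraction B Q (\<theta> a) (\<theta> t)))"


section \<open>Varieties and their associated schemes\<close>

text \<open>
  A variety is given by its set of points inside an ambient affine space, together with the
  coordinate functions of that space. All sets of points below are locally closed; the regular
  functions are those of a quasi-affine variety.
\<close>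

record 'a variety =
  coords :: "('a \<Rightarrow> complex) set"
  points :: "'a set"

inductive_set poly_funs :: "('a \<Rightarrow> complex) set \<Rightarrow> ('a \<Rightarrow> complex) set"
  for K :: "('a \<Rightarrow> complex) set" where
  const: "(\<lambda>_. c) \<in> poly_funs K"
| coord: "f \<in> K \<Longrightarrow> f \<in> poly_funs K"
| add: "f \<in> poly_funs K \<Longrightarrow> g \<in> poly_funs K \<Longrightarrow> (\<lambda>x. f x + g x) \<in> poly_funs K"
| mult: "f \<in> poly_funs K \<Longrightarrow> g \<in> poly_funs K \<Longrightarrow> (\<lambda>x. f x * g x) \<in> poly_funs K"

definition zariski :: "'a variety \<Rightarrow> 'a topology" where
  "zariski X =
     topology (\<lambda>U. \<exists>S\<subseteq>poly_funs (coords X). U = {x \<in> points X. \<exists>f\<in>S. f x \<noteq> 0})"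

definition regular_funs :: "'a variety \<Rightarrow> 'a set \<Rightarrow> ('a \<Rightarrow> complex) set" where
  "regular_funs X U =
     {f \<in> extensional U.
        \<forall>x\<in>U. \<exists>V. openin (zariski X) V \<and> x \<in> V \<and> V \<subseteq> U \<and>
          (\<exists>a\<in>poly_funs (coords X). \<exists>b\<in>poly_funs (coords X).
             \<forall>y\<in>V. b y \<noteq> 0 \<and> f y = a y / b y)}"

definition fun_algebra :: "'a set \<Rightarrow> ('a \<Rightarrow> complex) set \<Rightarrow> (complex, 'a \<Rightarrow> complex) module" where
  "fun_algebra U F =
     \<lparr>carrier = F,
      mult = \<lambda>f g. \<lambda>x\<in>U. f x * g x,
      one = \<lambda>x\<in>U. 1,
      zero = \<lambda>x\<in>U. 0,
      add = \<lambda>f g. \<lambda>x\<in>U. f x + g x,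
      smult = \<lambda>c f. \<lambda>x\<in>U. c * f x\<rparr>"

text \<open>
  The scheme associated with a variety: its points are the irreducible closed subsets of the variety,
  its open sets correspond to those of the variety, and its structure sheaf is the direct image of the
  sheaf of regular functions under the map sending a point of the variety to its closure.
\<close>

definition irreducible_closed :: "'a topology \<Rightarrow> 'a set \<Rightarrow> bool" where
  "irreducible_closed T Z \<longleftrightarrow> closedin T Z \<and> Z \<noteq> {} \<and>
     (\<forall>C D. closedin T C \<longrightarrow> closedin T D \<longrightarrow> Z = C \<union> D \<longrightarrow> Z = C \<or> Z = D)"

definition sober_topology :: "'a topology \<Rightarrow> 'a set topology" where
  "sober_topology T =
     topology (\<lambda>W. \<exists>U. openin T U \<and> W = {Z. irreducible_closed T Z \<and> Z \<inter> U \<noteq> {}})"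

definition trace_on :: "'a variety \<Rightarrow> 'a set set \<Rightarrow> 'a set" where
  "trace_on X W = {x \<in> points X. Abstract_Topology.closure_of (zariski X) {x} \<in> W}"

definition scheme_of :: "'a variety \<Rightarrow> ('a set, 'a \<Rightarrow> complex) ringed_space" where
  "scheme_of X =
     \<lparr>top_of = sober_topology (zariski X),
      sect = \<lambda>W. fun_algebra (trace_on X W) (regular_funs X (trace_on X W)),
      res = \<lambda>W W' f. restrict f (trace_on X W')\<rparr>"

definition scheme_map_of ::
  "'a variety \<Rightarrow> 'b variety \<Rightarrow> ('a \<Rightarrow> 'b) \<Rightarrow> ('a set, 'a \<Rightarrow> complex, 'b set, 'b \<Rightarrow> complex) rs_map" where
  "scheme_map_of X Y \<psi> =
     (\<lambda>Z. Abstract_Topology.closure_of (zariski Y) (\<psi> ` Z),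
      \<lambda>W f. \<lambda>x\<in>{x \<in> points X. \<psi> x \<in> trace_on Y W}. f (\<psi> x))"


section \<open>The variety Wh, the birational map and its algebra\<close>

definition entries :: "nat \<Rightarrow> nat \<Rightarrow> ('a \<Rightarrow> complex mat) \<Rightarrow> ('a \<Rightarrow> complex) set" where
  "entries r c \<pi> = {\<lambda>x. \<pi> x $$ (i, j) | i j. i < r \<and> j < c}"

definition GL :: "nat \<Rightarrow> complex mat set" where
  "GL n = {g \<in> carrier_mat n n. invertible_mat g}"

abbreviation inv_mat :: "complex mat \<Rightarrow> complex mat" where
  "inv_mat g \<equiv> the (mat_inverse g)"

definition companion_mat :: "nat \<Rightarrow> complex poly \<Rightarrow> complex mat" where
  "companion_mat n p =
     mat n n (\<lambda>(i, j). if j = n - 1 then - coeff p i else if i = Suc j then 1 else 0)"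

definition monic_polys :: "nat \<Rightarrow> complex poly set" where
  "monic_polys n = {p. lead_coeff p = 1 \<and> degree p = n}"

definition companion_space :: "nat \<Rightarrow> complex mat set" where
  "companion_space n = companion_mat n ` monic_polys n"

definition poly_of_companion :: "nat \<Rightarrow> complex mat \<Rightarrow> complex poly" where
  "poly_of_companion n = the_inv_into (monic_polys n) (companion_mat n)"

definition eval_poly_mat :: "nat \<Rightarrow> complex poly \<Rightarrow> complex mat \<Rightarrow> complex mat" where
  "eval_poly_mat n p A =
     mat n n (\<lambda>(i, j). \<Sum>k\<le>degree p. coeff p k * (A ^\<^sub>m k) $$ (i, j))"

type_synonym wh_point = "complex mat \<times> complex mat \<times> complex mat \<times> complex mat"

definition Wh :: "nat \<Rightarrow> nat \<Rightarrow> wh_point variety" where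
  "Wh n m =
     \<lparr>coords = entries n n (\<lambda>(g, h, a, b). g) \<union> entries m m (\<lambda>(g, h, a, b). h) \<union>
               entries n n (\<lambda>(g, h, a, b). a) \<union> entries m m (\<lambda>(g, h, a, b). b),
      points = GL n \<times> GL m \<times> companion_space n \<times> companion_space m\<rparr>"

fun sigma_rho :: "nat \<Rightarrow> nat \<Rightarrow> wh_point \<Rightarrow> wh_point" where
  "sigma_rho n m (g, h, a, b) =
     (let p = poly_of_companion n a; q = poly_of_companion m b in
       (g * eval_poly_mat n q a,
        (-1) ^ n \<cdot>\<^sub>m (h * inv_mat (eval_poly_mat m p b)),
        a, b))"

text \<open>
  The dense open subset on which \<open>sigma_rho\<close> is defined as a map into \<open>Wh\<close>. Each of the two
  conditions says that the two polynomials are coprime.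
\<close>

definition sigma_dom :: "nat \<Rightarrow> nat \<Rightarrow> wh_point set" where
  "sigma_dom n m =
     {(g, h, a, b) \<in> points (Wh n m).
        invertible_mat (eval_poly_mat n (poly_of_companion m b) a) \<and>
        invertible_mat (eval_poly_mat m (poly_of_companion n a) b)}"

text \<open>
  The pullback of \<open>f\<close> is a rational function; it is regular if it is the restriction to \<open>sigma_dom\<close>
  of a regular function \<open>F\<close> on \<open>Wh\<close>.
\<close>

definition A_sigma :: "nat \<Rightarrow> nat \<Rightarrow> (complex, wh_point \<Rightarrow> complex) module" where
  "A_sigma n m =
     fun_algebra (points (Wh n m))
       {f \<in> regular_funs (Wh n m) (points (Wh n m)).
          \<exists>F\<in>regular_funs (Wh n m) (points (Wh n m)). \<forall>w\<in>sigma_dom n m. F w = f (sigma_rho n m w)}"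

fun wh_act :: "complex mat \<times> complex mat \<Rightarrow> wh_point \<Rightarrow> wh_point" where
  "wh_act (g, h) (g', h', a, b) = (g * g', h * h', a, b)"

text \<open>
  A group element acts on the spectrum through the pullback of functions along its action on \<open>Wh\<close>
  (not along that of its inverse), which makes this a left action.
\<close>

definition spec_act ::
  "nat \<Rightarrow> nat \<Rightarrow> complex mat \<times> complex mat
    \<Rightarrow> ((wh_point \<Rightarrow> complex) set,
        (wh_point \<Rightarrow> complex) set \<Rightarrow> ((wh_point \<Rightarrow> complex) \<times> (wh_point \<Rightarrow> complex)) set,
        (wh_point \<Rightarrow> complex) set,
        (wh_point \<Rightarrow> complex) set \<Rightarrow> ((wh_point \<Rightarrow> complex) \<times> (wh_point \<Rightarrow> complex)) set) rs_map" where
  "spec_act n m \<gamma> =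
     Spec_map (A_sigma n m) (A_sigma n m) (\<lambda>f. \<lambda>w\<in>points (Wh n m). f (wh_act \<gamma> w))"


section \<open>The triangle part\<close>

text \<open>
  Linear maps are matrices; the vector \<open>v\<close> is an \<open>n \<times> 1\<close> matrix and the covector \<open>u\<close> a \<open>1 \<times> m\<close> matrix.
\<close>

type_synonym quintuple =
  "complex mat \<times> complex mat \<times> complex mat \<times> complex mat \<times> complex mat"

abbreviation is_subspace :: "nat \<Rightarrow> complex vec set \<Rightarrow> bool" where
  "is_subspace n S \<equiv> VectorSpace.subspace class_ring S (module_vec TYPE(complex) n)"

definition mat_image :: "complex mat \<Rightarrow> complex vec set" where
  "mat_image A = (\<lambda>w. A *\<^sub>v w) ` carrier_vec (dim_col A)"

definition triangle_points :: "nat \<Rightarrow> nat \<Rightarrow> quintuple set" where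
  "triangle_points m n =
     {(x, y1, y2, v, u).
        x \<in> carrier_mat n m \<and> y1 \<in> carrier_mat n n \<and> y2 \<in> carrier_mat m m \<and>
        v \<in> carrier_mat n 1 \<and> u \<in> carrier_mat 1 m \<and>
        y1 * x - x * y2 + v * u = 0\<^sub>m n m \<and>
        \<not> (\<exists>S. is_subspace n S \<and> S \<noteq> carrier_vec n \<and> (\<forall>w\<in>S. y1 *\<^sub>v w \<in> S) \<and>
               {w + w' | w w'. w \<in> mat_image x \<and> w' \<in> mat_image v} \<subseteq> S) \<and>
        \<not> (\<exists>S. is_subspace m S \<and> S \<noteq> {0\<^sub>v m} \<and> (\<forall>w\<in>S. y2 *\<^sub>v w \<in> S) \<and>
               S \<subseteq> mat_kernel x \<inter> mat_kernel u)}"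

definition triangle_variety :: "nat \<Rightarrow> nat \<Rightarrow> quintuple variety" where
  "triangle_variety m n =
     \<lparr>coords = entries n m (\<lambda>(x, y1, y2, v, u). x) \<union> entries n n (\<lambda>(x, y1, y2, v, u). y1) \<union>
               entries m m (\<lambda>(x, y1, y2, v, u). y2) \<union> entries n 1 (\<lambda>(x, y1, y2, v, u). v) \<union>
               entries 1 m (\<lambda>(x, y1, y2, v, u). u),
      points = triangle_points m n\<rparr>"

fun triangle_act :: "complex mat \<times> complex mat \<Rightarrow> quintuple \<Rightarrow> quintuple" where
  "triangle_act (g, h) (x, y1, y2, v, u) =
     (g * x * transpose_mat h,
      g * y1 * inv_mat g,
      inv_mat (transpose_mat h) * y2 * transpose_mat h,
      g * v,
      u * transpose_mat h)"


section \<open>The defining predicates of the topologies are topologies\<close>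

lemma openin_zariski:
  "openin (zariski X) U \<longleftrightarrow> (\<exists>S\<subseteq>poly_funs (coords X). U = {x \<in> points X. \<exists>f\<in>S. f x \<noteq> 0})"
proof -
  let ?L = "\<lambda>U. \<exists>S\<subseteq>poly_funs (coords X). U = {x \<in> points X. \<exists>f\<in>S. f x \<noteq> 0}"
  have "istopology ?L"
    unfolding istopology_def
  proof (intro conjI allI impI)
    fix U V assume "?L U" "?L V"
    then obtain S T where S: "S \<subseteq> poly_funs (coords X)" "U = {x \<in> points X. \<exists>f\<in>S. f x \<noteq> 0}"
      and T: "T \<subseteq> poly_funs (coords X)" "V = {x \<in> points X. \<exists>f\<in>T. f x \<noteq> 0}" by blast
    let ?R = "(\<lambda>(f, g) x. f x * g x) ` (S \<times> T)"
    have "?R \<subseteq> poly_funs (coords X)" using S(1) T(1) by (auto intro!: poly_funs.mult)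
    moreover have "U \<inter> V = {x \<in> points X. \<exists>f\<in>?R. f x \<noteq> 0}" unfolding S(2) T(2) by fastforce
    ultimately show "?L (U \<inter> V)" by blast
  next
    fix \<K> assume K: "\<forall>U\<in>\<K>. ?L U"
    let ?F = "{S. S \<subseteq> poly_funs (coords X) \<and> {x \<in> points X. \<exists>f\<in>S. f x \<noteq> 0} \<in> \<K>}"
    have "\<Union>?F \<subseteq> poly_funs (coords X)" by blast
    moreover have "\<Union>\<K> = {x \<in> points X. \<exists>f\<in>\<Union>?F. f x \<noteq> 0}"
    proof (intro equalityI subsetI)
      fix z assume "z \<in> \<Union>\<K>"
      then obtain V where V: "V \<in> \<K>" "z \<in> V" by blast
      with K obtain S where "S \<subseteq> poly_funs (coords X)" "V = {x \<in> points X. \<exists>f\<in>S. f x \<noteq> 0}" by blast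
      with V show "z \<in> {x \<in> points X. \<exists>f\<in>\<Union>?F. f x \<noteq> 0}" by blast
    qed blast
    ultimately show "?L (\<Union>\<K>)" by blast
  qed
  then show ?thesis unfolding zariski_def by simp
qed

lemma topspace_zariski: "topspace (zariski X) = points X"
proof
  show "topspace (zariski X) \<subseteq> points X"
    using openin_topspace[of "zariski X"] unfolding openin_zariski by auto
  have "openin (zariski X) (points X)"
    unfolding openin_zariski
    by (rule exI[of _ "{\<lambda>_. 1}"]) (auto intro: poly_funs.const)
  then show "points X \<subseteq> topspace (zariski X)" by (rule openin_subset)
qed

lemma openin_spec_topology:
  "openin (spec_topology A) U \<longleftrightarrow> (\<exists>S\<subseteq>carrier A. U = {P. primeideal P A \<and> \<not> S \<subseteq> P})"
proof -
  let ?L = "\<lambda>U. \<exists>S\<subseteq>carrier A. U = {P. primeideal P A \<and> \<not> S \<subseteq> P}"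
  have "istopology ?L"
    unfolding istopology_def
  proof (intro conjI allI impI)
    fix U V assume "?L U" "?L V"
    then obtain S T where S: "S \<subseteq> carrier A" "U = {P. primeideal P A \<and> \<not> S \<subseteq> P}"
      and T: "T \<subseteq> carrier A" "V = {P. primeideal P A \<and> \<not> T \<subseteq> P}" by blast
    show "?L (U \<inter> V)"
    proof (cases "\<exists>P. primeideal P A")
      case False
      then show ?thesis unfolding S(2) T(2) by (intro exI[of _ "{}"]) auto
    next
      case True
      then interpret cring A by (auto simp: primeideal_def)
      let ?R = "{a \<otimes>\<^bsub>A\<^esub> b | a b. a \<in> S \<and> b \<in> T}"
      have R: "?R \<subseteq> carrier A" using S(1) T(1) by auto
      have prime: "\<not> ?R \<subseteq> P \<longleftrightarrow> \<not> S \<subseteq> P \<and> \<not> T \<subseteq> P" if "primeideal P A" for P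
      proof -
        interpret primeideal P A by fact
        show ?thesis
        proof
          assume "\<not> ?R \<subseteq> P"
          then obtain a b where ab: "a \<in> S" "b \<in> T" "a \<otimes>\<^bsub>A\<^esub> b \<notin> P" by blast
          then have "a \<in> carrier A" "b \<in> carrier A" using S(1) T(1) by auto
          then have "a \<notin> P" "b \<notin> P" using ab(3) I_l_closed I_r_closed by metis+
          with ab show "\<not> S \<subseteq> P \<and> \<not> T \<subseteq> P" by blast
        next
          assume "\<not> S \<subseteq> P \<and> \<not> T \<subseteq> P"
          then obtain a b where ab: "a \<in> S" "a \<notin> P" "b \<in> T" "b \<notin> P" by blast
          then have "a \<otimes>\<^bsub>A\<^esub> b \<notin> P" using S(1) T(1) I_prime[of a b] by auto
          with ab show "\<not> ?R \<subseteq> P" by blast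
        qed
      qed
      have "U \<inter> V = {P. primeideal P A \<and> \<not> ?R \<subseteq> P}"
      proof (rule Set.set_eqI)
        fix P
        show "P \<in> U \<inter> V \<longleftrightarrow> P \<in> {P. primeideal P A \<and> \<not> ?R \<subseteq> P}"
          unfolding S(2) T(2) Int_iff mem_Collect_eq using prime[of P] by satx
      qed
      with R show ?thesis by (intro exI[of _ ?R]) (rule conjI)
    qed
  next
    define D where "D S = {P. primeideal P A \<and> \<not> S \<subseteq> P}" for S
    have D: "P \<in> D S \<longleftrightarrow> primeideal P A \<and> \<not> S \<subseteq> P" for P S unfolding D_def by (rule mem_Collect_eq)
    fix \<K> assume "\<forall>U\<in>\<K>. ?L U"
    then have K: "\<And>U. U \<in> \<K> \<Longrightarrow> \<exists>S\<subseteq>carrier A. U = D S" unfolding D_def[symmetric] by (rule bspec)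
    let ?F = "{S. S \<subseteq> carrier A \<and> D S \<in> \<K>}"
    have "\<Union>\<K> = D (\<Union>?F)"
    proof (intro equalityI subsetI)
      fix P assume "P \<in> \<Union>\<K>"
      then obtain U where U: "U \<in> \<K>" "P \<in> U" by (rule UnionE)
      from K[OF U(1)] obtain S where S: "S \<subseteq> carrier A" "U = D S" by metis
      have "primeideal P A" "\<not> S \<subseteq> P" using U(2) unfolding S(2) D by simp_all
      moreover have "S \<subseteq> \<Union>?F" using S U(1) by (intro Union_upper) simp
      ultimately show "P \<in> D (\<Union>?F)" unfolding D by (metis subset_trans)
    next
      fix P assume P: "P \<in> D (\<Union>?F)"
      then obtain a where a: "a \<in> \<Union>?F" "a \<notin> P" unfolding D by (meson subsetI)
      from a(1) obtain S where S: "S \<in> ?F" "a \<in> S" by (rule UnionE)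
      have "P \<in> D S" using P a(2) S(2) unfolding D by (meson subsetD)
      moreover have "D S \<in> \<K>" using S(1) by simp
      ultimately show "P \<in> \<Union>\<K>" by (rule UnionI[rotated])
    qed
    moreover have "\<Union>?F \<subseteq> carrier A" by (rule Union_least) simp
    ultimately show "?L (\<Union>\<K>)" unfolding D_def[symmetric] by metis
  qed
  then show ?thesis unfolding spec_topology_def by simp
qed

lemma openin_sober_topology:
  "openin (sober_topology T) W \<longleftrightarrow>
     (\<exists>U. openin T U \<and> W = {Z. irreducible_closed T Z \<and> Z \<inter> U \<noteq> {}})"
proof -
  let ?L = "\<lambda>W. \<exists>U. openin T U \<and> W = {Z. irreducible_closed T Z \<and> Z \<inter> U \<noteq> {}}"
  have "istopology ?L"
    unfolding istopology_def
  proof (intro conjI allI impI)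
    fix W W' assume "?L W" "?L W'"
    then obtain U V where U: "openin T U" "W = {Z. irreducible_closed T Z \<and> Z \<inter> U \<noteq> {}}"
      and V: "openin T V" "W' = {Z. irreducible_closed T Z \<and> Z \<inter> V \<noteq> {}}" by blast
    have "Z \<inter> (U \<inter> V) \<noteq> {}" if Z: "irreducible_closed T Z" and "Z \<inter> U \<noteq> {}" "Z \<inter> V \<noteq> {}" for Z
    proof
      assume "Z \<inter> (U \<inter> V) = {}"
      then have "Z = (Z - U) \<union> (Z - V)" by blast
      moreover have "closedin T (Z - U)" "closedin T (Z - V)"
        using Z U(1) V(1) unfolding irreducible_closed_def by (auto intro: closedin_diff)
      ultimately have "Z = Z - U \<or> Z = Z - V" using Z unfolding irreducible_closed_def by blast
      with that show False by blast
    qed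
    then have "W \<inter> W' = {Z. irreducible_closed T Z \<and> Z \<inter> (U \<inter> V) \<noteq> {}}"
      unfolding U(2) V(2) by blast
    with U(1) V(1) show "?L (W \<inter> W')" by blast
  next
    fix \<K> assume K: "\<forall>W\<in>\<K>. ?L W"
    let ?F = "{U. openin T U \<and> {Z. irreducible_closed T Z \<and> Z \<inter> U \<noteq> {}} \<in> \<K>}"
    have "openin T (\<Union>?F)" by blast
    moreover have "\<Union>\<K> = {Z. irreducible_closed T Z \<and> Z \<inter> \<Union>?F \<noteq> {}}"
    proof (intro equalityI subsetI)
      fix z assume "z \<in> \<Union>\<K>"
      then obtain V where V: "V \<in> \<K>" "z \<in> V" by blast
      with K obtain U where "openin T U" "V = {Z. irreducible_closed T Z \<and> Z \<inter> U \<noteq> {}}" by blast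
      with V show "z \<in> {Z. irreducible_closed T Z \<and> Z \<inter> \<Union>?F \<noteq> {}}" by blast
    qed blast
    ultimately show "?L (\<Union>\<K>)" by blast
  qed
  then show ?thesis unfolding sober_topology_def by simp
qed

end

theory Submission
 imports Defs
  "HOL-Analysis.Continuum_Not_Denumerable"
  "HOL-Computational_Algebra.Field_as_Ring"
  "HOL-Computational_Algebra.Fundamental_Theorem_Algebra"
  "HOL-Computational_Algebra.Polynomial_Factorial"
  "Jordan_Normal_Form.Determinant"
begin

text \<open>
  The variety \<open>M\<close> of the triangle part is covered, up to a set of codimension two, by two open charts which
  are both copies of \<open>Wh\<close>, and the gluing map between the two copies is the birational map \<open>\<sigma>\<close>. A function on
  \<open>Wh\<close> whose pullback under \<open>\<sigma>\<close> is regular is therefore the same as a regular function on the union of the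
  charts, hence on \<open>M\<close>; and \<open>M\<close> is affine.

  The first chart is the set where \<open>v\<close> is a cyclic vector of \<open>y1\<close>. In the Krylov basis \<open>v, y1 v, y1\<^sup>2 v, ...\<close> the
  matrix \<open>y1\<close> is a companion matrix and the moment map equation becomes a Sylvester equation, which the Horner
  scheme solves: \<open>x\<close> and \<open>u\<close> are determined by the last row \<open>r\<close> of \<open>x\<close> (\<open>sylvester_iff\<close>), and \<open>u = r p(y2)\<close> with
  \<open>p\<close> the characteristic polynomial of \<open>y1\<close> (\<open>syl_u_eval\<close>). Stability says that \<open>r\<close> is cyclic for the transpose
  of \<open>y2\<close>, which makes \<open>y2\<close> a companion matrix as well. This is the chart \<open>psi\<close>. The second chart is the set where
  \<open>u\<close> is cocyclic for \<open>y2\<close>; transposing all matrices interchanges the charts. On a point of the overlap the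
  parameters of the two charts differ by the factors \<open>q(C_p)\<close> and \<open>p(C_q)\<close> and by signs, that is, by \<open>\<sigma>\<close>
  (\<open>sigma_charts\<close>, \<open>overlap_sigma_dom\<close>).

  For \<open>m \<le> n\<close>, a solution of the moment map equation is stable exactly if the frame
  \<open>(x, v, y1 v, ..., y1\<^sup>(\<^sup>n\<^sup>-\<^sup>m\<^sup>-\<^sup>1\<^sup>) v)\<close> is a basis (\<open>frame_nonsingular_iff\<close>), so that \<open>M\<close> is a closed subset of an
  affine space minus a hypersurface. In this frame \<open>y1\<close> has a simple normal form, which shows that \<open>M\<close> is the
  product of \<open>GL\<^sub>n\<close> and an affine space (\<open>from_frame_facts\<close>, \<open>from_frame_surj\<close>). The case \<open>n < m\<close> follows by duality.

  The extension over the complement of the charts avoids dimension theory. Through each point \<open>z\<close> of \<open>M\<close> passes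
  a polynomial surface \<open>surface n m z (s, \<tau>)\<close>, with \<open>z\<close> at \<open>(0, 1)\<close>. Along it, a function \<open>d\<close> whose nonvanishing
  implies that \<open>v\<close> is cyclic is monic in \<open>s\<close> of constant degree, while the determinant that defines the second
  chart is \<open>1\<close> for \<open>\<tau> = 0\<close>. Hence the two are coprime in \<open>\<complex>[\<tau>][s]\<close>, and a function which is
  regular on both charts restricts to a polynomial on the surface. Dividing its numerator by a
  power of \<open>d\<close>, as polynomials in \<open>s\<close> for \<open>\<tau> = 1\<close>, gives a quotient whose coefficients are regular in \<open>z\<close>, because
  \<open>d\<close> is monic; its value at \<open>s = 0\<close> is the extension (\<open>hartogs_division\<close>, \<open>hartogs_triangle\<close>).

  Finally an algebra which is identified with the regular functions on an affine variety has as its spectrum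
  the scheme of that variety. The points of both are compared by the Nullstellensatz and the sections by
  germs of fractions (\<open>spec_iso\<close>). The isomorphism is equivariant since \<open>psi\<close> is.
\<close>

section \<open>The Nullstellensatz over the complex numbers\<close>

lemma linear_relation:
 fixes m :: "'i \<Rightarrow> 'b \<Rightarrow> complex"
 assumes "finite F" "finite S" "card F < card S"
 shows "\<exists>c. (\<exists>i\<in>S. c i \<noteq> 0) \<and> (\<forall>b\<in>F. (\<Sum>i\<in>S. c i * m i b) = 0)"
 using assms
proof (induction F arbitrary: S m rule: finite_induct)
 case empty
 then obtain i where "i \<in> S" by fastforce
 then show ?case by (intro exI[of _ "\<lambda>_. 1"]) auto
next
 case (insert b F)
 show ?case
 proof (cases "\<forall>i\<in>S. m i b = 0")
  case True
  have "card F < card S" using insert by simp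
  from insert.IH[OF insert.prems(1) this] obtain c where
   "\<exists>i\<in>S. c i \<noteq> 0" "\<forall>b\<in>F. (\<Sum>i\<in>S. c i * m i b) = 0" by blast
  with True show ?thesis by (intro exI[of _ c]) auto
 next
  case False
  then obtain k where k: "k \<in> S" "m k b \<noteq> 0" by blast
  let ?m = "\<lambda>i b'. m i b' - m i b / m k b * m k b'"
  have "card F < card (S - {k})" "finite (S - {k})" using insert k by auto
  from insert.IH[OF this(2,1), of ?m] obtain c where
   c: "\<exists>i\<in>S - {k}. c i \<noteq> 0" "\<forall>b'\<in>F. (\<Sum>i\<in>S - {k}. c i * ?m i b') = 0" by blast
  let ?c = "c(k := - (\<Sum>i\<in>S - {k}. c i * m i b) / m k b)"
  have eq: "(\<Sum>i\<in>S. ?c i * m i b') = (\<Sum>i\<in>S - {k}. c i * ?m i b')" for b'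
  proof -
   have "(\<Sum>i\<in>S. ?c i * m i b') = ?c k * m k b' + (\<Sum>i\<in>S - {k}. ?c i * m i b')"
    by (rule sum.remove[OF insert.prems(1) k(1)])
   also have "(\<Sum>i\<in>S - {k}. ?c i * m i b') = (\<Sum>i\<in>S - {k}. c i * m i b')"
    by (rule sum.cong) auto
   also have "?c k * m k b' = - (\<Sum>i\<in>S - {k}. c i * (m i b / m k b * m k b'))"
    by (simp add: sum_distrib_right sum_divide_distrib mult.assoc)
   also have "\<dots> + (\<Sum>i\<in>S - {k}. c i * m i b') = (\<Sum>i\<in>S - {k}. c i * ?m i b')"
    by (simp add: sum_subtractf right_diff_distrib)
   finally show ?thesis .
  qed
  have "(\<Sum>i\<in>S. ?c i * m i b') = 0" if "b' \<in> insert b F" for b'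
   unfolding eq using that c(2) k(2) by (cases "b' = b") auto
  moreover have "\<exists>i\<in>S. ?c i \<noteq> 0" using c(1) by auto
  ultimately show ?thesis by blast
 qed
qed

text \<open>Formal sums of monomials. Over countably many coordinates there are only countably many monomials,
 on which the proof of \<open>residue_constant\<close> rests.\<close>

definition monomial_sum :: "(complex \<times> ('a \<Rightarrow> complex) list) list \<Rightarrow> 'a \<Rightarrow> complex" where
 "monomial_sum L x = (\<Sum>(c, ks)\<leftarrow>L. c * prod_list (map (\<lambda>k. k x) ks))"

lemma monomial_sum_simps [simp]:
 "monomial_sum [] x = 0"
 "monomial_sum ((c, ks) # L) x = c * prod_list (map (\<lambda>k. k x) ks) + monomial_sum L x"
 "monomial_sum (L @ L') x = monomial_sum L x + monomial_sum L' x"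
 by (auto simp: monomial_sum_def)

lemma monomial_sum_scale:
 "monomial_sum (map (\<lambda>(c, ks). (d * c, ls @ ks)) L) x =
   d * prod_list (map (\<lambda>k. k x) ls) * monomial_sum L x"
 by (induction L) (auto simp: algebra_simps)

lemma poly_funs_monomial_sum:
 assumes "f \<in> poly_funs K"
 shows "\<exists>L. snd ` set L \<subseteq> lists K \<and> f = monomial_sum L"
 using assms
proof induction
 case (const c)
 show ?case by (rule exI[of _ "[(c, [])]"]) auto
next
 case (coord f)
 then show ?case by (intro exI[of _ "[(1, [f])]"]) auto
next
 case (add f g)
 then obtain L M where "snd ` set L \<subseteq> lists K" "f = monomial_sum L"
  "snd ` set M \<subseteq> lists K" "g = monomial_sum M" by blast
 then show ?case by (intro exI[of _ "L @ M"]) auto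
next
 case (mult f g)
 then obtain L M where L: "snd ` set L \<subseteq> lists K" "f = monomial_sum L"
  and M: "snd ` set M \<subseteq> lists K" "g = monomial_sum M" by blast
 have "\<exists>N. snd ` set N \<subseteq> lists K \<and> (\<forall>x. monomial_sum N x = monomial_sum L x * monomial_sum M x)"
  using L(1)
 proof (induction L)
  case Nil
  show ?case by (rule exI[of _ "[]"]) auto
 next
  case (Cons a L)
  obtain c ks where a: "a = (c, ks)" by force
  from Cons obtain N where N: "snd ` set N \<subseteq> lists K"
   "\<forall>x. monomial_sum N x = monomial_sum L x * monomial_sum M x" by auto
  let ?N = "map (\<lambda>(d, ls). (c * d, ks @ ls)) M @ N"
  have "snd ` set ?N \<subseteq> lists K" using N(1) M(1) Cons.prems a by force
  moreover have "\<forall>x. monomial_sum ?N x = monomial_sum (a # L) x * monomial_sum M x"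
   using N(2) monomial_sum_scale[of c ks M] by (simp add: a algebra_simps)
  ultimately show ?case by blast
 qed
 then show ?case unfolding L(2) M(2) by (metis (no_types, lifting) ext)
qed

lemma poly_funs_diff:
 assumes "f \<in> poly_funs K" "g \<in> poly_funs K"
 shows "(\<lambda>x. f x - g x) \<in> poly_funs K"
proof -
 have "(\<lambda>x. f x + (-1) * g x) \<in> poly_funs K"
  by (intro poly_funs.add poly_funs.mult poly_funs.const assms)
 then show ?thesis by simp
qed

lemma poly_funs_power: "f \<in> poly_funs K \<Longrightarrow> (\<lambda>x. f x ^ e) \<in> poly_funs K"
 by (induction e) (auto intro: poly_funs.const poly_funs.mult)

lemma poly_funs_prod: "(\<And>i. i \<in> I \<Longrightarrow> f i \<in> poly_funs K) \<Longrightarrow> (\<lambda>x. \<Prod>i\<in>I. f i x) \<in> poly_funs K"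
 by (induction I rule: infinite_finite_induct) (auto intro: poly_funs.const poly_funs.mult)

lemma poly_funs_poly: "f \<in> poly_funs K \<Longrightarrow> (\<lambda>x. poly q (f x)) \<in> poly_funs K"
 by (induction q) (auto intro: poly_funs.const poly_funs.mult poly_funs.add)

definition poly_ideal :: "('a \<Rightarrow> complex) set \<Rightarrow> ('a \<Rightarrow> complex) set \<Rightarrow> bool" where
 "poly_ideal K J \<longleftrightarrow> J \<subseteq> poly_funs K \<and> (\<lambda>_. 0) \<in> J \<and>
   (\<forall>f\<in>J. \<forall>g\<in>J. (\<lambda>x. f x + g x) \<in> J) \<and> (\<forall>r\<in>poly_funs K. \<forall>f\<in>J. (\<lambda>x. r x * f x) \<in> J)"

lemma poly_idealD:
 assumes "poly_ideal K J"
 shows "J \<subseteq> poly_funs K" "(\<lambda>_. 0) \<in> J"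
  "f \<in> J \<Longrightarrow> g \<in> J \<Longrightarrow> (\<lambda>x. f x + g x) \<in> J"
  "r \<in> poly_funs K \<Longrightarrow> f \<in> J \<Longrightarrow> (\<lambda>x. r x * f x) \<in> J"
 using assms unfolding poly_ideal_def by blast+

lemma poly_ideal_sum:
 assumes J: "poly_ideal K J" and "\<And>i. i \<in> I \<Longrightarrow> f i \<in> J"
 shows "(\<lambda>x. \<Sum>i\<in>I. f i x) \<in> J"
 using assms(2) by (induction I rule: infinite_finite_induct) (auto intro: poly_idealD[OF J])

lemma poly_ideal_extend:
 assumes J: "poly_ideal K J" and a: "a \<in> poly_funs K"
 shows "poly_ideal K {\<lambda>x. j x + r x * a x | j r. j \<in> J \<and> r \<in> poly_funs K}" (is "poly_ideal K ?I")
proof -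
 note J' = poly_idealD[OF J]
 have "?I \<subseteq> poly_funs K" using J'(1) a by (auto intro!: poly_funs.add poly_funs.mult)
 moreover have "(\<lambda>_. 0) \<in> ?I"
  using J'(2) by (intro CollectI exI[of _ "\<lambda>_. 0"]) (auto intro: poly_funs.const)
 moreover have "(\<lambda>x. f x + g x) \<in> ?I" if "f \<in> ?I" "g \<in> ?I" for f g
 proof -
  from that obtain j r j' r' where "j \<in> J" "r \<in> poly_funs K" "f = (\<lambda>x. j x + r x * a x)"
   "j' \<in> J" "r' \<in> poly_funs K" "g = (\<lambda>x. j' x + r' x * a x)" by blast
  then show ?thesis using J'(3)
   by (intro CollectI exI[of _ "\<lambda>x. j x + j' x"] exI[of _ "\<lambda>x. r x + r' x"])
    (auto simp: algebra_simps intro: poly_funs.add)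
 qed
 moreover have "(\<lambda>x. s x * f x) \<in> ?I" if "f \<in> ?I" "s \<in> poly_funs K" for f s
 proof -
  from that obtain j r where "j \<in> J" "r \<in> poly_funs K" "f = (\<lambda>x. j x + r x * a x)" by blast
  then show ?thesis using J'(4)[OF that(2)] that(2)
   by (intro CollectI exI[of _ "\<lambda>x. s x * j x"] exI[of _ "\<lambda>x. s x * r x"])
    (auto simp: algebra_simps intro: poly_funs.mult)
 qed
 ultimately show ?thesis unfolding poly_ideal_def by auto
qed

text \<open>Zorn. Maximality says that \<open>D\<close> becomes nilpotent, modulo the ideal, once a further
 element is added; this does the work of a maximal ideal of the localisation at \<open>D\<close> without
 constructing the localisation.\<close>

lemma maximal_ideal_avoiding_powers:
 assumes J: "poly_ideal K J" and D: "D \<in> poly_funs K" and no: "\<And>e. (\<lambda>x. D x ^ e) \<notin> J"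
 obtains M where "poly_ideal K M" "J \<subseteq> M" "\<And>e. (\<lambda>x. D x ^ e) \<notin> M"
  "\<And>a. a \<in> poly_funs K \<Longrightarrow> a \<notin> M \<Longrightarrow> \<exists>e. \<exists>r\<in>poly_funs K. (\<lambda>x. D x ^ e - r x * a x) \<in> M"
proof -
 let ?A = "{I. poly_ideal K I \<and> J \<subseteq> I \<and> (\<forall>e. (\<lambda>x. D x ^ e) \<notin> I)}"
 have "\<exists>M\<in>?A. \<forall>X\<in>?A. M \<subseteq> X \<longrightarrow> X = M"
 proof (rule subset_Zorn_nonempty)
  show "?A \<noteq> {}" using assms by blast
  fix C assume C: "C \<noteq> {}" "subset.chain ?A C"
  then have CA: "C \<subseteq> ?A" and tot: "\<And>X Y. X \<in> C \<Longrightarrow> Y \<in> C \<Longrightarrow> X \<subseteq> Y \<or> Y \<subseteq> X"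
   by (auto simp: subset.chain_def)
  have "poly_ideal K (\<Union>C)"
   unfolding poly_ideal_def
  proof (intro conjI ballI)
   show "\<Union>C \<subseteq> poly_funs K" using CA poly_idealD(1) by blast
   show "(\<lambda>_. 0) \<in> \<Union>C" using C(1) CA poly_idealD(2) by blast
   fix f assume f: "f \<in> \<Union>C"
   { fix g assume "g \<in> \<Union>C"
    with f obtain X where "X \<in> C" "f \<in> X" "g \<in> X" using tot by blast
    then show "(\<lambda>x. f x + g x) \<in> \<Union>C" using CA poly_idealD(3) by blast }
  next
   fix r f assume "r \<in> poly_funs K" "f \<in> \<Union>C"
   then show "(\<lambda>x. r x * f x) \<in> \<Union>C" using CA poly_idealD(4) by blast
  qed
  then show "\<Union>C \<in> ?A" using CA C(1) by blast
 qed
 then obtain M where MA: "M \<in> ?A" and max: "\<forall>X\<in>?A. M \<subseteq> X \<longrightarrow> X = M" by (elim bexE)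
 have M: "poly_ideal K M" "J \<subseteq> M" "\<And>e. (\<lambda>x. D x ^ e) \<notin> M" using MA by auto
 have "\<exists>e. \<exists>r\<in>poly_funs K. (\<lambda>x. D x ^ e - r x * a x) \<in> M" if a: "a \<in> poly_funs K" "a \<notin> M" for a
 proof -
  let ?I = "{\<lambda>x. j x + r x * a x | j r. j \<in> M \<and> r \<in> poly_funs K}"
  have sub: "M \<subseteq> ?I"
  proof
   fix j assume "j \<in> M"
   then show "j \<in> ?I" by (intro CollectI exI[of _ j] exI[of _ "\<lambda>_. 0"]) (auto intro: poly_funs.const)
  qed
  have "a \<in> ?I" using poly_idealD(2)[OF M(1)]
   by (intro CollectI exI[of _ "\<lambda>_. 0"] exI[of _ "\<lambda>_. 1"]) (auto intro: poly_funs.const)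
  with a(2) have "?I \<noteq> M" by blast
  then have "?I \<notin> ?A" using max sub by meson
  then obtain e where "(\<lambda>x. D x ^ e) \<in> ?I"
   using poly_ideal_extend[OF M(1) a(1)] sub M(2) by auto
  then obtain j r where jr: "j \<in> M" "r \<in> poly_funs K" "(\<lambda>x. D x ^ e) = (\<lambda>x. j x + r x * a x)" by blast
  have "(\<lambda>x. D x ^ e - r x * a x) = j"
  proof
   fix x show "D x ^ e - r x * a x = j x" using fun_cong[OF jr(3), of x] by simp
  qed
  with jr show ?thesis by metis
 qed
 then show thesis by (rule that[OF M])
qed

text \<open>The residue field of \<open>\<complex>[K]\<^sub>D\<close> at \<open>M\<close> has countable
 dimension over \<open>\<complex>\<close>. If the residue of \<open>t\<close> were not a constant, then it
 would be transcendental, because \<open>\<complex>\<close> is algebraically closed, and the uncountably many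
 inverses of \<open>t - \<mu>\<close> would be linearly independent.\<close>

lemma residue_constant:
 assumes cK: "countable K" and M: "poly_ideal K M" and D: "D \<in> poly_funs K"
  and no: "\<And>e. (\<lambda>x. D x ^ e) \<notin> M"
  and max: "\<And>a. a \<in> poly_funs K \<Longrightarrow> a \<notin> M \<Longrightarrow> \<exists>e. \<exists>r\<in>poly_funs K. (\<lambda>x. D x ^ e - r x * a x) \<in> M"
  and t: "t \<in> poly_funs K"
 shows "\<exists>\<mu>. (\<lambda>x. t x - \<mu>) \<in> M"
proof (rule ccontr)
 assume "\<not> ?thesis"
 then have neg: "(\<lambda>x. t x - \<mu>) \<notin> M" for \<mu> by blast
 note M' = poly_idealD[OF M]
 have tm: "(\<lambda>x. t x - \<mu>) \<in> poly_funs K" for \<mu> by (intro poly_funs_diff t poly_funs.const)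
 have Dp: "(\<lambda>x. D x ^ e) \<in> poly_funs K" for e by (rule poly_funs_power[OF D])
 have prime: "(\<lambda>x. t x - \<mu>) \<in> M \<or> b \<in> M \<or> (\<exists>e. (\<lambda>x. D x ^ e) \<in> M)"
  if b: "b \<in> poly_funs K" and ab: "(\<lambda>x. (t x - \<mu>) * b x) \<in> M" for b \<mu>
 proof (rule ccontr)
  assume "\<not> ?thesis"
  then obtain e r e' r' where r: "r \<in> poly_funs K" "(\<lambda>x. D x ^ e - r x * (t x - \<mu>)) \<in> M"
   and r': "r' \<in> poly_funs K" "(\<lambda>x. D x ^ e' - r' x * b x) \<in> M"
   using max[OF tm[of \<mu>]] max[OF b] by blast
  have "(\<lambda>x. D x ^ e * (D x ^ e' - r' x * b x) + (r' x * b x * (D x ^ e - r x * (t x - \<mu>))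
    + r x * r' x * ((t x - \<mu>) * b x))) \<in> M"
   by (intro M'(3) M'(4)[OF Dp r'(2)] M'(4)[OF poly_funs.mult[OF r'(1) b] r(2)]
     M'(4)[OF poly_funs.mult[OF r(1) r'(1)] ab])
  also have "(\<lambda>x. D x ^ e * (D x ^ e' - r' x * b x) + (r' x * b x * (D x ^ e - r x * (t x - \<mu>))
    + r x * r' x * ((t x - \<mu>) * b x))) = (\<lambda>x. D x ^ (e + e'))"
   by (auto simp: algebra_simps power_add)
  finally show False using no by blast
 qed
 have nofactor: "\<not> (\<lambda>x. poly Q (t x) * D x ^ e) \<in> M" if "Q \<noteq> 0" for Q e
  using that
 proof (induction "degree Q" arbitrary: Q)
  case 0
  then obtain c where Q: "Q = [:c:]" by (metis degree_eq_zeroE)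
  with 0 have c: "c \<noteq> 0" by simp
  show ?case
  proof
   assume "(\<lambda>x. poly Q (t x) * D x ^ e) \<in> M"
   from M'(4)[OF poly_funs.const[of "1 / c"] this] have "(\<lambda>x. D x ^ e) \<in> M" using c by (simp add: Q)
   with no show False by blast
  qed
 next
  case (Suc d)
  then have "\<not> constant (poly Q)" using constant_degree[of Q] by simp
  then obtain z where "poly Q z = 0" using fundamental_theorem_of_algebra by blast
  then obtain R where Q: "Q = [:-z, 1:] * R" unfolding poly_eq_0_iff_dvd by blast
  with Suc.prems have R: "R \<noteq> 0" by auto
  have "degree Q = Suc (degree R)" unfolding Q using R by (subst degree_mult_eq) auto
  with Suc have IH: "(\<lambda>x. poly R (t x) * D x ^ e) \<notin> M" using R by auto
  show ?case
  proof
   assume "(\<lambda>x. poly Q (t x) * D x ^ e) \<in> M"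
   then have "(\<lambda>x. (t x - z) * (poly R (t x) * D x ^ e)) \<in> M"
    by (simp add: Q algebra_simps)
   from prime[OF _ this] IH neg no poly_funs.mult[OF poly_funs_poly[OF t] Dp]
   show False by blast
  qed
 qed
 have "\<forall>\<mu>. \<exists>p. snd ` set (snd p) \<subseteq> lists K \<and>
   (\<lambda>x. D x ^ fst p - monomial_sum (snd p) x * (t x - of_real \<mu>)) \<in> M"
 proof
  fix \<mu> :: real
  obtain e r where r: "r \<in> poly_funs K" "(\<lambda>x. D x ^ e - r x * (t x - of_real \<mu>)) \<in> M"
   using max[OF tm neg, of "of_real \<mu>"] by blast
  obtain L where "snd ` set L \<subseteq> lists K" "r = monomial_sum L" using poly_funs_monomial_sum[OF r(1)] by blast
  with r(2) show "\<exists>p. snd ` set (snd p) \<subseteq> lists K \<and>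
   (\<lambda>x. D x ^ fst p - monomial_sum (snd p) x * (t x - of_real \<mu>)) \<in> M"
   by (intro exI[of _ "(e, L)"]) simp
 qed
 from choice[OF this] obtain p where p: "\<forall>\<mu>. snd ` set (snd (p \<mu>)) \<subseteq> lists K \<and>
   (\<lambda>x. D x ^ fst (p \<mu>) - monomial_sum (snd (p \<mu>)) x * (t x - of_real \<mu>)) \<in> M" ..
 define e L where "e \<mu> = fst (p \<mu>)" and "L \<mu> = snd (p \<mu>)" for \<mu>
 have L: "snd ` set (L \<mu>) \<subseteq> lists K"
  and rep: "(\<lambda>x. D x ^ e \<mu> - monomial_sum (L \<mu>) x * (t x - of_real \<mu>)) \<in> M" for \<mu>
  using p unfolding e_def L_def by blast+
 \<comment> \<open>There are only countably many exponents and lists of monomials, but uncountably many \<open>\<mu>\<close>.\<close>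
 let ?h = "\<lambda>\<mu>. (e \<mu>, map snd (L \<mu>))"
 have "countable (lists (lists K))" by (intro countable_lists cK)
 then have "countable ((UNIV :: nat set) \<times> lists (lists K))" by (intro countable_SIGMA) auto
 moreover have "range ?h \<subseteq> UNIV \<times> lists (lists K)" using L by fastforce
 ultimately have cr: "countable (range ?h)" by (rule countable_subset[rotated])
 have "\<exists>y\<in>range ?h. infinite (?h -` {y})"
 proof (rule ccontr)
  assume "\<not> ?thesis"
  then have "countable (?h -` {y})" if "y \<in> range ?h" for y
   using that by (intro countable_finite) blast
  then have "countable (\<Union>y\<in>range ?h. ?h -` {y})" by (rule countable_UN[OF cr])
  moreover have "(\<Union>y\<in>range ?h. ?h -` {y}) = UNIV" by auto
  ultimately show False using uncountable_UNIV_real by simp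
 qed
 then obtain e0 B where inf: "infinite (?h -` {(e0, B)})" by auto
 then obtain S where S: "S \<subseteq> ?h -` {(e0, B)}" "finite S" "card S = Suc (length B)"
  using infinite_arbitrarily_large by blast
 have eS: "e \<mu> = e0" "map snd (L \<mu>) = B" if "\<mu> \<in> S" for \<mu> using S(1) that by auto
 let ?b = "\<lambda>j x. prod_list (map (\<lambda>k. k x) (B ! j))"
 have expand: "monomial_sum (L \<mu>) x = (\<Sum>j<length B. fst (L \<mu> ! j) * ?b j x)" if "\<mu> \<in> S" for \<mu> x
 proof -
  have len: "length B = length (L \<mu>)" using eS(2)[OF that] by auto
  have "B ! j = snd (L \<mu> ! j)" if "j < length B" for j
   using eS(2)[OF \<open>\<mu> \<in> S\<close>] that len by auto
  then show ?thesis unfolding monomial_sum_def len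
   by (subst sum_list_sum_nth) (auto simp: case_prod_unfold atLeast0LessThan len intro!: sum.cong)
 qed
 obtain c where c: "\<exists>i\<in>S. c i \<noteq> 0" "\<forall>j\<in>{..<length B}. (\<Sum>i\<in>S. c i * fst (L i ! j)) = 0"
  using linear_relation[of "{..<length B}" S "\<lambda>i j. fst (L i ! j)"] S by auto
 have rel: "(\<Sum>i\<in>S. c i * monomial_sum (L i) x) = 0" for x
 proof -
  have "(\<Sum>i\<in>S. c i * monomial_sum (L i) x) = (\<Sum>i\<in>S. \<Sum>j<length B. c i * fst (L i ! j) * ?b j x)"
   by (intro sum.cong refl) (simp add: expand sum_distrib_left algebra_simps)
  also have "\<dots> = (\<Sum>j<length B. (\<Sum>i\<in>S. c i * fst (L i ! j)) * ?b j x)"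
   unfolding sum_distrib_right by (rule sum.swap)
  also have "\<dots> = 0" using c(2) by simp
  finally show ?thesis .
 qed
 define P where "P i x = (\<Prod>j\<in>S - {i}. t x - of_real j)" for i x
 define Q where "Q = (\<Sum>i\<in>S. smult (c i) (\<Prod>j\<in>S - {i}. [:- of_real j, 1:]))"
 have PP: "P i \<in> poly_funs K" for i
  unfolding P_def by (rule poly_funs_prod) (rule tm)
 have Pall: "P i x * (t x - of_real i) = (\<Prod>j\<in>S. t x - of_real j)" if "i \<in> S" for i x
  unfolding P_def using prod.remove[OF S(2) that, of "\<lambda>j. t x - of_real j"] by (simp add: mult.commute)
 have Qt: "poly Q (t x) = (\<Sum>i\<in>S. c i * P i x)" for x
  unfolding Q_def P_def by (simp add: poly_sum poly_prod)
 have "(\<lambda>x. \<Sum>i\<in>S. c i * P i x * (D x ^ e0 - monomial_sum (L i) x * (t x - of_real i))) \<in> M"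
 proof (rule poly_ideal_sum[OF M])
  fix i assume i: "i \<in> S"
  have ci: "(\<lambda>x. c i * P i x) \<in> poly_funs K" by (intro poly_funs.mult poly_funs.const PP)
  show "(\<lambda>x. c i * P i x * (D x ^ e0 - monomial_sum (L i) x * (t x - of_real i))) \<in> M"
   using M'(4)[OF ci rep[of i]] eS(1)[OF i] by simp
 qed
 moreover have "(\<Sum>i\<in>S. c i * P i x * (D x ^ e0 - monomial_sum (L i) x * (t x - of_real i)))
   = poly Q (t x) * D x ^ e0" for x
 proof -
  have "(\<Sum>i\<in>S. c i * P i x * (D x ^ e0 - monomial_sum (L i) x * (t x - of_real i)))
   = (\<Sum>i\<in>S. c i * P i x * D x ^ e0 - c i * monomial_sum (L i) x * (P i x * (t x - of_real i)))"
   by (intro sum.cong refl) (simp add: algebra_simps)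
  also have "\<dots> = (\<Sum>i\<in>S. c i * P i x * D x ^ e0 - c i * monomial_sum (L i) x * (\<Prod>j\<in>S. t x - of_real j))"
   by (intro sum.cong refl) (simp add: Pall)
  also have "\<dots> = (\<Sum>i\<in>S. c i * P i x) * D x ^ e0 - (\<Sum>i\<in>S. c i * monomial_sum (L i) x) * (\<Prod>j\<in>S. t x - of_real j)"
   by (simp add: sum_subtractf sum_distrib_right)
  finally show ?thesis by (simp add: rel Qt)
 qed
 ultimately have inM: "(\<lambda>x. poly Q (t x) * D x ^ e0) \<in> M" by simp
 obtain i where i: "i \<in> S" "c i \<noteq> 0" using c(1) by blast
 have "poly Q (of_real i) = (\<Sum>k\<in>S. c k * (\<Prod>j\<in>S - {k}. of_real i - of_real j))"
  unfolding Q_def by (simp add: poly_sum poly_prod)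
 also have "\<dots> = (\<Sum>k\<in>{i}. c k * (\<Prod>j\<in>S - {k}. of_real i - of_real j))"
  using S(2) i(1) by (intro sum.mono_neutral_right) auto
 also have "\<dots> \<noteq> 0" using S(2) i(2) by (auto simp: prod_zero_iff)
 finally have "Q \<noteq> 0" by auto
 with nofactor inM show False by blast
qed

text \<open>The coordinates take arbitrary values independently: the ambient set is a full affine
 space.\<close>

definition free_coords :: "('a \<Rightarrow> complex) set \<Rightarrow> 'a set \<Rightarrow> bool" where
 "free_coords K E \<longleftrightarrow> (\<forall>val. \<exists>x\<in>E. \<forall>k\<in>K. k x = val k)"

text \<open>A maximal ideal as above consists of the functions vanishing at one point, by
 \<open>residue_constant\<close> applied to each coordinate.\<close>

lemma nullstellensatz:
 assumes "countable K" "free_coords K E"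
  and J: "poly_ideal K J" and D: "D \<in> poly_funs K" and no: "\<And>e. (\<lambda>x. D x ^ e) \<notin> J"
 obtains x where "x \<in> E" "\<And>f. f \<in> J \<Longrightarrow> f x = 0" "D x \<noteq> 0"
proof -
 obtain M where M: "poly_ideal K M" "J \<subseteq> M" "\<And>e. (\<lambda>x. D x ^ e) \<notin> M"
  and max: "\<And>a. a \<in> poly_funs K \<Longrightarrow> a \<notin> M \<Longrightarrow> \<exists>e. \<exists>r\<in>poly_funs K. (\<lambda>x. D x ^ e - r x * a x) \<in> M"
  using maximal_ideal_avoiding_powers[OF J D no] by blast
 note M' = poly_idealD[OF M(1)]
 have "\<exists>\<mu>. (\<lambda>x. k x - \<mu>) \<in> M" if "k \<in> K" for k
  by (rule residue_constant[OF assms(1) M(1) D M(3) max]) (use poly_funs.coord[OF that] in auto)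
 then obtain val where val: "\<And>k. k \<in> K \<Longrightarrow> (\<lambda>x. k x - val k) \<in> M" by metis
 obtain x where x: "x \<in> E" "\<And>k. k \<in> K \<Longrightarrow> k x = val k"
  using assms(2) unfolding free_coords_def by blast
 have res: "(\<lambda>y. f y - f x) \<in> M" if "f \<in> poly_funs K" for f
  using that
 proof induction
  case (const c)
  then show ?case using M'(2) by simp
 next
  case (coord f)
  then show ?case using val x(2) by simp
 next
  case (add f g)
  have "(\<lambda>y. (f y - f x) + (g y - g x)) \<in> M" by (intro M'(3) add)
  then show ?case by (simp add: algebra_simps)
 next
  case (mult f g)
  have "(\<lambda>y. g y * (f y - f x) + f x * (g y - g x)) \<in> M"
   by (intro M'(3) M'(4) mult poly_funs.const)
  then show ?case by (simp add: algebra_simps)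
 qed
 have one: "(\<lambda>_. 1) \<notin> M" using M(3)[of 0] by simp
 have "f x = 0" if "f \<in> M" for f
 proof (rule ccontr)
  assume f: "f x \<noteq> 0"
  have "(\<lambda>y. (- 1 / f x) * (f y - f x) + (1 / f x) * f y) \<in> M"
   by (intro M'(3) M'(4) poly_funs.const res that subsetD[OF M'(1)])
  moreover have "(\<lambda>y. (- 1 / f x) * (f y - f x) + (1 / f x) * f y) = (\<lambda>_. 1)"
   using f by (auto simp: field_simps)
  ultimately show False using one by simp
 qed
 moreover have "D x \<noteq> 0" using res[OF D] M(3)[of 1] by auto
 ultimately show thesis using that[OF x(1)] M(2) by blast
qed

section \<open>Invertible matrices\<close>

lemma invertible_mat_iff_det:
 assumes A: "(A :: complex mat) \<in> carrier_mat n n"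
 shows "invertible_mat A \<longleftrightarrow> det A \<noteq> 0"
proof
 assume "invertible_mat A"
 then obtain B where B: "A * B = 1\<^sub>m (dim_row A)" "B * A = 1\<^sub>m (dim_row B)"
  unfolding invertible_mat_def inverts_mat_def by blast
 have "B \<in> carrier_mat n n"
  using A arg_cong[OF B(1), of dim_col] arg_cong[OF B(2), of dim_col] by auto
 from det_mult[OF A this] show "det A \<noteq> 0" using B(1) A by auto
next
 assume "det A \<noteq> 0"
 from det_non_zero_imp_unit[OF A this, of "()"] obtain B where
  "B \<in> carrier_mat n n" "A * B = 1\<^sub>m n" "B * A = 1\<^sub>m n"
  unfolding Units_def ring_mat_def by auto
 with A show "invertible_mat A" unfolding invertible_mat_def inverts_mat_def by auto
qed

lemma inv_mat:
 assumes A: "(A :: complex mat) \<in> carrier_mat n n" and "det A \<noteq> 0"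
 shows "inv_mat A \<in> carrier_mat n n" "A * inv_mat A = 1\<^sub>m n" "inv_mat A * A = 1\<^sub>m n"
proof -
 have "mat_inverse A \<noteq> None"
  using mat_inverse(1)[OF A, of "()"] det_non_zero_imp_unit[OF assms, of "()"] by blast
 then show "inv_mat A \<in> carrier_mat n n" "A * inv_mat A = 1\<^sub>m n" "inv_mat A * A = 1\<^sub>m n"
  using mat_inverse(2)[OF A] by auto
qed

lemma inv_mat_unique:
 assumes A: "(A :: complex mat) \<in> carrier_mat n n" and B: "B \<in> carrier_mat n n" and AB: "A * B = 1\<^sub>m n"
 shows "inv_mat A = B" "det A \<noteq> 0"
proof -
 show d: "det A \<noteq> 0" using det_mult[OF A B] AB by auto
 note I = inv_mat[OF A d]
 have "inv_mat A = inv_mat A * (A * B)" using I(1) by (simp add: AB)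
 also have "\<dots> = B" using I B by (simp flip: assoc_mult_mat[OF I(1) A B])
 finally show "inv_mat A = B" .
qed

lemma inv_mat_adj:
 assumes A: "(A :: complex mat) \<in> carrier_mat n n" and d: "det A \<noteq> 0"
 shows "inv_mat A = (1 / det A) \<cdot>\<^sub>m adj_mat A"
proof (rule inv_mat_unique(1)[OF A])
 note adj = adj_mat[OF A]
 show "(1 / det A) \<cdot>\<^sub>m adj_mat A \<in> carrier_mat n n" using adj(1) by simp
 show "A * ((1 / det A) \<cdot>\<^sub>m adj_mat A) = 1\<^sub>m n"
  using adj d by (auto simp: mult_smult_distrib[OF A adj(1)] intro!: eq_matI)
qed

lemma GL_iff: "g \<in> GL n \<longleftrightarrow> g \<in> carrier_mat n n \<and> det g \<noteq> 0"
 unfolding GL_def using invertible_mat_iff_det by blast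

section \<open>Rings of functions and matrices over them\<close>

text \<open>The same constructions with matrices are needed over several rings of functions: polynomial
 functions, regular functions, polynomials along a surface, and families of polynomials with regular
 coefficients.\<close>

locale function_ring =
 fixes U :: "'a set" and R :: "('a \<Rightarrow> complex) set"
 assumes const: "(\<lambda>_. c) \<in> R"
  and add: "f \<in> R \<Longrightarrow> g \<in> R \<Longrightarrow> (\<lambda>x. f x + g x) \<in> R"
  and mult: "f \<in> R \<Longrightarrow> g \<in> R \<Longrightarrow> (\<lambda>x. f x * g x) \<in> R"
  and cong: "f \<in> R \<Longrightarrow> (\<And>x. x \<in> U \<Longrightarrow> g x = f x) \<Longrightarrow> g \<in> R"
begin

lemma uminus: "f \<in> R \<Longrightarrow> (\<lambda>x. - f x) \<in> R"
 using mult[OF const[of "-1"], of f] by simp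

lemma diff: "f \<in> R \<Longrightarrow> g \<in> R \<Longrightarrow> (\<lambda>x. f x - g x) \<in> R"
 using add[OF _ uminus, of f g] by simp

lemma power: "f \<in> R \<Longrightarrow> (\<lambda>x. f x ^ k) \<in> R"
 by (induction k) (auto intro: const mult)

lemma sum: "(\<And>i. i \<in> I \<Longrightarrow> f i \<in> R) \<Longrightarrow> (\<lambda>x. \<Sum>i\<in>I. f i x) \<in> R"
 by (induction I rule: infinite_finite_induct) (auto intro: const add)

lemma prod: "(\<And>i. i \<in> I \<Longrightarrow> f i \<in> R) \<Longrightarrow> (\<lambda>x. \<Prod>i\<in>I. f i x) \<in> R"
 by (induction I rule: infinite_finite_induct) (auto intro: const mult)

lemma poly_funs_comp:
 assumes "f \<in> poly_funs K" "\<And>k. k \<in> K \<Longrightarrow> (\<lambda>x. k (\<phi> x)) \<in> R"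
 shows "(\<lambda>x. f (\<phi> x)) \<in> R"
 using assms(1) by induction (auto intro: const add mult assms(2))

text \<open>Matrices with entries in the ring. Proving regularity of a map reduces to reading off how it is
 built from matrix operations.\<close>

definition mats :: "nat \<Rightarrow> nat \<Rightarrow> ('a \<Rightarrow> complex mat) \<Rightarrow> bool" where
 "mats r c F \<longleftrightarrow> (\<forall>x\<in>U. F x \<in> carrier_mat r c) \<and> (\<forall>i<r. \<forall>j<c. (\<lambda>x. F x $$ (i, j)) \<in> R)"

lemma matsI:
 assumes "\<And>x. x \<in> U \<Longrightarrow> F x \<in> carrier_mat r c"
  "\<And>i j. i < r \<Longrightarrow> j < c \<Longrightarrow> (\<lambda>x. F x $$ (i, j)) \<in> R"
 shows "mats r c F"
 using assms unfolding mats_def by blast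

lemma matsD:
 assumes "mats r c F"
 shows "x \<in> U \<Longrightarrow> F x \<in> carrier_mat r c" "x \<in> U \<Longrightarrow> dim_row (F x) = r" "x \<in> U \<Longrightarrow> dim_col (F x) = c"
  "i < r \<Longrightarrow> j < c \<Longrightarrow> (\<lambda>x. F x $$ (i, j)) \<in> R"
 using assms unfolding mats_def by auto

lemma mats_cong: "mats r c F \<Longrightarrow> (\<And>x. x \<in> U \<Longrightarrow> G x = F x) \<Longrightarrow> mats r c G"
 by (rule matsI) (auto simp: mats_def intro: cong[of "\<lambda>x. F x $$ (i, j)" "\<lambda>x. G x $$ (i, j)" for i j])

lemma mats_const: "A \<in> carrier_mat r c \<Longrightarrow> mats r c (\<lambda>_. A)"
 by (rule matsI) (auto intro: const)

lemma mats_mat: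
 assumes "\<And>i j. i < r \<Longrightarrow> j < c \<Longrightarrow> (\<lambda>x. f x (i, j)) \<in> R"
 shows "mats r c (\<lambda>x. mat r c (f x))"
 using assms by (intro matsI) (auto intro: cong)

lemma mats_transpose:
 assumes F: "mats r c F"
 shows "mats c r (\<lambda>x. transpose_mat (F x))"
proof (rule matsI)
 show "transpose_mat (F x) \<in> carrier_mat c r" if "x \<in> U" for x
  using assms that by (auto dest: matsD)
 fix i j assume ij: "i < c" "j < r"
 have "(\<lambda>x. F x $$ (j, i)) \<in> R" by (intro matsD(4)[OF F]) (use ij in auto)
 then show "(\<lambda>x. (transpose_mat (F x)) $$ (i, j)) \<in> R"
  by (rule cong) (use ij matsD(2,3)[OF F] in simp)
qed

lemma mats_uminus:
 assumes F: "mats r c F"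
 shows "mats r c (\<lambda>x. - F x)"
proof (rule matsI)
 show "- F x \<in> carrier_mat r c" if "x \<in> U" for x
  using assms that by (auto dest: matsD)
 fix i j assume ij: "i < r" "j < c"
 have "(\<lambda>x. - F x $$ (i, j)) \<in> R" by (intro uminus matsD(4)[OF F]) (use ij in auto)
 then show "(\<lambda>x. (- F x) $$ (i, j)) \<in> R"
  by (rule cong) (use ij matsD(2,3)[OF F] in simp)
qed

lemma mats_smult:
 assumes f: "f \<in> R" and F: "mats r c F"
 shows "mats r c (\<lambda>x. f x \<cdot>\<^sub>m F x)"
proof (rule matsI)
 show "f x \<cdot>\<^sub>m F x \<in> carrier_mat r c" if "x \<in> U" for x
  using assms that by (auto dest: matsD)
 fix i j assume ij: "i < r" "j < c"
 have "(\<lambda>x. f x * F x $$ (i, j)) \<in> R" by (intro mult f matsD(4)[OF F]) (use ij in auto)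
 then show "(\<lambda>x. (f x \<cdot>\<^sub>m F x) $$ (i, j)) \<in> R"
  by (rule cong) (use ij matsD(2,3)[OF F] in simp)
qed

lemma mats_add:
 assumes F: "mats r c F" and G: "mats r c G"
 shows "mats r c (\<lambda>x. F x + G x)"
proof (rule matsI)
 show "F x + G x \<in> carrier_mat r c" if "x \<in> U" for x
  using assms that by (auto dest: matsD)
 fix i j assume ij: "i < r" "j < c"
 have "(\<lambda>x. F x $$ (i, j) + G x $$ (i, j)) \<in> R" by (intro add matsD(4)[OF F] matsD(4)[OF G]) (use ij in auto)
 then show "(\<lambda>x. (F x + G x) $$ (i, j)) \<in> R"
  by (rule cong) (use ij matsD(2,3)[OF F] matsD(2,3)[OF G] in simp)
qed

lemma mats_diff:
 assumes F: "mats r c F" and G: "mats r c G"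
 shows "mats r c (\<lambda>x. F x - G x)"
proof (rule matsI)
 show "F x - G x \<in> carrier_mat r c" if "x \<in> U" for x
  by (rule minus_carrier_mat[OF matsD(1)[OF G that]])
 fix i j assume ij: "i < r" "j < c"
 have "(\<lambda>x. F x $$ (i, j) - G x $$ (i, j)) \<in> R" by (intro diff matsD(4)[OF F] matsD(4)[OF G]) (use ij in auto)
 then show "(\<lambda>x. (F x - G x) $$ (i, j)) \<in> R"
  by (rule cong) (use ij matsD(2,3)[OF F] matsD(2,3)[OF G] in simp)
qed

lemma mats_mult:
 assumes F: "mats r k F" and G: "mats k c G"
 shows "mats r c (\<lambda>x. F x * G x)"
proof (rule matsI)
 show "F x * G x \<in> carrier_mat r c" if "x \<in> U" for x
  using matsD(1)[OF F that] matsD(1)[OF G that] by simp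
 fix i j assume ij: "i < r" "j < c"
 have "(\<lambda>x. \<Sum>l = 0..<k. F x $$ (i, l) * G x $$ (l, j)) \<in> R"
  by (intro sum mult matsD(4)[OF F] matsD(4)[OF G]) (use ij in auto)
 then show "(\<lambda>x. (F x * G x) $$ (i, j)) \<in> R"
  by (rule cong) (use ij matsD(2,3)[OF F] matsD(2,3)[OF G] in \<open>simp add: scalar_prod_def\<close>)
qed

lemma mats_power:
 assumes F: "mats r r F"
 shows "mats r r (\<lambda>x. F x ^\<^sub>m k)"
proof (induction k)
 case 0
 have "mats r r (\<lambda>_. 1\<^sub>m r)" by (rule mats_const) simp
 then show ?case by (rule mats_cong) (use matsD(2)[OF F] in simp)
next
 case (Suc k)
 show ?case using mats_mult[OF Suc F] by simp
qed

lemma mats_det: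
 assumes F: "mats r r F"
 shows "(\<lambda>x. det (F x)) \<in> R"
proof (rule cong)
 show "(\<lambda>x. \<Sum>p\<in>{p. p permutes {0..<r}}. of_int (sign p) * (\<Prod>i = 0..<r. F x $$ (i, p i))) \<in> R"
  by (intro sum mult const prod matsD(4)[OF F]) (auto dest: permutes_in_image)
 show "det (F x) = (\<Sum>p\<in>{p. p permutes {0..<r}}. of_int (sign p) * (\<Prod>i = 0..<r. F x $$ (i, p i)))"
  if "x \<in> U" for x
  using det_def'[OF matsD(1)[OF F that]] by (simp add: of_int_hom.hom_sum)
qed

lemma mats_adj:
 assumes F: "mats r r F"
 shows "mats r r (\<lambda>x. adj_mat (F x))"
proof (rule matsI)
 show "adj_mat (F x) \<in> carrier_mat r r" if "x \<in> U" for x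
  by (rule adj_mat(1)[OF matsD(1)[OF F that]])
 fix i j assume ij: "i < r" "j < r"
 have "mats (r - 1) (r - 1) (\<lambda>x. mat_delete (F x) j i)"
 proof (rule matsI)
  show "mat_delete (F x) j i \<in> carrier_mat (r - 1) (r - 1)" if "x \<in> U" for x
   by (rule mat_delete_carrier[OF matsD(1)[OF F that]])
  fix i' j' assume ij': "i' < r - 1" "j' < r - 1"
  let ?i = "if i' < j then i' else Suc i'" and ?j = "if j' < i then j' else Suc j'"
  have "(\<lambda>x. F x $$ (?i, ?j)) \<in> R" by (rule matsD(4)[OF F]) (use ij' in auto)
  then show "(\<lambda>x. mat_delete (F x) j i $$ (i', j')) \<in> R"
   by (rule cong) (use ij' matsD(2,3)[OF F] in \<open>auto simp: mat_delete_def\<close>)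
 qed
 then have "(\<lambda>x. (-1) ^ (j + i) * det (mat_delete (F x) j i)) \<in> R" by (intro mult const mats_det)
 then show "(\<lambda>x. adj_mat (F x) $$ (i, j)) \<in> R"
  by (rule cong) (use ij matsD(2,3)[OF F] in \<open>simp add: adj_mat_def cofactor_def\<close>)
qed

end

locale function_ring_inv = function_ring +
 assumes inverse: "f \<in> R \<Longrightarrow> (\<And>x. x \<in> U \<Longrightarrow> f x \<noteq> 0) \<Longrightarrow> (\<lambda>x. 1 / f x) \<in> R"
begin

lemma divide:
 assumes "f \<in> R" "g \<in> R" "\<And>x. x \<in> U \<Longrightarrow> g x \<noteq> 0"
 shows "(\<lambda>x. f x / g x) \<in> R"
 using mult[OF assms(1) inverse[OF assms(2)]] assms(3) by simp

lemma mats_inv: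
 assumes F: "mats r r F" and d: "\<And>x. x \<in> U \<Longrightarrow> det (F x) \<noteq> 0"
 shows "mats r r (\<lambda>x. inv_mat (F x))"
proof (rule mats_cong)
 show "mats r r (\<lambda>x. (1 / det (F x)) \<cdot>\<^sub>m adj_mat (F x))"
  by (intro mats_smult inverse[OF mats_det[OF F] d] mats_adj[OF F])
 show "inv_mat (F x) = (1 / det (F x)) \<cdot>\<^sub>m adj_mat (F x)" if "x \<in> U" for x
  by (rule inv_mat_adj[OF matsD(1)[OF F that] d[OF that]])
qed

end

definition polys_on :: "('a \<Rightarrow> complex) set \<Rightarrow> 'a set \<Rightarrow> ('a \<Rightarrow> complex) set" where
 "polys_on K U = {f. \<exists>a\<in>poly_funs K. \<forall>x\<in>U. f x = a x}"

lemma polys_on: "function_ring U (polys_on K U)"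
proof
 fix f g :: "'a \<Rightarrow> complex" and c
 show "(\<lambda>_. c) \<in> polys_on K U" unfolding polys_on_def by (intro CollectI bexI[OF _ poly_funs.const[of c]]) simp
 { assume "f \<in> polys_on K U" "g \<in> polys_on K U"
  then obtain a b where ab: "a \<in> poly_funs K" "b \<in> poly_funs K" "\<forall>x\<in>U. f x = a x" "\<forall>x\<in>U. g x = b x"
   unfolding polys_on_def by blast
  show "(\<lambda>x. f x + g x) \<in> polys_on K U"
   unfolding polys_on_def using poly_funs.add[OF ab(1,2)] ab(3,4) by force
  show "(\<lambda>x. f x * g x) \<in> polys_on K U"
   unfolding polys_on_def using poly_funs.mult[OF ab(1,2)] ab(3,4) by force }
 { assume "f \<in> polys_on K U" "\<And>x. x \<in> U \<Longrightarrow> g x = f x"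
  then show "g \<in> polys_on K U" unfolding polys_on_def by auto }
qed

text \<open>Membership in this set does not depend on the values outside \<open>U\<close>, which frees the calculus from
 restricting every function to its domain.\<close>

definition regs :: "('a \<Rightarrow> complex) set \<Rightarrow> 'a set \<Rightarrow> ('a \<Rightarrow> complex) set" where
 "regs K U = {f. \<forall>x\<in>U. \<exists>a\<in>poly_funs K. \<exists>b\<in>poly_funs K. b x \<noteq> 0 \<and> (\<forall>y\<in>U. b y \<noteq> 0 \<longrightarrow> f y = a y / b y)}"

lemma regsD:
 assumes "f \<in> regs K U" "x \<in> U"
 shows "\<exists>a\<in>poly_funs K. \<exists>b\<in>poly_funs K. b x \<noteq> 0 \<and> (\<forall>y\<in>U. b y \<noteq> 0 \<longrightarrow> f y = a y / b y)"
 using assms unfolding regs_def by blast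

lemma regsI:
 assumes "\<And>x. x \<in> U \<Longrightarrow> \<exists>a\<in>poly_funs K. \<exists>b\<in>poly_funs K. b x \<noteq> 0 \<and> (\<forall>y\<in>U. b y \<noteq> 0 \<longrightarrow> f y = a y / b y)"
 shows "f \<in> regs K U"
 using assms unfolding regs_def by blast

lemma polys_on_regs: "f \<in> polys_on K U \<Longrightarrow> f \<in> regs K U"
proof (rule regsI)
 fix x assume "f \<in> polys_on K U" and "x \<in> U"
 then obtain a where "a \<in> poly_funs K" "\<forall>x\<in>U. f x = a x" unfolding polys_on_def by blast
 then show "\<exists>a\<in>poly_funs K. \<exists>b\<in>poly_funs K. b x \<noteq> 0 \<and> (\<forall>y\<in>U. b y \<noteq> 0 \<longrightarrow> f y = a y / b y)"
  by (intro bexI[of _ a] bexI[OF _ poly_funs.const[of 1]]) auto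
qed

lemma poly_funs_regs: "f \<in> poly_funs K \<Longrightarrow> f \<in> regs K U"
 by (rule polys_on_regs) (auto simp: polys_on_def)

lemma regs_subset: "f \<in> regs K U \<Longrightarrow> V \<subseteq> U \<Longrightarrow> f \<in> regs K V"
proof (rule regsI)
 fix x assume f: "f \<in> regs K U" and V: "V \<subseteq> U" "x \<in> V"
 obtain a b where "a \<in> poly_funs K" "b \<in> poly_funs K" "b x \<noteq> 0"
  "\<And>y. y \<in> U \<Longrightarrow> b y \<noteq> 0 \<Longrightarrow> f y = a y / b y" using regsD[OF f subsetD[OF V]] by blast
 with V(1) show "\<exists>a\<in>poly_funs K. \<exists>b\<in>poly_funs K. b x \<noteq> 0 \<and> (\<forall>y\<in>V. b y \<noteq> 0 \<longrightarrow> f y = a y / b y)"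
  by blast
qed

lemma regs: "function_ring_inv U (regs K U)"
proof
 fix f g :: "'a \<Rightarrow> complex" and c
 show "(\<lambda>_. c) \<in> regs K U" by (rule poly_funs_regs[OF poly_funs.const])
 { assume f: "f \<in> regs K U" and g: "g \<in> regs K U"
  show "(\<lambda>x. f x + g x) \<in> regs K U"
  proof (rule regsI)
   fix x assume x: "x \<in> U"
   obtain a b where ab: "a \<in> poly_funs K" "b \<in> poly_funs K" "b x \<noteq> 0"
    "\<And>y. y \<in> U \<Longrightarrow> b y \<noteq> 0 \<Longrightarrow> f y = a y / b y" using regsD[OF f x] by blast
   obtain c d where cd: "c \<in> poly_funs K" "d \<in> poly_funs K" "d x \<noteq> 0"
    "\<And>y. y \<in> U \<Longrightarrow> d y \<noteq> 0 \<Longrightarrow> g y = c y / d y" using regsD[OF g x] by blast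
   show "\<exists>a\<in>poly_funs K. \<exists>b\<in>poly_funs K. b x \<noteq> 0 \<and> (\<forall>y\<in>U. b y \<noteq> 0 \<longrightarrow> f y + g y = a y / b y)"
    using ab cd
    by (intro bexI[of _ "\<lambda>y. a y * d y + c y * b y"] bexI[of _ "\<lambda>y. b y * d y"])
     (auto intro!: poly_funs.add poly_funs.mult simp: field_simps)
  qed
  show "(\<lambda>x. f x * g x) \<in> regs K U"
  proof (rule regsI)
   fix x assume x: "x \<in> U"
   obtain a b where ab: "a \<in> poly_funs K" "b \<in> poly_funs K" "b x \<noteq> 0"
    "\<And>y. y \<in> U \<Longrightarrow> b y \<noteq> 0 \<Longrightarrow> f y = a y / b y" using regsD[OF f x] by blast
   obtain c d where cd: "c \<in> poly_funs K" "d \<in> poly_funs K" "d x \<noteq> 0"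
    "\<And>y. y \<in> U \<Longrightarrow> d y \<noteq> 0 \<Longrightarrow> g y = c y / d y" using regsD[OF g x] by blast
   show "\<exists>a\<in>poly_funs K. \<exists>b\<in>poly_funs K. b x \<noteq> 0 \<and> (\<forall>y\<in>U. b y \<noteq> 0 \<longrightarrow> f y * g y = a y / b y)"
    using ab cd
    by (intro bexI[of _ "\<lambda>y. a y * c y"] bexI[of _ "\<lambda>y. b y * d y"])
     (auto intro!: poly_funs.mult)
  qed }
 { assume "f \<in> regs K U" "\<And>x. x \<in> U \<Longrightarrow> g x = f x"
  then show "g \<in> regs K U" unfolding regs_def by simp }
 { assume f: "f \<in> regs K U" and nz: "\<And>x. x \<in> U \<Longrightarrow> f x \<noteq> 0"
  show "(\<lambda>x. 1 / f x) \<in> regs K U"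
  proof (rule regsI)
   fix x assume x: "x \<in> U"
   obtain a b where ab: "a \<in> poly_funs K" "b \<in> poly_funs K" "b x \<noteq> 0"
    "\<And>y. y \<in> U \<Longrightarrow> b y \<noteq> 0 \<Longrightarrow> f y = a y / b y" using regsD[OF f x] by blast
   have "a x \<noteq> 0" using ab(3) ab(4)[of x] nz[OF x] x by auto
   then show "\<exists>a\<in>poly_funs K. \<exists>b\<in>poly_funs K. b x \<noteq> 0 \<and> (\<forall>y\<in>U. b y \<noteq> 0 \<longrightarrow> 1 / f y = a y / b y)"
    using ab
    by (intro bexI[of _ "\<lambda>y. b y * b y"] bexI[of _ "\<lambda>y. a y * b y"])
     (auto intro!: poly_funs.mult)
  qed }
qed

lemma regs_comp:
 assumes f: "f \<in> regs K V" and \<phi>: "\<And>x. x \<in> U \<Longrightarrow> \<phi> x \<in> V"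
  and coords: "\<And>k. k \<in> K \<Longrightarrow> (\<lambda>x. k (\<phi> x)) \<in> regs L U"
 shows "(\<lambda>x. f (\<phi> x)) \<in> regs L U"
proof (rule regsI)
 interpret function_ring_inv U "regs L U" by (rule regs)
 fix x assume x: "x \<in> U"
 obtain a b where ab: "a \<in> poly_funs K" "b \<in> poly_funs K" "b (\<phi> x) \<noteq> 0"
  "\<And>y. y \<in> V \<Longrightarrow> b y \<noteq> 0 \<Longrightarrow> f y = a y / b y" using regsD[OF f \<phi>[OF x]] by blast
 have comp_a: "(\<lambda>x. a (\<phi> x)) \<in> regs L U" by (rule poly_funs_comp[OF ab(1)]) (rule coords)
 have comp_b: "(\<lambda>x. b (\<phi> x)) \<in> regs L U" by (rule poly_funs_comp[OF ab(2)]) (rule coords)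
 obtain a1 a2 where a: "a1 \<in> poly_funs L" "a2 \<in> poly_funs L" "a2 x \<noteq> 0"
  "\<And>y. y \<in> U \<Longrightarrow> a2 y \<noteq> 0 \<Longrightarrow> a (\<phi> y) = a1 y / a2 y"
  using regsD[OF comp_a x] by blast
 obtain b1 b2 where b: "b1 \<in> poly_funs L" "b2 \<in> poly_funs L" "b2 x \<noteq> 0"
  "\<And>y. y \<in> U \<Longrightarrow> b2 y \<noteq> 0 \<Longrightarrow> b (\<phi> y) = b1 y / b2 y"
  using regsD[OF comp_b x] by blast
 have "b1 x \<noteq> 0" using b(3) b(4)[of x] x ab(3) by auto
 moreover have "f (\<phi> y) = (a1 y * b2 y * b2 y) / (a2 y * b1 y * b2 y)"
  if "y \<in> U" "a2 y * b1 y * b2 y \<noteq> 0" for y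
  using that a(4)[of y] b(4)[of y] ab(4)[of "\<phi> y"] \<phi>[of y] by auto
 ultimately show "\<exists>a\<in>poly_funs L. \<exists>b\<in>poly_funs L. b x \<noteq> 0 \<and> (\<forall>y\<in>U. b y \<noteq> 0 \<longrightarrow> f (\<phi> y) = a y / b y)"
  using a b
  by (intro bexI[of _ "\<lambda>y. a1 y * b2 y * b2 y"] bexI[of _ "\<lambda>y. a2 y * b1 y * b2 y"])
   (auto intro!: poly_funs.mult)
qed

text \<open>Quotients of polynomial functions may be tested on the whole of \<open>U\<close> instead of on a
 neighbourhood, since a neighbourhood contains a basic open set, whose equation can be absorbed into numerator
 and denominator.\<close>

lemma regular_funs_iff:
 assumes "openin (zariski X) U"
 shows "f \<in> regular_funs X U \<longleftrightarrow> f \<in> extensional U \<and> f \<in> regs (coords X) U"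
proof
 assume f: "f \<in> regular_funs X U"
 have "f \<in> regs (coords X) U"
 proof (rule regsI)
  fix x assume "x \<in> U"
  then obtain V a b where V: "openin (zariski X) V" "x \<in> V" "V \<subseteq> U"
   and ab: "a \<in> poly_funs (coords X)" "b \<in> poly_funs (coords X)" "\<forall>y\<in>V. b y \<noteq> 0 \<and> f y = a y / b y"
   using f unfolding regular_funs_def by blast
  obtain S where S: "S \<subseteq> poly_funs (coords X)" "V = {x \<in> points X. \<exists>f\<in>S. f x \<noteq> 0}"
   using V(1) unfolding openin_zariski by blast
  then obtain c where c: "c \<in> S" "c x \<noteq> 0" using V(2) by blast
  have Up: "U \<subseteq> points X" using assms unfolding openin_zariski by blast
  have "f y = (a y * c y) / (b y * c y)" if "y \<in> U" "b y * c y \<noteq> 0" for y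
  proof -
   have "y \<in> V" using that c(1) Up unfolding S(2) by auto
   with ab(3) that(2) show ?thesis by auto
  qed
  with ab V(2) c S(1)
  show "\<exists>a\<in>poly_funs (coords X). \<exists>b\<in>poly_funs (coords X). b x \<noteq> 0 \<and> (\<forall>y\<in>U. b y \<noteq> 0 \<longrightarrow> f y = a y / b y)"
   by (intro bexI[of _ "\<lambda>y. a y * c y"] bexI[of _ "\<lambda>y. b y * c y"]) (auto intro!: poly_funs.mult)
 qed
 with f show "f \<in> extensional U \<and> f \<in> regs (coords X) U" unfolding regular_funs_def by blast
next
 assume f: "f \<in> extensional U \<and> f \<in> regs (coords X) U"
 have "\<exists>V. openin (zariski X) V \<and> x \<in> V \<and> V \<subseteq> U \<and>
     (\<exists>a\<in>poly_funs (coords X). \<exists>b\<in>poly_funs (coords X). \<forall>y\<in>V. b y \<noteq> 0 \<and> f y = a y / b y)"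
  if x: "x \<in> U" for x
 proof -
  obtain a b where ab: "a \<in> poly_funs (coords X)" "b \<in> poly_funs (coords X)" "b x \<noteq> 0"
   "\<And>y. y \<in> U \<Longrightarrow> b y \<noteq> 0 \<Longrightarrow> f y = a y / b y" using f x regsD[of f "coords X" U x] by blast
  have "openin (zariski X) {x \<in> points X. \<exists>f\<in>{b}. f x \<noteq> 0}"
   unfolding openin_zariski using ab(2) by blast
  then have "openin (zariski X) (U \<inter> {x \<in> points X. \<exists>f\<in>{b}. f x \<noteq> 0})"
   by (rule openin_Int[OF assms])
  moreover have "x \<in> points X" using x assms unfolding openin_zariski by blast
  moreover have "\<forall>y\<in>U \<inter> {x \<in> points X. \<exists>f\<in>{b}. f x \<noteq> 0}. b y \<noteq> 0 \<and> f y = a y / b y"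
   using ab(4) by simp
  ultimately show ?thesis using ab(1-3) x by blast
 qed
 with f show "f \<in> regular_funs X U" unfolding regular_funs_def by blast
qed

section \<open>Regular functions on affine sets\<close>

text \<open>A closed subset of a principal open subset of an affine space, with countably many
 coordinates.\<close>

definition affine_set :: "('a \<Rightarrow> complex) set \<Rightarrow> 'a set \<Rightarrow> ('a \<Rightarrow> complex) \<Rightarrow> 'a set \<Rightarrow> bool" where
 "affine_set K E D U \<longleftrightarrow> countable K \<and> free_coords K E \<and> D \<in> poly_funs K \<and>
   (\<exists>S\<subseteq>poly_funs K. U = {z \<in> E. (\<forall>f\<in>S. f z = 0) \<and> D z \<noteq> 0})"

lemma affine_set_basic_open:
 assumes "affine_set K E D U" "b \<in> poly_funs K"
 shows "affine_set K E (\<lambda>x. D x * b x) {x \<in> U. b x \<noteq> 0}"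
proof -
 from assms(1) obtain S where S: "countable K" "free_coords K E" "D \<in> poly_funs K" "S \<subseteq> poly_funs K"
  "U = {z \<in> E. (\<forall>f\<in>S. f z = 0) \<and> D z \<noteq> 0}" unfolding affine_set_def by blast
 then have "{x \<in> U. b x \<noteq> 0} = {z \<in> E. (\<forall>f\<in>S. f z = 0) \<and> D z * b z \<noteq> 0}" by auto
 with S show ?thesis unfolding affine_set_def using poly_funs.mult[OF S(3) assms(2)] by blast
qed

lemma affine_nullstellensatz:
 assumes U: "affine_set K E D U" and J: "poly_ideal K J"
  and vanish: "\<And>f. f \<in> poly_funs K \<Longrightarrow> (\<And>x. x \<in> U \<Longrightarrow> f x = 0) \<Longrightarrow> f \<in> J"
  and a: "a \<in> poly_funs K" and no: "\<And>e. (\<lambda>x. (a x * D x) ^ e) \<notin> J"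
 shows "\<exists>x\<in>U. (\<forall>f\<in>J. f x = 0) \<and> a x \<noteq> 0"
proof -
 from U obtain S where S: "countable K" "free_coords K E" "D \<in> poly_funs K" "S \<subseteq> poly_funs K"
  "U = {z \<in> E. (\<forall>f\<in>S. f z = 0) \<and> D z \<noteq> 0}" unfolding affine_set_def by blast
 obtain x where x: "x \<in> E" "\<And>f. f \<in> J \<Longrightarrow> f x = 0" "a x * D x \<noteq> 0"
  using nullstellensatz[OF S(1,2) J poly_funs.mult[OF a S(3)] no, of thesis] by blast
 have "f \<in> J" if "f \<in> S" for f using vanish[of f] that S(4,5) by blast
 then have "x \<in> U" using x unfolding S(5) by auto
 with x show ?thesis by auto
qed

text \<open>The denominators of \<open>f\<close> form an ideal without a common zero on \<open>U\<close>, so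
 that it contains a power of \<open>D\<close>.\<close>

lemma regs_affine:
 assumes U: "affine_set K E D U" and f: "f \<in> regs K U"
 obtains a e where "a \<in> poly_funs K" "\<And>x. x \<in> U \<Longrightarrow> f x = a x / D x ^ e"
proof -
 let ?J = "{b \<in> poly_funs K. \<exists>a\<in>poly_funs K. \<forall>x\<in>U. b x * f x = a x}"
 have D: "D \<in> poly_funs K" and D0: "\<And>x. x \<in> U \<Longrightarrow> D x \<noteq> 0" using U unfolding affine_set_def by auto
 have J: "poly_ideal K ?J"
  unfolding poly_ideal_def
 proof (intro conjI ballI)
  show "(\<lambda>_. 0) \<in> ?J" by (auto intro: poly_funs.const intro!: bexI[of _ "\<lambda>_. 0"])
  show "(\<lambda>x. b x + c x) \<in> ?J" if b: "b \<in> ?J" and c: "c \<in> ?J" for b c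
  proof -
   from b c obtain a d where "a \<in> poly_funs K" "\<forall>x\<in>U. b x * f x = a x" "d \<in> poly_funs K" "\<forall>x\<in>U. c x * f x = d x"
    by blast
   with b c show ?thesis
    by (auto intro!: poly_funs.add bexI[of _ "\<lambda>x. a x + d x"] simp: algebra_simps)
  qed
  show "(\<lambda>x. r x * b x) \<in> ?J" if r: "r \<in> poly_funs K" and b: "b \<in> ?J" for r b
  proof -
   from b obtain a where "a \<in> poly_funs K" "\<forall>x\<in>U. b x * f x = a x" by blast
   with b r show ?thesis
    by (auto intro!: poly_funs.mult bexI[of _ "\<lambda>x. r x * a x"] simp: algebra_simps)
  qed
 qed blast
 have vanish: "b \<in> ?J" if "b \<in> poly_funs K" "\<And>x. x \<in> U \<Longrightarrow> b x = 0" for b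
  using that by (auto intro!: bexI[of _ "\<lambda>_. 0"] poly_funs.const)
 have "\<exists>e. (\<lambda>x. (1 * D x) ^ e) \<in> ?J"
 proof (rule ccontr)
  assume neg: "\<not> ?thesis"
  have no: "(\<lambda>x. (1 * D x) ^ e) \<notin> ?J" for e
   by (rule notI) (rule notE[OF neg exI[of _ e]])
  have "\<exists>x\<in>U. (\<forall>b\<in>?J. b x = 0) \<and> (1::complex) \<noteq> 0"
   by (rule affine_nullstellensatz[OF U J]) (rule vanish, assumption+, rule poly_funs.const, rule no)
  then obtain x where x: "x \<in> U" "\<forall>b\<in>?J. b x = 0" by (elim bexE conjE)
  obtain a b where ab: "a \<in> poly_funs K" "b \<in> poly_funs K" "b x \<noteq> 0"
   "\<And>y. y \<in> U \<Longrightarrow> b y \<noteq> 0 \<Longrightarrow> f y = a y / b y" using regsD[OF f x(1)] by blast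
  have eq: "(b y * b y) * f y = b y * a y" if "y \<in> U" for y
   using ab(4)[OF that] by (cases "b y = 0") auto
  have "(\<lambda>y. b y * b y) \<in> ?J"
   by (intro CollectI conjI bexI[of _ "\<lambda>y. b y * a y"] ballI eq poly_funs.mult ab)
  from bspec[OF x(2) this] ab(3) show False by simp
 qed
 then obtain e where "(\<lambda>x. (1 * D x) ^ e) \<in> ?J" ..
 then have "\<exists>a\<in>poly_funs K. \<forall>x\<in>U. (1 * D x) ^ e * f x = a x" unfolding mem_Collect_eq by (rule conjunct2)
 then obtain a where a: "a \<in> poly_funs K" "\<forall>x\<in>U. (1 * D x) ^ e * f x = a x" ..
 have "f x = a x / D x ^ e" if "x \<in> U" for x
  using bspec[OF a(2) that] D0[OF that] by (simp add: field_simps)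
 with a(1) show thesis by (rule that)
qed

section \<open>The topologies of a variety and of its scheme\<close>

lemma closedin_zariski:
 "closedin (zariski X) C \<longleftrightarrow> (\<exists>S\<subseteq>poly_funs (coords X). C = {x \<in> points X. \<forall>f\<in>S. f x = 0})"
proof
 assume "closedin (zariski X) C"
 then have C: "C \<subseteq> points X" "openin (zariski X) (points X - C)"
  unfolding closedin_def topspace_zariski by auto
 then obtain S where "S \<subseteq> poly_funs (coords X)" "points X - C = {x \<in> points X. \<exists>f\<in>S. f x \<noteq> 0}"
  unfolding openin_zariski by blast
 then show "\<exists>S\<subseteq>poly_funs (coords X). C = {x \<in> points X. \<forall>f\<in>S. f x = 0}"
  using C(1) by (intro exI[of _ S]) blast
next
 assume "\<exists>S\<subseteq>poly_funs (coords X). C = {x \<in> points X. \<forall>f\<in>S. f x = 0}"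
 then obtain S where S: "S \<subseteq> poly_funs (coords X)" "C = {x \<in> points X. \<forall>f\<in>S. f x = 0}" by blast
 then have "points X - C = {x \<in> points X. \<exists>f\<in>S. f x \<noteq> 0}" by blast
 then have "openin (zariski X) (points X - C)" unfolding openin_zariski using S(1) by blast
 then show "closedin (zariski X) C" unfolding closedin_def topspace_zariski using S(2) by blast
qed

lemma closedin_zariski_funs:
 "A \<subseteq> poly_funs (coords X) \<Longrightarrow> closedin (zariski X) {x \<in> points X. \<forall>f\<in>A. f x = 0}"
 unfolding closedin_zariski by blast

lemma zariski_closure:
 assumes A: "A \<subseteq> points X"
 shows "Abstract_Topology.closure_of (zariski X) A =
  {y \<in> points X. \<forall>f\<in>poly_funs (coords X). (\<forall>x\<in>A. f x = 0) \<longrightarrow> f y = 0}"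
proof (intro equalityI subsetI)
 let ?S = "{f \<in> poly_funs (coords X). \<forall>x\<in>A. f x = 0}"
 fix y assume y: "y \<in> Abstract_Topology.closure_of (zariski X) A"
 have "closedin (zariski X) {x \<in> points X. \<forall>f\<in>?S. f x = 0}" by (rule closedin_zariski_funs) simp
 moreover have "A \<subseteq> {x \<in> points X. \<forall>f\<in>?S. f x = 0}" using A by auto
 ultimately have "y \<in> {x \<in> points X. \<forall>f\<in>?S. f x = 0}" using closure_of_minimal y by (metis (lifting) subsetD)
 then show "y \<in> {y \<in> points X. \<forall>f\<in>poly_funs (coords X). (\<forall>x\<in>A. f x = 0) \<longrightarrow> f y = 0}" by auto
next
 fix y assume y: "y \<in> {y \<in> points X. \<forall>f\<in>poly_funs (coords X). (\<forall>x\<in>A. f x = 0) \<longrightarrow> f y = 0}"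
 have "\<exists>x\<in>A. x \<in> T" if T: "y \<in> T" "openin (zariski X) T" for T
 proof -
  obtain S where S: "S \<subseteq> poly_funs (coords X)" "T = {x \<in> points X. \<exists>f\<in>S. f x \<noteq> 0}"
   using T(2) unfolding openin_zariski by (elim exE conjE)
  then obtain f where f: "f \<in> S" "f y \<noteq> 0" using T(1) by auto
  then obtain x where "x \<in> A" "f x \<noteq> 0" using y S(1) by auto
  then show ?thesis using f(1) S(2) A by auto
 qed
 then show "y \<in> Abstract_Topology.closure_of (zariski X) A"
  unfolding in_closure_of topspace_zariski using y by auto
qed

lemma irreducible_closure_singleton:
 assumes x: "x \<in> topspace T"
 shows "irreducible_closed T (Abstract_Topology.closure_of T {x})"
proof -
 let ?Z = "Abstract_Topology.closure_of T {x}"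
 have xZ: "x \<in> ?Z" using x closure_of_subset[of "{x}" T] by auto
 have sub: "?Z \<subseteq> C" if "closedin T C" "x \<in> C" for C using closure_of_minimal[of "{x}" C T] that by auto
 have "?Z = C \<or> ?Z = D" if C: "closedin T C" and D: "closedin T D" and "?Z = C \<union> D" for C D
 proof -
  have "x \<in> C \<or> x \<in> D" using xZ that(3) by blast
  then show ?thesis using sub[OF C] sub[OF D] that(3) by blast
 qed
 then show ?thesis unfolding irreducible_closed_def using xZ by auto
qed

lemma trace_on_open:
 assumes U: "openin (zariski X) U"
 shows "trace_on X {Z. irreducible_closed (zariski X) Z \<and> Z \<inter> U \<noteq> {}} = U"
proof -
 have Up: "U \<subseteq> points X" using openin_subset[OF U] topspace_zariski by metis
 have meets: "Abstract_Topology.closure_of (zariski X) {x} \<inter> U \<noteq> {} \<longleftrightarrow> x \<in> U" if x: "x \<in> points X" for x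
 proof
  assume "Abstract_Topology.closure_of (zariski X) {x} \<inter> U \<noteq> {}"
  then obtain y where y: "y \<in> Abstract_Topology.closure_of (zariski X) {x}" "y \<in> U" by blast
  then show "x \<in> U" using U unfolding in_closure_of by auto
 next
  assume "x \<in> U"
  moreover have "x \<in> Abstract_Topology.closure_of (zariski X) {x}"
   using x closure_of_subset[of "{x}" "zariski X"] by (simp add: topspace_zariski)
  ultimately show "Abstract_Topology.closure_of (zariski X) {x} \<inter> U \<noteq> {}" by blast
 qed
 show ?thesis
  unfolding trace_on_def using meets irreducible_closure_singleton[of _ "zariski X"] Up
  by (auto simp: topspace_zariski)
qed

lemma sober_open_trace:
 assumes "openin (sober_topology (zariski X)) W"
 shows "openin (zariski X) (trace_on X W)"
  "W = {Z. irreducible_closed (zariski X) Z \<and> Z \<inter> trace_on X W \<noteq> {}}"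
proof -
 obtain U where U: "openin (zariski X) U" "W = {Z. irreducible_closed (zariski X) Z \<and> Z \<inter> U \<noteq> {}}"
  using assms unfolding openin_sober_topology by blast
 then have "trace_on X W = U" using trace_on_open by simp
 with U show "openin (zariski X) (trace_on X W)"
  "W = {Z. irreducible_closed (zariski X) Z \<and> Z \<inter> trace_on X W \<noteq> {}}" by simp_all
qed

lemma topspace_sober: "topspace (sober_topology (zariski X)) = {Z. irreducible_closed (zariski X) Z}"
proof
 show "topspace (sober_topology (zariski X)) \<subseteq> {Z. irreducible_closed (zariski X) Z}"
  using openin_topspace[of "sober_topology (zariski X)"] unfolding openin_sober_topology by auto
 have "openin (zariski X) (points X)" using openin_topspace[of "zariski X"] topspace_zariski by metis
 then have "openin (sober_topology (zariski X)) {Z. irreducible_closed (zariski X) Z \<and> Z \<inter> points X \<noteq> {}}"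
  unfolding openin_sober_topology by blast
 moreover have "Z \<inter> points X \<noteq> {}" if "irreducible_closed (zariski X) Z" for Z
  using that closedin_subset[of "zariski X" Z] unfolding irreducible_closed_def topspace_zariski by auto
 ultimately show "{Z. irreducible_closed (zariski X) Z} \<subseteq> topspace (sober_topology (zariski X))"
  using openin_subset by fastforce
qed

section \<open>The spectrum of an algebra of functions on an affine variety\<close>

text \<open>An algebra \<open>B\<close> of which an evaluation map \<open>ev\<close> identifies the elements
 with the regular functions on an affine variety \<open>X\<close>. The elements of \<open>B\<close> need not
 be functions on \<open>X\<close> itself: those of the algebra of the birational map are functions on another
 variety.\<close>

locale function_model =
 fixes X :: "'a variety" and E :: "'a set" and D :: "'a \<Rightarrow> complex"
  and B :: "(complex, 'b) module" and ev :: "'b \<Rightarrow> 'a \<Rightarrow> complex"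
 assumes affine: "affine_set (coords X) E D (points X)"
  and cring: "cring B"
  and ev_add: "a \<in> carrier B \<Longrightarrow> b \<in> carrier B \<Longrightarrow> x \<in> points X \<Longrightarrow> ev (a \<oplus>\<^bsub>B\<^esub> b) x = ev a x + ev b x"
  and ev_mult: "a \<in> carrier B \<Longrightarrow> b \<in> carrier B \<Longrightarrow> x \<in> points X \<Longrightarrow> ev (a \<otimes>\<^bsub>B\<^esub> b) x = ev a x * ev b x"
  and ev_zero: "x \<in> points X \<Longrightarrow> ev \<zero>\<^bsub>B\<^esub> x = 0"
  and ev_one: "x \<in> points X \<Longrightarrow> ev \<one>\<^bsub>B\<^esub> x = 1"
  and smult_closed: "a \<in> carrier B \<Longrightarrow> z \<odot>\<^bsub>B\<^esub> a \<in> carrier B"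
  and ev_smult: "a \<in> carrier B \<Longrightarrow> x \<in> points X \<Longrightarrow> ev (z \<odot>\<^bsub>B\<^esub> a) x = z * ev a x"
  and ev_inj: "a \<in> carrier B \<Longrightarrow> b \<in> carrier B \<Longrightarrow> (\<And>x. x \<in> points X \<Longrightarrow> ev a x = ev b x) \<Longrightarrow> a = b"
  and ev_regs: "a \<in> carrier B \<Longrightarrow> ev a \<in> regs (coords X) (points X)"
  and ev_surj: "f \<in> regs (coords X) (points X) \<Longrightarrow> \<exists>a\<in>carrier B. \<forall>x\<in>points X. ev a x = f x"
begin

lemma closed:
 "\<zero>\<^bsub>B\<^esub> \<in> carrier B" "\<one>\<^bsub>B\<^esub> \<in> carrier B"
 "a \<in> carrier B \<Longrightarrow> b \<in> carrier B \<Longrightarrow> a \<oplus>\<^bsub>B\<^esub> b \<in> carrier B"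
 "a \<in> carrier B \<Longrightarrow> b \<in> carrier B \<Longrightarrow> a \<otimes>\<^bsub>B\<^esub> b \<in> carrier B"
 "a \<in> carrier B \<Longrightarrow> b \<in> carrier B \<Longrightarrow> a \<ominus>\<^bsub>B\<^esub> b \<in> carrier B"
proof -
 interpret cring B by (rule cring)
 show "\<zero>\<^bsub>B\<^esub> \<in> carrier B" "\<one>\<^bsub>B\<^esub> \<in> carrier B"
  "a \<in> carrier B \<Longrightarrow> b \<in> carrier B \<Longrightarrow> a \<oplus>\<^bsub>B\<^esub> b \<in> carrier B"
  "a \<in> carrier B \<Longrightarrow> b \<in> carrier B \<Longrightarrow> a \<otimes>\<^bsub>B\<^esub> b \<in> carrier B"
  "a \<in> carrier B \<Longrightarrow> b \<in> carrier B \<Longrightarrow> a \<ominus>\<^bsub>B\<^esub> b \<in> carrier B" by auto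
qed

lemma ev_minus:
 assumes "a \<in> carrier B" "b \<in> carrier B" "x \<in> points X"
 shows "ev (a \<ominus>\<^bsub>B\<^esub> b) x = ev a x - ev b x"
proof -
 interpret cring B by (rule cring)
 have "a = (a \<ominus>\<^bsub>B\<^esub> b) \<oplus>\<^bsub>B\<^esub> b" using assms(1,2) by (simp add: minus_eq a_assoc l_neg)
 then have "ev a x = ev (a \<ominus>\<^bsub>B\<^esub> b) x + ev b x" using ev_add[OF closed(5)[OF assms(1,2)] assms(2,3)] by simp
 then show ?thesis by simp
qed

lemmas ev_simps = ev_add ev_mult ev_zero ev_one ev_smult ev_minus closed smult_closed

lemma ev_poly: "f \<in> poly_funs (coords X) \<Longrightarrow> \<exists>a\<in>carrier B. \<forall>x\<in>points X. ev a x = f x"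
 by (rule ev_surj[OF poly_funs_regs])

lemma primeD:
 assumes "primeideal P B"
 shows "P \<subseteq> carrier B" "\<zero>\<^bsub>B\<^esub> \<in> P" "\<one>\<^bsub>B\<^esub> \<notin> P"
  "a \<in> P \<Longrightarrow> b \<in> P \<Longrightarrow> a \<oplus>\<^bsub>B\<^esub> b \<in> P"
  "a \<in> carrier B \<Longrightarrow> b \<in> P \<Longrightarrow> a \<otimes>\<^bsub>B\<^esub> b \<in> P"
  "a \<in> carrier B \<Longrightarrow> b \<in> carrier B \<Longrightarrow> a \<otimes>\<^bsub>B\<^esub> b \<in> P \<Longrightarrow> a \<in> P \<or> b \<in> P"
proof -
 interpret primeideal P B by fact
 show "P \<subseteq> carrier B" by (rule a_subset)
 show "\<zero>\<^bsub>B\<^esub> \<in> P" by simp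
 show "\<one>\<^bsub>B\<^esub> \<notin> P" using I_notcarr one_imp_carrier by blast
 show "a \<in> P \<Longrightarrow> b \<in> P \<Longrightarrow> a \<oplus>\<^bsub>B\<^esub> b \<in> P" by simp
 show "a \<in> carrier B \<Longrightarrow> b \<in> P \<Longrightarrow> a \<otimes>\<^bsub>B\<^esub> b \<in> P" by (rule I_l_closed)
 show "a \<in> carrier B \<Longrightarrow> b \<in> carrier B \<Longrightarrow> a \<otimes>\<^bsub>B\<^esub> b \<in> P \<Longrightarrow> a \<in> P \<or> b \<in> P" by (rule I_prime)
qed

lemma prime_compl_mult:
 assumes "primeideal P B" "a \<in> carrier B - P" "b \<in> carrier B - P"
 shows "a \<otimes>\<^bsub>B\<^esub> b \<in> carrier B - P"
 using primeD(6)[OF assms(1)] assms(2,3) closed(4) by blast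

lemma primeI:
 assumes sub: "P \<subseteq> carrier B" and zero: "\<zero>\<^bsub>B\<^esub> \<in> P" and one: "\<one>\<^bsub>B\<^esub> \<notin> P"
  and add: "\<And>a b. a \<in> P \<Longrightarrow> b \<in> P \<Longrightarrow> a \<oplus>\<^bsub>B\<^esub> b \<in> P"
  and mult: "\<And>a b. a \<in> carrier B \<Longrightarrow> b \<in> P \<Longrightarrow> a \<otimes>\<^bsub>B\<^esub> b \<in> P"
  and prime: "\<And>a b. a \<in> carrier B \<Longrightarrow> b \<in> carrier B \<Longrightarrow> a \<otimes>\<^bsub>B\<^esub> b \<in> P \<Longrightarrow> a \<in> P \<or> b \<in> P"
 shows "primeideal P B"
proof -
 interpret cring B by (rule cring)
 have "ideal P B"
 proof (rule idealI[OF ring_axioms])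
  show "subgroup P (add_monoid B)"
  proof
   show "P \<subseteq> carrier (add_monoid B)" using sub by simp
   show "x \<otimes>\<^bsub>add_monoid B\<^esub> y \<in> P" if "x \<in> P" "y \<in> P" for x y using add[OF that] by simp
   show "\<one>\<^bsub>add_monoid B\<^esub> \<in> P" using zero by simp
   show "inv\<^bsub>add_monoid B\<^esub> x \<in> P" if "x \<in> P" for x
   proof -
    have x: "x \<in> carrier B" using that sub by blast
    have "(\<ominus>\<^bsub>B\<^esub> \<one>\<^bsub>B\<^esub>) \<otimes>\<^bsub>B\<^esub> x = \<ominus>\<^bsub>B\<^esub> x" using x by (simp add: l_minus)
    with mult[OF _ that, of "\<ominus>\<^bsub>B\<^esub> \<one>\<^bsub>B\<^esub>"] show ?thesis by (simp add: a_inv_def)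
   qed
  qed
  show "x \<otimes>\<^bsub>B\<^esub> a \<in> P" if "a \<in> P" "x \<in> carrier B" for a x by (rule mult[OF that(2,1)])
  show "a \<otimes>\<^bsub>B\<^esub> x \<in> P" if "a \<in> P" "x \<in> carrier B" for a x
   using mult[OF that(2,1)] m_comm[of a x] that sub by auto
 qed
 then show ?thesis
 proof (rule primeidealI)
  show "cring B" by (rule cring)
  show "carrier B \<noteq> P" using one closed(2) by blast
 qed (rule prime)
qed

definition zeros :: "'b set \<Rightarrow> 'a set" where
 "zeros P = {x \<in> points X. \<forall>b\<in>P. ev b x = 0}"

lemma ev_units:
 assumes "a \<in> carrier B" "\<And>x. x \<in> points X \<Longrightarrow> ev a x \<noteq> 0" "primeideal P B"
 shows "a \<notin> P"
proof
 assume a: "a \<in> P"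
 interpret function_ring_inv "points X" "regs (coords X) (points X)" by (rule regs)
 obtain b where b: "b \<in> carrier B" "\<forall>x\<in>points X. ev b x = 1 / ev a x"
  using ev_surj[OF inverse[OF ev_regs[OF assms(1)] assms(2)]] by blast
 have "b \<otimes>\<^bsub>B\<^esub> a = \<one>\<^bsub>B\<^esub>"
  by (rule ev_inj) (use b assms in \<open>auto simp: ev_simps\<close>)
 with primeD(5)[OF assms(3) b(1) a] primeD(3)[OF assms(3)] show False by simp
qed

text \<open>The Nullstellensatz for \<open>B\<close>: after clearing the powers of \<open>D\<close> in the
 denominators, the prime ideal becomes an ideal of polynomial functions.\<close>

lemma zeros_separate:
 assumes P: "primeideal P B" and a: "a \<in> carrier B" "a \<notin> P"
 shows "\<exists>x\<in>zeros P. ev a x \<noteq> 0"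
proof -
 note P' = primeD[OF P]
 define J where "J = {f \<in> poly_funs (coords X). \<exists>b\<in>P. \<forall>x\<in>points X. ev b x = f x}"
 have JI: "f \<in> J" if "f \<in> poly_funs (coords X)" "b \<in> P" "\<And>x. x \<in> points X \<Longrightarrow> ev b x = f x" for f b
  unfolding J_def using that by blast
 have JE: "f \<in> poly_funs (coords X)" "\<exists>b\<in>P. \<forall>x\<in>points X. ev b x = f x" if "f \<in> J" for f
  using that unfolding J_def by blast+
 have Dp: "D \<in> poly_funs (coords X)" and D0: "\<And>x. x \<in> points X \<Longrightarrow> D x \<noteq> 0"
  using affine unfolding affine_set_def by auto
 obtain a' k where a': "a' \<in> poly_funs (coords X)" "\<And>x. x \<in> points X \<Longrightarrow> ev a x = a' x / D x ^ k"
  using regs_affine[OF affine ev_regs[OF a(1)]] by blast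
 have J: "poly_ideal (coords X) J"
  unfolding poly_ideal_def
 proof (intro conjI ballI subsetI)
  fix f assume f: "f \<in> J"
  show "f \<in> poly_funs (coords X)" by (rule JE[OF f])
  from JE(2)[OF f] obtain b where b: "b \<in> P" "\<forall>x\<in>points X. ev b x = f x" by blast
  { fix g assume g: "g \<in> J"
   from JE(2)[OF g] obtain c where c: "c \<in> P" "\<forall>x\<in>points X. ev c x = g x" by blast
   show "(\<lambda>x. f x + g x) \<in> J"
    by (rule JI[OF poly_funs.add[OF JE(1)[OF f] JE(1)[OF g]] P'(4)[OF b(1) c(1)]])
     (use b c P'(1) in \<open>auto simp: ev_add subset_iff\<close>) }
  { fix r assume r: "r \<in> poly_funs (coords X)"
   obtain c where c: "c \<in> carrier B" "\<forall>x\<in>points X. ev c x = r x" using ev_poly[OF r] by blast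
   show "(\<lambda>x. r x * f x) \<in> J"
    by (rule JI[OF poly_funs.mult[OF r JE(1)[OF f]] P'(5)[OF c(1) b(1)]])
     (use b c P'(1) in \<open>auto simp: ev_mult subset_iff\<close>) }
 next
  show "(\<lambda>_. 0) \<in> J" by (rule JI[OF poly_funs.const P'(2)]) (simp add: ev_zero)
 qed
 have "\<exists>x\<in>points X. (\<forall>f\<in>J. f x = 0) \<and> a' x \<noteq> 0"
 proof (rule affine_nullstellensatz[OF affine J _ a'(1)])
  show "f \<in> J" if "f \<in> poly_funs (coords X)" "\<And>x. x \<in> points X \<Longrightarrow> f x = 0" for f
   by (rule JI[OF that(1) P'(2)]) (simp add: ev_zero that(2))
  obtain h where h: "h \<in> carrier B" "\<forall>x\<in>points X. ev h x = D x ^ Suc k"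
   using ev_poly[OF poly_funs_power[OF Dp]] by blast
  have hP: "h \<notin> P" by (rule ev_units[OF h(1) _ P]) (use h D0 in auto)
  have g: "a \<otimes>\<^bsub>B\<^esub> h \<notin> P" using P'(6)[OF a(1) h(1)] a(2) hP by blast
  have nb: "b \<notin> P" if "b \<in> carrier B" "\<forall>x\<in>points X. ev b x = (a' x * D x) ^ e" for e b
   using that
  proof (induction e arbitrary: b)
   case 0
   have "b = \<one>\<^bsub>B\<^esub>" by (rule ev_inj) (use 0 in \<open>auto simp: ev_simps\<close>)
   then show ?case using P'(3) by simp
  next
   case (Suc e)
   obtain c where c: "c \<in> carrier B" "\<forall>x\<in>points X. ev c x = (a' x * D x) ^ e"
    using ev_poly[OF poly_funs_power[OF poly_funs.mult[OF a'(1) Dp]]] by blast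
   have "b = (a \<otimes>\<^bsub>B\<^esub> h) \<otimes>\<^bsub>B\<^esub> c"
    by (rule ev_inj) (use Suc.prems c a(1) h a'(2) D0 in \<open>auto simp: ev_simps\<close>)
   then show ?case using P'(6)[OF closed(4)[OF a(1) h(1)] c(1)] g Suc.IH[OF c] by auto
  qed
  fix e
  show "(\<lambda>x. (a' x * D x) ^ e) \<notin> J"
  proof
   assume "(\<lambda>x. (a' x * D x) ^ e) \<in> J"
   from JE(2)[OF this] obtain b where b: "b \<in> P" "\<forall>x\<in>points X. ev b x = (a' x * D x) ^ e" ..
   with nb P'(1) show False by blast
  qed
 qed
 then obtain x where x: "x \<in> points X" "\<forall>f\<in>J. f x = 0" "a' x \<noteq> 0" by blast
 have "ev b x = 0" if b: "b \<in> P" for b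
 proof -
  have bB: "b \<in> carrier B" using b P'(1) by blast
  obtain b' l where b': "b' \<in> poly_funs (coords X)" "\<And>x. x \<in> points X \<Longrightarrow> ev b x = b' x / D x ^ l"
   using regs_affine[OF affine ev_regs[OF bB]] by blast
  obtain h where h: "h \<in> carrier B" "\<forall>x\<in>points X. ev h x = D x ^ l"
   using ev_poly[OF poly_funs_power[OF Dp]] by blast
  have "b' \<in> J"
   by (rule JI[OF b'(1) P'(5)[OF h(1) b]]) (use h b' bB D0 in \<open>simp add: ev_mult\<close>)
  with x show ?thesis by (simp add: b'(2))
 qed
 then have "x \<in> zeros P" unfolding zeros_def using x(1) by simp
 moreover have "ev a x \<noteq> 0" using a'(2)[OF x(1)] x(3) D0[OF x(1)] by simp
 ultimately show ?thesis by blast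
qed

lemma prime_eq_vanishing: "primeideal P B \<Longrightarrow> P = {b \<in> carrier B. \<forall>x\<in>zeros P. ev b x = 0}"
 using zeros_separate primeD(1) unfolding zeros_def by blast

lemma open_nonvanishing:
 assumes a: "a \<in> carrier B"
 shows "openin (zariski X) {x \<in> points X. ev a x \<noteq> 0}"
proof -
 let ?S = "{f \<in> poly_funs (coords X). \<forall>y\<in>points X. f y \<noteq> 0 \<longrightarrow> ev a y \<noteq> 0}"
 have "\<exists>f\<in>?S. f x \<noteq> 0" if x: "x \<in> points X" "ev a x \<noteq> 0" for x
 proof -
  obtain p q where pq: "p \<in> poly_funs (coords X)" "q \<in> poly_funs (coords X)" "q x \<noteq> 0"
   "\<And>y. y \<in> points X \<Longrightarrow> q y \<noteq> 0 \<Longrightarrow> ev a y = p y / q y" using regsD[OF ev_regs[OF a] x(1)] by blast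
  then show ?thesis using x
   by (intro bexI[of _ "\<lambda>y. p y * q y"]) (auto intro!: poly_funs.mult)
 qed
 then have "{x \<in> points X. ev a x \<noteq> 0} = {x \<in> points X. \<exists>f\<in>?S. f x \<noteq> 0}" by auto
 then show ?thesis unfolding openin_zariski by (intro exI[of _ ?S]) auto
qed

lemma closedin_zeros:
 assumes "P \<subseteq> carrier B"
 shows "closedin (zariski X) (zeros P)"
proof -
 have "openin (zariski X) (\<Union>a\<in>P. {x \<in> points X. ev a x \<noteq> 0})"
  using open_nonvanishing assms by blast
 moreover have "points X - zeros P = (\<Union>a\<in>P. {x \<in> points X. ev a x \<noteq> 0})"
  unfolding zeros_def by blast
 ultimately show ?thesis unfolding closedin_def topspace_zariski by (simp add: zeros_def)
qed

lemma closed_separate: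
 assumes "closedin (zariski X) C" "x \<in> points X" "x \<notin> C"
 shows "\<exists>b\<in>carrier B. (\<forall>y\<in>C. ev b y = 0) \<and> ev b x \<noteq> 0"
proof -
 obtain S where S: "S \<subseteq> poly_funs (coords X)" "C = {x \<in> points X. \<forall>f\<in>S. f x = 0}"
  using assms(1) unfolding closedin_zariski by (elim exE conjE)
 then obtain f where f: "f \<in> S" "f x \<noteq> 0" using assms by auto
 obtain b where "b \<in> carrier B" "\<forall>x\<in>points X. ev b x = f x" using ev_poly f(1) S(1) by blast
 then show ?thesis using f S(2) assms(2) by (intro bexI[of _ b]) auto
qed

lemma irreducible_zeros:
 assumes P: "primeideal P B"
 shows "irreducible_closed (zariski X) (zeros P)"
 unfolding irreducible_closed_def
proof (intro conjI allI impI)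
 show "closedin (zariski X) (zeros P)" by (rule closedin_zeros[OF primeD(1)[OF P]])
 show "zeros P \<noteq> {}" using zeros_separate[OF P closed(2) primeD(3)[OF P]] by blast
 fix C D assume CD: "closedin (zariski X) C" "closedin (zariski X) D" "zeros P = C \<union> D"
 show "zeros P = C \<or> zeros P = D"
 proof (rule ccontr)
  assume "\<not> ?thesis"
  then obtain x y where x: "x \<in> zeros P" "x \<notin> C" and y: "y \<in> zeros P" "y \<notin> D" using CD(3) by blast
  have xy: "x \<in> points X" "y \<in> points X" using x y unfolding zeros_def by auto
  obtain b where b: "b \<in> carrier B" "\<forall>y\<in>C. ev b y = 0" "ev b x \<noteq> 0"
   using closed_separate[OF CD(1) xy(1) x(2)] by blast
  obtain c where c: "c \<in> carrier B" "\<forall>y\<in>D. ev c y = 0" "ev c y \<noteq> 0"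
   using closed_separate[OF CD(2) xy(2) y(2)] by blast
  have "ev (b \<otimes>\<^bsub>B\<^esub> c) z = 0" if "z \<in> zeros P" for z
   using that b c CD(3) by (auto simp: ev_mult zeros_def)
  then have "b \<otimes>\<^bsub>B\<^esub> c \<in> P" using prime_eq_vanishing[OF P] closed(4)[OF b(1) c(1)] by auto
  then have "b \<in> P \<or> c \<in> P" by (rule primeD(6)[OF P b(1) c(1)])
  then show False using b(3) c(3) x(1) y(1) unfolding zeros_def by auto
 qed
qed

definition vanishing :: "'a set \<Rightarrow> 'b set" where
 "vanishing Z = {b \<in> carrier B. \<forall>x\<in>Z. ev b x = 0}"

lemma vanishing_prime:
 assumes Z: "irreducible_closed (zariski X) Z"
 shows "primeideal (vanishing Z) B" "zeros (vanishing Z) = Z"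
proof -
 have Zp: "Z \<subseteq> points X" and Z0: "Z \<noteq> {}" and Zc: "closedin (zariski X) Z"
  and irr: "\<And>C D. closedin (zariski X) C \<Longrightarrow> closedin (zariski X) D \<Longrightarrow> Z = C \<union> D \<Longrightarrow> Z = C \<or> Z = D"
  using Z closedin_subset[of "zariski X" Z] unfolding irreducible_closed_def topspace_zariski by auto
 have evZ: "x \<in> Z \<Longrightarrow> x \<in> points X" for x using Zp by blast
 show "primeideal (vanishing Z) B"
 proof (rule primeI)
  show "\<one>\<^bsub>B\<^esub> \<notin> vanishing Z" using Z0 evZ by (auto simp: vanishing_def ev_one)
  fix a b assume ab: "a \<in> carrier B" "b \<in> carrier B" "a \<otimes>\<^bsub>B\<^esub> b \<in> vanishing Z"
  have "closedin (zariski X) (Z \<inter> zeros {a})" "closedin (zariski X) (Z \<inter> zeros {b})"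
   using ab by (auto intro!: closedin_Int Zc closedin_zeros)
  moreover have "Z = (Z \<inter> zeros {a}) \<union> (Z \<inter> zeros {b})"
   using ab evZ by (auto simp: vanishing_def zeros_def ev_mult)
  ultimately have "Z = Z \<inter> zeros {a} \<or> Z = Z \<inter> zeros {b}" by (rule irr)
  then show "a \<in> vanishing Z \<or> b \<in> vanishing Z"
   using ab unfolding vanishing_def zeros_def by blast
 qed (use evZ in \<open>auto simp: vanishing_def ev_simps\<close>)
 show "zeros (vanishing Z) = Z"
 proof
  show "Z \<subseteq> zeros (vanishing Z)" using evZ by (auto simp: zeros_def vanishing_def)
  show "zeros (vanishing Z) \<subseteq> Z"
  proof
   fix x assume x: "x \<in> zeros (vanishing Z)"
   show "x \<in> Z"
   proof (rule ccontr)
    assume "x \<notin> Z"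
    then obtain b where "b \<in> carrier B" "\<forall>y\<in>Z. ev b y = 0" "ev b x \<noteq> 0"
     using closed_separate[OF Zc] x unfolding zeros_def by blast
    with x show False unfolding zeros_def vanishing_def by blast
   qed
  qed
 qed
qed

lemma zeros_vanishing_closure:
 assumes x: "x \<in> points X"
 shows "primeideal (vanishing {x}) B" "zeros (vanishing {x}) = Abstract_Topology.closure_of (zariski X) {x}"
proof -
 let ?Z = "Abstract_Topology.closure_of (zariski X) {x}"
 have irr: "irreducible_closed (zariski X) ?Z"
  by (rule irreducible_closure_singleton) (simp add: topspace_zariski x)
 have xZ: "x \<in> ?Z" using x closure_of_subset[of "{x}" "zariski X"] by (simp add: topspace_zariski)
 have "vanishing {x} = vanishing ?Z"
 proof
  show "vanishing ?Z \<subseteq> vanishing {x}" using xZ unfolding vanishing_def by auto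
  show "vanishing {x} \<subseteq> vanishing ?Z"
  proof
   fix b assume b: "b \<in> vanishing {x}"
   then have bB: "{b} \<subseteq> carrier B" unfolding vanishing_def by auto
   have "?Z \<subseteq> zeros {b}"
    by (rule closure_of_minimal[OF _ closedin_zeros[OF bB]]) (use b x in \<open>auto simp: zeros_def vanishing_def\<close>)
   then show "b \<in> vanishing ?Z" using bB unfolding zeros_def vanishing_def by auto
  qed
 qed
 with vanishing_prime[OF irr] show "primeideal (vanishing {x}) B" "zeros (vanishing {x}) = ?Z" by auto
qed

lemma topspace_spec: "topspace (spec_topology B) = {P. primeideal P B}"
proof
 show "topspace (spec_topology B) \<subseteq> {P. primeideal P B}"
  using openin_topspace[of "spec_topology B"] unfolding openin_spec_topology by auto
 have "openin (spec_topology B) {P. primeideal P B \<and> \<not> carrier B \<subseteq> P}"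
  unfolding openin_spec_topology by blast
 moreover have "{P. primeideal P B \<and> \<not> carrier B \<subseteq> P} = {P. primeideal P B}"
  using primeD(3) closed(2) by blast
 ultimately show "{P. primeideal P B} \<subseteq> topspace (spec_topology B)"
  using openin_subset by metis
qed

lemma zeros_meets:
 assumes P: "primeideal P B" and S: "S \<subseteq> carrier B"
 shows "zeros P \<inter> {x \<in> points X. \<exists>a\<in>S. ev a x \<noteq> 0} \<noteq> {} \<longleftrightarrow> \<not> S \<subseteq> P"
proof
 assume "zeros P \<inter> {x \<in> points X. \<exists>a\<in>S. ev a x \<noteq> 0} \<noteq> {}"
 then show "\<not> S \<subseteq> P" unfolding zeros_def by blast
next
 assume "\<not> S \<subseteq> P"
 then obtain a where a: "a \<in> S" "a \<notin> P" by blast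
 with zeros_separate[OF P, of a] S obtain x where "x \<in> zeros P" "ev a x \<noteq> 0" by blast
 with a show "zeros P \<inter> {x \<in> points X. \<exists>a\<in>S. ev a x \<noteq> 0} \<noteq> {}" unfolding zeros_def by blast
qed

lemma open_as_ev:
 assumes U: "openin (zariski X) U"
 obtains S where "S \<subseteq> carrier B" "U = {x \<in> points X. \<exists>a\<in>S. ev a x \<noteq> 0}"
proof -
 let ?S = "{a \<in> carrier B. \<forall>x\<in>points X. ev a x \<noteq> 0 \<longrightarrow> x \<in> U}"
 have Up: "U \<subseteq> points X" using openin_subset[OF U] topspace_zariski by metis
 have "\<exists>a\<in>?S. ev a x \<noteq> 0" if "x \<in> U" for x
 proof -
  have "closedin (zariski X) (points X - U)" using U closedin_diff[OF closedin_topspace U] topspace_zariski by metis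
  from closed_separate[OF this, of x] that Up obtain b where
   "b \<in> carrier B" "\<forall>y\<in>points X - U. ev b y = 0" "ev b x \<noteq> 0" by blast
  then show ?thesis by blast
 qed
 then have "U \<subseteq> {x \<in> points X. \<exists>a\<in>?S. ev a x \<noteq> 0}" using Up by (intro subsetI CollectI conjI) auto
 moreover have "{x \<in> points X. \<exists>a\<in>?S. ev a x \<noteq> 0} \<subseteq> U" by (intro subsetI) auto
 ultimately have "U = {x \<in> points X. \<exists>a\<in>?S. ev a x \<noteq> 0}" by (rule equalityI)
 moreover have "?S \<subseteq> carrier B" by (rule Collect_subset)
 ultimately show thesis by (rule that[rotated])
qed

text \<open>Prime ideals correspond to irreducible closed sets by \<open>zeros\<close> and
 \<open>vanishing\<close>, and \<open>zeros P\<close> meets an open set exactly if \<open>P\<close> does not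
 contain the functions defining it.\<close>

lemma homeomorphic_zeros: "homeomorphic_map (spec_topology B) (sober_topology (zariski X)) zeros"
proof (rule bijective_open_imp_homeomorphic_map)
 show img: "zeros ` topspace (spec_topology B) = topspace (sober_topology (zariski X))"
  unfolding topspace_spec topspace_sober
 proof (intro equalityI subsetI)
  fix Z assume "Z \<in> {Z. irreducible_closed (zariski X) Z}"
  then show "Z \<in> zeros ` {P. primeideal P B}"
   using vanishing_prime[of Z] by (intro image_eqI[of _ _ "vanishing Z"]) auto
 qed (use irreducible_zeros in auto)
 show "inj_on zeros (topspace (spec_topology B))"
  unfolding topspace_spec
 proof (rule inj_onI)
  fix P Q assume P: "P \<in> {P. primeideal P B}" and Q: "Q \<in> {P. primeideal P B}" and eq: "zeros P = zeros Q"
  have "P = {b \<in> carrier B. \<forall>x\<in>zeros P. ev b x = 0}" by (rule prime_eq_vanishing) (use P in simp)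
  also have "\<dots> = Q" unfolding eq by (rule prime_eq_vanishing[symmetric]) (use Q in simp)
  finally show "P = Q" .
 qed
 show "open_map (spec_topology B) (sober_topology (zariski X)) zeros"
  unfolding open_map_def
 proof (intro allI impI)
  fix V assume "openin (spec_topology B) V"
  then obtain S where S: "S \<subseteq> carrier B" "V = {P. primeideal P B \<and> \<not> S \<subseteq> P}"
   unfolding openin_spec_topology by (elim exE conjE)
  let ?U = "{x \<in> points X. \<exists>a\<in>S. ev a x \<noteq> 0}"
  have "?U = (\<Union>a\<in>S. {x \<in> points X. ev a x \<noteq> 0})" by blast
  moreover have "openin (zariski X) (\<Union>a\<in>S. {x \<in> points X. ev a x \<noteq> 0})"
   by (rule openin_Union) (use open_nonvanishing S(1) in auto)
  ultimately have U: "openin (zariski X) ?U" by simp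
  have "zeros ` V = {Z. irreducible_closed (zariski X) Z \<and> Z \<inter> ?U \<noteq> {}}"
  proof (intro equalityI subsetI)
   fix Z assume "Z \<in> zeros ` V"
   then obtain P where P: "primeideal P B" "\<not> S \<subseteq> P" "Z = zeros P" unfolding S(2) by auto
   then show "Z \<in> {Z. irreducible_closed (zariski X) Z \<and> Z \<inter> ?U \<noteq> {}}"
    using zeros_meets[OF P(1) S(1)] irreducible_zeros[OF P(1)] by simp
  next
   fix Z assume Z: "Z \<in> {Z. irreducible_closed (zariski X) Z \<and> Z \<inter> ?U \<noteq> {}}"
   then have "primeideal (vanishing Z) B" "zeros (vanishing Z) = Z" using vanishing_prime[of Z] by auto
   then show "Z \<in> zeros ` V" using Z zeros_meets[of "vanishing Z" S] S
    by (intro image_eqI[of _ _ "vanishing Z"]) auto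
  qed
  then show "openin (sober_topology (zariski X)) (zeros ` V)"
   unfolding openin_sober_topology using U by (intro exI[of _ ?U]) simp
 qed
 show "continuous_map (spec_topology B) (sober_topology (zariski X)) zeros"
  unfolding continuous_map_def
 proof (intro conjI allI impI)
  show "zeros \<in> topspace (spec_topology B) \<rightarrow> topspace (sober_topology (zariski X))" using img by blast
  fix W assume W: "openin (sober_topology (zariski X)) W"
  obtain S where S: "S \<subseteq> carrier B" "trace_on X W = {x \<in> points X. \<exists>a\<in>S. ev a x \<noteq> 0}"
   by (rule open_as_ev[OF sober_open_trace(1)[OF W]])
  have "zeros P \<in> W \<longleftrightarrow> \<not> S \<subseteq> P" if "primeideal P B" for P
  proof -
   have "zeros P \<in> W \<longleftrightarrow> zeros P \<inter> trace_on X W \<noteq> {}"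
    by (subst sober_open_trace(2)[OF W]) (simp add: irreducible_zeros[OF that])
   then show ?thesis unfolding S(2) zeros_meets[OF that S(1)] .
  qed
  then have "{P \<in> topspace (spec_topology B). zeros P \<in> W} = {P. primeideal P B \<and> \<not> S \<subseteq> P}"
   unfolding topspace_spec by blast
  then show "openin (spec_topology B) {P \<in> topspace (spec_topology B). zeros P \<in> W}"
   unfolding openin_spec_topology using S(1) by blast
 qed
qed

end

lemma open_points: "openin (zariski X) U \<Longrightarrow> x \<in> U \<Longrightarrow> x \<in> points X"
 using openin_subset[of "zariski X" U] by (auto simp: topspace_zariski)

lemma regs_local_quotient:
 assumes UV: "U \<subseteq> V"
  and loc: "\<And>x. x \<in> U \<Longrightarrow> \<exists>h1\<in>regs K V. \<exists>h2\<in>regs K V. h2 x \<noteq> 0 \<and> (\<forall>y\<in>U. h2 y \<noteq> 0 \<longrightarrow> f y = h1 y / h2 y)"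
 shows "f \<in> regs K U"
proof (rule regsI)
 fix x assume x: "x \<in> U"
 obtain h1 h2 where h: "h1 \<in> regs K V" "h2 \<in> regs K V" "h2 x \<noteq> 0" "\<forall>y\<in>U. h2 y \<noteq> 0 \<longrightarrow> f y = h1 y / h2 y"
  using loc[OF x] by blast
 have xV: "x \<in> V" using x UV by blast
 obtain a b where ab: "a \<in> poly_funs K" "b \<in> poly_funs K" "b x \<noteq> 0"
  "\<forall>y\<in>V. b y \<noteq> 0 \<longrightarrow> h1 y = a y / b y" using regsD[OF h(1) xV] by blast
 obtain c d where cd: "c \<in> poly_funs K" "d \<in> poly_funs K" "d x \<noteq> 0"
  "\<forall>y\<in>V. d y \<noteq> 0 \<longrightarrow> h2 y = c y / d y" using regsD[OF h(2) xV] by blast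
 have "c x \<noteq> 0" using cd(3,4) xV h(3) by auto
 moreover have "f y = (a y * d y * d y) / (b y * c y * d y)" if y: "y \<in> U" and nz: "b y * c y * d y \<noteq> 0" for y
 proof -
  have "y \<in> V" using y UV by blast
  then show ?thesis using h(4) ab(4) cd(4) y nz by auto
 qed
 ultimately show "\<exists>a\<in>poly_funs K. \<exists>b\<in>poly_funs K. b x \<noteq> 0 \<and> (\<forall>y\<in>U. b y \<noteq> 0 \<longrightarrow> f y = a y / b y)"
  using ab(3) cd(3)
  by (intro bexI[of _ "\<lambda>y. a y * d y * d y"] bexI[of _ "\<lambda>y. b y * c y * d y"] poly_funs.mult ab cd) auto
qed

lemma Spec_sect_simps:
 "carrier (sect (Spec A) V) = spec_sections A V"
 "s \<otimes>\<^bsub>sect (Spec A) V\<^esub> t = (\<lambda>P\<in>V. s P \<otimes>\<^bsub>localization A P\<^esub> t P)"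
 "s \<oplus>\<^bsub>sect (Spec A) V\<^esub> t = (\<lambda>P\<in>V. s P \<oplus>\<^bsub>localization A P\<^esub> t P)"
 "\<one>\<^bsub>sect (Spec A) V\<^esub> = (\<lambda>P\<in>V. \<one>\<^bsub>localization A P\<^esub>)"
 "z \<odot>\<^bsub>sect (Spec A) V\<^esub> s = (\<lambda>P\<in>V. z \<odot>\<^bsub>localization A P\<^esub> s P)"
 "res (Spec A) V V' s = restrict s V'"
 unfolding Spec_def by simp_all

lemma fun_algebra_simps:
 "carrier (fun_algebra U F) = F"
 "f \<otimes>\<^bsub>fun_algebra U F\<^esub> g = (\<lambda>x\<in>U. f x * g x)"
 "f \<oplus>\<^bsub>fun_algebra U F\<^esub> g = (\<lambda>x\<in>U. f x + g x)"
 "\<one>\<^bsub>fun_algebra U F\<^esub> = (\<lambda>x\<in>U. 1)"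
 "\<zero>\<^bsub>fun_algebra U F\<^esub> = (\<lambda>x\<in>U. 0)"
 "z \<odot>\<^bsub>fun_algebra U F\<^esub> f = (\<lambda>x\<in>U. z * f x)"
 unfolding fun_algebra_def by simp_all

context function_model
begin

text \<open>The germ at \<open>P\<close> of a function \<open>f\<close> on \<open>U\<close>, as an equivalence
 class of fractions. The factor \<open>c\<close> says that \<open>b f = a\<close> holds only on some
 neighbourhood of the generic point of \<open>zeros P\<close>.\<close>

definition germs :: "'a set \<Rightarrow> ('a \<Rightarrow> complex) \<Rightarrow> 'b set \<Rightarrow> ('b \<times> 'b) set" where
 "germs U f P = {(a, b). a \<in> carrier B \<and> b \<in> carrier B - P \<and>
   (\<exists>c\<in>carrier B - P. \<forall>x\<in>U. ev c x = 0 \<or> ev b x * f x = ev a x)}"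

lemma germsI:
 assumes "a \<in> carrier B" "b \<in> carrier B - P" "c \<in> carrier B - P"
  "\<And>x. x \<in> U \<Longrightarrow> ev c x = 0 \<or> ev b x * f x = ev a x"
 shows "(a, b) \<in> germs U f P"
 using assms unfolding germs_def by blast

lemma germsD:
 assumes "(a, b) \<in> germs U f P"
 shows "a \<in> carrier B" "b \<in> carrier B - P" "\<exists>c\<in>carrier B - P. \<forall>x\<in>U. ev c x = 0 \<or> ev b x * f x = ev a x"
 using assms unfolding germs_def by blast+

lemma germs_cong: "(\<And>x. x \<in> U \<Longrightarrow> f x = g x) \<Longrightarrow> germs U f P = germs U g P"
 unfolding germs_def by simp

lemma fraction_iff:
 "(b, t) \<in> fraction B P a s \<longleftrightarrow> a \<in> carrier B \<and> b \<in> carrier B \<and> s \<in> carrier B - P \<and> t \<in> carrier B - P \<and>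
   (\<exists>u\<in>carrier B - P. \<forall>x\<in>points X. ev u x = 0 \<or> ev a x * ev t x = ev b x * ev s x)"
proof -
 have *: "u \<otimes>\<^bsub>B\<^esub> (a \<otimes>\<^bsub>B\<^esub> t \<ominus>\<^bsub>B\<^esub> b \<otimes>\<^bsub>B\<^esub> s) = \<zero>\<^bsub>B\<^esub> \<longleftrightarrow>
   (\<forall>x\<in>points X. ev u x = 0 \<or> ev a x * ev t x = ev b x * ev s x)"
  if "a \<in> carrier B" "b \<in> carrier B" "s \<in> carrier B" "t \<in> carrier B" "u \<in> carrier B" for u
 proof -
  let ?w = "u \<otimes>\<^bsub>B\<^esub> (a \<otimes>\<^bsub>B\<^esub> t \<ominus>\<^bsub>B\<^esub> b \<otimes>\<^bsub>B\<^esub> s)"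
  have w: "ev ?w x = ev u x * (ev a x * ev t x - ev b x * ev s x)" if "x \<in> points X" for x
   using that \<open>a \<in> carrier B\<close> \<open>b \<in> carrier B\<close> \<open>s \<in> carrier B\<close> \<open>t \<in> carrier B\<close> \<open>u \<in> carrier B\<close>
   by (simp add: ev_simps)
  have "?w = \<zero>\<^bsub>B\<^esub> \<longleftrightarrow> (\<forall>x\<in>points X. ev ?w x = ev \<zero>\<^bsub>B\<^esub> x)"
   using ev_inj[of ?w "\<zero>\<^bsub>B\<^esub>"] that closed by auto
  then show ?thesis using w by (simp add: ev_zero)
 qed
 show ?thesis
  unfolding fraction_def fraction_rel_def Image_singleton_iff mem_Collect_eq prod.case
 proof (intro conj_cong refl bex_cong)
  fix u assume "a \<in> carrier B" "b \<in> carrier B" "s \<in> carrier B - P" "t \<in> carrier B - P" "u \<in> carrier B - P"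
  then show "u \<otimes>\<^bsub>B\<^esub> (a \<otimes>\<^bsub>B\<^esub> t \<ominus>\<^bsub>B\<^esub> b \<otimes>\<^bsub>B\<^esub> s) = \<zero>\<^bsub>B\<^esub> \<longleftrightarrow>
   (\<forall>x\<in>points X. ev u x = 0 \<or> ev a x * ev t x = ev b x * ev s x)" by (intro *) auto
 qed
qed

text \<open>A function outside \<open>P\<close> which vanishes off \<open>U\<close> turns statements about
 functions on \<open>U\<close> into statements about elements of \<open>B\<close>.\<close>

lemma cutoff:
 assumes U: "openin (zariski X) U" and P: "primeideal P B" and meets: "zeros P \<inter> U \<noteq> {}"
 shows "\<exists>e\<in>carrier B - P. \<forall>x\<in>points X. x \<notin> U \<longrightarrow> ev e x = 0"
proof -
 obtain S where S: "S \<subseteq> carrier B" "U = {x \<in> points X. \<exists>a\<in>S. ev a x \<noteq> 0}"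
  by (rule open_as_ev[OF U])
 have "\<not> S \<subseteq> P" using zeros_meets[OF P S(1)] meets unfolding S(2) by simp
 then show ?thesis using S by blast
qed

lemma germs_class:
 assumes U: "openin (zariski X) U" and P: "primeideal P B" and meets: "zeros P \<inter> U \<noteq> {}"
  and ab: "(a, b) \<in> germs U f P"
 shows "fraction B P a b = germs U f P"
proof -
 note ab' = germsD[OF ab]
 obtain c where c: "c \<in> carrier B - P" "\<forall>x\<in>U. ev c x = 0 \<or> ev b x * f x = ev a x" using ab'(3) by blast
 obtain e where e: "e \<in> carrier B - P" "\<forall>x\<in>points X. x \<notin> U \<longrightarrow> ev e x = 0" using cutoff[OF U P meets] by blast
 have Up: "x \<in> U \<Longrightarrow> x \<in> points X" for x by (rule open_points[OF U])
 have "(a', t) \<in> fraction B P a b \<longleftrightarrow> (a', t) \<in> germs U f P" for a' t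
 proof
  assume "(a', t) \<in> fraction B P a b"
  then obtain u where u: "a' \<in> carrier B" "t \<in> carrier B - P" "u \<in> carrier B - P"
   "\<forall>x\<in>points X. ev u x = 0 \<or> ev a x * ev t x = ev a' x * ev b x" unfolding fraction_iff by blast
  let ?c = "(c \<otimes>\<^bsub>B\<^esub> u) \<otimes>\<^bsub>B\<^esub> b"
  have cP: "?c \<in> carrier B - P" by (intro prime_compl_mult[OF P] c u ab')
  show "(a', t) \<in> germs U f P"
  proof (rule germsI[OF u(1,2) cP])
   fix x assume x: "x \<in> U"
   have "ev c x = 0 \<or> ev b x * f x = ev a x" "ev u x = 0 \<or> ev a x * ev t x = ev a' x * ev b x"
    using c(2) u(4) x Up by blast+
   moreover have "ev b x = 0 \<or> ev t x * f x = ev a' x"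
    if "ev b x * f x = ev a x" "ev a x * ev t x = ev a' x * ev b x"
   proof -
    have "ev b x * (ev t x * f x) = ev a x * ev t x" unfolding that(1)[symmetric] by simp
    also have "\<dots> = ev b x * ev a' x" unfolding that(2) by simp
    finally have "ev b x * (ev t x * f x) = ev b x * ev a' x" .
    then show ?thesis by simp
   qed
   moreover have "ev ?c x = ev c x * ev u x * ev b x" using c(1) u(3) ab'(2) Up[OF x] by (simp add: ev_simps)
   ultimately show "ev ?c x = 0 \<or> ev t x * f x = ev a' x" by auto
  qed
 next
  assume g: "(a', t) \<in> germs U f P"
  note g' = germsD[OF g]
  obtain c' where c': "c' \<in> carrier B - P" "\<forall>x\<in>U. ev c' x = 0 \<or> ev t x * f x = ev a' x" using g'(3) by blast
  let ?u = "(c \<otimes>\<^bsub>B\<^esub> c') \<otimes>\<^bsub>B\<^esub> e"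
  have uP: "?u \<in> carrier B - P" by (intro prime_compl_mult[OF P] c c' e)
  have "ev ?u x = 0 \<or> ev a x * ev t x = ev a' x * ev b x" if x: "x \<in> points X" for x
  proof (cases "x \<in> U")
   case True
   have "ev c x = 0 \<or> ev b x * f x = ev a x" "ev c' x = 0 \<or> ev t x * f x = ev a' x"
    using c(2) c'(2) True by blast+
   moreover have "ev ?u x = ev c x * ev c' x * ev e x" using c(1) c'(1) e(1) x by (simp add: ev_simps)
   moreover have "ev a x * ev t x = ev a' x * ev b x"
    if "ev b x * f x = ev a x" "ev t x * f x = ev a' x"
    unfolding that[symmetric] by simp
   ultimately show ?thesis by auto
  next
   case False
   then show ?thesis using e(2) c(1) c'(1) e(1) x by (simp add: ev_simps)
  qed
  with uP show "(a', t) \<in> fraction B P a b" unfolding fraction_iff using ab'(1,2) g'(1,2) by blast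
 qed
 then show ?thesis by auto
qed

lemma germs_nonempty:
 assumes U: "openin (zariski X) U" and f: "f \<in> regs (coords X) U"
  and P: "primeideal P B" and meets: "zeros P \<inter> U \<noteq> {}"
 obtains a b where "(a, b) \<in> germs U f P" "b \<in> carrier B - P" "\<forall>x\<in>U. ev b x = 0 \<or> ev b x * f x = ev a x"
proof -
 obtain x where x: "x \<in> zeros P" "x \<in> U" using meets by blast
 have Up: "x \<in> U \<Longrightarrow> x \<in> points X" for x by (rule open_points[OF U])
 obtain p q where pq: "p \<in> poly_funs (coords X)" "q \<in> poly_funs (coords X)" "q x \<noteq> 0"
  "\<forall>y\<in>U. q y \<noteq> 0 \<longrightarrow> f y = p y / q y" using regsD[OF f x(2)] by blast
 obtain a where a: "a \<in> carrier B" "\<forall>x\<in>points X. ev a x = p x" using ev_poly[OF pq(1)] by blast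
 obtain b where b: "b \<in> carrier B" "\<forall>x\<in>points X. ev b x = q x" using ev_poly[OF pq(2)] by blast
 have bP: "b \<in> carrier B - P" using b x Up pq(3) unfolding zeros_def by auto
 have eq: "ev b x = 0 \<or> ev b x * f x = ev a x" if "x \<in> U" for x
  using that Up[OF that] a(2) b(2) pq(4) by (cases "q x = 0") auto
 show thesis by (rule that[OF germsI[OF a(1) bP bP eq] bP]) (use eq in auto)
qed

lemma germs_Union:
 assumes U: "openin (zariski X) U" and f: "f \<in> regs (coords X) U"
  and P: "primeideal P B" and meets: "zeros P \<inter> U \<noteq> {}"
  and F: "\<And>a b. (a, b) \<in> germs U f P \<Longrightarrow> F a b = G"
 shows "(\<Union>(a, b)\<in>germs U f P. F a b) = G"
proof -
 obtain a b where ab: "(a, b) \<in> germs U f P" by (rule germs_nonempty[OF U f P meets])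
 have "F (fst p) (snd p) = G" if "p \<in> germs U f P" for p using F[of "fst p" "snd p"] that by simp
 then have "(\<Union>p\<in>germs U f P. F (fst p) (snd p)) = G" using ab by auto
 then show ?thesis by (simp add: case_prod_unfold)
qed

lemma germs_mult:
 assumes U: "openin (zariski X) U" and f: "f \<in> regs (coords X) U" and g: "g \<in> regs (coords X) U"
  and P: "primeideal P B" and meets: "zeros P \<inter> U \<noteq> {}"
 shows "germs U f P \<otimes>\<^bsub>localization B P\<^esub> germs U g P = germs U (\<lambda>x. f x * g x) P"
 unfolding localization_def monoid.simps
proof (intro germs_Union[OF U _ P meets] f g)
 have Up: "x \<in> U \<Longrightarrow> x \<in> points X" for x by (rule open_points[OF U])
 fix a s b t assume 1: "(a, s) \<in> germs U f P" and 2: "(b, t) \<in> germs U g P"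
 note 1 = germsD[OF 1] and 2 = germsD[OF 2]
 from 1(3) 2(3) obtain c d where c: "c \<in> carrier B - P" "\<forall>x\<in>U. ev c x = 0 \<or> ev s x * f x = ev a x"
  and d: "d \<in> carrier B - P" "\<forall>x\<in>U. ev d x = 0 \<or> ev t x * g x = ev b x" by blast
 show "fraction B P (a \<otimes>\<^bsub>B\<^esub> b) (s \<otimes>\<^bsub>B\<^esub> t) = germs U (\<lambda>x. f x * g x) P"
 proof (rule germs_class[OF U P meets germsI])
  show "c \<otimes>\<^bsub>B\<^esub> d \<in> carrier B - P" by (rule prime_compl_mult[OF P c(1) d(1)])
  show "s \<otimes>\<^bsub>B\<^esub> t \<in> carrier B - P" by (rule prime_compl_mult[OF P 1(2) 2(2)])
  show "a \<otimes>\<^bsub>B\<^esub> b \<in> carrier B" by (rule closed(4)[OF 1(1) 2(1)])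
  fix x assume x: "x \<in> U"
  have "ev c x = 0 \<or> ev s x * f x = ev a x" "ev d x = 0 \<or> ev t x * g x = ev b x" using c d x by blast+
  moreover have "ev s x * ev t x * (f x * g x) = ev a x * ev b x"
   if "ev s x * f x = ev a x" "ev t x * g x = ev b x" unfolding that[symmetric] by simp
  ultimately show "ev (c \<otimes>\<^bsub>B\<^esub> d) x = 0 \<or> ev (s \<otimes>\<^bsub>B\<^esub> t) x * (f x * g x) = ev (a \<otimes>\<^bsub>B\<^esub> b) x"
   using 1 2 c(1) d(1) Up[OF x] by (auto simp: ev_simps)
 qed
qed

lemma germs_add:
 assumes U: "openin (zariski X) U" and f: "f \<in> regs (coords X) U" and g: "g \<in> regs (coords X) U"
  and P: "primeideal P B" and meets: "zeros P \<inter> U \<noteq> {}"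
 shows "germs U f P \<oplus>\<^bsub>localization B P\<^esub> germs U g P = germs U (\<lambda>x. f x + g x) P"
 unfolding localization_def ring_record_simps
proof (intro germs_Union[OF U _ P meets] f g)
 have Up: "x \<in> U \<Longrightarrow> x \<in> points X" for x by (rule open_points[OF U])
 fix a s b t assume 1: "(a, s) \<in> germs U f P" and 2: "(b, t) \<in> germs U g P"
 note 1 = germsD[OF 1] and 2 = germsD[OF 2]
 from 1(3) 2(3) obtain c d where c: "c \<in> carrier B - P" "\<forall>x\<in>U. ev c x = 0 \<or> ev s x * f x = ev a x"
  and d: "d \<in> carrier B - P" "\<forall>x\<in>U. ev d x = 0 \<or> ev t x * g x = ev b x" by blast
 show "fraction B P (a \<otimes>\<^bsub>B\<^esub> t \<oplus>\<^bsub>B\<^esub> b \<otimes>\<^bsub>B\<^esub> s) (s \<otimes>\<^bsub>B\<^esub> t) = germs U (\<lambda>x. f x + g x) P"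
 proof (rule germs_class[OF U P meets germsI])
  show "c \<otimes>\<^bsub>B\<^esub> d \<in> carrier B - P" by (rule prime_compl_mult[OF P c(1) d(1)])
  show "s \<otimes>\<^bsub>B\<^esub> t \<in> carrier B - P" by (rule prime_compl_mult[OF P 1(2) 2(2)])
  show "a \<otimes>\<^bsub>B\<^esub> t \<oplus>\<^bsub>B\<^esub> b \<otimes>\<^bsub>B\<^esub> s \<in> carrier B" using 1 2 by (intro closed) auto
  fix x assume x: "x \<in> U"
  have "ev c x = 0 \<or> ev s x * f x = ev a x" "ev d x = 0 \<or> ev t x * g x = ev b x" using c d x by blast+
  moreover have "ev s x * ev t x * (f x + g x) = ev a x * ev t x + ev b x * ev s x"
   if "ev s x * f x = ev a x" "ev t x * g x = ev b x" unfolding that[symmetric] by (simp add: algebra_simps)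
  ultimately show "ev (c \<otimes>\<^bsub>B\<^esub> d) x = 0 \<or>
    ev (s \<otimes>\<^bsub>B\<^esub> t) x * (f x + g x) = ev (a \<otimes>\<^bsub>B\<^esub> t \<oplus>\<^bsub>B\<^esub> b \<otimes>\<^bsub>B\<^esub> s) x"
   using 1 2 c(1) d(1) Up[OF x] by (auto simp: ev_simps)
 qed
qed

lemma germs_smult:
 assumes U: "openin (zariski X) U" and f: "f \<in> regs (coords X) U"
  and P: "primeideal P B" and meets: "zeros P \<inter> U \<noteq> {}"
 shows "z \<odot>\<^bsub>localization B P\<^esub> germs U f P = germs U (\<lambda>x. z * f x) P"
 unfolding localization_def module.simps
proof (intro germs_Union[OF U _ P meets] f)
 have Up: "x \<in> U \<Longrightarrow> x \<in> points X" for x by (rule open_points[OF U])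
 fix a s assume 1: "(a, s) \<in> germs U f P"
 note 1 = germsD[OF 1]
 from 1(3) obtain c where c: "c \<in> carrier B - P" "\<forall>x\<in>U. ev c x = 0 \<or> ev s x * f x = ev a x" by blast
 show "fraction B P (z \<odot>\<^bsub>B\<^esub> a) s = germs U (\<lambda>x. z * f x) P"
  by (rule germs_class[OF U P meets germsI[OF _ 1(2) c(1)]]) (use 1 c Up in \<open>auto simp: ev_simps\<close>)
qed

lemma germs_one:
 assumes U: "openin (zariski X) U" and P: "primeideal P B" and meets: "zeros P \<inter> U \<noteq> {}"
 shows "\<one>\<^bsub>localization B P\<^esub> = germs U (\<lambda>x. 1) P"
 unfolding localization_def monoid.simps
proof (rule germs_class[OF U P meets germsI])
 have Up: "x \<in> U \<Longrightarrow> x \<in> points X" for x by (rule open_points[OF U])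
 show "\<one>\<^bsub>B\<^esub> \<in> carrier B" "\<one>\<^bsub>B\<^esub> \<in> carrier B - P" "\<one>\<^bsub>B\<^esub> \<in> carrier B - P"
  using closed(2) primeD(3)[OF P] by auto
 show "ev \<one>\<^bsub>B\<^esub> x = 0 \<or> ev \<one>\<^bsub>B\<^esub> x * 1 = ev \<one>\<^bsub>B\<^esub> x" for x by simp
qed

lemma germs_carrier:
 assumes U: "openin (zariski X) U" and f: "f \<in> regs (coords X) U"
  and P: "primeideal P B" and meets: "zeros P \<inter> U \<noteq> {}"
 shows "germs U f P \<in> carrier (localization B P)"
proof -
 obtain a b where ab: "(a, b) \<in> germs U f P" by (rule germs_nonempty[OF U f P meets])
 note ab' = germsD[OF ab]
 have "fraction_rel B P `` {(a, b)} \<in> (carrier B \<times> (carrier B - P)) // fraction_rel B P"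
  by (rule quotientI) (use ab' in simp)
 then show ?thesis
  unfolding germs_class[OF U P meets ab, symmetric] fraction_def localization_def by simp
qed

definition spec_iso :: "('b set, 'b set \<Rightarrow> ('b \<times> 'b) set, 'a set, 'a \<Rightarrow> complex) rs_map" where
 "spec_iso = (zeros, \<lambda>W f. \<lambda>P\<in>preim (Spec B) zeros W. germs (trace_on X W) f P)"

lemma preim_iff:
 assumes W: "openin (sober_topology (zariski X)) W"
 shows "P \<in> preim (Spec B) zeros W \<longleftrightarrow> primeideal P B \<and> zeros P \<inter> trace_on X W \<noteq> {}"
proof -
 have "zeros P \<in> W \<longleftrightarrow> zeros P \<inter> trace_on X W \<noteq> {}" if "primeideal P B"
  by (subst sober_open_trace(2)[OF W]) (simp add: irreducible_zeros[OF that])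
 then show ?thesis unfolding preim_def Spec_def by (auto simp: topspace_spec)
qed

lemma vanishing_preim:
 assumes W: "openin (sober_topology (zariski X)) W" and x: "x \<in> trace_on X W"
 shows "vanishing {x} \<in> preim (Spec B) zeros W"
proof -
 have "x \<in> points X" using x unfolding trace_on_def by simp
 then show ?thesis unfolding preim_iff[OF W] using zeros_vanishing_closure(1) x
  by (auto simp: zeros_def vanishing_def)
qed

lemma germs_section:
 assumes W: "openin (sober_topology (zariski X)) W" and f: "f \<in> regs (coords X) (trace_on X W)"
 shows "(\<lambda>P\<in>preim (Spec B) zeros W. germs (trace_on X W) f P) \<in> spec_sections B (preim (Spec B) zeros W)"
  (is "?s \<in> _")
 unfolding spec_sections_def
proof (intro CollectI conjI ballI)
 let ?U = "trace_on X W" and ?V = "preim (Spec B) zeros W"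
 have U: "openin (zariski X) ?U" by (rule sober_open_trace(1)[OF W])
 show "?s \<in> (\<Pi>\<^sub>E P\<in>?V. carrier (localization B P))"
  by (rule PiE_I) (use germs_carrier[OF U f] preim_iff[OF W] in auto)
 fix P assume "P \<in> ?V"
 then have P: "primeideal P B" "zeros P \<inter> ?U \<noteq> {}" using preim_iff[OF W] by auto
 obtain a b where ab: "(a, b) \<in> germs ?U f P" "b \<in> carrier B - P" "\<forall>x\<in>?U. ev b x = 0 \<or> ev b x * f x = ev a x"
  by (rule germs_nonempty[OF U f P])
 obtain e where e: "e \<in> carrier B - P" "\<forall>x\<in>points X. x \<notin> ?U \<longrightarrow> ev e x = 0" using cutoff[OF U P] by blast
 have aB: "a \<in> carrier B" using germsD(1)[OF ab(1)] .
 have be: "b \<otimes>\<^bsub>B\<^esub> e \<in> carrier B - P" by (rule prime_compl_mult[OF P(1) ab(2) e(1)])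
 let ?N = "{Q. primeideal Q B \<and> \<not> {b \<otimes>\<^bsub>B\<^esub> e} \<subseteq> Q}"
 have N: "b \<in> carrier B - Q" "Q \<in> ?V" "?s Q = fraction B Q a b" if "Q \<in> ?N" for Q
 proof -
  have Q: "primeideal Q B" "b \<otimes>\<^bsub>B\<^esub> e \<notin> Q" using that by auto
  have "e \<notin> Q" using primeD(5)[OF Q(1), of b e] ab(2) Q(2) by auto
  then obtain y where y: "y \<in> zeros Q" "ev e y \<noteq> 0" using zeros_separate[OF Q(1), of e] e(1) by blast
  then have "y \<in> ?U" using e(2) unfolding zeros_def by blast
  with y have m: "zeros Q \<inter> ?U \<noteq> {}" by blast
  then show V: "Q \<in> ?V" using Q(1) preim_iff[OF W] by blast
  interpret cring B by (rule cring)
  have "e \<otimes>\<^bsub>B\<^esub> b \<notin> Q" using Q(2) m_comm[of e b] e(1) ab(2) by simp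
  then show bQ: "b \<in> carrier B - Q" using primeD(5)[OF Q(1), of e b] e(1) ab(2) by auto
  have "(a, b) \<in> germs ?U f Q" by (rule germsI[OF aB bQ bQ]) (use ab(3) in blast)
  from germs_class[OF U Q(1) m this] show "?s Q = fraction B Q a b" using V by simp
 qed
 show "\<exists>V a f. openin (spec_topology B) V \<and> P \<in> V \<and> V \<subseteq> ?V \<and> a \<in> carrier B \<and> f \<in> carrier B \<and>
   (\<forall>Q\<in>V. f \<notin> Q \<and> ?s Q = fraction B Q a f)"
 proof (rule exI[of _ ?N], rule exI[of _ a], rule exI[of _ b], intro conjI ballI subsetI)
  show "openin (spec_topology B) ?N" unfolding openin_spec_topology
   by (rule exI[of _ "{b \<otimes>\<^bsub>B\<^esub> e}"]) (use be in auto)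
  show "P \<in> ?N" using be P(1) by auto
  show "a \<in> carrier B" "b \<in> carrier B" using aB ab(2) by auto
 qed (use N in blast)+
qed

text \<open>The value of the function at a point \<open>x\<close> is read off from any fraction representing
 the section at the ideal of functions that vanish at \<open>x\<close>. Locally the section is one fraction,
 so that the function is regular.\<close>

lemma section_germs:
 assumes W: "openin (sober_topology (zariski X)) W" and s: "s \<in> spec_sections B (preim (Spec B) zeros W)"
 shows "\<exists>f\<in>regular_funs X (trace_on X W). (\<lambda>P\<in>preim (Spec B) zeros W. germs (trace_on X W) f P) = s"
proof -
 let ?U = "trace_on X W" and ?V = "preim (Spec B) zeros W"
 have U: "openin (zariski X) ?U" by (rule sober_open_trace(1)[OF W])
 have Up: "x \<in> ?U \<Longrightarrow> x \<in> points X" for x unfolding trace_on_def by simp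
 have loc: "\<exists>S a b. S \<subseteq> carrier B \<and> \<not> S \<subseteq> P \<and> a \<in> carrier B \<and> b \<in> carrier B \<and>
   (\<forall>Q. primeideal Q B \<longrightarrow> \<not> S \<subseteq> Q \<longrightarrow> b \<notin> Q \<and> s Q = fraction B Q a b)" if P: "P \<in> ?V" for P
 proof -
  obtain V a b where V: "openin (spec_topology B) V" "P \<in> V" "a \<in> carrier B" "b \<in> carrier B"
   "\<forall>Q\<in>V. b \<notin> Q \<and> s Q = fraction B Q a b" using s P unfolding spec_sections_def by blast
  obtain S where S: "S \<subseteq> carrier B" "V = {P. primeideal P B \<and> \<not> S \<subseteq> P}"
   using V(1) unfolding openin_spec_topology by (elim exE conjE)
  show ?thesis
   by (rule exI[of _ S], rule exI[of _ a], rule exI[of _ b]) (use V S in auto)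
 qed
 define f where "f = (\<lambda>x\<in>?U. let p = (SOME p. p \<in> s (vanishing {x})) in ev (fst p) x / ev (snd p) x)"
 have val: "ev b x \<noteq> 0" "f x = ev a x / ev b x"
  if x: "x \<in> ?U" and ab: "a \<in> carrier B" "b \<in> carrier B" "b \<notin> vanishing {x}"
   and sx: "s (vanishing {x}) = fraction B (vanishing {x}) a b" for x a b
 proof -
  have xp: "x \<in> points X" by (rule Up[OF x])
  show b0: "ev b x \<noteq> 0" using ab unfolding vanishing_def by auto
  have one: "\<one>\<^bsub>B\<^esub> \<in> carrier B - vanishing {x}" using closed(2) ev_one[OF xp] by (simp add: vanishing_def)
  have "(a, b) \<in> fraction B (vanishing {x}) a b" unfolding fraction_iff using ab one by auto
  then have "(SOME p. p \<in> s (vanishing {x})) \<in> fraction B (vanishing {x}) a b"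
   unfolding sx by (rule someI)
  then obtain a' b' where p: "(SOME p. p \<in> s (vanishing {x})) = (a', b')"
   and "(a', b') \<in> fraction B (vanishing {x}) a b" by (cases "SOME p. p \<in> s (vanishing {x})") auto
  then obtain u where u: "b' \<in> carrier B - vanishing {x}" "u \<in> carrier B - vanishing {x}"
   "ev u x = 0 \<or> ev a x * ev b' x = ev a' x * ev b x" unfolding fraction_iff using xp by blast
  then have "ev a x * ev b' x = ev a' x * ev b x" "ev b' x \<noteq> 0" unfolding vanishing_def by auto
  then show "f x = ev a x / ev b x" unfolding f_def using x b0 p by (simp add: field_simps)
 qed
 have point: "ev g x = 0 \<or> (ev b x \<noteq> 0 \<and> f x = ev a x / ev b x)"
  if "x \<in> ?U" "a \<in> carrier B" "b \<in> carrier B" "S \<subseteq> carrier B" "g \<in> S"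
   "\<forall>Q. primeideal Q B \<longrightarrow> \<not> S \<subseteq> Q \<longrightarrow> b \<notin> Q \<and> s Q = fraction B Q a b" for x a b S g
 proof (cases "ev g x = 0")
  case False
  then have "\<not> S \<subseteq> vanishing {x}" using that(5) unfolding vanishing_def by auto
  moreover have "primeideal (vanishing {x}) B" by (rule zeros_vanishing_closure(1)[OF Up[OF that(1)]])
  ultimately have "b \<notin> vanishing {x}" "s (vanishing {x}) = fraction B (vanishing {x}) a b"
   using that(6) by auto
  from val[OF that(1-3) this] show ?thesis by simp
 qed simp
 have "f \<in> regs (coords X) ?U"
 proof (rule regs_local_quotient[of _ "points X"])
  interpret function_ring_inv "points X" "regs (coords X) (points X)" by (rule regs)
  show "?U \<subseteq> points X" using Up by blast
  fix x assume x: "x \<in> ?U"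
  obtain S a b where S: "S \<subseteq> carrier B" "\<not> S \<subseteq> vanishing {x}" and ab: "a \<in> carrier B" "b \<in> carrier B"
   and sQ: "\<forall>Q. primeideal Q B \<longrightarrow> \<not> S \<subseteq> Q \<longrightarrow> b \<notin> Q \<and> s Q = fraction B Q a b"
   using loc[OF vanishing_preim[OF W x]] by (elim exE conjE)
  then obtain g where g: "g \<in> S" "ev g x \<noteq> 0" unfolding vanishing_def by auto
  have gB: "g \<in> carrier B" using g(1) S(1) by blast
  show "\<exists>h1\<in>regs (coords X) (points X). \<exists>h2\<in>regs (coords X) (points X).
    h2 x \<noteq> 0 \<and> (\<forall>y\<in>?U. h2 y \<noteq> 0 \<longrightarrow> f y = h1 y / h2 y)"
  proof (rule bexI[of _ "\<lambda>y. ev a y * ev g y"], rule bexI[of _ "\<lambda>y. ev b y * ev g y"], intro conjI ballI impI)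
   show "(\<lambda>y. ev a y * ev g y) \<in> regs (coords X) (points X)" "(\<lambda>y. ev b y * ev g y) \<in> regs (coords X) (points X)"
    by (intro mult ev_regs ab gB)+
   show "ev b x * ev g x \<noteq> 0" using point[OF x ab S(1) g(1) sQ] g(2) by auto
   show "f y = ev a y * ev g y / (ev b y * ev g y)" if "y \<in> ?U" "ev b y * ev g y \<noteq> 0" for y
    using point[OF that(1) ab S(1) g(1) sQ] that(2) by auto
  qed
 qed
 moreover have "f \<in> extensional ?U" unfolding f_def by simp
 ultimately have fr: "f \<in> regular_funs X ?U" using regular_funs_iff[OF U] by blast
 have "(\<lambda>P\<in>?V. germs ?U f P) P = s P" for P
 proof (cases "P \<in> ?V")
  case True
  then have P: "primeideal P B" "zeros P \<inter> ?U \<noteq> {}" using preim_iff[OF W] by auto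
  obtain S a b where S: "S \<subseteq> carrier B" "\<not> S \<subseteq> P" and ab: "a \<in> carrier B" "b \<in> carrier B"
   and sQ: "\<forall>Q. primeideal Q B \<longrightarrow> \<not> S \<subseteq> Q \<longrightarrow> b \<notin> Q \<and> s Q = fraction B Q a b"
   using loc[OF True] by (elim exE conjE)
  from S obtain g where g: "g \<in> S" "g \<in> carrier B - P" by blast
  have bs: "b \<notin> P \<and> s P = fraction B P a b" using sQ P(1) S(2) by simp
  then have bP: "b \<in> carrier B - P" and sP: "s P = fraction B P a b" using ab(2) by simp_all
  have "(a, b) \<in> germs ?U f P"
  proof (rule germsI[OF ab(1) bP g(2)])
   fix x assume "x \<in> ?U"
   from point[OF this ab S(1) g(1) sQ] show "ev g x = 0 \<or> ev b x * f x = ev a x" by auto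
  qed
  from germs_class[OF U P this] have "germs ?U f P = s P" unfolding sP by (rule sym)
  then show ?thesis using True by (simp only: restrict_apply if_True)
 next
  case False
  have "s \<in> (\<Pi>\<^sub>E P\<in>?V. carrier (localization B P))"
   using s unfolding spec_sections_def mem_Collect_eq by (rule conjunct1)
  from PiE_arb[OF this False] show ?thesis using False by (simp only: restrict_apply if_False)
 qed
 with fr show ?thesis by (intro bexI[of _ f] ext)
qed

theorem spec_iso: "rs_iso (Spec B) (scheme_of X) spec_iso"
 unfolding rs_iso_def
proof (intro conjI allI impI)
 have top: "top_of (Spec B) = spec_topology B" "top_of (scheme_of X) = sober_topology (zariski X)"
  unfolding Spec_def scheme_of_def by simp_all
 have fst: "fst spec_iso = zeros" unfolding spec_iso_def by simp
 show "homeomorphic_map (top_of (Spec B)) (top_of (scheme_of X)) (fst spec_iso)"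
  unfolding top fst by (rule homeomorphic_zeros)
 fix W assume "openin (top_of (scheme_of X)) W"
 then have W: "openin (sober_topology (zariski X)) W" unfolding top .
 let ?U = "trace_on X W" and ?V = "preim (Spec B) zeros W"
 have U: "openin (zariski X) ?U" by (rule sober_open_trace(1)[OF W])
 have sU: "sect (scheme_of X) W = fun_algebra ?U (regular_funs X ?U)" unfolding scheme_of_def by simp
 have VD: "primeideal P B" "zeros P \<inter> ?U \<noteq> {}" if "P \<in> ?V" for P using that preim_iff[OF W] by auto
 have snd: "snd spec_iso W f = (\<lambda>P\<in>?V. germs ?U f P)" for f unfolding spec_iso_def by simp
 have reg: "f \<in> regs (coords X) ?U" if "f \<in> regular_funs X ?U" for f
  using that regular_funs_iff[OF U] by blast
 { show "snd spec_iso W \<in> alg_iso (sect (scheme_of X) W) (sect (Spec B) (preim (Spec B) (fst spec_iso) W))"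
  unfolding alg_iso_def fst
 proof (intro CollectI conjI allI ballI)
  show "snd spec_iso W \<in> ring_iso (sect (scheme_of X) W) (sect (Spec B) ?V)"
   unfolding ring_iso_def
  proof (intro CollectI conjI)
   show "snd spec_iso W \<in> Ring.ring_hom (sect (scheme_of X) W) (sect (Spec B) ?V)"
   proof (rule Ring.ring_hom_memI)
    fix f assume "f \<in> carrier (sect (scheme_of X) W)"
    then have f: "f \<in> regular_funs X ?U" unfolding sU fun_algebra_def by simp
    show "snd spec_iso W f \<in> carrier (sect (Spec B) ?V)"
     unfolding snd Spec_sect_simps by (rule germs_section[OF W reg[OF f]])
    fix g assume "g \<in> carrier (sect (scheme_of X) W)"
    then have g: "g \<in> regular_funs X ?U" unfolding sU fun_algebra_def by simp
    show "snd spec_iso W (f \<otimes>\<^bsub>sect (scheme_of X) W\<^esub> g) =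
      snd spec_iso W f \<otimes>\<^bsub>sect (Spec B) ?V\<^esub> snd spec_iso W g"
    proof -
     have "germs ?U (\<lambda>x\<in>?U. f x * g x) P = germs ?U f P \<otimes>\<^bsub>localization B P\<^esub> germs ?U g P" if "P \<in> ?V" for P
      unfolding germs_mult[OF U reg[OF f] reg[OF g] VD[OF that]] by (rule germs_cong) simp
     then show ?thesis unfolding snd sU fun_algebra_simps Spec_sect_simps by (intro restrict_ext) simp
    qed
    show "snd spec_iso W (f \<oplus>\<^bsub>sect (scheme_of X) W\<^esub> g) =
      snd spec_iso W f \<oplus>\<^bsub>sect (Spec B) ?V\<^esub> snd spec_iso W g"
    proof -
     have "germs ?U (\<lambda>x\<in>?U. f x + g x) P = germs ?U f P \<oplus>\<^bsub>localization B P\<^esub> germs ?U g P" if "P \<in> ?V" for P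
      unfolding germs_add[OF U reg[OF f] reg[OF g] VD[OF that]] by (rule germs_cong) simp
     then show ?thesis unfolding snd sU fun_algebra_simps Spec_sect_simps by (intro restrict_ext) simp
    qed
   next
    have "germs ?U (\<lambda>x\<in>?U. 1) P = \<one>\<^bsub>localization B P\<^esub>" if "P \<in> ?V" for P
     unfolding germs_one[OF U VD[OF that]] by (rule germs_cong) simp
    then show "snd spec_iso W \<one>\<^bsub>sect (scheme_of X) W\<^esub> = \<one>\<^bsub>sect (Spec B) ?V\<^esub>"
     unfolding snd sU fun_algebra_simps Spec_sect_simps by (intro restrict_ext) simp
   qed
   show "bij_betw (snd spec_iso W) (carrier (sect (scheme_of X) W)) (carrier (sect (Spec B) ?V))"
    unfolding bij_betw_def
   proof
    have cU: "carrier (sect (scheme_of X) W) = regular_funs X ?U" unfolding sU fun_algebra_def by simp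
    have cV: "carrier (sect (Spec B) ?V) = spec_sections B ?V" by (rule Spec_sect_simps)
    show "snd spec_iso W ` carrier (sect (scheme_of X) W) = carrier (sect (Spec B) ?V)"
     unfolding cU cV
    proof (intro equalityI subsetI)
     fix s assume "s \<in> snd spec_iso W ` regular_funs X ?U"
     then show "s \<in> spec_sections B ?V" using germs_section[OF W reg] unfolding snd by auto
    next
     fix s assume "s \<in> spec_sections B ?V"
     from section_germs[OF W this] show "s \<in> snd spec_iso W ` regular_funs X ?U" unfolding snd by blast
    qed
    show "inj_on (snd spec_iso W) (carrier (sect (scheme_of X) W))"
     unfolding cU
    proof (rule inj_onI)
     fix f g assume f: "f \<in> regular_funs X ?U" and g: "g \<in> regular_funs X ?U"
      and eq: "snd spec_iso W f = snd spec_iso W g"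
     show "f = g"
     proof (rule extensionalityI[of _ ?U])
      show "f \<in> extensional ?U" "g \<in> extensional ?U" using f g unfolding regular_funs_def by auto
      fix x assume x: "x \<in> ?U"
      let ?P = "vanishing {x}"
      have V: "?P \<in> ?V" by (rule vanishing_preim[OF W x])
      obtain a b where ab: "(a, b) \<in> germs ?U f ?P" by (rule germs_nonempty[OF U reg[OF f] VD[OF V]])
      have "(a, b) \<in> germs ?U g ?P" using ab fun_cong[OF eq, of ?P] V unfolding snd by simp
      with ab obtain c d where "b \<in> carrier B - ?P" "c \<in> carrier B - ?P" "d \<in> carrier B - ?P"
       "ev c x = 0 \<or> ev b x * f x = ev a x" "ev d x = 0 \<or> ev b x * g x = ev a x"
       using germsD x by meson
      then have "ev b x \<noteq> 0" "ev b x * f x = ev a x" "ev b x * g x = ev a x"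
       unfolding vanishing_def by auto
      then show "f x = g x" by (metis mult_left_cancel)
     qed
    qed
   qed
  qed
  fix z f assume "f \<in> carrier (sect (scheme_of X) W)"
  then have f: "f \<in> regular_funs X ?U" unfolding sU fun_algebra_def by simp
  have "germs ?U (\<lambda>x\<in>?U. z * f x) P = z \<odot>\<^bsub>localization B P\<^esub> germs ?U f P" if "P \<in> ?V" for P
   unfolding germs_smult[OF U reg[OF f] VD[OF that]] by (rule germs_cong) simp
  then show "snd spec_iso W (z \<odot>\<^bsub>sect (scheme_of X) W\<^esub> f) = z \<odot>\<^bsub>sect (Spec B) ?V\<^esub> snd spec_iso W f"
   unfolding snd sU fun_algebra_simps Spec_sect_simps by (intro restrict_ext) simp
 qed }
 fix W' f assume "openin (top_of (scheme_of X)) W'" and sub: "W' \<subseteq> W" and "f \<in> carrier (sect (scheme_of X) W)"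
 then have W': "openin (sober_topology (zariski X)) W'" and f: "f \<in> regular_funs X ?U"
  unfolding top sU fun_algebra_def by simp_all
 let ?U' = "trace_on X W'" and ?V' = "preim (Spec B) zeros W'"
 have U': "openin (zariski X) ?U'" by (rule sober_open_trace(1)[OF W'])
 have UU: "?U' \<subseteq> ?U" using sub unfolding trace_on_def by blast
 have VV: "?V' \<subseteq> ?V" using sub unfolding preim_def by blast
 have "germs ?U' (restrict f ?U') P = germs ?U f P" if PV: "P \<in> ?V'" for P
 proof -
  have P: "primeideal P B" "zeros P \<inter> ?U' \<noteq> {}" using PV preim_iff[OF W'] by auto
  have PU: "zeros P \<inter> ?U \<noteq> {}" using P(2) UU by blast
  obtain a b where ab: "(a, b) \<in> germs ?U f P" by (rule germs_nonempty[OF U reg[OF f] P(1) PU])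
  note ab' = germsD[OF ab]
  then obtain c where c: "c \<in> carrier B - P" "\<forall>x\<in>?U. ev c x = 0 \<or> ev b x * f x = ev a x" by blast
  have "(a, b) \<in> germs ?U' (restrict f ?U') P"
   by (rule germsI[OF ab'(1,2) c(1)]) (use c(2) UU in auto)
  from germs_class[OF U' P this] germs_class[OF U P(1) PU ab] show ?thesis by simp
 qed
 then have "(\<lambda>P\<in>?V'. germs ?U' (restrict f ?U') P) = restrict (\<lambda>P\<in>?V. germs ?U f P) ?V'"
  using VV by (intro ext) (auto simp: restrict_def)
 then show "snd spec_iso W' (res (scheme_of X) W W' f) =
   res (Spec B) (preim (Spec B) (fst spec_iso) W) (preim (Spec B) (fst spec_iso) W') (snd spec_iso W f)"
  unfolding fst Spec_sect_simps by (simp add: spec_iso_def scheme_of_def)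
qed

end

context function_model
begin

text \<open>Both composites send a function to its composition with \<open>\<psi>\<close>; on points,
 \<open>zeros\<close> of the preimage of an ideal is the closure of the image of its zero set.\<close>

lemma spec_iso_equivariant:
 assumes \<kappa>: "\<And>a. a \<in> carrier B \<Longrightarrow> \<kappa> a \<in> carrier B"
  and \<psi>: "\<And>x. x \<in> points X \<Longrightarrow> \<psi> x \<in> points X"
  and ev\<kappa>: "\<And>a x. a \<in> carrier B \<Longrightarrow> x \<in> points X \<Longrightarrow> ev (\<kappa> a) x = ev a (\<psi> x)"
 shows "rs_map_eq (Spec B) (scheme_of X) (rs_comp (Spec B) spec_iso (Spec_map B B \<kappa>))
  (rs_comp (scheme_of X) (scheme_map_of X X \<psi>) spec_iso)"
proof -
 define \<phi> where "\<phi> Q = {a \<in> carrier B. \<kappa> a \<in> Q}" for Q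
 let ?\<beta> = "\<lambda>Z. Abstract_Topology.closure_of (zariski X) (\<psi> ` Z)"
 have top: "top_of (Spec B) = spec_topology B" "top_of (scheme_of X) = sober_topology (zariski X)"
  unfolding Spec_def scheme_of_def by simp_all
 have \<kappa>_mult: "\<kappa> (a \<otimes>\<^bsub>B\<^esub> b) = \<kappa> a \<otimes>\<^bsub>B\<^esub> \<kappa> b" if "a \<in> carrier B" "b \<in> carrier B" for a b
  by (rule ev_inj) (use that \<kappa> \<psi> in \<open>auto simp: ev_simps ev\<kappa>\<close>)
 have \<kappa>_add: "\<kappa> (a \<oplus>\<^bsub>B\<^esub> b) = \<kappa> a \<oplus>\<^bsub>B\<^esub> \<kappa> b" if "a \<in> carrier B" "b \<in> carrier B" for a b
  by (rule ev_inj) (use that \<kappa> \<psi> in \<open>auto simp: ev_simps ev\<kappa>\<close>)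
 have \<kappa>_zero: "\<kappa> \<zero>\<^bsub>B\<^esub> = \<zero>\<^bsub>B\<^esub>" by (rule ev_inj) (use \<kappa> \<psi> in \<open>auto simp: ev_simps ev\<kappa>\<close>)
 have \<kappa>_one: "\<kappa> \<one>\<^bsub>B\<^esub> = \<one>\<^bsub>B\<^esub>" by (rule ev_inj) (use \<kappa> \<psi> in \<open>auto simp: ev_simps ev\<kappa>\<close>)
 have \<phi>_prime: "primeideal (\<phi> Q) B" if Q: "primeideal Q B" for Q
 proof (rule primeI)
  note Q' = primeD[OF Q]
  show "\<phi> Q \<subseteq> carrier B" "\<zero>\<^bsub>B\<^esub> \<in> \<phi> Q" "\<one>\<^bsub>B\<^esub> \<notin> \<phi> Q"
   unfolding \<phi>_def using \<kappa>_zero \<kappa>_one Q'(2,3) closed(1) by auto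
  show "a \<oplus>\<^bsub>B\<^esub> b \<in> \<phi> Q" if "a \<in> \<phi> Q" "b \<in> \<phi> Q" for a b
   using that \<kappa>_add Q'(4) closed(3) unfolding \<phi>_def by simp
  show "a \<otimes>\<^bsub>B\<^esub> b \<in> \<phi> Q" if "a \<in> carrier B" "b \<in> \<phi> Q" for a b
   using that \<kappa>_mult Q'(5) closed(4) \<kappa> unfolding \<phi>_def by simp
  show "a \<in> \<phi> Q \<or> b \<in> \<phi> Q" if "a \<in> carrier B" "b \<in> carrier B" "a \<otimes>\<^bsub>B\<^esub> b \<in> \<phi> Q" for a b
   using that \<kappa>_mult Q'(6)[OF \<kappa> \<kappa>] unfolding \<phi>_def by simp
 qed
 have \<beta>_zeros: "?\<beta> (zeros Q) = zeros (\<phi> Q)" if Q: "primeideal Q B" for Q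
 proof
  have zp: "\<psi> ` zeros Q \<subseteq> points X" using \<psi> unfolding zeros_def by auto
  show "?\<beta> (zeros Q) \<subseteq> zeros (\<phi> Q)"
  proof (rule closure_of_minimal)
   show "closedin (zariski X) (zeros (\<phi> Q))" by (rule closedin_zeros) (auto simp: \<phi>_def)
   show "\<psi> ` zeros Q \<subseteq> zeros (\<phi> Q)"
   proof
    fix y assume "y \<in> \<psi> ` zeros Q"
    then obtain x where x: "x \<in> zeros Q" "y = \<psi> x" by blast
    have xp: "x \<in> points X" using x(1) unfolding zeros_def by simp
    have "ev a y = 0" if "a \<in> \<phi> Q" for a
     using that x ev\<kappa>[of a x] xp unfolding \<phi>_def zeros_def by simp
    then show "y \<in> zeros (\<phi> Q)" unfolding zeros_def using \<psi>[OF xp] x(2) by simp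
   qed
  qed
  show "zeros (\<phi> Q) \<subseteq> ?\<beta> (zeros Q)"
   unfolding zariski_closure[OF zp]
  proof (intro subsetI CollectI conjI ballI impI)
   fix y assume y: "y \<in> zeros (\<phi> Q)"
   then show "y \<in> points X" unfolding zeros_def by simp
   fix f assume f: "f \<in> poly_funs (coords X)" "\<forall>x\<in>\<psi> ` zeros Q. f x = 0"
   obtain a where a: "a \<in> carrier B" "\<forall>x\<in>points X. ev a x = f x" using ev_poly[OF f(1)] by blast
   have "ev (\<kappa> a) x = 0" if "x \<in> zeros Q" for x
   proof -
    have "x \<in> points X" using that unfolding zeros_def by simp
    then show ?thesis using ev\<kappa>[OF a(1)] a(2) \<psi> f(2) that by simp
   qed
   then have "\<kappa> a \<in> Q" by (subst prime_eq_vanishing[OF Q]) (simp add: \<kappa>[OF a(1)])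
   then have "a \<in> \<phi> Q" unfolding \<phi>_def using a(1) by simp
   then show "f y = 0" using y a(2) unfolding zeros_def by auto
  qed
 qed
 have \<phi>_vanishing: "\<phi> (vanishing {x}) = vanishing {\<psi> x}" if "x \<in> points X" for x
  unfolding \<phi>_def vanishing_def using ev\<kappa>[OF _ that] \<kappa> by auto
 have fsts: "fst (rs_comp (Spec B) spec_iso (Spec_map B B \<kappa>)) = (\<lambda>Q. zeros (\<phi> Q))"
  "fst (rs_comp (scheme_of X) (scheme_map_of X X \<psi>) spec_iso) = (\<lambda>Q. ?\<beta> (zeros Q))"
  unfolding rs_comp_def spec_iso_def Spec_map_def scheme_map_of_def \<phi>_def by (simp_all add: Let_def)
 show ?thesis
  unfolding rs_map_eq_def fsts top topspace_spec
 proof (intro conjI ballI allI impI)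
  show "zeros (\<phi> Q) = ?\<beta> (zeros Q)" if "Q \<in> {P. primeideal P B}" for Q
   using \<beta>_zeros[of Q] that by simp
  fix W s assume W: "openin (sober_topology (zariski X)) W" and "s \<in> carrier (sect (scheme_of X) W)"
  let ?U = "trace_on X W" and ?V = "preim (Spec B) zeros W"
  have U: "openin (zariski X) ?U" by (rule sober_open_trace(1)[OF W])
  have s: "s \<in> regs (coords X) ?U"
   using \<open>s \<in> carrier _\<close> regular_funs_iff[OF U] unfolding scheme_of_def by (simp add: fun_algebra_simps)
  let ?W = "preim (scheme_of X) ?\<beta> W" and ?U' = "{x \<in> points X. \<psi> x \<in> ?U}"
  have W': "zeros Q \<in> ?W \<longleftrightarrow> zeros (\<phi> Q) \<in> W" if "primeideal Q B" for Q
   unfolding preim_def top topspace_sober using irreducible_zeros[OF that] \<beta>_zeros[OF that] by simp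
  have tr: "trace_on X ?W = ?U'"
  proof -
   have "Abstract_Topology.closure_of (zariski X) {x} \<in> ?W \<longleftrightarrow> \<psi> x \<in> ?U" if x: "x \<in> points X" for x
   proof -
    have "Abstract_Topology.closure_of (zariski X) {x} \<in> ?W \<longleftrightarrow> zeros (vanishing {\<psi> x}) \<in> W"
     using W'[OF zeros_vanishing_closure(1)[OF x]] zeros_vanishing_closure(2)[OF x] \<phi>_vanishing[OF x] by simp
    also have "\<dots> \<longleftrightarrow> \<psi> x \<in> ?U"
     using zeros_vanishing_closure(2)[OF \<psi>[OF x]] \<psi>[OF x] unfolding trace_on_def by simp
    finally show ?thesis .
   qed
   then show ?thesis unfolding trace_on_def[of X ?W] by blast
  qed
  have V: "preim (Spec B) \<phi> ?V = preim (Spec B) zeros ?W"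
   unfolding preim_def[of "Spec B"] top topspace_spec using W' \<phi>_prime by auto
  obtain S where S: "S \<subseteq> carrier B" "?U = {x \<in> points X. \<exists>a\<in>S. ev a x \<noteq> 0}"
   by (rule open_as_ev[OF U])
  have \<kappa>S: "\<kappa> ` S \<subseteq> carrier B" using \<kappa> S(1) by auto
  have U'S: "?U' = {x \<in> points X. \<exists>a\<in>\<kappa> ` S. ev a x \<noteq> 0}"
   unfolding S(2) using \<psi> ev\<kappa> S(1) by (auto simp: subset_iff)
  have "{x \<in> points X. \<exists>a\<in>\<kappa> ` S. ev a x \<noteq> 0} = (\<Union>a\<in>\<kappa> ` S. {x \<in> points X. ev a x \<noteq> 0})" by blast
  moreover have "openin (zariski X) (\<Union>a\<in>\<kappa> ` S. {x \<in> points X. ev a x \<noteq> 0})"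
   by (rule openin_Union) (use open_nonvanishing \<kappa>S in auto)
  ultimately have U': "openin (zariski X) ?U'" unfolding U'S by simp
  have "(\<Union>(a, t)\<in>germs ?U s (\<phi> Q). fraction B Q (\<kappa> a) (\<kappa> t)) =
    germs ?U' (\<lambda>x\<in>?U'. s (\<psi> x)) Q" if QV: "Q \<in> preim (Spec B) \<phi> ?V" for Q
  proof (rule germs_Union[OF U s])
   have Q: "primeideal Q B" and QV': "\<phi> Q \<in> ?V"
    using QV unfolding preim_def[of "Spec B" \<phi>] top topspace_spec by auto
   show P: "primeideal (\<phi> Q) B" by (rule \<phi>_prime[OF Q])
   show m: "zeros (\<phi> Q) \<inter> ?U \<noteq> {}" using QV' preim_iff[OF W] by blast
   then have "\<not> S \<subseteq> \<phi> Q" using zeros_meets[OF P S(1)] unfolding S(2) by simp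
   then have "\<not> \<kappa> ` S \<subseteq> Q" using S(1) unfolding \<phi>_def by auto
   then have m': "zeros Q \<inter> ?U' \<noteq> {}" using zeros_meets[OF Q \<kappa>S] unfolding U'S by simp
   fix a t assume "(a, t) \<in> germs ?U s (\<phi> Q)"
   note at = germsD[OF this]
   from at(3) obtain c where c: "c \<in> carrier B - \<phi> Q" "\<forall>x\<in>?U. ev c x = 0 \<or> ev t x * s x = ev a x" by blast
   show "fraction B Q (\<kappa> a) (\<kappa> t) = germs ?U' (\<lambda>x\<in>?U'. s (\<psi> x)) Q"
   proof (rule germs_class[OF U' Q m'], rule germsI)
    show "\<kappa> a \<in> carrier B" "\<kappa> t \<in> carrier B - Q" "\<kappa> c \<in> carrier B - Q"
     using at(1,2) c(1) \<kappa> unfolding \<phi>_def by auto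
    fix x assume x: "x \<in> ?U'"
    then have "ev c (\<psi> x) = 0 \<or> ev t (\<psi> x) * s (\<psi> x) = ev a (\<psi> x)" using c(2) by simp
    then show "ev (\<kappa> c) x = 0 \<or> ev (\<kappa> t) x * (\<lambda>x\<in>?U'. s (\<psi> x)) x = ev (\<kappa> a) x"
     using x at(1,2) c(1) by (simp add: ev\<kappa>)
   qed
  qed
  moreover have "\<phi> Q \<in> ?V" if "Q \<in> preim (Spec B) \<phi> ?V" for Q using that unfolding preim_def[of "Spec B" \<phi>] by simp
  ultimately have "(\<lambda>Q\<in>preim (Spec B) \<phi> ?V.
     \<Union>(a, t)\<in>(\<lambda>P\<in>?V. germs ?U s P) (\<phi> Q). fraction B Q (\<kappa> a) (\<kappa> t)) =
    (\<lambda>Q\<in>preim (Spec B) zeros ?W. germs (trace_on X ?W) (\<lambda>x\<in>?U'. s (\<psi> x)) Q)"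
   unfolding tr V[symmetric] by (intro restrict_ext) simp
  then show "snd (rs_comp (Spec B) spec_iso (Spec_map B B \<kappa>)) W s =
    snd (rs_comp (scheme_of X) (scheme_map_of X X \<psi>) spec_iso) W s"
   unfolding rs_comp_def spec_iso_def Spec_map_def scheme_map_of_def \<phi>_def by (simp add: Let_def)
 qed
qed

end

section \<open>The stability conditions in terms of covectors and vectors\<close>

lemma mat_assoc: "dim_col A = dim_row B \<Longrightarrow> dim_col B = dim_row C \<Longrightarrow> A * B * C = A * (B * C)"
 for A B C :: "'a :: semiring_0 mat"
 by (rule assoc_mult_mat[of A "dim_row A" "dim_row B" B "dim_row C" C "dim_col C"]) auto

lemma mult_mat_entry:
 "i < dim_row A \<Longrightarrow> j < dim_col B \<Longrightarrow> dim_col A = dim_row B \<Longrightarrow>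
  (A * B) $$ (i, j) = (\<Sum>l<dim_row B. A $$ (i, l) * B $$ (l, j))"
 by (simp add: scalar_prod_def atLeast0LessThan)

lemma pow_mat_intertwine:
 fixes A g C :: "'a :: comm_ring_1 mat"
 assumes A: "A \<in> carrier_mat n n" and g: "g \<in> carrier_mat n m" and C: "C \<in> carrier_mat m m"
  and eq: "A * g = g * C"
 shows "A ^\<^sub>m k * g = g * C ^\<^sub>m k"
proof (induction k)
 case 0
 then show ?case using A g C by simp
next
 case (Suc k)
 have Ak: "A ^\<^sub>m k \<in> carrier_mat n n" and Ck: "C ^\<^sub>m k \<in> carrier_mat m m" using A C by auto
 have "A ^\<^sub>m Suc k * g = A ^\<^sub>m k * (A * g)" using Ak A g by (simp add: mat_assoc)
 also have "\<dots> = (A ^\<^sub>m k * g) * C" unfolding eq using Ak g C by (simp add: mat_assoc)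
 also have "\<dots> = g * C ^\<^sub>m Suc k" unfolding Suc using Ck g C by (simp add: mat_assoc)
 finally show ?case .
qed

lemma pow_mat_commute:
 fixes A :: "'a :: comm_ring_1 mat"
 assumes "A \<in> carrier_mat n n"
 shows "A ^\<^sub>m k * A = A * A ^\<^sub>m k"
 by (rule pow_mat_intertwine[OF assms assms assms refl])

lemma pow_mat_add:
 fixes A :: "'a :: comm_ring_1 mat"
 assumes A: "A \<in> carrier_mat n n"
 shows "A ^\<^sub>m (k + l) = A ^\<^sub>m k * A ^\<^sub>m l"
proof (induction l)
 case 0
 then show ?case using A by simp
next
 case (Suc l)
 have "A ^\<^sub>m k \<in> carrier_mat n n" "A ^\<^sub>m l \<in> carrier_mat n n" using A by auto
 then show ?case using Suc A by (simp add: mat_assoc)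
qed

lemma transpose_pow_mat:
 fixes A :: "'a :: comm_ring_1 mat"
 assumes A: "A \<in> carrier_mat n n"
 shows "transpose_mat (A ^\<^sub>m k) = transpose_mat A ^\<^sub>m k"
proof (induction k)
 case 0
 then show ?case using A by simp
next
 case (Suc k)
 have Ak: "A ^\<^sub>m k \<in> carrier_mat n n" and At: "transpose_mat A \<in> carrier_mat n n" using A by auto
 have "transpose_mat (A ^\<^sub>m Suc k) = transpose_mat A * transpose_mat A ^\<^sub>m k"
  using transpose_mult[OF Ak A] Suc by simp
 then show ?case using pow_mat_commute[OF At, of k] by simp
qed

text \<open>Vectors as matrices with one column, so that all of the linear algebra takes place among
 matrices.\<close>

definition vec_mat :: "complex vec \<Rightarrow> complex mat" where
 "vec_mat w = mat (dim_vec w) 1 (\<lambda>(i, j). w $ i)"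

lemma vec_mat_carrier [simp]: "w \<in> carrier_vec n \<Longrightarrow> vec_mat w \<in> carrier_mat n 1"
 "w \<in> carrier_vec n \<Longrightarrow> vec_mat w \<in> carrier_mat n (Suc 0)"
 "dim_row (vec_mat w) = dim_vec w" "dim_col (vec_mat w) = 1"
 "i < dim_vec w \<Longrightarrow> vec_mat w $$ (i, 0) = w $ i"
 unfolding vec_mat_def by auto

lemma vec_mat_mult: "A \<in> carrier_mat r c \<Longrightarrow> w \<in> carrier_vec c \<Longrightarrow> vec_mat (A *\<^sub>v w) = A * vec_mat w"
 by (rule eq_matI) (auto simp: vec_mat_def scalar_prod_def)

lemma vec_mat_eq_iff: "w \<in> carrier_vec n \<Longrightarrow> w' \<in> carrier_vec n \<Longrightarrow> vec_mat w = vec_mat w' \<longleftrightarrow> w = w'"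
proof
 assume w: "w \<in> carrier_vec n" "w' \<in> carrier_vec n" and eq: "vec_mat w = vec_mat w'"
 show "w = w'"
 proof (rule eq_vecI)
  show "w $ i = w' $ i" if "i < dim_vec w'" for i
   using arg_cong[OF eq, of "\<lambda>A. A $$ (i, 0)"] that w by simp
 qed (use w in simp)
qed simp

lemma vec_mat_zero: "w \<in> carrier_vec n \<Longrightarrow> vec_mat w = 0\<^sub>m n 1 \<longleftrightarrow> w = 0\<^sub>v n"
proof -
 assume w: "w \<in> carrier_vec n"
 have "vec_mat (0\<^sub>v n) = 0\<^sub>m n 1" by (rule eq_matI) (auto simp: vec_mat_def)
 then show ?thesis using vec_mat_eq_iff[OF w, of "0\<^sub>v n"] by simp
qed

lemma vec_mat_add: "w \<in> carrier_vec n \<Longrightarrow> w' \<in> carrier_vec n \<Longrightarrow> vec_mat (w + w') = vec_mat w + vec_mat w'"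
 and vec_mat_smult: "vec_mat (c \<cdot>\<^sub>v w) = c \<cdot>\<^sub>m vec_mat w"
 unfolding vec_mat_def by (auto intro!: eq_matI)

lemma vec_mat_surj:
 assumes "s \<in> carrier_mat n 1"
 shows "\<exists>w\<in>carrier_vec n. s = vec_mat w"
 by (rule bexI[of _ "col s 0"]) (use assms in \<open>auto simp: vec_mat_def intro!: eq_matI\<close>)

lemma is_subspace_iff:
 "is_subspace n S \<longleftrightarrow> S \<subseteq> carrier_vec n \<and> 0\<^sub>v n \<in> S \<and> (\<forall>v\<in>S. \<forall>w\<in>S. v + w \<in> S) \<and> (\<forall>c. \<forall>v\<in>S. c \<cdot>\<^sub>v v \<in> S)"
proof -
 interpret vec_space "TYPE(complex)" n .
 have "subspace class_ring S V \<longleftrightarrow> submodule class_ring S V"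
  unfolding subspace_def using vectorspace_axioms by auto
 also have "\<dots> \<longleftrightarrow> S \<subseteq> carrier_vec n \<and> 0\<^sub>v n \<in> S \<and> (\<forall>v\<in>S. \<forall>w\<in>S. v + w \<in> S) \<and> (\<forall>c. \<forall>v\<in>S. c \<cdot>\<^sub>v v \<in> S)"
  unfolding submodule_def using module_axioms
  by (auto simp: module_vec_simps class_ring_simps)
 finally show ?thesis .
qed

lemma subspaceD:
 assumes "is_subspace n S"
 shows "v \<in> S \<Longrightarrow> v \<in> carrier_vec n" "0\<^sub>v n \<in> S" "v \<in> S \<Longrightarrow> w \<in> S \<Longrightarrow> v + w \<in> S" "v \<in> S \<Longrightarrow> c \<cdot>\<^sub>v v \<in> S"
 using assms unfolding is_subspace_iff by auto

lemma kernel_subspace: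
 assumes "\<And>A. A \<in> \<A> \<Longrightarrow> \<exists>r. A \<in> carrier_mat r n"
 shows "is_subspace n {w \<in> carrier_vec n. \<forall>A\<in>\<A>. A * vec_mat w = 0\<^sub>m (dim_row A) 1}"
 unfolding is_subspace_iff
proof (intro conjI ballI allI)
 let ?S = "{w \<in> carrier_vec n. \<forall>A\<in>\<A>. A * vec_mat w = 0\<^sub>m (dim_row A) 1}"
 show "?S \<subseteq> carrier_vec n" by blast
 have z: "vec_mat (0\<^sub>v n) = 0\<^sub>m n 1" using vec_mat_zero[of "0\<^sub>v n" n] by simp
 have "A * vec_mat (0\<^sub>v n) = 0\<^sub>m (dim_row A) 1" if "A \<in> \<A>" for A
  using assms[OF that] unfolding z by (auto intro: right_mult_zero_mat)
 then show "0\<^sub>v n \<in> ?S" by simp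
 fix v w assume v: "v \<in> ?S"
 show "v + w \<in> ?S" if w: "w \<in> ?S"
 proof -
  have "A * vec_mat (v + w) = 0\<^sub>m (dim_row A) 1" if A: "A \<in> \<A>" for A
  proof -
   obtain r where r: "A \<in> carrier_mat r n" using assms[OF A] by blast
   have "A * vec_mat (v + w) = A * vec_mat v + A * vec_mat w"
    using v w r mult_add_distrib_mat[of A r n "vec_mat v" 1 "vec_mat w"] by (simp add: vec_mat_add[of _ n])
   also have "\<dots> = 0\<^sub>m (dim_row A) 1" using v w A by simp
   finally show ?thesis .
  qed
  then show ?thesis using v w by simp
 qed
 fix c
 have "A * vec_mat (c \<cdot>\<^sub>v v) = 0\<^sub>m (dim_row A) 1" if A: "A \<in> \<A>" for A
 proof -
  obtain r where r: "A \<in> carrier_mat r n" using assms[OF A] by blast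
  have "A * vec_mat (c \<cdot>\<^sub>v v) = c \<cdot>\<^sub>m (A * vec_mat v)"
   using v r by (simp add: vec_mat_smult mult_smult_distrib[of _ r n _ 1])
  then show ?thesis using v A by simp
 qed
 then show "c \<cdot>\<^sub>v v \<in> ?S" using v by simp
qed

lemma proper_subspace_annihilator:
 assumes S: "is_subspace n S" and proper: "S \<noteq> carrier_vec n"
 shows "\<exists>l\<in>carrier_mat 1 n. l \<noteq> 0\<^sub>m 1 n \<and> (\<forall>w\<in>S. l * vec_mat w = 0\<^sub>m 1 1)"
proof -
 note S' = subspaceD[OF S]
 let ?ind = "\<lambda>r w. \<forall>c. (\<forall>i<n. (\<Sum>j<r. c j * w j $ i) = 0) \<longrightarrow> (\<forall>j<r. c j = (0::complex))"
 let ?P = "\<lambda>r. \<exists>w :: nat \<Rightarrow> complex vec. (\<forall>j<r. w j \<in> S) \<and> ?ind r w"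
 have bound: "r \<le> n" if P: "?P r" for r
 proof (rule ccontr)
  assume "\<not> r \<le> n"
  obtain w :: "nat \<Rightarrow> complex vec" where w: "?ind r w" using P by (elim exE conjE)
  from linear_relation[of "{..<n}" "{..<r}" "\<lambda>j i. w j $ i"] \<open>\<not> r \<le> n\<close>
  obtain c where "\<exists>j\<in>{..<r}. c j \<noteq> 0" "\<forall>i\<in>{..<n}. (\<Sum>j\<in>{..<r}. c j * w j $ i) = 0" by auto
  moreover from this(2) have "\<forall>j<r. c j = 0" by (intro mp[OF spec[OF w]]) simp
  ultimately show False by simp
 qed
 have "?P 0" by simp
 moreover have "\<forall>r. ?P r \<longrightarrow> r < Suc n" using bound by (intro allI impI) (simp add: less_Suc_eq_le)
 ultimately have "\<exists>r. ?P r \<and> (\<forall>r'. ?P r' \<longrightarrow> r' \<le> r)" by (rule ex_has_greatest_nat)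
 then obtain r where r': "?P r \<and> (\<forall>r'. ?P r' \<longrightarrow> r' \<le> r)" ..
 note r = conjunct1[OF r'] and max' = conjunct2[OF r']
 have max: "r' \<le> r" if "?P r'" for r' by (rule mp[OF spec[OF max'] that])
 obtain w where wS: "\<forall>j<r. w j \<in> S" and ind: "?ind r w" using r by (elim exE conjE)
 then have w: "\<And>j. j < r \<Longrightarrow> w j \<in> S" by blast
 have dep: "\<exists>c. \<forall>i<n. v $ i = (\<Sum>j<r. c j * w j $ i)" if v: "v \<in> S" for v
 proof -
  let ?w = "w(r := v)"
  have "\<not> ?ind (Suc r) ?w"
  proof
   assume "?ind (Suc r) ?w"
   moreover have "\<forall>j<Suc r. ?w j \<in> S" using w v by (auto simp: less_Suc_eq)
   ultimately have "Suc r \<le> r" by (intro max exI[of _ ?w] conjI)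
   then show False by simp
  qed
  then have "\<exists>c. (\<forall>i<n. (\<Sum>j<Suc r. c j * ?w j $ i) = 0) \<and> \<not> (\<forall>j<Suc r. c j = 0)"
   unfolding not_all not_imp .
  then obtain c where c': "(\<forall>i<n. (\<Sum>j<Suc r. c j * ?w j $ i) = 0) \<and> \<not> (\<forall>j<Suc r. c j = 0)" ..
  note c = conjunct1[OF c'] conjunct2[OF c']
  have c1: "(\<Sum>j<r. c j * w j $ i) + c r * v $ i = 0" if "i < n" for i
   using c(1) that by simp
  have "c r \<noteq> 0"
  proof
   assume "c r = 0"
   then have "\<forall>i<n. (\<Sum>j<r. c j * w j $ i) = 0" using c1 by simp
   then have "\<forall>j<r. c j = 0" by (rule mp[OF spec[OF ind]])
   with c(2) \<open>c r = 0\<close> show False by (auto simp: less_Suc_eq)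
  qed
  have "v $ i = (\<Sum>j<r. (- c j / c r) * w j $ i)" if "i < n" for i
  proof -
   have "(\<Sum>j<r. (- c j / c r) * w j $ i) = - (\<Sum>j<r. c j * w j $ i) / c r"
    by (simp add: sum_divide_distrib sum_negf)
   also have "\<dots> = v $ i" using c1[OF that] \<open>c r \<noteq> 0\<close> by (simp add: field_simps add_eq_0_iff)
   finally show ?thesis by simp
  qed
  then show ?thesis by (intro exI[of _ "\<lambda>j. - c j / c r"]) blast
 qed
 define W where "W = mat n n (\<lambda>(i, j). if i < r then w i $ j else 0)"
 have W: "W \<in> carrier_mat n n" unfolding W_def by simp
 have rn: "r \<le> n" using bound[OF r] .
 have "det W = 0"
 proof (rule ccontr)
  assume d: "det W \<noteq> 0"
  have "r = n"
  proof (rule ccontr)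
   assume "r \<noteq> n"
   then have "r < n" using rn by simp
   have "row W (n - 1) = 0\<^sub>v n" unfolding W_def using \<open>r < n\<close> by (auto intro!: eq_vecI)
   then have "(W * inv_mat W) $$ (n - 1, n - 1) = 0"
    using W inv_mat(1)[OF W d] \<open>r < n\<close> by (subst index_mult_mat) auto
   then show False using inv_mat(2)[OF W d] \<open>r < n\<close> by simp
  qed
  have "carrier_vec n \<subseteq> S"
  proof
   fix v :: "complex vec" assume v: "v \<in> carrier_vec n"
   let ?c = "\<lambda>j. (transpose_mat (inv_mat W) *\<^sub>v v) $ j"
   let ?s = "\<lambda>k. finsum_vec TYPE(complex) n (\<lambda>j. ?c j \<cdot>\<^sub>v w j) {..<k}"
   have in_S: "?s k \<in> S" if "k \<le> n" for k
    using that
   proof (induction k)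
    case 0
    then show ?case using S'(2) by (simp add: finsum_vec_empty)
   next
    case (Suc k)
    have wc: "(\<lambda>j. ?c j \<cdot>\<^sub>v w j) \<in> {..<k} \<rightarrow> carrier_vec n" using w \<open>r = n\<close> Suc.prems S'(1) by auto
    have wk: "?c k \<cdot>\<^sub>v w k \<in> S" using w[of k] \<open>r = n\<close> Suc.prems by (intro S'(4)) auto
    have "?s (Suc k) = ?c k \<cdot>\<^sub>v w k + ?s k"
     unfolding lessThan_Suc by (rule finsum_vec_insert[OF _ _ wc S'(1)[OF wk]]) auto
    then show ?case using S'(3)[OF wk] Suc by simp
   qed
   have wc: "(\<lambda>j. ?c j \<cdot>\<^sub>v w j) \<in> {..<n} \<rightarrow> carrier_vec n" using w \<open>r = n\<close> S'(1) by auto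
   have "v = ?s n"
   proof (rule eq_vecI)
    show "dim_vec v = dim_vec (?s n)" using v finsum_vec_closed[OF wc] by simp
    fix i assume "i < dim_vec (?s n)"
    then have i: "i < n" using finsum_vec_closed[OF wc] by simp
    have I: "inv_mat W \<in> carrier_mat n n" by (rule inv_mat(1)[OF W d])
    have "?s n $ i = (\<Sum>j<n. (?c j \<cdot>\<^sub>v w j) $ i)" by (rule index_finsum_vec[OF _ i wc]) simp
    also have "\<dots> = (\<Sum>j<n. W $$ (j, i) * ?c j)"
    proof (rule sum.cong[OF refl])
     fix j assume "j \<in> {..<n}"
     then have "w j \<in> carrier_vec n" "j < n" using w \<open>r = n\<close> S'(1) by auto
     then show "(?c j \<cdot>\<^sub>v w j) $ i = W $$ (j, i) * ?c j" unfolding W_def using i \<open>r = n\<close> by simp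
    qed
    also have "\<dots> = (transpose_mat W *\<^sub>v (transpose_mat (inv_mat W) *\<^sub>v v)) $ i"
     using W I i v by (simp add: scalar_prod_def atLeast0LessThan)
    also have "transpose_mat W *\<^sub>v (transpose_mat (inv_mat W) *\<^sub>v v) = (transpose_mat W * transpose_mat (inv_mat W)) *\<^sub>v v"
     using W I v by (subst assoc_mult_mat_vec[of _ n n _ n]) auto
    also have "transpose_mat W * transpose_mat (inv_mat W) = 1\<^sub>m n"
     using transpose_mult[OF I W] inv_mat(3)[OF W d] by simp
    also have "1\<^sub>m n *\<^sub>v v = v" using v by simp
    finally show "v $ i = ?s n $ i" by simp
   qed
   then show "v \<in> S" using in_S[of n] by simp
  qed
  then show False using proper S'(1) by blast
 qed
 then obtain v where v: "v \<in> carrier_vec n" "v \<noteq> 0\<^sub>v n" "W *\<^sub>v v = 0\<^sub>v n"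
  using det_0_iff_vec_prod_zero[OF W] by blast
 let ?l = "transpose_mat (vec_mat v)"
 have wv: "(\<Sum>i<n. v $ i * w j $ i) = 0" if "j < r" for j
 proof -
  have "(W *\<^sub>v v) $ j = (\<Sum>i<n. W $$ (j, i) * v $ i)"
   using W v(1) that rn by (simp add: scalar_prod_def atLeast0LessThan)
  also have "\<dots> = (\<Sum>i<n. v $ i * w j $ i)"
   by (rule sum.cong) (use that rn in \<open>auto simp: W_def\<close>)
  finally show ?thesis using v(3) that rn by simp
 qed
 have "?l * vec_mat z = 0\<^sub>m 1 1" if z: "z \<in> S" for z
 proof -
  obtain c where c: "\<forall>i<n. z $ i = (\<Sum>j<r. c j * w j $ i)" using dep[OF z] by blast
  have zc: "dim_vec z = n" using S'(1)[OF z] by simp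
  have "(\<Sum>i<n. v $ i * z $ i) = (\<Sum>i<n. \<Sum>j<r. c j * (v $ i * w j $ i))"
   using c by (simp add: sum_distrib_left mult_ac)
  also have "\<dots> = (\<Sum>j<r. c j * (\<Sum>i<n. v $ i * w j $ i))"
   unfolding sum_distrib_left by (rule sum.swap)
  also have "\<dots> = 0" using wv by simp
  finally have 0: "(\<Sum>i<n. v $ i * z $ i) = 0" .
  show ?thesis
   by (rule eq_matI) (use 0 v(1) zc in \<open>auto simp: scalar_prod_def atLeast0LessThan vec_mat_def\<close>)
 qed
 moreover have "?l \<in> carrier_mat 1 n" using v(1) by simp
 moreover have "?l \<noteq> 0\<^sub>m 1 n"
 proof
  assume "?l = 0\<^sub>m 1 n"
  then have "transpose_mat ?l = transpose_mat (0\<^sub>m 1 n)" by simp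
  also have "\<dots> = 0\<^sub>m n 1" by (rule eq_matI) auto
  finally show False using v(1,2) vec_mat_zero[OF v(1)] by simp
 qed
 ultimately show ?thesis by blast
qed

definition quint_space :: "nat \<Rightarrow> nat \<Rightarrow> quintuple set" where
 "quint_space n m = carrier_mat n m \<times> carrier_mat n n \<times> carrier_mat m m \<times> carrier_mat n 1 \<times> carrier_mat 1 m"

fun moment_eq :: "nat \<Rightarrow> nat \<Rightarrow> quintuple \<Rightarrow> bool" where
 "moment_eq n m (x, y1, y2, v, u) \<longleftrightarrow> y1 * x - x * y2 + v * u = 0\<^sub>m n m"

text \<open>The first stability condition, dually: no nonzero covector annihilates the subspace generated by
 the images of \<open>x\<close> and \<open>v\<close> under \<open>y1\<close>.\<close>

fun generating :: "nat \<Rightarrow> nat \<Rightarrow> quintuple \<Rightarrow> bool" where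
 "generating n m (x, y1, y2, v, u) \<longleftrightarrow> (\<forall>l\<in>carrier_mat 1 n.
   (\<forall>k. l * (y1 ^\<^sub>m k * x) = 0\<^sub>m 1 m \<and> l * (y1 ^\<^sub>m k * v) = 0\<^sub>m 1 1) \<longrightarrow> l = 0\<^sub>m 1 n)"

text \<open>The largest \<open>y2\<close>-invariant subspace of the kernels of \<open>x\<close> and
 \<open>u\<close> is zero.\<close>

fun cogenerating :: "nat \<Rightarrow> nat \<Rightarrow> quintuple \<Rightarrow> bool" where
 "cogenerating n m (x, y1, y2, v, u) \<longleftrightarrow> (\<forall>s\<in>carrier_mat m 1.
   (\<forall>k. x * (y2 ^\<^sub>m k * s) = 0\<^sub>m n 1 \<and> u * (y2 ^\<^sub>m k * s) = 0\<^sub>m 1 1) \<longrightarrow> s = 0\<^sub>m m 1)"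

lemma generating_iff:
 assumes x: "x \<in> carrier_mat n m" and y: "y1 \<in> carrier_mat n n" and v: "v \<in> carrier_mat n 1"
 shows "generating n m (x, y1, y2, v, u) \<longleftrightarrow>
  \<not> (\<exists>S. is_subspace n S \<and> S \<noteq> carrier_vec n \<and> (\<forall>w\<in>S. y1 *\<^sub>v w \<in> S) \<and>
    {w + w' | w w'. w \<in> mat_image x \<and> w' \<in> mat_image v} \<subseteq> S)" (is "_ \<longleftrightarrow> \<not> (\<exists>S. ?bad S)")
proof
 assume gen: "generating n m (x, y1, y2, v, u)"
 show "\<not> (\<exists>S. ?bad S)"
 proof
  assume "\<exists>S. ?bad S"
  then obtain S where S: "is_subspace n S" "S \<noteq> carrier_vec n" and inv: "\<And>w. w \<in> S \<Longrightarrow> y1 *\<^sub>v w \<in> S"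
   and im: "\<And>w w'. w \<in> mat_image x \<Longrightarrow> w' \<in> mat_image v \<Longrightarrow> w + w' \<in> S" by blast
  note S' = subspaceD[OF S(1)]
  obtain l where l: "l \<in> carrier_mat 1 n" "l \<noteq> 0\<^sub>m 1 n" "\<And>w. w \<in> S \<Longrightarrow> l * vec_mat w = 0\<^sub>m 1 1"
   using proper_subspace_annihilator[OF S] by blast
  have invk: "(y1 ^\<^sub>m k) *\<^sub>v w \<in> S" if "w \<in> S" for k w
   using that
  proof (induction k arbitrary: w)
   case 0
   then show ?case using y S'(1) by simp
  next
   case (Suc k)
   have "(y1 ^\<^sub>m Suc k) *\<^sub>v w = (y1 ^\<^sub>m k) *\<^sub>v (y1 *\<^sub>v w)"
    using y S'(1)[OF Suc.prems] by (simp add: assoc_mult_mat_vec[of _ n n _ n])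
   then show ?case using Suc.IH[OF inv[OF Suc.prems]] by simp
  qed
  have x0: "x *\<^sub>v c \<in> S" if c: "c \<in> carrier_vec m" for c
  proof -
   have "x *\<^sub>v c + v *\<^sub>v 0\<^sub>v 1 \<in> S" by (rule im) (use c x v in \<open>auto simp: mat_image_def\<close>)
   moreover have "v *\<^sub>v 0\<^sub>v 1 = 0\<^sub>v n" using v by (auto intro!: eq_vecI)
   ultimately show ?thesis using x c by simp
  qed
  have v0: "v *\<^sub>v c \<in> S" if c: "c \<in> carrier_vec 1" for c
  proof -
   have "x *\<^sub>v 0\<^sub>v m + v *\<^sub>v c \<in> S" by (rule im) (use c x v in \<open>auto simp: mat_image_def\<close>)
   moreover have "x *\<^sub>v 0\<^sub>v m = 0\<^sub>v n" using x by (auto intro!: eq_vecI)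
   ultimately show ?thesis using v c by simp
  qed
  have kill: "l * (y1 ^\<^sub>m k * A) = 0\<^sub>m 1 c"
   if A: "A \<in> carrier_mat n c" and AS: "\<And>w. w \<in> carrier_vec c \<Longrightarrow> A *\<^sub>v w \<in> S" for A c k
  proof (rule eq_matI)
   fix i j assume ij: "i < dim_row (0\<^sub>m 1 c :: complex mat)" "j < dim_col (0\<^sub>m 1 c :: complex mat)"
   have yk: "y1 ^\<^sub>m k \<in> carrier_mat n n" using y by simp
   have "(y1 ^\<^sub>m k) *\<^sub>v (A *\<^sub>v unit_vec c j) \<in> S" by (intro invk AS) simp
   from l(3)[OF this] have "l * (y1 ^\<^sub>m k * (A * vec_mat (unit_vec c j))) = 0\<^sub>m 1 1"
    using yk A by (simp add: vec_mat_mult[of _ n n] vec_mat_mult[of _ n c])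
   then have "(l * (y1 ^\<^sub>m k * A)) * vec_mat (unit_vec c j) = 0\<^sub>m 1 1"
    using l(1) yk y A by (simp add: mat_assoc)
   then have "((l * (y1 ^\<^sub>m k * A)) * vec_mat (unit_vec c j)) $$ (0, 0) = 0" by simp
   moreover have "((l * (y1 ^\<^sub>m k * A)) * vec_mat (unit_vec c j)) $$ (0, 0) = (l * (y1 ^\<^sub>m k * A)) $$ (0, j)"
    using l(1) A ij by (subst mult_mat_entry) (auto simp: if_distrib[of "\<lambda>t. _ * t"] sum.delta cong: if_cong)
   ultimately show "(l * (y1 ^\<^sub>m k * A)) $$ (i, j) = 0\<^sub>m 1 c $$ (i, j)" using ij by simp
  qed (use l(1) A in auto)
  have "l = 0\<^sub>m 1 n" using gen l(1) kill[OF x x0] kill[OF v v0] by simp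
  with l(2) show False by simp
 qed
next
 assume no: "\<not> (\<exists>S. ?bad S)"
 show "generating n m (x, y1, y2, v, u)"
  unfolding generating.simps
 proof (intro ballI impI)
  fix l :: "complex mat" assume l: "l \<in> carrier_mat 1 n"
   and kill: "\<forall>k. l * (y1 ^\<^sub>m k * x) = 0\<^sub>m 1 m \<and> l * (y1 ^\<^sub>m k * v) = 0\<^sub>m 1 1"
  let ?S = "{w \<in> carrier_vec n. \<forall>A\<in>range (\<lambda>k. l * y1 ^\<^sub>m k). A * vec_mat w = 0\<^sub>m (dim_row A) 1}"
  have yk: "y1 ^\<^sub>m k \<in> carrier_mat n n" for k using y by simp
  have lk: "l * y1 ^\<^sub>m k \<in> carrier_mat 1 n" for k using l yk by simp
  have mem: "w \<in> ?S \<longleftrightarrow> w \<in> carrier_vec n \<and> (\<forall>k. l * y1 ^\<^sub>m k * vec_mat w = 0\<^sub>m 1 1)" for w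
   using l by auto
  have sub: "is_subspace n ?S" by (rule kernel_subspace) (use lk in blast)
  have inv: "y1 *\<^sub>v w \<in> ?S" if "w \<in> ?S" for w
  proof -
   have w: "w \<in> carrier_vec n" "\<And>k. l * y1 ^\<^sub>m k * vec_mat w = 0\<^sub>m 1 1" using that mem by auto
   have "l * y1 ^\<^sub>m k * vec_mat (y1 *\<^sub>v w) = 0\<^sub>m 1 1" for k
   proof -
    have "l * y1 ^\<^sub>m k * vec_mat (y1 *\<^sub>v w) = l * y1 ^\<^sub>m Suc k * vec_mat w"
     using l yk y w(1) by (simp add: vec_mat_mult[of _ n n] mat_assoc)
    also have "\<dots> = 0\<^sub>m 1 1" by (rule w(2))
    finally show ?thesis .
   qed
   then show ?thesis using mem y w(1) by simp
  qed
  have im: "w + w' \<in> ?S" if ww: "w \<in> mat_image x" "w' \<in> mat_image v" for w w'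
  proof -
   have dc: "dim_col x = m" "dim_col v = 1" using x v by auto
   obtain c c' where c: "c \<in> carrier_vec m" "w = x *\<^sub>v c" and c': "c' \<in> carrier_vec 1" "w' = v *\<^sub>v c'"
    using ww unfolding mat_image_def dc by blast
   have "l * y1 ^\<^sub>m k * vec_mat w = 0\<^sub>m 1 1" for k
   proof -
    have "l * y1 ^\<^sub>m k * vec_mat w = (l * (y1 ^\<^sub>m k * x)) * vec_mat c"
     unfolding c(2) using l yk y x c(1) by (simp add: vec_mat_mult[of _ n m] mat_assoc)
    then show ?thesis using kill c(1) by simp
   qed
   moreover have "l * y1 ^\<^sub>m k * vec_mat w' = 0\<^sub>m 1 1" for k
   proof -
    have "l * y1 ^\<^sub>m k * vec_mat w' = (l * (y1 ^\<^sub>m k * v)) * vec_mat c'"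
     unfolding c'(2) using l yk y v c'(1) by (simp add: vec_mat_mult[of _ n 1] mat_assoc)
    then show ?thesis using kill c'(1) by simp
   qed
   ultimately have "w \<in> ?S" "w' \<in> ?S" using mem c c' x v by auto
   then show ?thesis by (rule subspaceD(3)[OF sub])
  qed
  have full: "?S = carrier_vec n"
  proof (rule ccontr)
   assume ne: "?S \<noteq> carrier_vec n"
   have "{w + w' | w w'. w \<in> mat_image x \<and> w' \<in> mat_image v} \<subseteq> ?S"
   proof
    fix t assume "t \<in> {w + w' | w w'. w \<in> mat_image x \<and> w' \<in> mat_image v}"
    then obtain w w' where "w \<in> mat_image x" "w' \<in> mat_image v" "t = w + w'" by blast
    then show "t \<in> ?S" using im by simp
   qed
   then have bad: "?bad ?S" by (intro conjI ballI sub ne inv)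
   have "\<exists>S. ?bad S" by (rule exI[of _ ?S]) (rule bad)
   then show False by (rule notE[OF no])
  qed
  show "l = 0\<^sub>m 1 n"
  proof (rule eq_matI)
   fix i j assume ij: "i < dim_row (0\<^sub>m 1 n :: complex mat)" "j < dim_col (0\<^sub>m 1 n :: complex mat)"
   have "unit_vec n j \<in> ?S" unfolding full by simp
   then have "l * y1 ^\<^sub>m 0 * vec_mat (unit_vec n j) = 0\<^sub>m 1 1" using mem by blast
   then have "(l * vec_mat (unit_vec n j)) $$ (0, 0) = 0" using l y by simp
   moreover have "(l * vec_mat (unit_vec n j)) $$ (0, 0) = l $$ (0, j)"
    using l ij by (subst mult_mat_entry) (auto simp: if_distrib[of "\<lambda>t. _ * t"] sum.delta cong: if_cong)
   ultimately show "l $$ (i, j) = 0\<^sub>m 1 n $$ (i, j)" using ij by simp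
  qed (use l in auto)
 qed
qed

lemma cogenerating_iff:
 assumes x: "x \<in> carrier_mat n m" and y: "y2 \<in> carrier_mat m m" and u: "u \<in> carrier_mat 1 m"
 shows "cogenerating n m (x, y1, y2, v, u) \<longleftrightarrow>
  \<not> (\<exists>S. is_subspace m S \<and> S \<noteq> {0\<^sub>v m} \<and> (\<forall>w\<in>S. y2 *\<^sub>v w \<in> S) \<and>
    S \<subseteq> mat_kernel x \<inter> mat_kernel u)" (is "_ \<longleftrightarrow> \<not> (\<exists>S. ?bad S)")
proof -
 have yk: "y2 ^\<^sub>m k \<in> carrier_mat m m" for k using y by simp
 have kx: "w \<in> mat_kernel x \<longleftrightarrow> w \<in> carrier_vec m \<and> x * vec_mat w = 0\<^sub>m n 1" for w
  using x vec_mat_zero[of "x *\<^sub>v w" n] vec_mat_mult[OF x, of w] unfolding mat_kernel_def by auto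
 have ku: "w \<in> mat_kernel u \<longleftrightarrow> w \<in> carrier_vec m \<and> u * vec_mat w = 0\<^sub>m 1 1" for w
  using u vec_mat_zero[of "u *\<^sub>v w" 1] vec_mat_mult[OF u, of w] unfolding mat_kernel_def by auto
 show ?thesis
 proof
  assume cog: "cogenerating n m (x, y1, y2, v, u)"
  show "\<not> (\<exists>S. ?bad S)"
  proof
   assume "\<exists>S. ?bad S"
   then obtain S where S: "is_subspace m S" "S \<noteq> {0\<^sub>v m}" and inv: "\<And>w. w \<in> S \<Longrightarrow> y2 *\<^sub>v w \<in> S"
    and ker: "S \<subseteq> mat_kernel x \<inter> mat_kernel u" by blast
   note S' = subspaceD[OF S(1)]
   obtain w where w: "w \<in> S" "w \<noteq> 0\<^sub>v m" using S(2) S'(2) by blast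
   have invk: "(y2 ^\<^sub>m k) *\<^sub>v w \<in> S" if "w \<in> S" for k w
    using that
   proof (induction k arbitrary: w)
    case 0
    then show ?case using y S'(1) by simp
   next
    case (Suc k)
    have "(y2 ^\<^sub>m Suc k) *\<^sub>v w = (y2 ^\<^sub>m k) *\<^sub>v (y2 *\<^sub>v w)"
     using y S'(1)[OF Suc.prems] by (simp add: assoc_mult_mat_vec[of _ m m _ m])
    then show ?case using Suc.IH[OF inv[OF Suc.prems]] by simp
   qed
   have wc: "w \<in> carrier_vec m" using S'(1)[OF w(1)] .
   have "x * (y2 ^\<^sub>m k * vec_mat w) = 0\<^sub>m n 1 \<and> u * (y2 ^\<^sub>m k * vec_mat w) = 0\<^sub>m 1 1" for k
    using invk[OF w(1), of k] ker kx ku wc yk by (auto simp: vec_mat_mult[of _ m m])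
   then have "vec_mat w = 0\<^sub>m m 1"
    using cog vec_mat_carrier(1)[OF wc] unfolding cogenerating.simps by blast
   then show False using vec_mat_zero[OF wc] w(2) by simp
  qed
 next
  assume no: "\<not> (\<exists>S. ?bad S)"
  show "cogenerating n m (x, y1, y2, v, u)"
   unfolding cogenerating.simps
  proof (intro ballI impI)
   fix s :: "complex mat" assume s: "s \<in> carrier_mat m 1"
    and kill: "\<forall>k. x * (y2 ^\<^sub>m k * s) = 0\<^sub>m n 1 \<and> u * (y2 ^\<^sub>m k * s) = 0\<^sub>m 1 1"
   let ?A = "range (\<lambda>k. x * y2 ^\<^sub>m k) \<union> range (\<lambda>k. u * y2 ^\<^sub>m k)"
   let ?S = "{w \<in> carrier_vec m. \<forall>A\<in>?A. A * vec_mat w = 0\<^sub>m (dim_row A) 1}"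
   have xk: "x * y2 ^\<^sub>m k \<in> carrier_mat n m" "u * y2 ^\<^sub>m k \<in> carrier_mat 1 m" for k using x u yk by auto
   have mem: "w \<in> ?S \<longleftrightarrow> w \<in> carrier_vec m \<and>
     (\<forall>k. x * y2 ^\<^sub>m k * vec_mat w = 0\<^sub>m n 1 \<and> u * y2 ^\<^sub>m k * vec_mat w = 0\<^sub>m 1 1)" for w
    using x u by auto
   have sub: "is_subspace m ?S" by (rule kernel_subspace) (use xk in blast)
   have inv: "y2 *\<^sub>v w \<in> ?S" if "w \<in> ?S" for w
   proof -
    have w: "w \<in> carrier_vec m" "\<And>k. x * y2 ^\<^sub>m k * vec_mat w = 0\<^sub>m n 1" "\<And>k. u * y2 ^\<^sub>m k * vec_mat w = 0\<^sub>m 1 1"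
     using that mem by auto
    have eqs: "x * y2 ^\<^sub>m k * vec_mat (y2 *\<^sub>v w) = x * y2 ^\<^sub>m Suc k * vec_mat w"
     "u * y2 ^\<^sub>m k * vec_mat (y2 *\<^sub>v w) = u * y2 ^\<^sub>m Suc k * vec_mat w" for k
      using x u yk y w(1) by (simp_all add: vec_mat_mult[of _ m m] mat_assoc)
    have "x * y2 ^\<^sub>m k * vec_mat (y2 *\<^sub>v w) = 0\<^sub>m n 1 \<and> u * y2 ^\<^sub>m k * vec_mat (y2 *\<^sub>v w) = 0\<^sub>m 1 1" for k
     unfolding eqs by (rule conjI[OF w(2)[of "Suc k"] w(3)[of "Suc k"]])
    then show ?thesis using mem y w(1) by simp
   qed
   have ker: "?S \<subseteq> mat_kernel x \<inter> mat_kernel u"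
   proof
    fix w assume "w \<in> ?S"
    then have w: "w \<in> carrier_vec m" "x * y2 ^\<^sub>m 0 * vec_mat w = 0\<^sub>m n 1" "u * y2 ^\<^sub>m 0 * vec_mat w = 0\<^sub>m 1 1"
     using mem by blast+
    have "x * vec_mat w = 0\<^sub>m n 1" "u * vec_mat w = 0\<^sub>m 1 1" using w(2,3) x u y by simp_all
    then show "w \<in> mat_kernel x \<inter> mat_kernel u" unfolding Int_iff kx ku using w(1) by blast
   qed
   have S0: "?S = {0\<^sub>v m}"
   proof (rule ccontr)
    assume ne: "?S \<noteq> {0\<^sub>v m}"
    have bad: "?bad ?S" by (intro conjI ballI sub ne inv ker)
    have "\<exists>S. ?bad S" by (rule exI[of _ ?S]) (rule bad)
    then show False by (rule notE[OF no])
   qed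
   obtain w where w: "w \<in> carrier_vec m" "s = vec_mat w" using vec_mat_surj[OF s] by blast
   have "x * y2 ^\<^sub>m k * vec_mat w = 0\<^sub>m n 1 \<and> u * y2 ^\<^sub>m k * vec_mat w = 0\<^sub>m 1 1" for k
   proof -
    have "x * y2 ^\<^sub>m k * vec_mat w = x * (y2 ^\<^sub>m k * s)" "u * y2 ^\<^sub>m k * vec_mat w = u * (y2 ^\<^sub>m k * s)"
     unfolding w(2) using x u yk y w(1) by (simp_all add: mat_assoc)
    then show ?thesis using kill by simp
   qed
   then have "w \<in> ?S" using mem w(1) by blast
   then have "w = 0\<^sub>v m" unfolding S0 by (rule singletonD)
   then show "s = 0\<^sub>m m 1" using vec_mat_zero[OF w(1)] w(2) by simp
  qed
 qed
qed

lemma triangle_points_iff: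
 "z \<in> triangle_points m n \<longleftrightarrow> z \<in> quint_space n m \<and> moment_eq n m z \<and> generating n m z \<and> cogenerating n m z"
proof (cases z)
 case (fields x y1 y2 v u)
 have c: "(x, y1, y2, v, u) \<in> quint_space n m \<longleftrightarrow> x \<in> carrier_mat n m \<and> y1 \<in> carrier_mat n n \<and>
   y2 \<in> carrier_mat m m \<and> v \<in> carrier_mat n 1 \<and> u \<in> carrier_mat 1 m"
  unfolding quint_space_def by simp
 show ?thesis
 proof (cases "(x, y1, y2, v, u) \<in> quint_space n m")
  case True
  then have x: "x \<in> carrier_mat n m" and y1: "y1 \<in> carrier_mat n n" and y2: "y2 \<in> carrier_mat m m"
   and v: "v \<in> carrier_mat n 1" and u: "u \<in> carrier_mat 1 m" unfolding c by simp_all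
  show ?thesis
   unfolding fields triangle_points_def mem_Collect_eq prod.case moment_eq.simps
    generating_iff[OF x y1 v] cogenerating_iff[OF x y2 u] c by satx
 next
  case False
  then show ?thesis unfolding fields triangle_points_def mem_Collect_eq prod.case c by satx
 qed
qed

section \<open>Companion matrices and Krylov matrices\<close>

text \<open>Companion matrices by their shape; the last column is arbitrary.\<close>

definition companions :: "nat \<Rightarrow> complex mat set" where
 "companions n = {a \<in> carrier_mat n n. \<forall>i<n. \<forall>j<n - 1. a $$ (i, j) = (if i = Suc j then 1 else 0)}"

text \<open>The coefficients of the polynomial of which \<open>a\<close> is the companion matrix, including
 the leading one.\<close>

definition ccoeff :: "nat \<Rightarrow> complex mat \<Rightarrow> nat \<Rightarrow> complex" where
 "ccoeff n a k = (if k < n then - a $$ (k, n - 1) else if k = n then 1 else 0)"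

lemma companions_carrier: "a \<in> companions n \<Longrightarrow> a \<in> carrier_mat n n"
 unfolding companions_def by simp

lemma companion_mat_companions: "companion_mat n p \<in> companions n"
 unfolding companions_def companion_mat_def by auto

lemma coeff_companion:
 assumes "0 < n" "p \<in> monic_polys n"
 shows "coeff p k = ccoeff n (companion_mat n p) k"
 using assms unfolding ccoeff_def companion_mat_def monic_polys_def by (auto simp: coeff_eq_0)

lemma inj_companion_mat: "0 < n \<Longrightarrow> inj_on (companion_mat n) (monic_polys n)"
 by (rule inj_onI) (metis coeff_companion poly_eqI)

lemma companion_space_eq:
 assumes n: "0 < n"
 shows "companion_space n = companions n"
proof (intro equalityI subsetI)
 fix a assume "a \<in> companion_space n"
 then show "a \<in> companions n" unfolding companion_space_def using companion_mat_companions by auto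
next
 fix a assume a: "a \<in> companions n"
 define p where "p = (\<Sum>k\<le>n. monom (ccoeff n a k) k)"
 have c: "coeff p k = ccoeff n a k" for k
  unfolding p_def by (simp add: coeff_sum) (simp add: ccoeff_def)
 have "degree p \<le> n" by (rule degree_le) (simp add: c ccoeff_def)
 moreover have "coeff p n = 1" by (simp add: c ccoeff_def)
 ultimately have "degree p = n" using le_degree[of p n] by simp
 then have "p \<in> monic_polys n" unfolding monic_polys_def using \<open>coeff p n = 1\<close> by simp
 moreover have "a = companion_mat n p"
  by (rule eq_matI) (use a in \<open>auto simp: companion_mat_def companions_def c ccoeff_def\<close>)
 ultimately show "a \<in> companion_space n" unfolding companion_space_def by blast
qed

lemma poly_of_companion:
 assumes n: "0 < n" and a: "a \<in> companions n"
 shows "coeff (poly_of_companion n a) k = ccoeff n a k" "degree (poly_of_companion n a) = n"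
proof -
 obtain p where p: "p \<in> monic_polys n" "a = companion_mat n p"
  using a companion_space_eq[OF n] unfolding companion_space_def by blast
 have "poly_of_companion n a = p"
  unfolding poly_of_companion_def p(2) by (rule the_inv_into_f_f[OF inj_companion_mat[OF n] p(1)])
 then show "coeff (poly_of_companion n a) k = ccoeff n a k" "degree (poly_of_companion n a) = n"
  using coeff_companion[OF n p(1)] p unfolding monic_polys_def by auto
qed

text \<open>The value at \<open>b\<close> of the characteristic polynomial of the companion matrix
 \<open>a\<close>.\<close>

definition eval_char :: "nat \<Rightarrow> complex mat \<Rightarrow> nat \<Rightarrow> complex mat \<Rightarrow> complex mat" where
 "eval_char n a m b = mat m m (\<lambda>(i, j). \<Sum>k\<le>n. ccoeff n a k * (b ^\<^sub>m k) $$ (i, j))"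

lemma eval_char_carrier [simp]: "eval_char n a m b \<in> carrier_mat m m"
 "dim_row (eval_char n a m b) = m" "dim_col (eval_char n a m b) = m"
 unfolding eval_char_def by simp_all

lemma eval_poly_mat_companion:
 "0 < n \<Longrightarrow> a \<in> companions n \<Longrightarrow> eval_poly_mat m (poly_of_companion n a) b = eval_char n a m b"
 unfolding eval_poly_mat_def eval_char_def by (simp add: poly_of_companion)

lemma eval_char_intertwine:
 assumes A: "A \<in> carrier_mat r r" and g: "g \<in> carrier_mat r s" and C: "C \<in> carrier_mat s s"
  and eq: "A * g = g * C"
 shows "eval_char n a r A * g = g * eval_char n a s C"
proof (rule eq_matI)
 fix i j assume "i < dim_row (g * eval_char n a s C)" "j < dim_col (g * eval_char n a s C)"
 then have ij: "i < r" "j < s" using g by auto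
 have "(eval_char n a r A * g) $$ (i, j) = (\<Sum>l<r. (\<Sum>k\<le>n. ccoeff n a k * (A ^\<^sub>m k) $$ (i, l)) * g $$ (l, j))"
  using g ij by (simp add: mult_mat_entry eval_char_def del: index_mult_mat)
 also have "\<dots> = (\<Sum>k\<le>n. ccoeff n a k * (\<Sum>l<r. (A ^\<^sub>m k) $$ (i, l) * g $$ (l, j)))"
  by (simp add: sum_distrib_right sum_distrib_left mult.assoc) (rule sum.swap)
 also have "\<dots> = (\<Sum>k\<le>n. ccoeff n a k * (A ^\<^sub>m k * g) $$ (i, j))"
  using A g ij by (simp add: mult_mat_entry del: index_mult_mat(1))
 also have "\<dots> = (\<Sum>k\<le>n. ccoeff n a k * (g * C ^\<^sub>m k) $$ (i, j))"
  by (simp add: pow_mat_intertwine[OF A g C eq])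
 also have "\<dots> = (\<Sum>k\<le>n. ccoeff n a k * (\<Sum>l<s. g $$ (i, l) * (C ^\<^sub>m k) $$ (l, j)))"
  using C g ij by (simp add: mult_mat_entry del: index_mult_mat(1))
 also have "\<dots> = (\<Sum>l<s. g $$ (i, l) * (\<Sum>k\<le>n. ccoeff n a k * (C ^\<^sub>m k) $$ (l, j)))"
  by (simp add: sum_distrib_left mult.left_commute) (rule sum.swap)
 also have "\<dots> = (g * eval_char n a s C) $$ (i, j)"
  using g ij by (simp add: mult_mat_entry eval_char_def del: index_mult_mat)
 finally show "(eval_char n a r A * g) $$ (i, j) = (g * eval_char n a s C) $$ (i, j)" .
qed (use g in auto)

lemma eval_char_transpose:
 assumes "b \<in> carrier_mat m m"
 shows "eval_char n a m (transpose_mat b) = transpose_mat (eval_char n a m b)"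
 by (rule eq_matI) (use assms in \<open>auto simp: eval_char_def transpose_pow_mat[OF assms, symmetric]\<close>)

definition first_unit :: "nat \<Rightarrow> complex mat" where
 "first_unit n = mat n 1 (\<lambda>(i, j). if i = 0 then 1 else 0)"

lemma first_unit_carrier [simp]: "first_unit n \<in> carrier_mat n 1" "first_unit n \<in> carrier_mat n (Suc 0)"
 "dim_row (first_unit n) = n" "dim_col (first_unit n) = 1"
 unfolding first_unit_def by simp_all

definition krylov :: "nat \<Rightarrow> complex mat \<Rightarrow> complex mat \<Rightarrow> complex mat" where
 "krylov n y v = mat n n (\<lambda>(i, j). (y ^\<^sub>m j * v) $$ (i, 0))"

lemma krylov_carrier [simp]: "krylov n y v \<in> carrier_mat n n"
 "dim_row (krylov n y v) = n" "dim_col (krylov n y v) = n"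
 unfolding krylov_def by simp_all

lemma krylov_entry: "i < n \<Longrightarrow> j < n \<Longrightarrow> krylov n y v $$ (i, j) = (y ^\<^sub>m j * v) $$ (i, 0)"
 unfolding krylov_def by simp

lemma krylov_intertwine:
 assumes A: "A \<in> carrier_mat n n" and g: "g \<in> carrier_mat n n" and C: "C \<in> carrier_mat n n"
  and v: "v \<in> carrier_mat n 1" and eq: "A * g = g * C"
 shows "krylov n A (g * v) = g * krylov n C v"
proof (rule eq_matI)
 fix i j assume "i < dim_row (g * krylov n C v)" "j < dim_col (g * krylov n C v)"
 then have ij: "i < n" "j < n" using g by auto
 have "A ^\<^sub>m j * (g * v) = (A ^\<^sub>m j * g) * v" using A g v by (simp add: mat_assoc)
 also have "\<dots> = g * (C ^\<^sub>m j * v)"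
  unfolding pow_mat_intertwine[OF A g C eq] using g C v by (simp add: mat_assoc)
 finally have "A ^\<^sub>m j * (g * v) = g * (C ^\<^sub>m j * v)" .
 then have "krylov n A (g * v) $$ (i, j) = (g * (C ^\<^sub>m j * v)) $$ (i, 0)"
  using ij by (simp add: krylov_entry)
 also have "\<dots> = (\<Sum>l<n. g $$ (i, l) * (C ^\<^sub>m j * v) $$ (l, 0))"
  using g C v ij by (subst mult_mat_entry) auto
 also have "\<dots> = (\<Sum>l<n. g $$ (i, l) * krylov n C v $$ (l, j))" using ij by (simp add: krylov_entry)
 also have "\<dots> = (g * krylov n C v) $$ (i, j)" using g ij by (subst mult_mat_entry) auto
 finally show "krylov n A (g * v) $$ (i, j) = (g * krylov n C v) $$ (i, j)" .
qed (use g in auto)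

lemma companion_mult_entry:
 assumes n: "0 < n" and a: "a \<in> companions n" and X: "X \<in> carrier_mat n r" and ij: "i < n" "j < r"
 shows "(a * X) $$ (i, j) = (if i = 0 then 0 else X $$ (i - 1, j)) - ccoeff n a i * X $$ (n - 1, j)"
proof -
 obtain n' where n': "n = Suc n'" using n by (cases n) auto
 have ac: "a \<in> carrier_mat n n" by (rule companions_carrier[OF a])
 have "(a * X) $$ (i, j) = (\<Sum>l<n'. a $$ (i, l) * X $$ (l, j)) + a $$ (i, n') * X $$ (n', j)"
  using ac X ij n' by (subst mult_mat_entry) auto
 also have "(\<Sum>l<n'. a $$ (i, l) * X $$ (l, j)) = (\<Sum>l<n'. if l = i - 1 then (if i = 0 then 0 else X $$ (i - 1, j)) else 0)"
  by (rule sum.cong[OF refl]) (use a ij n' in \<open>auto simp: companions_def\<close>)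
 also have "\<dots> = (if i = 0 then 0 else X $$ (i - 1, j))" using ij n' by (cases i) (auto simp: sum.delta)
 finally show ?thesis using ij n' by (simp add: ccoeff_def)
qed

lemma companion_pow_first_unit:
 assumes n: "0 < n" and a: "a \<in> companions n" and "j < n" "i < n"
 shows "(a ^\<^sub>m j * first_unit n) $$ (i, 0) = (if i = j then 1 else 0)"
 using assms(3,4)
proof (induction j arbitrary: i)
 case 0
 have "a ^\<^sub>m 0 * first_unit n = first_unit n" using companions_carrier[OF a] by simp
 then show ?case using 0 by (simp add: first_unit_def)
next
 case (Suc j)
 have ac: "a \<in> carrier_mat n n" by (rule companions_carrier[OF a])
 have "a ^\<^sub>m Suc j * first_unit n = a * (a ^\<^sub>m j * first_unit n)"
  using ac pow_mat_commute[OF ac, of j] by (simp add: mat_assoc)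
 moreover have "a ^\<^sub>m j * first_unit n \<in> carrier_mat n 1" using ac by (intro mult_carrier_mat[of _ n n]) auto
 ultimately have "(a ^\<^sub>m Suc j * first_unit n) $$ (i, 0) =
   (if i = 0 then 0 else (a ^\<^sub>m j * first_unit n) $$ (i - 1, 0)) - ccoeff n a i * (a ^\<^sub>m j * first_unit n) $$ (n - 1, 0)"
  using companion_mult_entry[OF n a _ Suc.prems(2), of "a ^\<^sub>m j * first_unit n" 1 0] by simp
 then show ?case using Suc by auto
qed

lemma krylov_companion:
 assumes n: "0 < n" and a: "a \<in> companions n"
 shows "krylov n a (first_unit n) = 1\<^sub>m n"
 by (rule eq_matI) (use companion_pow_first_unit[OF n a] in \<open>auto simp: krylov_entry\<close>)

text \<open>The columns \<open>y\<^sup>k v\<close> with \<open>k < n\<close> already span all of the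
 \<open>y\<^sup>k v\<close>.\<close>

lemma krylov_nonsingular_iff:
 assumes y: "y \<in> carrier_mat n n" and v: "v \<in> carrier_mat n 1"
 shows "det (krylov n y v) \<noteq> 0 \<longleftrightarrow> (\<forall>l\<in>carrier_mat 1 n. (\<forall>k. l * (y ^\<^sub>m k * v) = 0\<^sub>m 1 1) \<longrightarrow> l = 0\<^sub>m 1 n)"
proof
 let ?K = "krylov n y v"
 assume d: "det ?K \<noteq> 0"
 show "\<forall>l\<in>carrier_mat 1 n. (\<forall>k. l * (y ^\<^sub>m k * v) = 0\<^sub>m 1 1) \<longrightarrow> l = 0\<^sub>m 1 n"
 proof (intro ballI impI)
  fix l :: "complex mat" assume l: "l \<in> carrier_mat 1 n" and k: "\<forall>k. l * (y ^\<^sub>m k * v) = 0\<^sub>m 1 1"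
  note I = inv_mat[OF krylov_carrier(1) d]
  have "l * ?K = 0\<^sub>m 1 n"
  proof (rule eq_matI)
   fix i j assume "i < dim_row (0\<^sub>m 1 n :: complex mat)" "j < dim_col (0\<^sub>m 1 n :: complex mat)"
   then have ij: "i = 0" "j < n" by auto
   have "(l * ?K) $$ (0, j) = (\<Sum>i<n. l $$ (0, i) * (y ^\<^sub>m j * v) $$ (i, 0))"
    using l ij by (subst mult_mat_entry) (auto simp: krylov_entry)
   also have "\<dots> = (l * (y ^\<^sub>m j * v)) $$ (0, 0)" using l y v by (subst mult_mat_entry) auto
   also have "\<dots> = 0" using k by simp
   finally show "(l * ?K) $$ (i, j) = 0\<^sub>m 1 n $$ (i, j)" using ij by simp
  qed (use l in auto)
  then have "(l * ?K) * inv_mat ?K = 0\<^sub>m 1 n" using I(1) by simp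
  then show "l = 0\<^sub>m 1 n" using l I by (simp add: assoc_mult_mat[of l 1 n ?K n "inv_mat ?K" n])
 qed
next
 let ?K = "krylov n y v"
 assume R: "\<forall>l\<in>carrier_mat 1 n. (\<forall>k. l * (y ^\<^sub>m k * v) = 0\<^sub>m 1 1) \<longrightarrow> l = 0\<^sub>m 1 n"
 show "det ?K \<noteq> 0"
 proof
  assume d: "det ?K = 0"
  obtain c where c: "c \<in> carrier_vec n" "c \<noteq> 0\<^sub>v n" "?K *\<^sub>v c = 0\<^sub>v n"
   using det_0_iff_vec_prod_zero[OF krylov_carrier(1)] d by blast
  have "det (transpose_mat ?K) = 0" using det_transpose[OF krylov_carrier(1)] d by metis
  then obtain l where l: "l \<in> carrier_vec n" "l \<noteq> 0\<^sub>v n" "transpose_mat ?K *\<^sub>v l = 0\<^sub>v n"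
   using det_0_iff_vec_prod_zero[of "transpose_mat ?K" n] by auto
  define t where "t k i = (y ^\<^sub>m k * v) $$ (i, 0)" for k i
  define r where "r k = (\<Sum>i<n. l $ i * t k i)" for k
  have t_add: "t (k + j) i = (\<Sum>p<n. (y ^\<^sub>m k) $$ (i, p) * t j p)" if "i < n" for k j i
  proof -
   have "y ^\<^sub>m (k + j) * v = y ^\<^sub>m k * (y ^\<^sub>m j * v)" using y v by (simp add: pow_mat_add[OF y] mat_assoc)
   then show ?thesis unfolding t_def using y v that by (simp add: mult_mat_entry del: index_mult_mat(1))
  qed
  have c_rel: "(\<Sum>j<n. c $ j * t j p) = 0" if "p < n" for p
  proof -
   have "(?K *\<^sub>v c) $ p = (\<Sum>j<n. t j p * c $ j)"
    using that c(1) by (simp add: scalar_prod_def atLeast0LessThan krylov_entry t_def)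
   then show ?thesis using c(3) that by (simp add: mult.commute)
  qed
  have r0: "r k = 0" if "k < n" for k
  proof -
   have "(transpose_mat ?K *\<^sub>v l) $ k = (\<Sum>i<n. t k i * l $ i)"
    using that l(1) by (simp add: scalar_prod_def atLeast0LessThan krylov_entry t_def)
   then show ?thesis unfolding r_def using l(3) that by (simp add: mult.commute)
  qed
  have rec: "(\<Sum>j<n. c $ j * r (k + j)) = 0" for k
  proof -
   have "(\<Sum>j<n. c $ j * r (k + j)) = (\<Sum>j<n. \<Sum>i<n. l $ i * (\<Sum>p<n. (y ^\<^sub>m k) $$ (i, p) * (c $ j * t j p)))"
    unfolding r_def by (intro sum.cong refl) (simp add: t_add sum_distrib_left mult_ac)
   also have "\<dots> = (\<Sum>i<n. \<Sum>j<n. l $ i * (\<Sum>p<n. (y ^\<^sub>m k) $$ (i, p) * (c $ j * t j p)))" by (rule sum.swap)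
   also have "\<dots> = (\<Sum>i<n. l $ i * (\<Sum>j<n. \<Sum>p<n. (y ^\<^sub>m k) $$ (i, p) * (c $ j * t j p)))"
    by (simp add: sum_distrib_left)
   also have "\<dots> = (\<Sum>i<n. l $ i * (\<Sum>p<n. \<Sum>j<n. (y ^\<^sub>m k) $$ (i, p) * (c $ j * t j p)))"
    by (intro sum.cong refl arg_cong2[where f = "(*)"] sum.swap)
   also have "\<dots> = (\<Sum>i<n. l $ i * (\<Sum>p<n. (y ^\<^sub>m k) $$ (i, p) * (\<Sum>j<n. c $ j * t j p)))"
    by (simp add: sum_distrib_left)
   also have "\<dots> = 0" by (simp add: c_rel)
   finally show ?thesis .
  qed
  obtain J where J: "J < n" "c $ J \<noteq> 0" "\<And>j. j < n \<Longrightarrow> J < j \<Longrightarrow> c $ j = 0"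
  proof -
   have "\<exists>j. j < n \<and> c $ j \<noteq> 0" using c(1,2) by (auto intro!: eq_vecI)
   then have "\<exists>J. (J < n \<and> c $ J \<noteq> 0) \<and> (\<forall>j. j < n \<and> c $ j \<noteq> 0 \<longrightarrow> j \<le> J)"
    by (elim exE) (rule ex_has_greatest_nat[of "\<lambda>j. j < n \<and> c $ j \<noteq> 0" _ "\<lambda>j. j" n], auto)
   then show thesis using that by (metis leD)
  qed
  have rz: "r k = 0" for k
  proof (induction k rule: less_induct)
   case (less k)
   show ?case
   proof (cases "k < n")
    case False
    define k' where "k' = k - J"
    have k: "k = k' + J" using False J(1) unfolding k'_def by simp
    have "c $ j * r (k' + j) = 0" if "j < n" "j \<noteq> J" for j
     using that J(3)[of j] less[of "k' + j"] k by (cases "j < J") auto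
    then have "(\<Sum>j<n. c $ j * r (k' + j)) = (\<Sum>j<n. if j = J then c $ J * r k else 0)"
     by (intro sum.cong refl) (auto simp: k)
    then show ?thesis using rec[of k'] J(1,2) by simp
   qed (rule r0)
  qed
  let ?l = "transpose_mat (vec_mat l)"
  have "?l * (y ^\<^sub>m k * v) = 0\<^sub>m 1 1" for k
  proof (rule eq_matI)
   fix i j assume "i < dim_row (0\<^sub>m 1 1 :: complex mat)" "j < dim_col (0\<^sub>m 1 1 :: complex mat)"
   then have ij: "i = 0" "j = 0" by auto
   have "(?l * (y ^\<^sub>m k * v)) $$ (0, 0) = (\<Sum>i<n. l $ i * (y ^\<^sub>m k * v) $$ (i, 0))"
    using l(1) y v by (subst mult_mat_entry) auto
   then show "(?l * (y ^\<^sub>m k * v)) $$ (i, j) = 0\<^sub>m 1 1 $$ (i, j)"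
    using rz[of k] ij unfolding r_def t_def by simp
  qed (use l(1) y v in auto)
  moreover have "?l \<in> carrier_mat 1 n" using l(1) by simp
  ultimately have "?l = 0\<^sub>m 1 n" using R by blast
  then have "vec_mat l = transpose_mat (0\<^sub>m 1 n)" by (metis transpose_transpose)
  also have "\<dots> = 0\<^sub>m n 1" by (rule eq_matI) auto
  finally show False using vec_mat_zero[OF l(1)] l(2) by simp
 qed
qed

lemma krylov_basis:
 assumes n: "0 < n" and y: "y \<in> carrier_mat n n" and v: "v \<in> carrier_mat n 1" and d: "det (krylov n y v) \<noteq> 0"
 defines "g \<equiv> krylov n y v"
 shows "inv_mat g * y * g \<in> companions n" "y * g = g * (inv_mat g * y * g)" "v = g * first_unit n"
proof -
 have g: "g \<in> carrier_mat n n" unfolding g_def by simp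
 note I = inv_mat[OF g d[folded g_def]]
 show "y * g = g * (inv_mat g * y * g)"
 proof -
  have "g * (inv_mat g * y * g) = (g * inv_mat g) * (y * g)" using g y I(1) by (simp add: mat_assoc)
  then show ?thesis using I(2) g y by simp
 qed
 show "v = g * first_unit n"
 proof (rule eq_matI)
  fix i j assume "i < dim_row (g * first_unit n)" "j < dim_col (g * first_unit n)"
  then have ij: "i < n" "j = 0" using g by auto
  have "(g * first_unit n) $$ (i, 0) = (\<Sum>l<n. g $$ (i, l) * (if l = 0 then 1 else 0))"
   using g ij by (subst mult_mat_entry) (auto simp: first_unit_def)
  also have "\<dots> = (\<Sum>l<n. if l = 0 then g $$ (i, l) else 0)" by (intro sum.cong refl) simp
  also have "\<dots> = g $$ (i, 0)" using n by (simp add: sum.delta)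
  also have "\<dots> = v $$ (i, 0)" unfolding g_def using ij n y v by (simp add: krylov_entry)
  finally show "v $$ (i, j) = (g * first_unit n) $$ (i, j)" using ij by simp
 qed (use g v in auto)
 show "inv_mat g * y * g \<in> companions n"
  unfolding companions_def
 proof (intro CollectI conjI allI impI)
  show "inv_mat g * y * g \<in> carrier_mat n n" using I(1) y g by auto
  fix i j assume i: "i < n" and j: "j < n - 1"
  have yg: "(y * g) $$ (l, j) = g $$ (l, Suc j)" if l: "l < n" for l
  proof -
   have "(y * g) $$ (l, j) = (\<Sum>p<n. y $$ (l, p) * (y ^\<^sub>m j * v) $$ (p, 0))"
    using y g l j unfolding g_def by (subst mult_mat_entry) (auto simp: krylov_entry)
   also have "\<dots> = (y * (y ^\<^sub>m j * v)) $$ (l, 0)" using y v l by (subst mult_mat_entry) auto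
   also have "y * (y ^\<^sub>m j * v) = y ^\<^sub>m Suc j * v"
    using y v pow_mat_commute[OF y, of j] by (simp flip: mat_assoc)
   finally show ?thesis unfolding g_def using l j by (simp add: krylov_entry)
  qed
  have "(inv_mat g * y * g) $$ (i, j) = (inv_mat g * (y * g)) $$ (i, j)" using I(1) y g by (simp add: mat_assoc)
  also have "\<dots> = (\<Sum>l<n. inv_mat g $$ (i, l) * (y * g) $$ (l, j))"
   using I(1) y g i j by (subst mult_mat_entry) auto
  also have "\<dots> = (\<Sum>l<n. inv_mat g $$ (i, l) * g $$ (l, Suc j))" by (simp add: yg del: index_mult_mat)
  also have "\<dots> = (inv_mat g * g) $$ (i, Suc j)" using I(1) g i j by (subst mult_mat_entry) auto
  also have "\<dots> = (if i = Suc j then 1 else 0)" unfolding I(3) using i j by auto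
  finally show "(inv_mat g * y * g) $$ (i, j) = (if i = Suc j then 1 else 0)" .
 qed
qed

section \<open>The Sylvester equation of a companion matrix\<close>

text \<open>Row \<open>i\<close> of the Horner scheme for the value of the characteristic polynomial of
 \<open>a\<close> at \<open>B\<close>, applied to the row \<open>r\<close>.\<close>

definition horner :: "nat \<Rightarrow> complex mat \<Rightarrow> complex mat \<Rightarrow> complex mat \<Rightarrow> nat \<Rightarrow> nat \<Rightarrow> complex" where
 "horner n a r B i j = (\<Sum>k=i..n. ccoeff n a k * (r * B ^\<^sub>m (k - i)) $$ (0, j))"

definition syl_x :: "nat \<Rightarrow> nat \<Rightarrow> complex mat \<Rightarrow> complex mat \<Rightarrow> complex mat \<Rightarrow> complex mat" where
 "syl_x n m a r B = mat n m (\<lambda>(i, j). horner n a r B (Suc i) j)"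

definition syl_u :: "nat \<Rightarrow> nat \<Rightarrow> complex mat \<Rightarrow> complex mat \<Rightarrow> complex mat \<Rightarrow> complex mat" where
 "syl_u n m a r B = mat 1 m (\<lambda>(i, j). horner n a r B 0 j)"

definition last_row :: "nat \<Rightarrow> nat \<Rightarrow> complex mat \<Rightarrow> complex mat" where
 "last_row n m X = mat 1 m (\<lambda>(i, j). X $$ (n - 1, j))"

lemma syl_carrier [simp]: "syl_x n m a r B \<in> carrier_mat n m" "syl_u n m a r B \<in> carrier_mat 1 m"
 "syl_u n m a r B \<in> carrier_mat (Suc 0) m" "last_row n m X \<in> carrier_mat 1 m" "last_row n m X \<in> carrier_mat (Suc 0) m"
 "dim_row (syl_x n m a r B) = n" "dim_col (syl_x n m a r B) = m"
 "dim_row (syl_u n m a r B) = 1" "dim_col (syl_u n m a r B) = m"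
 "dim_row (last_row n m X) = 1" "dim_col (last_row n m X) = m"
 unfolding syl_x_def syl_u_def last_row_def by simp_all

lemma horner_last:
 assumes "r \<in> carrier_mat 1 m" "B \<in> carrier_mat m m"
 shows "horner n a r B n j = r $$ (0, j)"
 using assms by (simp add: horner_def ccoeff_def)

lemma horner_step:
 assumes r: "r \<in> carrier_mat 1 m" and B: "B \<in> carrier_mat m m" and i: "i < n" and j: "j < m"
 shows "horner n a r B i j = ccoeff n a i * r $$ (0, j) + (\<Sum>l<m. horner n a r B (Suc i) l * B $$ (l, j))"
proof -
 have "horner n a r B i j = ccoeff n a i * (r * B ^\<^sub>m (i - i)) $$ (0, j) +
   (\<Sum>k=Suc i..n. ccoeff n a k * (r * B ^\<^sub>m (k - i)) $$ (0, j))"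
  unfolding horner_def using i by (intro sum.atLeast_Suc_atMost) simp
 also have "(r * B ^\<^sub>m (i - i)) $$ (0, j) = r $$ (0, j)" using r B by simp
 also have "(\<Sum>k=Suc i..n. ccoeff n a k * (r * B ^\<^sub>m (k - i)) $$ (0, j)) =
   (\<Sum>k=Suc i..n. \<Sum>l<m. ccoeff n a k * (r * B ^\<^sub>m (k - Suc i)) $$ (0, l) * B $$ (l, j))"
 proof (rule sum.cong[OF refl])
  fix k assume "k \<in> {Suc i..n}"
  then have "k - i = Suc (k - Suc i)" by auto
  then have "r * B ^\<^sub>m (k - i) = (r * B ^\<^sub>m (k - Suc i)) * B" using r B by (simp add: mat_assoc)
  then have "(r * B ^\<^sub>m (k - i)) $$ (0, j) = (\<Sum>l<m. (r * B ^\<^sub>m (k - Suc i)) $$ (0, l) * B $$ (l, j))"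
   using r B j by (simp add: mult_mat_entry del: index_mult_mat(1))
  then show "ccoeff n a k * (r * B ^\<^sub>m (k - i)) $$ (0, j) =
    (\<Sum>l<m. ccoeff n a k * (r * B ^\<^sub>m (k - Suc i)) $$ (0, l) * B $$ (l, j))"
   by (simp add: sum_distrib_left mult.assoc)
 qed
 also have "\<dots> = (\<Sum>l<m. horner n a r B (Suc i) l * B $$ (l, j))"
  unfolding horner_def sum_distrib_right by (rule sum.swap)
 finally show ?thesis .
qed

lemma last_row_syl:
 assumes n: "0 < n" and r: "r \<in> carrier_mat 1 m" and B: "B \<in> carrier_mat m m"
 shows "last_row n m (syl_x n m a r B) = r"
 by (rule eq_matI) (use n r horner_last[OF r B] in \<open>auto simp: last_row_def syl_x_def\<close>)

text \<open>Row by row, the equation expresses row \<open>i - 1\<close> of \<open>X\<close> in terms of row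
 \<open>i\<close> and the last row: this is the recursion of the Horner scheme. The top row of the equation
 then gives \<open>U\<close>.\<close>

lemma sylvester_iff:
 assumes n: "0 < n" and a: "a \<in> companions n" and X: "X \<in> carrier_mat n m" and B: "B \<in> carrier_mat m m"
  and U: "U \<in> carrier_mat 1 m"
 shows "a * X - X * B + first_unit n * U = 0\<^sub>m n m \<longleftrightarrow>
  X = syl_x n m a (last_row n m X) B \<and> U = syl_u n m a (last_row n m X) B"
proof -
 let ?r = "last_row n m X"
 have r: "?r \<in> carrier_mat 1 m" by simp
 have ac: "a \<in> carrier_mat n n" by (rule companions_carrier[OF a])
 define T where "T i j = (if i = 0 then U $$ (0, j) else X $$ (i - 1, j))" for i j
 have Tn: "T n j = ?r $$ (0, j)" if "j < m" for j using that n unfolding T_def last_row_def by simp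
 have entry: "(a * X - X * B + first_unit n * U) $$ (i, j) =
   T i j - (ccoeff n a i * ?r $$ (0, j) + (\<Sum>l<m. T (Suc i) l * B $$ (l, j)))" if ij: "i < n" "j < m" for i j
 proof -
  have "(first_unit n * U) $$ (i, j) = (if i = 0 then U $$ (0, j) else 0)"
   using U ij by (subst mult_mat_entry) (auto simp: first_unit_def)
  moreover have "(X * B) $$ (i, j) = (\<Sum>l<m. T (Suc i) l * B $$ (l, j))"
   using X B ij by (subst mult_mat_entry) (auto simp: T_def)
  moreover have "(a * X) $$ (i, j) = (if i = 0 then 0 else X $$ (i - 1, j)) - ccoeff n a i * ?r $$ (0, j)"
   using companion_mult_entry[OF n a X ij] ij by (simp add: last_row_def)
  moreover have "(a * X - X * B + first_unit n * U) $$ (i, j) =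
    (a * X) $$ (i, j) - (X * B) $$ (i, j) + (first_unit n * U) $$ (i, j)"
   using ac X B U ij by (simp del: index_mult_mat(1))
  ultimately show ?thesis unfolding T_def by simp
 qed
 have "a * X - X * B + first_unit n * U = 0\<^sub>m n m \<longleftrightarrow>
   (\<forall>i<n. \<forall>j<m. (a * X - X * B + first_unit n * U) $$ (i, j) = 0)" (is "?M = _ \<longleftrightarrow> _")
 proof
  assume "\<forall>i<n. \<forall>j<m. ?M $$ (i, j) = 0"
  then show "?M = 0\<^sub>m n m" using ac X B U by (intro eq_matI) auto
 qed auto
 also have "\<dots> \<longleftrightarrow> (\<forall>i<n. \<forall>j<m. T i j = ccoeff n a i * ?r $$ (0, j) + (\<Sum>l<m. T (Suc i) l * B $$ (l, j)))"
  by (simp add: entry)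
 also have "\<dots> \<longleftrightarrow> (\<forall>i\<le>n. \<forall>j<m. T i j = horner n a ?r B i j)"
 proof
  assume rec: "\<forall>i<n. \<forall>j<m. T i j = ccoeff n a i * ?r $$ (0, j) + (\<Sum>l<m. T (Suc i) l * B $$ (l, j))"
  have "\<forall>j<m. T (n - d) j = horner n a ?r B (n - d) j" if "d \<le> n" for d
   using that
  proof (induction d)
   case 0
   then show ?case using Tn horner_last[OF r B] by simp
  next
   case (Suc d)
   then have lt: "n - Suc d < n" and s: "Suc (n - Suc d) = n - d" by auto
   show ?case
   proof (intro allI impI)
    fix j assume j: "j < m"
    have "T (n - Suc d) j = ccoeff n a (n - Suc d) * ?r $$ (0, j) + (\<Sum>l<m. T (n - d) l * B $$ (l, j))"
     using rec[rule_format, OF lt j] unfolding s .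
    moreover have "\<forall>l<m. T (n - d) l = horner n a ?r B (n - d) l" using Suc by simp
    ultimately show "T (n - Suc d) j = horner n a ?r B (n - Suc d) j"
     using horner_step[OF r B lt j, of a] unfolding s by simp
   qed
  qed
  then show "\<forall>i\<le>n. \<forall>j<m. T i j = horner n a ?r B i j" by (metis diff_diff_cancel diff_le_self)
 next
  assume "\<forall>i\<le>n. \<forall>j<m. T i j = horner n a ?r B i j"
  then show "\<forall>i<n. \<forall>j<m. T i j = ccoeff n a i * ?r $$ (0, j) + (\<Sum>l<m. T (Suc i) l * B $$ (l, j))"
   using horner_step[OF r B, of _ n _ a] by simp
 qed
 also have "\<dots> \<longleftrightarrow> X = syl_x n m a ?r B \<and> U = syl_u n m a ?r B"
 proof
  assume H: "\<forall>i\<le>n. \<forall>j<m. T i j = horner n a ?r B i j"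
  have "X $$ (i, j) = horner n a ?r B (Suc i) j" if "i < n" "j < m" for i j
   using H[rule_format, of "Suc i" j] that unfolding T_def by simp
  moreover have "U $$ (0, j) = horner n a ?r B 0 j" if "j < m" for j
   using H[rule_format, of 0 j] that unfolding T_def by simp
  ultimately show "X = syl_x n m a ?r B \<and> U = syl_u n m a ?r B"
   using X U by (intro conjI eq_matI) (auto simp: syl_x_def syl_u_def)
 next
  assume H: "X = syl_x n m a ?r B \<and> U = syl_u n m a ?r B"
  have "X $$ (i, j) = horner n a ?r B (Suc i) j" if "i < n" "j < m" for i j
   using arg_cong[OF conjunct1[OF H], of "\<lambda>A. A $$ (i, j)"] that unfolding syl_x_def by simp
  moreover have "U $$ (0, j) = horner n a ?r B 0 j" if "j < m" for j
   using arg_cong[OF conjunct2[OF H], of "\<lambda>A. A $$ (0, j)"] that unfolding syl_u_def by simp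
  ultimately show "\<forall>i\<le>n. \<forall>j<m. T i j = horner n a ?r B i j"
   unfolding T_def by (auto simp: gr0_conv_Suc)
 qed
 finally show ?thesis .
qed

text \<open>The complete Horner scheme is the value of the polynomial.\<close>

lemma syl_u_eval:
 assumes r: "r \<in> carrier_mat 1 m" and B: "B \<in> carrier_mat m m"
 shows "syl_u n m a r B = r * eval_char n a m B"
proof (rule eq_matI)
 fix i j assume "i < dim_row (r * eval_char n a m B)" "j < dim_col (r * eval_char n a m B)"
 then have ij: "i = 0" "j < m" using r by auto
 have "(r * eval_char n a m B) $$ (0, j) = (\<Sum>l<m. r $$ (0, l) * (\<Sum>k\<le>n. ccoeff n a k * (B ^\<^sub>m k) $$ (l, j)))"
  using r ij by (subst mult_mat_entry) (auto simp: eval_char_def)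
 also have "\<dots> = (\<Sum>k\<le>n. ccoeff n a k * (\<Sum>l<m. r $$ (0, l) * (B ^\<^sub>m k) $$ (l, j)))"
  by (simp add: sum_distrib_left mult.left_commute) (rule sum.swap)
 also have "\<dots> = (\<Sum>k\<le>n. ccoeff n a k * (r * B ^\<^sub>m k) $$ (0, j))"
  using r B ij by (simp add: mult_mat_entry del: index_mult_mat(1))
 also have "\<dots> = syl_u n m a r B $$ (0, j)" using ij by (simp add: syl_u_def horner_def atMost_atLeast0)
 finally show "syl_u n m a r B $$ (i, j) = (r * eval_char n a m B) $$ (i, j)" using ij by simp
qed (use r in auto)

section \<open>The chart of the triangle part on which v is cyclic\<close>

lemma mult_left_cancel_zero:
 assumes g: "(g :: complex mat) \<in> carrier_mat n n" "det g \<noteq> 0" and M: "M \<in> carrier_mat n m"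
 shows "g * M = 0\<^sub>m n m \<longleftrightarrow> M = 0\<^sub>m n m"
proof
 assume "g * M = 0\<^sub>m n m"
 then have "inv_mat g * (g * M) = 0\<^sub>m n m" using inv_mat(1)[OF g] by simp
 moreover have "inv_mat g * (g * M) = M"
  using inv_mat(1,3)[OF g] g M by (simp flip: mat_assoc)
 ultimately show "M = 0\<^sub>m n m" by simp
qed (use g in simp)

lemma moment_chart:
 assumes g: "(g :: complex mat) \<in> carrier_mat n n" "det g \<noteq> 0" and a: "a \<in> carrier_mat n n"
  and X: "X \<in> carrier_mat n m" and y1: "y1 \<in> carrier_mat n n" and y2: "y2 \<in> carrier_mat m m"
  and e: "e \<in> carrier_mat n 1" and u: "u \<in> carrier_mat 1 m" and eq: "y1 * g = g * a"
 shows "y1 * (g * X) - (g * X) * y2 + (g * e) * u = 0\<^sub>m n m \<longleftrightarrow> a * X - X * y2 + e * u = 0\<^sub>m n m"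
proof -
 have "y1 * (g * X) = g * (a * X)"
 proof -
  have "y1 * (g * X) = (y1 * g) * X" using y1 g X by (simp add: mat_assoc)
  then show ?thesis unfolding eq using a g X by (simp add: mat_assoc)
 qed
 moreover have "(g * X) * y2 = g * (X * y2)" "(g * e) * u = g * (e * u)"
  using g X y2 e u by (simp_all add: mat_assoc)
 moreover have "g * (a * X - X * y2 + e * u) = g * (a * X) - g * (X * y2) + g * (e * u)"
  using g a X y2 e u
  by (simp add: mult_add_distrib_mat[of g n n _ m] mult_minus_distrib_mat[of g n n _ m] minus_carrier_mat)
 ultimately have eq2: "y1 * (g * X) - (g * X) * y2 + (g * e) * u = g * (a * X - X * y2 + e * u)" by simp
 have c: "a * X - X * y2 + e * u \<in> carrier_mat n m" using a X y2 e u by auto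
 show ?thesis unfolding eq2 by (rule mult_left_cancel_zero[OF g c])
qed

lemma last_row_mult:
 assumes "0 < n" "X \<in> carrier_mat n m" "t \<in> carrier_mat m r"
 shows "last_row n r (X * t) = last_row n m X * t"
proof (rule eq_matI)
 fix i j assume "i < dim_row (last_row n m X * t)" "j < dim_col (last_row n m X * t)"
 then have ij: "i = 0" "j < r" using assms by auto
 have "(X * t) $$ (n - 1, j) = (\<Sum>l<m. X $$ (n - 1, l) * t $$ (l, j))"
  using assms ij by (subst mult_mat_entry) auto
 also have "\<dots> = (last_row n m X * t) $$ (0, j)"
  using assms ij by (subst mult_mat_entry) (auto simp: last_row_def)
 finally show "last_row n r (X * t) $$ (i, j) = (last_row n m X * t) $$ (i, j)"
  using ij by (simp add: last_row_def)
qed (use assms in auto)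

lemma horner_mult:
 assumes r: "r \<in> carrier_mat 1 m" and B: "B \<in> carrier_mat m m" and t: "t \<in> carrier_mat m s" and j: "j < s"
 shows "(\<Sum>l<m. horner n a r B i l * t $$ (l, j)) = (\<Sum>k=i..n. ccoeff n a k * (r * (B ^\<^sub>m (k - i) * t)) $$ (0, j))"
proof -
 have "(\<Sum>l<m. horner n a r B i l * t $$ (l, j)) =
   (\<Sum>k=i..n. \<Sum>l<m. ccoeff n a k * (r * B ^\<^sub>m (k - i)) $$ (0, l) * t $$ (l, j))"
  unfolding horner_def sum_distrib_right by (rule sum.swap)
 also have "\<dots> = (\<Sum>k=i..n. ccoeff n a k * (\<Sum>l<m. (r * B ^\<^sub>m (k - i)) $$ (0, l) * t $$ (l, j)))"
  by (simp add: sum_distrib_left mult.assoc)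
 also have "\<dots> = (\<Sum>k=i..n. ccoeff n a k * ((r * B ^\<^sub>m (k - i)) * t) $$ (0, j))"
  using r B t j by (simp add: mult_mat_entry del: index_mult_mat(1))
 also have "\<dots> = (\<Sum>k=i..n. ccoeff n a k * (r * (B ^\<^sub>m (k - i) * t)) $$ (0, j))"
  using r B t by (simp add: mat_assoc)
 finally show ?thesis .
qed

lemma syl_mult:
 assumes r: "r \<in> carrier_mat 1 m" and B: "B \<in> carrier_mat m m" and C: "C \<in> carrier_mat s s" and t: "t \<in> carrier_mat m s"
  and eq: "B * t = t * C"
 shows "syl_x n m a r B * t = syl_x n s a (r * t) C" "syl_u n m a r B * t = syl_u n s a (r * t) C"
proof -
 have pow: "r * (B ^\<^sub>m k * t) = (r * t) * C ^\<^sub>m k" for k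
  unfolding pow_mat_intertwine[OF B t C eq] using r t C by (simp add: mat_assoc)
 have h: "(\<Sum>l<m. horner n a r B i l * t $$ (l, j)) = horner n a (r * t) C i j" if "j < s" for i j
  unfolding horner_mult[OF r B t that] horner_def[of n a "r * t"] pow ..
 show "syl_x n m a r B * t = syl_x n s a (r * t) C"
 proof (rule eq_matI)
  fix i j assume "i < dim_row (syl_x n s a (r * t) C)" "j < dim_col (syl_x n s a (r * t) C)"
  then have ij: "i < n" "j < s" by auto
  then show "(syl_x n m a r B * t) $$ (i, j) = syl_x n s a (r * t) C $$ (i, j)"
   using t h[OF ij(2), of "Suc i"] by (subst mult_mat_entry) (auto simp: syl_x_def)
 qed (use t in auto)
 show "syl_u n m a r B * t = syl_u n s a (r * t) C"
 proof (rule eq_matI)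
  fix i j assume "i < dim_row (syl_u n s a (r * t) C)" "j < dim_col (syl_u n s a (r * t) C)"
  then have ij: "i = 0" "j < s" by auto
  then show "(syl_u n m a r B * t) $$ (i, j) = syl_u n s a (r * t) C $$ (i, j)"
   using t h[OF ij(2), of 0] by (subst mult_mat_entry) (auto simp: syl_u_def)
 qed (use t in auto)
qed

text \<open>A vector which the last row and all its translates annihilate lies in the kernel of
 \<open>X\<close> and of \<open>U\<close>. This is how cogeneration forces the last row to be
 cocyclic.\<close>

lemma syl_kill:
 assumes r: "r \<in> carrier_mat 1 m" and B: "B \<in> carrier_mat m m" and t: "t \<in> carrier_mat m 1"
  and kill: "\<And>k. r * (B ^\<^sub>m k * t) = 0\<^sub>m 1 1"
 shows "syl_x n m a r B * t = 0\<^sub>m n 1" "syl_u n m a r B * t = 0\<^sub>m 1 1"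
proof -
 have h: "(\<Sum>l<m. horner n a r B i l * t $$ (l, 0)) = 0" for i
  using horner_mult[OF r B t, of 0 n a i] kill by simp
 show "syl_x n m a r B * t = 0\<^sub>m n 1"
 proof (rule eq_matI)
  fix i j assume "i < dim_row (0\<^sub>m n 1 :: complex mat)" "j < dim_col (0\<^sub>m n 1 :: complex mat)"
  then have ij: "i < n" "j = 0" by auto
  then show "(syl_x n m a r B * t) $$ (i, j) = 0\<^sub>m n 1 $$ (i, j)"
   using t h[of "Suc i"] by (subst mult_mat_entry) (auto simp: syl_x_def)
 qed (use t in auto)
 show "syl_u n m a r B * t = 0\<^sub>m 1 1"
 proof (rule eq_matI)
  fix i j assume "i < dim_row (0\<^sub>m 1 1 :: complex mat)" "j < dim_col (0\<^sub>m 1 1 :: complex mat)"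
  then have ij: "i = 0" "j = 0" by auto
  then show "(syl_u n m a r B * t) $$ (i, j) = 0\<^sub>m 1 1 $$ (i, j)"
   using t h[of 0] by (subst mult_mat_entry) (auto simp: syl_u_def)
 qed (use t in auto)
qed

lemma transpose_kill:
 assumes w: "w \<in> carrier_mat r m" and y: "y \<in> carrier_mat m m" and s: "(s :: complex mat) \<in> carrier_mat m 1"
 shows "transpose_mat s * (transpose_mat y ^\<^sub>m k * transpose_mat w) = transpose_mat (w * (y ^\<^sub>m k * s))"
proof -
 have yk: "y ^\<^sub>m k \<in> carrier_mat m m" using y by simp
 have "transpose_mat (w * (y ^\<^sub>m k * s)) = transpose_mat (y ^\<^sub>m k * s) * transpose_mat w"
  by (rule transpose_mult[OF w mult_carrier_mat[OF yk s]])
 also have "transpose_mat (y ^\<^sub>m k * s) = transpose_mat s * transpose_mat (y ^\<^sub>m k)"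
  by (rule transpose_mult[OF yk s])
 finally show ?thesis using w y s by (simp add: transpose_pow_mat[OF y] mat_assoc)
qed

lemma transpose_zero: "transpose_mat (0\<^sub>m r c) = 0\<^sub>m c r"
 by (rule eq_matI) auto

lemma krylov_transpose_nonsingular_iff:
 assumes y: "y \<in> carrier_mat m m" and w: "w \<in> carrier_mat 1 m"
 shows "det (krylov m (transpose_mat y) (transpose_mat w)) \<noteq> 0 \<longleftrightarrow>
  (\<forall>s\<in>carrier_mat m 1. (\<forall>k. w * (y ^\<^sub>m k * s) = 0\<^sub>m 1 1) \<longrightarrow> s = 0\<^sub>m m 1)" (is "_ \<longleftrightarrow> ?R")
proof -
 have yt: "transpose_mat y \<in> carrier_mat m m" and wt: "transpose_mat w \<in> carrier_mat m 1" using y w by auto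
 have kill: "transpose_mat s * (transpose_mat y ^\<^sub>m k * transpose_mat w) = 0\<^sub>m 1 1 \<longleftrightarrow> w * (y ^\<^sub>m k * s) = 0\<^sub>m 1 1"
  if "s \<in> carrier_mat m 1" for s k
  unfolding transpose_kill[OF w y that] by (metis transpose_transpose transpose_zero)
 show ?thesis
  unfolding krylov_nonsingular_iff[OF yt wt]
 proof
  assume L: "\<forall>l\<in>carrier_mat 1 m. (\<forall>k. l * (transpose_mat y ^\<^sub>m k * transpose_mat w) = 0\<^sub>m 1 1) \<longrightarrow> l = 0\<^sub>m 1 m"
  show ?R
  proof (intro ballI impI)
   fix s :: "complex mat" assume s: "s \<in> carrier_mat m 1" and "\<forall>k. w * (y ^\<^sub>m k * s) = 0\<^sub>m 1 1"
   then have "\<forall>k. transpose_mat s * (transpose_mat y ^\<^sub>m k * transpose_mat w) = 0\<^sub>m 1 1" using kill[OF s] by simp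
   moreover have "transpose_mat s \<in> carrier_mat 1 m" using s by simp
   ultimately have "transpose_mat s = 0\<^sub>m 1 m" using L by blast
   then show "s = 0\<^sub>m m 1" by (metis transpose_transpose transpose_zero)
  qed
 next
  assume R: ?R
  show "\<forall>l\<in>carrier_mat 1 m. (\<forall>k. l * (transpose_mat y ^\<^sub>m k * transpose_mat w) = 0\<^sub>m 1 1) \<longrightarrow> l = 0\<^sub>m 1 m"
  proof (intro ballI impI)
   fix l :: "complex mat" assume l: "l \<in> carrier_mat 1 m"
    and k: "\<forall>k. l * (transpose_mat y ^\<^sub>m k * transpose_mat w) = 0\<^sub>m 1 1"
   have lt: "transpose_mat l \<in> carrier_mat m 1" using l by simp
   have "\<forall>k. w * (y ^\<^sub>m k * transpose_mat l) = 0\<^sub>m 1 1" using k kill[OF lt] by simp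
   then have "transpose_mat l = 0\<^sub>m m 1" using R lt by blast
   then show "l = 0\<^sub>m 1 m" by (metis transpose_transpose transpose_zero)
  qed
 qed
qed

definition dual_conj :: "complex mat \<Rightarrow> complex mat \<Rightarrow> complex mat" where
 "dual_conj h b = inv_mat (transpose_mat h) * transpose_mat b * transpose_mat h"

lemma dual_conj:
 assumes h: "h \<in> carrier_mat m m" "det h \<noteq> 0" and b: "b \<in> carrier_mat m m"
 shows "dual_conj h b \<in> carrier_mat m m" "transpose_mat (dual_conj h b) * h = h * b"
  "transpose_mat h * dual_conj h b = transpose_mat b * transpose_mat h"
proof -
 let ?H = "transpose_mat h"
 have H: "?H \<in> carrier_mat m m" "det ?H \<noteq> 0" using h det_transpose[OF h(1)] by auto
 note I = inv_mat[OF H]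
 show c: "dual_conj h b \<in> carrier_mat m m" unfolding dual_conj_def using I(1) H b by auto
 have "?H * dual_conj h b = (?H * inv_mat ?H) * (transpose_mat b * ?H)"
  unfolding dual_conj_def using I(1) H(1) b h(1) by (simp add: mat_assoc)
 then show eq: "?H * dual_conj h b = transpose_mat b * ?H" using I(2) H b by simp
 have "transpose_mat (dual_conj h b) * h = transpose_mat (?H * dual_conj h b)"
  using transpose_mult[OF H(1) c] by simp
 also have "\<dots> = h * b" unfolding eq using transpose_mult[of "transpose_mat b" m m ?H m] b h by simp
 finally show "transpose_mat (dual_conj h b) * h = h * b" .
qed

lemma dual_conj_unique:
 assumes h: "h \<in> carrier_mat m m" "det h \<noteq> 0" and y: "y \<in> carrier_mat m m" and eq: "transpose_mat y * h = h * b"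
  and b: "b \<in> carrier_mat m m"
 shows "dual_conj h b = y"
proof -
 let ?H = "transpose_mat h"
 have H: "?H \<in> carrier_mat m m" "det ?H \<noteq> 0" using h det_transpose[OF h(1)] by auto
 note I = inv_mat[OF H]
 have "transpose_mat b * ?H = transpose_mat (h * b)" using transpose_mult[OF h(1) b] by simp
 also have "\<dots> = ?H * y" unfolding eq[symmetric] using transpose_mult[of "transpose_mat y" m m h m] y h by simp
 finally have *: "transpose_mat b * ?H = ?H * y" .
 have "dual_conj h b = inv_mat ?H * (transpose_mat b * ?H)"
  unfolding dual_conj_def using I(1) H b h(1) by (simp add: mat_assoc)
 also have "\<dots> = (inv_mat ?H * ?H) * y" unfolding * using I(1) H y h(1) by (simp add: mat_assoc)
 finally show ?thesis using I(3) y by simp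
qed

lemma conj_eq:
 assumes g: "(g :: complex mat) \<in> carrier_mat n n" "det g \<noteq> 0" and a: "a \<in> carrier_mat n n"
 shows "g * a * inv_mat g \<in> carrier_mat n n" "(g * a * inv_mat g) * g = g * a"
proof -
 note I = inv_mat[OF g]
 show "g * a * inv_mat g \<in> carrier_mat n n" using g a I(1) by auto
 show "(g * a * inv_mat g) * g = g * a" using g a I by (simp add: mat_assoc)
qed

lemma conj_unique:
 assumes g: "(g :: complex mat) \<in> carrier_mat n n" "det g \<noteq> 0" and y: "y \<in> carrier_mat n n" and a: "a \<in> carrier_mat n n"
  and eq: "y * g = g * a"
 shows "g * a * inv_mat g = y" "inv_mat g * y * g = a"
proof -
 note I = inv_mat[OF g]
 have "g * a * inv_mat g = y * (g * inv_mat g)" unfolding eq[symmetric] using g y I(1) by (simp add: mat_assoc)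
 then show "g * a * inv_mat g = y" using I(2) y by simp
 have "inv_mat g * y * g = inv_mat g * (g * a)" unfolding eq[symmetric] using g y I(1) by (simp add: mat_assoc)
 also have "\<dots> = (inv_mat g * g) * a" using g a I(1) by (simp add: mat_assoc)
 finally show "inv_mat g * y * g = a" using I(3) a by simp
qed

text \<open>The columns of \<open>g\<close> are the Krylov basis for \<open>y1\<close> and \<open>v\<close>,
 those of \<open>h\<close> the Krylov basis for the transpose of \<open>y2\<close> and the last row of
 \<open>x\<close> in the basis \<open>g\<close>.\<close>

fun psi :: "nat \<Rightarrow> nat \<Rightarrow> wh_point \<Rightarrow> quintuple" where
 "psi n m (g, h, a, b) =
   (g * syl_x n m a (transpose_mat (h * first_unit m)) (dual_conj h b), g * a * inv_mat g, dual_conj h b,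
   g * first_unit n, syl_u n m a (transpose_mat (h * first_unit m)) (dual_conj h b))"

fun psi_inv :: "nat \<Rightarrow> nat \<Rightarrow> quintuple \<Rightarrow> wh_point" where
 "psi_inv n m (x, y1, y2, v, u) =
   (let g = krylov n y1 v; h = krylov m (transpose_mat y2) (transpose_mat (last_row n m (inv_mat g * x)))
   in (g, h, inv_mat g * y1 * g, inv_mat h * transpose_mat y2 * h))"

text \<open>The equations of the complements of the two charts.\<close>

fun cyclic_det :: "nat \<Rightarrow> quintuple \<Rightarrow> complex" where
 "cyclic_det n (x, y1, y2, v, u) = det (krylov n y1 v)"

fun cocyclic_det :: "nat \<Rightarrow> quintuple \<Rightarrow> complex" where
 "cocyclic_det m (x, y1, y2, v, u) = det (krylov m (transpose_mat y2) (transpose_mat u))"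

lemma Wh_points_iff:
 assumes "0 < n" "0 < m"
 shows "(g, h, a, b) \<in> points (Wh n m) \<longleftrightarrow> (g \<in> carrier_mat n n \<and> det g \<noteq> 0) \<and> (h \<in> carrier_mat m m \<and> det h \<noteq> 0) \<and>
  a \<in> companions n \<and> b \<in> companions m"
 unfolding Wh_def using assms by (simp add: GL_iff companion_space_eq)

lemma quint_spaceD:
 assumes "(x, y1, y2, v, u) \<in> quint_space n m"
 shows "x \<in> carrier_mat n m" "y1 \<in> carrier_mat n n" "y2 \<in> carrier_mat m m" "v \<in> carrier_mat n 1" "u \<in> carrier_mat 1 m"
 using assms unfolding quint_space_def by auto

lemma krylov_conj:
 assumes "0 < n" "g \<in> carrier_mat n n" "a \<in> companions n" "y \<in> carrier_mat n n" "y * g = g * a"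
 shows "krylov n y (g * first_unit n) = g"
 using krylov_intertwine[OF assms(4,2) companions_carrier[OF assms(3)] _ assms(5), of "first_unit n"]
  krylov_companion[OF assms(1,3)] assms(2) by simp

lemma syl_point:
 assumes n: "0 < n" and m: "0 < m" and g: "g \<in> carrier_mat n n" "det g \<noteq> 0" and a: "a \<in> companions n"
  and y1: "y1 \<in> carrier_mat n n" "y1 * g = g * a" and y2: "y2 \<in> carrier_mat m m" and w: "w \<in> carrier_mat 1 m"
  and d: "det (krylov m (transpose_mat y2) (transpose_mat w)) \<noteq> 0"
 shows "(g * syl_x n m a w y2, y1, y2, g * first_unit n, syl_u n m a w y2) \<in> triangle_points m n"
 unfolding triangle_points_iff
proof (intro conjI)
 have ac: "a \<in> carrier_mat n n" by (rule companions_carrier[OF a])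
 show "(g * syl_x n m a w y2, y1, y2, g * first_unit n, syl_u n m a w y2) \<in> quint_space n m"
  unfolding quint_space_def using g y1 y2 by auto
 show "moment_eq n m (g * syl_x n m a w y2, y1, y2, g * first_unit n, syl_u n m a w y2)"
  unfolding moment_eq.simps
  using moment_chart[OF g ac _ y1(1) y2 _ _ y1(2), of "syl_x n m a w y2" "first_unit n" "syl_u n m a w y2"]
   sylvester_iff[OF n a _ y2, of "syl_x n m a w y2" "syl_u n m a w y2"] last_row_syl[OF n w y2] by simp
 have v: "g * first_unit n \<in> carrier_mat n 1" using g(1) by auto
 have "det (krylov n y1 (g * first_unit n)) \<noteq> 0" unfolding krylov_conj[OF n g(1) a y1] by (rule g(2))
 then show "generating n m (g * syl_x n m a w y2, y1, y2, g * first_unit n, syl_u n m a w y2)"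
  unfolding generating.simps krylov_nonsingular_iff[OF y1(1) v] by blast
 show "cogenerating n m (g * syl_x n m a w y2, y1, y2, g * first_unit n, syl_u n m a w y2)"
  unfolding cogenerating.simps
 proof (intro ballI impI)
  fix s :: "complex mat" assume s: "s \<in> carrier_mat m 1"
   and kill: "\<forall>k. g * syl_x n m a w y2 * (y2 ^\<^sub>m k * s) = 0\<^sub>m n 1 \<and> syl_u n m a w y2 * (y2 ^\<^sub>m k * s) = 0\<^sub>m 1 1"
  have "w * (y2 ^\<^sub>m k * s) = 0\<^sub>m 1 1" for k
  proof -
   have t: "y2 ^\<^sub>m k * s \<in> carrier_mat m 1" using y2 s by (intro mult_carrier_mat[of _ m m]) auto
   have X: "syl_x n m a w y2 * (y2 ^\<^sub>m k * s) \<in> carrier_mat n 1" using t by (intro mult_carrier_mat[of _ n m]) auto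
   have "g * (syl_x n m a w y2 * (y2 ^\<^sub>m k * s)) = 0\<^sub>m n 1"
    using kill unfolding assoc_mult_mat[OF g(1) syl_carrier(1) t, symmetric] by blast
   then have "syl_x n m a w y2 * (y2 ^\<^sub>m k * s) = 0\<^sub>m n 1" using mult_left_cancel_zero[OF g X] by blast
   then have "last_row n m (syl_x n m a w y2) * (y2 ^\<^sub>m k * s) = last_row n 1 (0\<^sub>m n 1)"
    using last_row_mult[OF n _ t, of "syl_x n m a w y2"] by simp
   also have "\<dots> = 0\<^sub>m 1 1" using n by (intro eq_matI) (auto simp: last_row_def)
   finally show ?thesis by (simp add: last_row_syl[OF n w y2])
  qed
  then show "s = 0\<^sub>m m 1" using d s unfolding krylov_transpose_nonsingular_iff[OF y2 w] by blast
 qed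
qed

lemma chart_form:
 assumes n: "0 < n" and z: "(x, y1, y2, v, u) \<in> quint_space n m" "moment_eq n m (x, y1, y2, v, u)"
  and g: "g \<in> carrier_mat n n" "det g \<noteq> 0" and a: "a \<in> companions n" and y1: "y1 * g = g * a" and v: "v = g * first_unit n"
  and w: "w = last_row n m (inv_mat g * x)"
 shows "x = g * syl_x n m a w y2" "u = syl_u n m a w y2"
proof -
 note z' = quint_spaceD[OF z(1)]
 have ac: "a \<in> carrier_mat n n" by (rule companions_carrier[OF a])
 note I = inv_mat[OF g]
 let ?X = "inv_mat g * x"
 have X: "?X \<in> carrier_mat n m" using I(1) z'(1) by auto
 have "g * ?X = (g * inv_mat g) * x" using g(1) I(1) z'(1) by (simp add: mat_assoc)
 then have x: "g * ?X = x" using I(2) z'(1) by simp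
 have "y1 * (g * ?X) - (g * ?X) * y2 + (g * first_unit n) * u = 0\<^sub>m n m"
  using z(2) unfolding x v by simp
 then have "a * ?X - ?X * y2 + first_unit n * u = 0\<^sub>m n m"
  using moment_chart[OF g ac X z'(2,3) first_unit_carrier(1) z'(5) y1] by blast
 then have "?X = syl_x n m a w y2 \<and> u = syl_u n m a w y2"
  unfolding sylvester_iff[OF n a X z'(3,5)] w .
 then show "x = g * syl_x n m a w y2" "u = syl_u n m a w y2" using x by auto
qed

text \<open>A vector annihilated by all translates of the last row spans a subspace which the second stability
 condition excludes, by \<open>syl_kill\<close>.\<close>

lemma chart_nonsingular:
 assumes n: "0 < n" and z: "(x, y1, y2, v, u) \<in> triangle_points m n" and d: "det (krylov n y1 v) \<noteq> 0"
  and w: "w = last_row n m (inv_mat (krylov n y1 v) * x)"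
 shows "det (krylov m (transpose_mat y2) (transpose_mat w)) \<noteq> 0"
proof -
 have z1: "(x, y1, y2, v, u) \<in> quint_space n m" "moment_eq n m (x, y1, y2, v, u)" "cogenerating n m (x, y1, y2, v, u)"
  using z unfolding triangle_points_iff by auto
 note z' = quint_spaceD[OF z1(1)]
 let ?g = "krylov n y1 v" let ?a = "inv_mat ?g * y1 * ?g"
 have wc: "w \<in> carrier_mat 1 m" unfolding w by simp
 note K = krylov_basis[OF n z'(2,4) d]
 note C = chart_form[OF n z1(1,2) krylov_carrier(1) d K w]
 show ?thesis
  unfolding krylov_transpose_nonsingular_iff[OF z'(3) wc]
 proof (intro ballI impI)
  fix s :: "complex mat" assume s: "s \<in> carrier_mat m 1" and kill: "\<forall>k. w * (y2 ^\<^sub>m k * s) = 0\<^sub>m 1 1"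
  have "x * (y2 ^\<^sub>m k * s) = 0\<^sub>m n 1 \<and> u * (y2 ^\<^sub>m k * s) = 0\<^sub>m 1 1" for k
  proof -
   have t: "y2 ^\<^sub>m k * s \<in> carrier_mat m 1" using z'(3) s by (intro mult_carrier_mat[of _ m m]) auto
   have "w * (y2 ^\<^sub>m j * (y2 ^\<^sub>m k * s)) = 0\<^sub>m 1 1" for j
   proof -
    have "y2 ^\<^sub>m j * (y2 ^\<^sub>m k * s) = y2 ^\<^sub>m (j + k) * s"
     using z'(3) s by (simp add: pow_mat_add[OF z'(3)] mat_assoc)
    then show ?thesis using kill by simp
   qed
   note sk = syl_kill[OF wc z'(3) t this, where n = n and a = ?a]
   have "x * (y2 ^\<^sub>m k * s) = ?g * (syl_x n m ?a w y2 * (y2 ^\<^sub>m k * s))"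
    by (subst C(1)) (rule assoc_mult_mat[OF krylov_carrier(1) syl_carrier(1) t])
   then have "x * (y2 ^\<^sub>m k * s) = 0\<^sub>m n 1" unfolding sk by simp
   moreover have "u * (y2 ^\<^sub>m k * s) = 0\<^sub>m 1 1" by (subst C(2)) (rule sk)
   ultimately show ?thesis ..
  qed
  then show "s = 0\<^sub>m m 1" using z1(3) s unfolding cogenerating.simps by blast
 qed
qed

lemma psi_points:
 assumes n: "0 < n" and m: "0 < m" and w: "w \<in> points (Wh n m)"
 shows "psi n m w \<in> triangle_points m n" "cyclic_det n (psi n m w) \<noteq> 0" "psi_inv n m (psi n m w) = w"
proof -
 obtain g h a b where w_eq: "w = (g, h, a, b)" by (cases w)
 have g: "g \<in> carrier_mat n n" "det g \<noteq> 0" and h: "h \<in> carrier_mat m m" "det h \<noteq> 0"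
  and a: "a \<in> companions n" and b: "b \<in> companions m"
  using w Wh_points_iff[OF n m] unfolding w_eq by auto
 have ac: "a \<in> carrier_mat n n" and bc: "b \<in> carrier_mat m m" using companions_carrier a b by auto
 note C = conj_eq[OF g ac] and Dc = dual_conj[OF h bc]
 let ?w = "transpose_mat (h * first_unit m)" and ?y2 = "dual_conj h b"
 have wc: "?w \<in> carrier_mat 1 m" using h(1) by auto
 have kh: "krylov m (transpose_mat ?y2) (transpose_mat ?w) = h"
  using krylov_conj[OF m h(1) b _ Dc(2)] Dc(1) by simp
 have kg: "krylov n (g * a * inv_mat g) (g * first_unit n) = g" by (rule krylov_conj[OF n g(1) a C])
 show "psi n m w \<in> triangle_points m n" unfolding w_eq psi.simps
  by (rule syl_point[OF n m g a C Dc(1) wc]) (unfold kh, rule h(2))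
 show "cyclic_det n (psi n m w) \<noteq> 0" unfolding w_eq psi.simps cyclic_det.simps kg by (rule g(2))
 note I = inv_mat[OF g]
 have "inv_mat g * (g * syl_x n m a ?w ?y2) = (inv_mat g * g) * syl_x n m a ?w ?y2"
  using I(1) g(1) by (simp add: mat_assoc)
 then have "last_row n m (inv_mat g * (g * syl_x n m a ?w ?y2)) = ?w"
  using I(3) last_row_syl[OF n wc Dc(1)] by simp
 then show "psi_inv n m (psi n m w) = w"
  unfolding w_eq psi.simps psi_inv.simps Let_def kg
  using kh conj_unique(2)[OF g C(1) ac C(2)] conj_unique(2)[OF h _ bc Dc(2)] Dc(1) by simp
qed

lemma psi_inv_points:
 assumes n: "0 < n" and m: "0 < m" and z: "z \<in> triangle_points m n" and d: "cyclic_det n z \<noteq> 0"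
 shows "psi_inv n m z \<in> points (Wh n m)" "psi n m (psi_inv n m z) = z"
proof -
 obtain x y1 y2 v u where z_eq: "z = (x, y1, y2, v, u)" by (cases z)
 have z1: "(x, y1, y2, v, u) \<in> quint_space n m" "moment_eq n m (x, y1, y2, v, u)"
  using z unfolding triangle_points_iff z_eq by auto
 note z' = quint_spaceD[OF z1(1)]
 have dg: "det (krylov n y1 v) \<noteq> 0" using d unfolding z_eq by simp
 define g where "g = krylov n y1 v"
 define a where "a = inv_mat g * y1 * g"
 define w where "w = last_row n m (inv_mat g * x)"
 define h where "h = krylov m (transpose_mat y2) (transpose_mat w)"
 define b where "b = inv_mat h * transpose_mat y2 * h"
 have g: "g \<in> carrier_mat n n" "det g \<noteq> 0" using dg unfolding g_def by auto
 have y2t: "transpose_mat y2 \<in> carrier_mat m m" and wt: "transpose_mat w \<in> carrier_mat m 1"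
  using z'(3) unfolding w_def by auto
 have hd: "det (krylov m (transpose_mat y2) (transpose_mat w)) \<noteq> 0"
  by (rule chart_nonsingular[OF n z[unfolded z_eq] dg]) (simp add: w_def g_def)
 then have h: "h \<in> carrier_mat m m" "det h \<noteq> 0" unfolding h_def by auto
 note K = krylov_basis[OF n z'(2,4) dg, folded g_def, folded a_def]
 note L = krylov_basis[OF m y2t wt hd, folded h_def, folded b_def]
 have P: "psi_inv n m z = (g, h, a, b)"
  unfolding z_eq psi_inv.simps Let_def g_def a_def w_def h_def b_def ..
 show "psi_inv n m z \<in> points (Wh n m)"
  unfolding P Wh_points_iff[OF n m] using g h K(1) L(1) by blast
 note C = chart_form[OF n z1 g K w_def]
 have y2: "dual_conj h b = y2" by (rule dual_conj_unique[OF h z'(3) L(2) companions_carrier[OF L(1)]])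
 have hw: "transpose_mat (h * first_unit m) = w" unfolding L(3)[symmetric] by simp
 have "psi n m (g, h, a, b) = (x, y1, y2, v, u)"
  unfolding psi.simps y2 hw conj_unique(1)[OF g z'(2) companions_carrier[OF K(1)] K(2)]
  using C K(3) by simp
 then show "psi n m (psi_inv n m z) = z" unfolding P unfolding z_eq .
qed

section \<open>Duality and the second chart\<close>

text \<open>The sign makes the moment map equation invariant under transposition.\<close>

fun dual :: "quintuple \<Rightarrow> quintuple" where
 "dual (x, y1, y2, v, u) =
   (- transpose_mat x, transpose_mat y2, transpose_mat y1, transpose_mat u, transpose_mat v)"

lemma dual_quint: "z \<in> quint_space n m \<Longrightarrow> dual z \<in> quint_space m n"
 unfolding quint_space_def by auto

lemma dual_dual: "z \<in> quint_space n m \<Longrightarrow> dual (dual z) = z"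
 unfolding quint_space_def by (auto intro!: eq_matI)

lemma dual_moment:
 assumes "z \<in> quint_space n m" "moment_eq n m z"
 shows "moment_eq m n (dual z)"
proof -
 obtain x y1 y2 v u where z: "z = (x, y1, y2, v, u)" by (cases z)
 note z' = quint_spaceD[OF assms(1)[unfolded z]]
 let ?t = transpose_mat
 have "?t y2 * (- ?t x) - (- ?t x) * ?t y1 + ?t u * ?t v = ?t (y1 * x - x * y2 + v * u)"
 proof -
  have "?t (y1 * x) = ?t x * ?t y1" "?t (x * y2) = ?t y2 * ?t x" "?t (v * u) = ?t u * ?t v"
   using transpose_mult z' by blast+
  moreover have "?t y2 * (- ?t x) = - (?t y2 * ?t x)" "(- ?t x) * ?t y1 = - (?t x * ?t y1)"
   using z' by (auto intro: uminus_mult_right_mat uminus_mult_left_mat)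
  moreover have "- ?t (x * y2) - (- ?t (y1 * x)) + ?t (v * u) = ?t (y1 * x - x * y2 + v * u)"
   using z' by (intro eq_matI) (auto simp del: index_mult_mat(1))
  ultimately show ?thesis by simp
 qed
 then show ?thesis using assms(2) unfolding z by (simp add: transpose_zero)
qed

lemma dual_generating:
 assumes z: "z \<in> quint_space n m"
 shows "generating m n (dual z) \<longleftrightarrow> cogenerating n m z"
proof -
 obtain x y1 y2 v u where z_eq: "z = (x, y1, y2, v, u)" by (cases z)
 note z' = quint_spaceD[OF z[unfolded z_eq]]
 let ?t = transpose_mat
 have t0: "A = 0\<^sub>m r c \<longleftrightarrow> ?t A = 0\<^sub>m c r" for A :: "complex mat" and r c
  by (metis transpose_transpose transpose_zero)
 have x: "?t s * (?t y2 ^\<^sub>m k * (- ?t x)) = 0\<^sub>m 1 n \<longleftrightarrow> x * (y2 ^\<^sub>m k * s) = 0\<^sub>m n 1" if s: "s \<in> carrier_mat m 1" for s k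
 proof -
  have 1: "?t y2 ^\<^sub>m k * (- ?t x) = - (?t y2 ^\<^sub>m k * ?t x)" using z' by (intro uminus_mult_right_mat) auto
  have 2: "?t s * (- (?t y2 ^\<^sub>m k * ?t x)) = - (?t s * (?t y2 ^\<^sub>m k * ?t x))" using z' s by (intro uminus_mult_right_mat) auto
  have 3: "- A = 0\<^sub>m 1 n \<longleftrightarrow> A = 0\<^sub>m 1 n" if "A \<in> carrier_mat 1 n" for A :: "complex mat"
  proof -
   have "- (0\<^sub>m 1 n) = (0\<^sub>m 1 n :: complex mat)" by (rule eq_matI) auto
   then show ?thesis by (metis uminus_uminus_mat)
  qed
  have c: "?t s * (?t y2 ^\<^sub>m k * ?t x) \<in> carrier_mat 1 n"
   using z' s by (intro mult_carrier_mat[of _ 1 m] mult_carrier_mat[of _ m m]) auto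
  show ?thesis unfolding 1 2 3[OF c] unfolding transpose_kill[OF z'(1,3) s]
   by (simp add: t0[symmetric])
 qed
 have u: "?t s * (?t y2 ^\<^sub>m k * ?t u) = 0\<^sub>m 1 1 \<longleftrightarrow> u * (y2 ^\<^sub>m k * s) = 0\<^sub>m 1 1" if s: "s \<in> carrier_mat m 1" for s k
  unfolding transpose_kill[OF z'(5,3) s] by (simp add: t0[symmetric])
 show ?thesis
 proof
  assume G: "generating m n (dual z)"
  show "cogenerating n m z"
   unfolding z_eq cogenerating.simps
  proof (intro ballI impI)
   fix s :: "complex mat" assume s: "s \<in> carrier_mat m 1"
    and "\<forall>k. x * (y2 ^\<^sub>m k * s) = 0\<^sub>m n 1 \<and> u * (y2 ^\<^sub>m k * s) = 0\<^sub>m 1 1"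
   then have "\<forall>k. ?t s * (?t y2 ^\<^sub>m k * (- ?t x)) = 0\<^sub>m 1 n \<and> ?t s * (?t y2 ^\<^sub>m k * ?t u) = 0\<^sub>m 1 1"
    using x[OF s] u[OF s] by simp
   moreover have "?t s \<in> carrier_mat 1 m" using s by simp
   ultimately have "?t s = 0\<^sub>m 1 m" using G unfolding z_eq dual.simps generating.simps by blast
   then show "s = 0\<^sub>m m 1" unfolding t0[of s m 1] .
  qed
 next
  assume C: "cogenerating n m z"
  show "generating m n (dual z)"
   unfolding z_eq dual.simps generating.simps
  proof (intro ballI impI)
   fix l :: "complex mat" assume l: "l \<in> carrier_mat 1 m"
    and k: "\<forall>k. l * (?t y2 ^\<^sub>m k * (- ?t x)) = 0\<^sub>m 1 n \<and> l * (?t y2 ^\<^sub>m k * ?t u) = 0\<^sub>m 1 1"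
   have s: "?t l \<in> carrier_mat m 1" using l by simp
   have "\<forall>k. x * (y2 ^\<^sub>m k * ?t l) = 0\<^sub>m n 1 \<and> u * (y2 ^\<^sub>m k * ?t l) = 0\<^sub>m 1 1"
    using k x[OF s] u[OF s] by simp
   then have "?t l = 0\<^sub>m m 1" using C s unfolding z_eq cogenerating.simps by blast
   then show "l = 0\<^sub>m 1 m" unfolding t0[of l 1 m] .
  qed
 qed
qed

lemma dual_points:
 assumes "z \<in> triangle_points m n"
 shows "dual z \<in> triangle_points n m" "dual (dual z) = z"
proof -
 have z: "z \<in> quint_space n m" "moment_eq n m z" "generating n m z" "cogenerating n m z"
  using assms unfolding triangle_points_iff by auto
 show dd: "dual (dual z) = z" by (rule dual_dual[OF z(1)])
 have "cogenerating m n (dual z)" using dual_generating[OF dual_quint[OF z(1)]] z(3) unfolding dd by simp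
 then show "dual z \<in> triangle_points n m"
  unfolding triangle_points_iff using dual_quint[OF z(1)] dual_moment[OF z(1,2)] dual_generating[OF z(1)] z(4) by simp
qed

lemma dual_points_iff:
 assumes z: "z \<in> quint_space n m"
 shows "z \<in> triangle_points m n \<longleftrightarrow> dual z \<in> triangle_points n m"
 using dual_points[of z m n] dual_points[of "dual z" n m] dual_dual[OF z] by metis

lemma dual_dets: "cyclic_det m (dual z) = cocyclic_det m z" "cocyclic_det n (dual z) = cyclic_det n z"
 by (cases z, simp)+

text \<open>The sign \<open>(-1)\<^sup>n\<close> is that of \<open>\<sigma>\<close>.\<close>

fun swap :: "nat \<Rightarrow> wh_point \<Rightarrow> wh_point" where
 "swap n (g, h, a, b) = ((-1) ^ n \<cdot>\<^sub>m h, g, b, a)"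

fun unswap :: "nat \<Rightarrow> wh_point \<Rightarrow> wh_point" where
 "unswap n (h, g, b, a) = (g, (-1) ^ n \<cdot>\<^sub>m h, a, b)"

lemma det_sign: "h \<in> carrier_mat m m \<Longrightarrow> det ((-1) ^ n \<cdot>\<^sub>m h) \<noteq> 0 \<longleftrightarrow> det (h :: complex mat) \<noteq> 0"
 by simp

lemma sign_sign: "(-1) ^ n \<cdot>\<^sub>m ((-1) ^ n \<cdot>\<^sub>m h) = (h :: complex mat)"
 by (intro eq_matI) (auto simp flip: mult.assoc power_mult_distrib)

lemma swap_points:
 assumes n: "0 < n" and m: "0 < m"
 shows "w \<in> points (Wh n m) \<Longrightarrow> swap n w \<in> points (Wh m n)"
  "w' \<in> points (Wh m n) \<Longrightarrow> unswap n w' \<in> points (Wh n m)"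
  "swap n (unswap n w') = w'" "unswap n (swap n w) = w"
proof -
 show "w \<in> points (Wh n m) \<Longrightarrow> swap n w \<in> points (Wh m n)"
  by (cases w) (simp add: Wh_points_iff[OF n m] Wh_points_iff[OF m n])
 show "w' \<in> points (Wh m n) \<Longrightarrow> unswap n w' \<in> points (Wh n m)"
  by (cases w') (simp add: Wh_points_iff[OF n m] Wh_points_iff[OF m n])
 show "swap n (unswap n w') = w'" by (cases w') (simp add: sign_sign)
 show "unswap n (swap n w) = w" by (cases w) (simp add: sign_sign)
qed

text \<open>The chart on which \<open>u\<close> is cocyclic, obtained from the first one by duality.\<close>

definition psi' :: "nat \<Rightarrow> nat \<Rightarrow> wh_point \<Rightarrow> quintuple" where
 "psi' n m w = dual (psi m n (swap n w))"

definition psi'_inv :: "nat \<Rightarrow> nat \<Rightarrow> quintuple \<Rightarrow> wh_point" where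
 "psi'_inv n m z = unswap n (psi_inv m n (dual z))"

lemma psi'_points:
 assumes n: "0 < n" and m: "0 < m" and w: "w \<in> points (Wh n m)"
 shows "psi' n m w \<in> triangle_points m n" "cocyclic_det m (psi' n m w) \<noteq> 0" "psi'_inv n m (psi' n m w) = w"
proof -
 note P = psi_points[OF m n swap_points(1)[OF n m w]]
 note Q = dual_points[OF P(1)]
 show "psi' n m w \<in> triangle_points m n" unfolding psi'_def by (rule Q(1))
 show "cocyclic_det m (psi' n m w) \<noteq> 0" unfolding psi'_def dual_dets by (rule P(2))
 show "psi'_inv n m (psi' n m w) = w" unfolding psi'_def psi'_inv_def Q(2) P(3) by (rule swap_points(4)[OF n m])
qed

lemma psi'_inv_points:
 assumes n: "0 < n" and m: "0 < m" and z: "z \<in> triangle_points m n" and d: "cocyclic_det m z \<noteq> 0"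
 shows "psi'_inv n m z \<in> points (Wh n m)" "psi' n m (psi'_inv n m z) = z"
proof -
 note Q = dual_points[OF z]
 have "cyclic_det m (dual z) \<noteq> 0" unfolding dual_dets by (rule d)
 note P = psi_inv_points[OF m n Q(1) this]
 show "psi'_inv n m z \<in> points (Wh n m)" unfolding psi'_inv_def by (rule swap_points(2)[OF n m P(1)])
 show "psi' n m (psi'_inv n m z) = z" unfolding psi'_def psi'_inv_def swap_points(3)[OF n m] P(2) by (rule Q(2))
qed

section \<open>The two charts differ by sigma\<close>

lemma eval_char_commute: "b \<in> carrier_mat m m \<Longrightarrow> eval_char n a m b * b = b * eval_char n a m b"
 by (rule eval_char_intertwine[of _ m _ m]) auto

lemma inv_commute:
 assumes P: "(P :: complex mat) \<in> carrier_mat m m" "det P \<noteq> 0" and b: "b \<in> carrier_mat m m" and eq: "P * b = b * P"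
 shows "inv_mat P * b = b * inv_mat P"
proof -
 note I = inv_mat[OF P]
 have "inv_mat P * b = inv_mat P * (b * P) * inv_mat P"
  using I b P by (simp add: mat_assoc)
 also have "\<dots> = (inv_mat P * P) * (b * inv_mat P)" unfolding eq[symmetric] using I(1) b P by (simp add: mat_assoc)
 finally show ?thesis using I b by simp
qed

text \<open>A point of the second chart in terms of the data that determine a point of the first one. The
 vector \<open>v\<close> is the image of \<open>g\<close> times the first unit vector under
 \<open>q(y1)\<close>, which produces the factor \<open>q(C_p)\<close> in \<open>\<sigma>\<close>.\<close>

lemma psi'_form:
 assumes n: "0 < n" and m: "0 < m" and w: "(g, h, a, b) \<in> points (Wh n m)"
 obtains x y1 y2 v u where "psi' n m (g, h, a, b) = (x, y1, y2, v, u)"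
  "y1 * g = g * a" "transpose_mat y2 * ((-1) ^ n \<cdot>\<^sub>m h) = ((-1) ^ n \<cdot>\<^sub>m h) * b"
  "v = (g * eval_char m b n a) * first_unit n" "transpose_mat u = ((-1) ^ n \<cdot>\<^sub>m h) * first_unit m"
proof -
 have g: "g \<in> carrier_mat n n" "det g \<noteq> 0" and h: "h \<in> carrier_mat m m" "det h \<noteq> 0"
  and a: "a \<in> companions n" and b: "b \<in> companions m"
  using w Wh_points_iff[OF n m] by auto
 have ac: "a \<in> carrier_mat n n" and bc: "b \<in> carrier_mat m m" using companions_carrier a b by auto
 let ?h = "(-1) ^ n \<cdot>\<^sub>m h" and ?r = "transpose_mat (g * first_unit n)" and ?Y = "dual_conj g a"
 have h': "?h \<in> carrier_mat m m" "det ?h \<noteq> 0" using h det_sign by auto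
 note G = dual_conj[OF g ac] and H = conj_eq[OF h' bc]
 have r: "?r \<in> carrier_mat 1 n" using g(1) by auto
 let ?x = "- transpose_mat (?h * syl_x m n b ?r ?Y)"
 have eq: "psi' n m (g, h, a, b) = (?x, transpose_mat ?Y, transpose_mat (?h * b * inv_mat ?h),
   transpose_mat (syl_u m n b ?r ?Y), transpose_mat (?h * first_unit m))"
  unfolding psi'_def swap.simps psi.simps dual.simps ..
 have Yt: "transpose_mat ?Y \<in> carrier_mat n n" using G(1) by simp
 have "transpose_mat (syl_u m n b ?r ?Y) = transpose_mat (eval_char m b n ?Y) * (g * first_unit n)"
  unfolding syl_u_eval[OF r G(1)] using transpose_mult[OF r eval_char_carrier(1)] by simp
 also have "\<dots> = (eval_char m b n (transpose_mat ?Y) * g) * first_unit n"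
  unfolding eval_char_transpose[OF G(1)] using g(1) by (simp add: mat_assoc)
 also have "eval_char m b n (transpose_mat ?Y) * g = g * eval_char m b n a"
  by (rule eval_char_intertwine[OF Yt g(1) ac G(2)])
 finally have v: "transpose_mat (syl_u m n b ?r ?Y) = (g * eval_char m b n a) * first_unit n" .
 show thesis
  by (rule that[OF eq G(2)]) (use H v in auto)
qed

text \<open>Both sides are solutions of the moment map equation with the same \<open>y1\<close>,
 \<open>y2\<close> and \<open>v\<close>. Such a solution is determined by the last row \<open>r\<close> of
 \<open>x\<close> in the Krylov basis, and \<open>r\<close> by \<open>u = r p(y2)\<close>, because
 \<open>p(y2)\<close> is invertible.\<close>

lemma sigma_charts:
 assumes n: "0 < n" and m: "0 < m" and w: "w \<in> sigma_dom n m"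
 shows "sigma_rho n m w \<in> points (Wh n m)" "psi n m (sigma_rho n m w) = psi' n m w" "w \<in> points (Wh n m)"
proof -
 obtain g h a b where w_eq: "w = (g, h, a, b)" by (cases w)
 have wp: "(g, h, a, b) \<in> points (Wh n m)"
  and inv: "invertible_mat (eval_poly_mat n (poly_of_companion m b) a)" "invertible_mat (eval_poly_mat m (poly_of_companion n a) b)"
  using w unfolding w_eq sigma_dom_def by auto
 then show "w \<in> points (Wh n m)" unfolding w_eq by simp
 have g: "g \<in> carrier_mat n n" "det g \<noteq> 0" and h: "h \<in> carrier_mat m m" "det h \<noteq> 0"
  and a: "a \<in> companions n" and b: "b \<in> companions m"
  using wp Wh_points_iff[OF n m] by auto
 have ac: "a \<in> carrier_mat n n" and bc: "b \<in> carrier_mat m m" using companions_carrier a b by auto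
 define Q where "Q = eval_char m b n a"
 define P where "P = eval_char n a m b"
 have Q: "Q \<in> carrier_mat n n" "det Q \<noteq> 0" and P: "P \<in> carrier_mat m m" "det P \<noteq> 0"
  using inv unfolding eval_poly_mat_companion[OF m b] eval_poly_mat_companion[OF n a] Q_def P_def
  by (simp_all add: invertible_mat_iff_det[of _ n] invertible_mat_iff_det[of _ m])
 define h' where "h' = (-1) ^ n \<cdot>\<^sub>m h"
 have h': "h' \<in> carrier_mat m m" "det h' \<noteq> 0" using h det_sign unfolding h'_def by auto
 define G where "G = g * Q"
 define H where "H = h' * inv_mat P"
 note IP = inv_mat[OF P]
 have G: "G \<in> carrier_mat n n" "det G \<noteq> 0" using g Q det_mult[OF g(1) Q(1)] unfolding G_def by auto
 have HP: "H * P = h'" unfolding H_def using h'(1) IP P by (simp add: mat_assoc)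
 have Hc: "H \<in> carrier_mat m m" using h'(1) IP(1) unfolding H_def by auto
 have H: "H \<in> carrier_mat m m" "det H \<noteq> 0" using Hc h'(2) det_mult[OF Hc P(1)] unfolding HP by auto
 have S: "sigma_rho n m w = (G, H, a, b)"
  unfolding w_eq sigma_rho.simps Let_def eval_poly_mat_companion[OF m b] eval_poly_mat_companion[OF n a]
   G_def H_def Q_def[symmetric] P_def[symmetric] h'_def
  using h(1) IP(1) by (simp add: mult_smult_assoc_mat[of _ m m _ m])
 show "sigma_rho n m w \<in> points (Wh n m)" unfolding S Wh_points_iff[OF n m] using G H a b by blast
 obtain x y1 y2 v u where z: "psi' n m (g, h, a, b) = (x, y1, y2, v, u)"
  and y1: "y1 * g = g * a" and y2: "transpose_mat y2 * h' = h' * b"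
  and v: "v = G * first_unit n" and u: "transpose_mat u = h' * first_unit m"
  using psi'_form[OF n m wp] unfolding h'_def G_def Q_def by metis
 have zt: "(x, y1, y2, v, u) \<in> triangle_points m n" using psi'_points(1)[OF n m wp] unfolding z .
 then have zq: "(x, y1, y2, v, u) \<in> quint_space n m" "moment_eq n m (x, y1, y2, v, u)"
  unfolding triangle_points_iff by auto
 note z' = quint_spaceD[OF zq(1)]
 have y2t: "transpose_mat y2 \<in> carrier_mat m m" using z'(3) by simp
 have y1G: "y1 * G = G * a"
 proof -
  have "y1 * G = (y1 * g) * Q" unfolding G_def using z' g Q by (simp add: mat_assoc)
  also have "\<dots> = g * (a * Q)" unfolding y1 using g ac Q by (simp add: mat_assoc)
  also have "a * Q = Q * a" unfolding Q_def by (rule eval_char_commute[OF ac, symmetric])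
  finally show ?thesis unfolding G_def using g ac Q by (simp add: mat_assoc)
 qed
 have y2H: "transpose_mat y2 * H = H * b"
 proof -
  have "transpose_mat y2 * H = (transpose_mat y2 * h') * inv_mat P"
   unfolding H_def using y2t h' IP(1) z'(3) by (simp add: mat_assoc)
  also have "\<dots> = h' * (b * inv_mat P)" unfolding y2 using h' bc IP(1) by (simp add: mat_assoc)
  also have "b * inv_mat P = inv_mat P * b"
   by (rule inv_commute[OF P bc, symmetric]) (unfold P_def, rule eval_char_commute[OF bc])
  finally show ?thesis unfolding H_def using h' bc IP(1) by (simp add: mat_assoc)
 qed
 define r where "r = last_row n m (inv_mat G * x)"
 note C = chart_form[OF n zq G a y1G v r_def]
 have r: "r \<in> carrier_mat 1 m" unfolding r_def by simp
 let ?R = "eval_char n a m (transpose_mat y2)"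
 have RH: "?R * H = h'" using eval_char_intertwine[OF y2t Hc bc y2H, of n a] HP unfolding P_def by simp
 have Rd: "det ?R \<noteq> 0" using det_mult[OF eval_char_carrier(1) Hc, of n a "transpose_mat y2"] h'(2) unfolding RH by auto
 have "transpose_mat u = ?R * transpose_mat r"
  unfolding C(2) syl_u_eval[OF r z'(3)] eval_char_transpose[OF z'(3)] using transpose_mult[OF r eval_char_carrier(1)] by simp
 moreover have "transpose_mat u = ?R * (H * first_unit m)"
  unfolding u RH[symmetric] using Hc by (simp add: mat_assoc)
 ultimately have "inv_mat ?R * (?R * (H * first_unit m)) = inv_mat ?R * (?R * transpose_mat r)" by simp
 then have "(inv_mat ?R * ?R) * (H * first_unit m) = (inv_mat ?R * ?R) * transpose_mat r"
  using inv_mat(1)[OF eval_char_carrier(1) Rd] Hc r by (simp add: mat_assoc)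
 then have "H * first_unit m = transpose_mat r"
  using inv_mat(3)[OF eval_char_carrier(1) Rd] Hc r by simp
 then have Hr: "transpose_mat (H * first_unit m) = r" by simp
 have "psi n m (G, H, a, b) = (x, y1, y2, v, u)"
  unfolding psi.simps Hr dual_conj_unique[OF H z'(3) y2H bc] conj_unique(1)[OF G z'(2) ac y1G]
  using C v by simp
 then show "psi n m (sigma_rho n m w) = psi' n m w" unfolding S unfolding w_eq z .
qed

text \<open>If \<open>v\<close> is cyclic, then \<open>q(C_p)\<close> is invertible, since the Krylov matrix
 of \<open>y1\<close> and \<open>v\<close> is \<open>g q(C_p)\<close>. The factor \<open>p(C_q)\<close> is
 invertible because \<open>u\<close> is cocyclic and equals the last row times \<open>p(y2)\<close>.\<close>

lemma overlap_sigma_dom: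
 assumes n: "0 < n" and m: "0 < m" and w: "w \<in> points (Wh n m)" and d: "cyclic_det n (psi' n m w) \<noteq> 0"
 shows "w \<in> sigma_dom n m"
proof -
 obtain g h a b where w_eq: "w = (g, h, a, b)" by (cases w)
 have wp: "(g, h, a, b) \<in> points (Wh n m)" using w unfolding w_eq .
 have g: "g \<in> carrier_mat n n" "det g \<noteq> 0" and h: "h \<in> carrier_mat m m" "det h \<noteq> 0"
  and a: "a \<in> companions n" and b: "b \<in> companions m"
  using wp Wh_points_iff[OF n m] by auto
 have ac: "a \<in> carrier_mat n n" and bc: "b \<in> carrier_mat m m" using companions_carrier a b by auto
 define Q where "Q = eval_char m b n a"
 define P where "P = eval_char n a m b"
 have Qc: "Q \<in> carrier_mat n n" and Pc: "P \<in> carrier_mat m m" unfolding Q_def P_def by auto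
 define h' where "h' = (-1) ^ n \<cdot>\<^sub>m h"
 have h': "h' \<in> carrier_mat m m" "det h' \<noteq> 0" using h det_sign unfolding h'_def by auto
 obtain x y1 y2 v u where z: "psi' n m (g, h, a, b) = (x, y1, y2, v, u)"
  and y1: "y1 * g = g * a" and y2: "transpose_mat y2 * h' = h' * b"
  and v: "v = (g * Q) * first_unit n" and u: "transpose_mat u = h' * first_unit m"
  using psi'_form[OF n m wp] unfolding h'_def Q_def by metis
 have zq: "(x, y1, y2, v, u) \<in> quint_space n m" "moment_eq n m (x, y1, y2, v, u)"
  using psi'_points(1)[OF n m wp] unfolding z triangle_points_iff by auto
 note z' = quint_spaceD[OF zq(1)]
 have y2t: "transpose_mat y2 \<in> carrier_mat m m" using z'(3) by simp
 have G: "g * Q \<in> carrier_mat n n" using g Qc by auto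
 have y1G: "y1 * (g * Q) = (g * Q) * a"
 proof -
  have "y1 * (g * Q) = (y1 * g) * Q" using z' g Qc by (simp add: mat_assoc)
  also have "\<dots> = g * (a * Q)" unfolding y1 using g ac Qc by (simp add: mat_assoc)
  also have "a * Q = Q * a" unfolding Q_def by (rule eval_char_commute[OF ac, symmetric])
  finally show ?thesis using g ac Qc by (simp add: mat_assoc)
 qed
 have "krylov n y1 v = g * Q" unfolding v by (rule krylov_conj[OF n G a z'(2) y1G])
 then have Gd: "det (g * Q) \<noteq> 0" using d unfolding w_eq z by simp
 then have Qd: "det Q \<noteq> 0" using det_mult[OF g(1) Qc] by auto
 define r where "r = last_row n m (inv_mat (g * Q) * x)"
 have r: "r \<in> carrier_mat 1 m" unfolding r_def by simp
 note C = chart_form[OF n zq G Gd a y1G v r_def]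
 let ?R = "eval_char n a m (transpose_mat y2)"
 have "transpose_mat u = ?R * transpose_mat r"
  unfolding C(2) syl_u_eval[OF r z'(3)] eval_char_transpose[OF z'(3)] using transpose_mult[OF r eval_char_carrier(1)] by simp
 then have "krylov m (transpose_mat y2) (transpose_mat u) = ?R * krylov m (transpose_mat y2) (transpose_mat r)"
  using krylov_intertwine[OF y2t eval_char_carrier(1) y2t _ eval_char_commute[OF y2t, symmetric], of "transpose_mat r"] r by simp
 moreover have "det (krylov m (transpose_mat y2) (transpose_mat u)) \<noteq> 0"
  unfolding u krylov_conj[OF m h'(1) b y2t y2] by (rule h'(2))
 ultimately have Rd: "det ?R \<noteq> 0"
  using det_mult[OF eval_char_carrier(1) krylov_carrier(1), of n a m "transpose_mat y2"] by auto
 have "?R * h' = h' * P" unfolding P_def by (rule eval_char_intertwine[OF y2t h'(1) bc y2])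
 then have "det (h' * P) \<noteq> 0" using det_mult[OF eval_char_carrier(1) h'(1), of n a "transpose_mat y2"] Rd h'(2) by simp
 then have Pd: "det P \<noteq> 0" using det_mult[OF h'(1) Pc] by auto
 show ?thesis
  unfolding w_eq sigma_dom_def using wp Qd Pd Qc Pc
   invertible_mat_iff_det[OF Qc] invertible_mat_iff_det[OF Pc]
  by (simp add: eval_poly_mat_companion[OF m b] eval_poly_mat_companion[OF n a] Q_def P_def)
qed

section \<open>Equivariance of the first chart\<close>

lemma mult_right_cancel_zero:
 assumes t: "(t :: complex mat) \<in> carrier_mat m m" "det t \<noteq> 0" and M: "M \<in> carrier_mat r m"
 shows "M * t = 0\<^sub>m r m \<longleftrightarrow> M = 0\<^sub>m r m"
proof
 assume "M * t = 0\<^sub>m r m"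
 then have "(M * t) * inv_mat t = 0\<^sub>m r m" using inv_mat(1)[OF t] by simp
 moreover have "(M * t) * inv_mat t = M"
  using inv_mat(1,2)[OF t] t M by (simp add: mat_assoc)
 ultimately show "M = 0\<^sub>m r m" by simp
qed (use t in simp)

lemma psi_equivariant:
 assumes n: "0 < n" and m: "0 < m" and w: "w \<in> points (Wh n m)" and \<gamma>: "\<gamma> \<in> GL n \<times> GL m"
 shows "psi n m (wh_act \<gamma> w) = triangle_act \<gamma> (psi n m w)" "wh_act \<gamma> w \<in> points (Wh n m)"
proof -
 obtain g h a b where w_eq: "w = (g, h, a, b)" by (cases w)
 obtain p q where \<gamma>_eq: "\<gamma> = (p, q)" by (cases \<gamma>)
 have g: "g \<in> carrier_mat n n" "det g \<noteq> 0" and h: "h \<in> carrier_mat m m" "det h \<noteq> 0"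
  and a: "a \<in> companions n" and b: "b \<in> companions m"
  using w Wh_points_iff[OF n m] unfolding w_eq by auto
 have p: "p \<in> carrier_mat n n" "det p \<noteq> 0" and q: "q \<in> carrier_mat m m" "det q \<noteq> 0"
  using \<gamma> unfolding \<gamma>_eq by (auto simp: GL_iff)
 have ac: "a \<in> carrier_mat n n" and bc: "b \<in> carrier_mat m m" using companions_carrier a b by auto
 have pg: "p * g \<in> carrier_mat n n" "det (p * g) \<noteq> 0" and qh: "q * h \<in> carrier_mat m m" "det (q * h) \<noteq> 0"
  using p g q h det_mult[OF p(1) g(1)] det_mult[OF q(1) h(1)] by auto
 show "wh_act \<gamma> w \<in> points (Wh n m)" unfolding w_eq \<gamma>_eq wh_act.simps Wh_points_iff[OF n m] using pg qh a b by blast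
 note Y = dual_conj[OF h bc]
 let ?Y = "dual_conj h b" and ?t = "transpose_mat q"
 have Yt: "transpose_mat ?Y \<in> carrier_mat m m" using Y(1) by simp
 note Z = dual_conj[OF q Yt]
 let ?Z = "dual_conj q (transpose_mat ?Y)"
 have Z_eq: "?Z = inv_mat ?t * ?Y * ?t" unfolding dual_conj_def by simp
 have Zqh: "transpose_mat ?Z * (q * h) = (q * h) * b"
 proof -
  have "transpose_mat ?Z * (q * h) = (transpose_mat ?Z * q) * h" using Z(1) q h by (simp add: mat_assoc)
  also have "\<dots> = q * (transpose_mat ?Y * h)" unfolding Z(2) using Yt Y(1) q h by (simp add: mat_assoc)
  also have "\<dots> = (q * h) * b" unfolding Y(2) using q h bc by (simp add: mat_assoc)
  finally show ?thesis .
 qed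
 have dc: "dual_conj (q * h) b = ?Z" by (rule dual_conj_unique[OF qh Z(1) Zqh bc])
 have tZ: "?Y * ?t = ?t * ?Z" using Z(3) by simp
 let ?r = "transpose_mat (h * first_unit m)"
 have r: "?r \<in> carrier_mat 1 m" using h(1) by auto
 have tc: "?t \<in> carrier_mat m m" using q(1) by simp
 have rq: "transpose_mat (q * h * first_unit m) = ?r * ?t"
 proof -
  have "q * h * first_unit m = q * (h * first_unit m)" using q h by (simp add: mat_assoc)
  moreover have "h * first_unit m \<in> carrier_mat m 1" using h(1) by auto
  ultimately show ?thesis using transpose_mult[OF q(1)] by simp
 qed
 note S = syl_mult[OF r Y(1) Z(1) tc tZ, of n a]
 note C = conj_eq[OF g ac]
 have yp: "p * (g * a * inv_mat g) * inv_mat p \<in> carrier_mat n n"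
  "(p * (g * a * inv_mat g) * inv_mat p) * p = p * (g * a * inv_mat g)" using conj_eq[OF p C(1)] by auto
 have ypg: "(p * (g * a * inv_mat g) * inv_mat p) * (p * g) = (p * g) * a"
 proof -
  let ?y = "p * (g * a * inv_mat g) * inv_mat p"
  have "?y * (p * g) = (?y * p) * g"
   by (rule assoc_mult_mat[OF yp(1) p(1) g(1), symmetric])
  also have "\<dots> = p * ((g * a * inv_mat g) * g)" unfolding yp(2) by (rule assoc_mult_mat[OF p(1) C(1) g(1)])
  also have "\<dots> = (p * g) * a" unfolding C(2) by (rule assoc_mult_mat[OF p(1) g(1) ac, symmetric])
  finally show ?thesis .
 qed
 have y1: "(p * g) * a * inv_mat (p * g) = p * (g * a * inv_mat g) * inv_mat p"
  by (rule conj_unique(1)[OF pg yp(1) ac ypg])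
 have x: "p * g * syl_x n m a (?r * ?t) ?Z = p * (g * syl_x n m a ?r ?Y) * ?t"
  unfolding S(1)[symmetric] using p g q by (simp add: mat_assoc)
 have v: "p * g * first_unit n = p * (g * first_unit n)" using p g by (simp add: mat_assoc)
 show "psi n m (wh_act \<gamma> w) = triangle_act \<gamma> (psi n m w)"
  unfolding w_eq \<gamma>_eq wh_act.simps psi.simps triangle_act.simps dc rq x v y1 S(2) Z_eq[symmetric] ..
qed

lemma triangle_act_points:
 assumes z: "z \<in> triangle_points m n" and \<gamma>: "\<gamma> \<in> GL n \<times> GL m"
 shows "triangle_act \<gamma> z \<in> triangle_points m n"
proof -
 obtain x y1 y2 v u where z_eq: "z = (x, y1, y2, v, u)" by (cases z)
 obtain p q where \<gamma>_eq: "\<gamma> = (p, q)" by (cases \<gamma>)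
 have p: "p \<in> carrier_mat n n" "det p \<noteq> 0" and q: "q \<in> carrier_mat m m" "det q \<noteq> 0"
  using \<gamma> unfolding \<gamma>_eq by (auto simp: GL_iff)
 have zt: "(x, y1, y2, v, u) \<in> quint_space n m" "moment_eq n m (x, y1, y2, v, u)"
  "generating n m (x, y1, y2, v, u)" "cogenerating n m (x, y1, y2, v, u)"
  using z unfolding z_eq triangle_points_iff by auto
 note z' = quint_spaceD[OF zt(1)]
 let ?t = "transpose_mat q"
 have t: "?t \<in> carrier_mat m m" "det ?t \<noteq> 0" using q det_transpose[OF q(1)] by auto
 note Ip = inv_mat[OF p] and It = inv_mat[OF t]
 let ?x = "p * x * ?t" and ?y1 = "p * y1 * inv_mat p" and ?y2 = "inv_mat ?t * y2 * ?t" and ?v = "p * v" and ?u = "u * ?t"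
 have c: "?x \<in> carrier_mat n m" "?y1 \<in> carrier_mat n n" "?y2 \<in> carrier_mat m m" "?v \<in> carrier_mat n 1" "?u \<in> carrier_mat 1 m"
  using z' p t Ip(1) It(1) by auto
 have y1p: "?y1 * p = p * y1" by (rule conj_eq(2)[OF p z'(2)])
 have ty2: "y2 * ?t = ?t * ?y2"
 proof -
  have "?t * ?y2 = (?t * inv_mat ?t) * (y2 * ?t)" using t(1) It(1) z'(3) q(1) by (simp add: mat_assoc)
  then show ?thesis using It(2) z'(3) t(1) by simp
 qed
 have "moment_eq n m (?x, ?y1, ?y2, ?v, ?u)"
 proof -
  have 1: "?y1 * ?x = p * (y1 * x) * ?t"
  proof -
   have "?y1 * ?x = (?y1 * p) * (x * ?t)" using c p z' q Ip(1) by (simp add: mat_assoc)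
   then show ?thesis unfolding y1p using p z' q by (simp add: mat_assoc)
  qed
  have 2: "?x * ?y2 = p * (x * y2) * ?t"
  proof -
   have "?x * ?y2 = (p * x) * (?t * ?y2)" using c p z' t q It(1) by (simp add: mat_assoc)
   then show ?thesis unfolding ty2[symmetric] using p z' q by (simp add: mat_assoc)
  qed
  have 3: "?v * ?u = p * (v * u) * ?t" using p z' q by (simp add: mat_assoc)
  have A: "y1 * x \<in> carrier_mat n m" "x * y2 \<in> carrier_mat n m" "v * u \<in> carrier_mat n m" using z' by auto
  have "?y1 * ?x - ?x * ?y2 + ?v * ?u = p * (y1 * x - x * y2 + v * u) * ?t"
   unfolding 1 2 3 using A p(1) t(1)
   by (simp add: mult_add_distrib_mat[of p n n _ m] mult_minus_distrib_mat[of p n n _ m]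
    add_mult_distrib_mat[of _ n m _ ?t m] minus_mult_distrib_mat[of _ n m _ ?t m] minus_carrier_mat)
  then show ?thesis using zt(2) p(1) t(1) by simp
 qed
 moreover have "generating n m (?x, ?y1, ?y2, ?v, ?u)"
  unfolding generating.simps
 proof (intro ballI impI)
  fix l :: "complex mat" assume l: "l \<in> carrier_mat 1 n"
   and k: "\<forall>k. l * (?y1 ^\<^sub>m k * ?x) = 0\<^sub>m 1 m \<and> l * (?y1 ^\<^sub>m k * ?v) = 0\<^sub>m 1 1"
  have lp: "l * p \<in> carrier_mat 1 n" using l p by auto
  have "(l * p) * (y1 ^\<^sub>m k * x) = 0\<^sub>m 1 m \<and> (l * p) * (y1 ^\<^sub>m k * v) = 0\<^sub>m 1 1" for k
  proof -
   have yk: "y1 ^\<^sub>m k \<in> carrier_mat n n" "?y1 ^\<^sub>m k \<in> carrier_mat n n" using z'(2) c(2) by auto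
   note pk = pow_mat_intertwine[OF c(2) p(1) z'(2) y1p, of k]
   have "?y1 ^\<^sub>m k * ?v = (?y1 ^\<^sub>m k * p) * v" by (rule assoc_mult_mat[OF yk(2) p(1) z'(4), symmetric])
   also have "\<dots> = p * (y1 ^\<^sub>m k * v)" unfolding pk by (rule assoc_mult_mat[OF p(1) yk(1) z'(4)])
   finally have 1: "l * (?y1 ^\<^sub>m k * ?v) = (l * p) * (y1 ^\<^sub>m k * v)"
    using assoc_mult_mat[OF l p(1) mult_carrier_mat[OF yk(1) z'(4)]] by simp
   have xt: "x * ?t \<in> carrier_mat n m" using z'(1) t(1) by auto
   have "?x = p * (x * ?t)" by (rule assoc_mult_mat[OF p(1) z'(1) t(1)])
   then have "?y1 ^\<^sub>m k * ?x = (?y1 ^\<^sub>m k * p) * (x * ?t)" using assoc_mult_mat[OF yk(2) p(1) xt] by simp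
   also have "\<dots> = p * (y1 ^\<^sub>m k * (x * ?t))" unfolding pk by (rule assoc_mult_mat[OF p(1) yk(1) xt])
   also have "y1 ^\<^sub>m k * (x * ?t) = (y1 ^\<^sub>m k * x) * ?t" by (rule assoc_mult_mat[OF yk(1) z'(1) t(1), symmetric])
   finally have "l * (?y1 ^\<^sub>m k * ?x) = (l * p) * ((y1 ^\<^sub>m k * x) * ?t)"
    using assoc_mult_mat[OF l p(1) mult_carrier_mat[OF mult_carrier_mat[OF yk(1) z'(1)] t(1)]] by simp
   also have "\<dots> = ((l * p) * (y1 ^\<^sub>m k * x)) * ?t"
    by (rule assoc_mult_mat[OF lp mult_carrier_mat[OF yk(1) z'(1)] t(1), symmetric])
   finally have "((l * p) * (y1 ^\<^sub>m k * x)) * ?t = 0\<^sub>m 1 m" using k by simp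
   then have "(l * p) * (y1 ^\<^sub>m k * x) = 0\<^sub>m 1 m"
    using mult_right_cancel_zero[OF t mult_carrier_mat[OF lp mult_carrier_mat[OF yk(1) z'(1)]]] by simp
   with 1 k show ?thesis by simp
  qed
  then have "l * p = 0\<^sub>m 1 n" using zt(3) lp unfolding generating.simps by blast
  then show "l = 0\<^sub>m 1 n" using mult_right_cancel_zero[OF p l] by simp
 qed
 moreover have "cogenerating n m (?x, ?y1, ?y2, ?v, ?u)"
  unfolding cogenerating.simps
 proof (intro ballI impI)
  fix s :: "complex mat" assume s: "s \<in> carrier_mat m 1"
   and k: "\<forall>k. ?x * (?y2 ^\<^sub>m k * s) = 0\<^sub>m n 1 \<and> ?u * (?y2 ^\<^sub>m k * s) = 0\<^sub>m 1 1"
  have ts: "?t * s \<in> carrier_mat m 1" using s t by auto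
  have "x * (y2 ^\<^sub>m k * (?t * s)) = 0\<^sub>m n 1 \<and> u * (y2 ^\<^sub>m k * (?t * s)) = 0\<^sub>m 1 1" for k
  proof -
   have yk: "y2 ^\<^sub>m k \<in> carrier_mat m m" "?y2 ^\<^sub>m k \<in> carrier_mat m m" using z'(3) c(3) by auto
   have ys: "?y2 ^\<^sub>m k * s \<in> carrier_mat m 1" by (rule mult_carrier_mat[OF yk(2) s])
   have "y2 ^\<^sub>m k * (?t * s) = (y2 ^\<^sub>m k * ?t) * s" by (rule assoc_mult_mat[OF yk(1) t(1) s, symmetric])
   also have "\<dots> = ?t * (?y2 ^\<^sub>m k * s)" unfolding pow_mat_intertwine[OF z'(3) t(1) c(3) ty2]
    by (rule assoc_mult_mat[OF t(1) yk(2) s])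
   finally have e: "y2 ^\<^sub>m k * (?t * s) = ?t * (?y2 ^\<^sub>m k * s)" .
   have "u * (y2 ^\<^sub>m k * (?t * s)) = ?u * (?y2 ^\<^sub>m k * s)" unfolding e by (rule assoc_mult_mat[OF z'(5) t(1) ys, symmetric])
   moreover have "p * (x * (y2 ^\<^sub>m k * (?t * s))) = 0\<^sub>m n 1"
   proof -
    have xt: "x * ?t \<in> carrier_mat n m" using z'(1) t(1) by auto
    have "p * (x * (y2 ^\<^sub>m k * (?t * s))) = p * ((x * ?t) * (?y2 ^\<^sub>m k * s))"
     unfolding e assoc_mult_mat[OF z'(1) t(1) ys] ..
    also have "\<dots> = (p * (x * ?t)) * (?y2 ^\<^sub>m k * s)" by (rule assoc_mult_mat[OF p(1) xt ys, symmetric])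
    also have "p * (x * ?t) = ?x" by (rule assoc_mult_mat[OF p(1) z'(1) t(1), symmetric])
    finally show ?thesis using k by simp
   qed
   moreover have "x * (y2 ^\<^sub>m k * (?t * s)) \<in> carrier_mat n 1"
    by (rule mult_carrier_mat[OF z'(1) mult_carrier_mat[OF yk(1) ts]])
   ultimately show ?thesis using mult_left_cancel_zero[OF p] k by simp
  qed
  then have "?t * s = 0\<^sub>m m 1" using zt(4) ts unfolding cogenerating.simps by blast
  then show "s = 0\<^sub>m m 1" using mult_left_cancel_zero[OF t s] by simp
 qed
 ultimately show ?thesis
  unfolding z_eq \<gamma>_eq triangle_act.simps triangle_points_iff using c by (simp add: quint_space_def)
qed

section \<open>The triangle part is affine\<close>

text \<open>The columns of \<open>x\<close>, followed by \<open>v, y1 v, ...\<close> up to size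
 \<open>n\<close>.\<close>

definition frame :: "nat \<Rightarrow> nat \<Rightarrow> quintuple \<Rightarrow> complex mat" where
 "frame n m z = mat n n (\<lambda>(i, j). if j < m then fst z $$ (i, j)
   else (fst (snd z) ^\<^sub>m (j - m) * fst (snd (snd (snd z)))) $$ (i, 0))"

lemma frame_carrier [simp]: "frame n m z \<in> carrier_mat n n" "dim_row (frame n m z) = n" "dim_col (frame n m z) = n"
 unfolding frame_def by simp_all

lemma frame_row:
 assumes z: "(x, y1, y2, v, u) \<in> quint_space n m" and r: "r \<in> carrier_mat 1 n" and j: "j < n"
 shows "(r * frame n m (x, y1, y2, v, u)) $$ (0, j) =
  (if j < m then (r * x) $$ (0, j) else (r * (y1 ^\<^sub>m (j - m) * v)) $$ (0, 0))"
proof -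
 note z' = quint_spaceD[OF z]
 have "(r * frame n m (x, y1, y2, v, u)) $$ (0, j) = (\<Sum>i<n. r $$ (0, i) * frame n m (x, y1, y2, v, u) $$ (i, j))"
  using r j by (subst mult_mat_entry) auto
 also have "\<dots> = (if j < m then (\<Sum>i<n. r $$ (0, i) * x $$ (i, j)) else (\<Sum>i<n. r $$ (0, i) * (y1 ^\<^sub>m (j - m) * v) $$ (i, 0)))"
  using j by (auto simp: frame_def intro!: sum.cong simp del: index_mult_mat)
 also have "(\<Sum>i<n. r $$ (0, i) * (y1 ^\<^sub>m (j - m) * v) $$ (i, 0)) = (r * (y1 ^\<^sub>m (j - m) * v)) $$ (0, 0)"
  using r z' by (subst mult_mat_entry[of 0 r 0]) auto
 also have "(if j < m then (\<Sum>i<n. r $$ (0, i) * x $$ (i, j)) else (r * (y1 ^\<^sub>m (j - m) * v)) $$ (0, 0)) =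
  (if j < m then (r * x) $$ (0, j) else (r * (y1 ^\<^sub>m (j - m) * v)) $$ (0, 0))"
  using r z' by (auto simp: mult_mat_entry simp del: index_mult_mat(1))
 finally show ?thesis .
qed

lemma mat_1_1: "A \<in> carrier_mat 1 1 \<Longrightarrow> A = 0\<^sub>m 1 1 \<longleftrightarrow> A $$ (0, 0) = (0 :: complex)"
 by (auto intro!: eq_matI)

lemma moment_row:
 assumes z: "(x, y1, y2, v, u) \<in> quint_space n m" "moment_eq n m (x, y1, y2, v, u)" and r: "r \<in> carrier_mat k n"
  and t: "t \<in> carrier_mat m l"
 shows "r * (y1 * (x * t)) + r * (v * (u * t)) = r * (x * (y2 * t))"
proof -
 note z' = quint_spaceD[OF z(1)]
 have A: "y1 * x \<in> carrier_mat n m" "x * y2 \<in> carrier_mat n m" "v * u \<in> carrier_mat n m" using z' by auto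
 have "y1 * x + v * u = x * y2"
 proof (rule eq_matI)
  fix i j assume "i < dim_row (x * y2)" "j < dim_col (x * y2)"
  then have ij: "i < n" "j < m" using z' by auto
  have e0: "(y1 * x - x * y2 + v * u) $$ (i, j) = 0" using z(2) ij by simp
  have e: "(y1 * x - x * y2 + v * u) $$ (i, j) = (y1 * x) $$ (i, j) - (x * y2) $$ (i, j) + (v * u) $$ (i, j)"
   "(y1 * x + v * u) $$ (i, j) = (y1 * x) $$ (i, j) + (v * u) $$ (i, j)"
   using A z' ij by (simp_all del: index_mult_mat(1))
  have "b - c + d = 0 \<Longrightarrow> b + d = c" for b c d :: complex by (simp add: algebra_simps)
  from this[OF e0[unfolded e(1)]] show "(y1 * x + v * u) $$ (i, j) = (x * y2) $$ (i, j)" unfolding e(2) .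
 qed (use A z' in auto)
 then have "r * ((y1 * x + v * u) * t) = r * ((x * y2) * t)" by simp
 moreover have "r * ((y1 * x + v * u) * t) = r * (y1 * x * t) + r * (v * u * t)"
  using A t r z' by (simp add: add_mult_distrib_mat[OF A(1,3) t] mult_add_distrib_mat[of r k n _ l])
 ultimately show ?thesis using z' t by (simp add: mat_assoc)
qed

text \<open>If the frame is singular, choose a row \<open>l\<close> that annihilates it. By generation some
 \<open>l y1\<^sup>k v\<close> is nonzero; let \<open>K\<close> be the smallest such \<open>k\<close>, which
 is at least \<open>n - m\<close>. The moment map equation shows inductively that the rows \<open>l, l y1,
 ..., l y1\<^sup>K\<close> annihilate \<open>x\<close>. They are more than \<open>n - m\<close> independent
 rows, so that \<open>x\<close> has a kernel. Multiplying the equation by \<open>l y1\<^sup>K\<close> shows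
 that \<open>u\<close> vanishes on this kernel, and the equation itself that the kernel is
 \<open>y2\<close>-invariant, against cogeneration.\<close>

lemma frame_nonsingular_iff:
 assumes mn: "m \<le> n" and zq: "z \<in> quint_space n m" and zm: "moment_eq n m z"
 shows "generating n m z \<and> cogenerating n m z \<longleftrightarrow> det (frame n m z) \<noteq> 0"
proof -
 obtain x y1 y2 v u where z_eq: "z = (x, y1, y2, v, u)" by (cases z)
 note zq = zq[unfolded z_eq] and zm = zm[unfolded z_eq]
 note z' = quint_spaceD[OF zq]
 let ?G = "frame n m (x, y1, y2, v, u)"
 have yk: "y1 ^\<^sub>m k \<in> carrier_mat n n" for k using z'(2) by simp
 have ykv: "y1 ^\<^sub>m k * v \<in> carrier_mat n 1" for k by (rule mult_carrier_mat[OF yk z'(4)])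
 have frame_zero: "l = 0\<^sub>m 1 n" if d: "det ?G \<noteq> 0" and l: "l \<in> carrier_mat 1 n" and lx: "l * x = 0\<^sub>m 1 m"
  and lv: "\<And>k. l * (y1 ^\<^sub>m k * v) = 0\<^sub>m 1 1" for l
 proof -
  have "l * ?G = 0\<^sub>m 1 n"
   by (rule eq_matI) (use l frame_row[OF zq l] lx lv in \<open>auto simp del: index_mult_mat(1)\<close>)
  then show ?thesis using mult_right_cancel_zero[OF frame_carrier(1) d l] by simp
 qed
 show ?thesis
  unfolding z_eq
 proof
  assume d: "det ?G \<noteq> 0"
  have "generating n m (x, y1, y2, v, u)"
   unfolding generating.simps
  proof (intro ballI impI)
   fix l :: "complex mat" assume l: "l \<in> carrier_mat 1 n"
    and k: "\<forall>k. l * (y1 ^\<^sub>m k * x) = 0\<^sub>m 1 m \<and> l * (y1 ^\<^sub>m k * v) = 0\<^sub>m 1 1"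
   have "l * (y1 ^\<^sub>m 0 * x) = 0\<^sub>m 1 m" using k by blast
   then have "l * x = 0\<^sub>m 1 m" using z'(1,2) by simp
   then show "l = 0\<^sub>m 1 n" using frame_zero[OF d l] k by blast
  qed
  moreover have "cogenerating n m (x, y1, y2, v, u)"
   unfolding cogenerating.simps
  proof (intro ballI impI)
   fix s :: "complex mat" assume s: "s \<in> carrier_mat m 1"
    and k: "\<forall>k. x * (y2 ^\<^sub>m k * s) = 0\<^sub>m n 1 \<and> u * (y2 ^\<^sub>m k * s) = 0\<^sub>m 1 1"
   have "x * (y2 ^\<^sub>m 0 * s) = 0\<^sub>m n 1" using k by blast
   then have xs: "x * s = 0\<^sub>m n 1" using z'(3) s by simp
   define c where "c = mat n 1 (\<lambda>(j, _). if j < m then s $$ (j, 0) else 0)"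
   have cc: "c \<in> carrier_mat n 1" unfolding c_def by simp
   have "?G * c = 0\<^sub>m n 1"
   proof (rule eq_matI)
    fix i j assume "i < dim_row (0\<^sub>m n 1 :: complex mat)" "j < dim_col (0\<^sub>m n 1 :: complex mat)"
    then have ij: "i < n" "j = 0" by auto
    have "(?G * c) $$ (i, 0) = (\<Sum>l<n. ?G $$ (i, l) * c $$ (l, 0))" using cc ij by (subst mult_mat_entry) auto
    also have "\<dots> = (\<Sum>l<m. ?G $$ (i, l) * c $$ (l, 0))"
     using mn by (intro sum.mono_neutral_right) (auto simp: c_def)
    also have "\<dots> = (\<Sum>l<m. x $$ (i, l) * s $$ (l, 0))"
     using mn ij by (intro sum.cong) (auto simp: c_def frame_def)
    also have "\<dots> = (x * s) $$ (i, 0)" using z'(1) s ij by (subst mult_mat_entry) auto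
    finally show "(?G * c) $$ (i, j) = 0\<^sub>m n 1 $$ (i, j)" using xs ij by simp
   qed (use cc in auto)
   then have c0: "c = 0\<^sub>m n 1" using mult_left_cancel_zero[OF frame_carrier(1) d cc] by simp
   have "s $$ (j, 0) = 0" if "j < m" for j
    using arg_cong[OF c0, of "\<lambda>A. A $$ (j, 0)"] that mn unfolding c_def by simp
   then show "s = 0\<^sub>m m 1" using s by (intro eq_matI) auto
  qed
  ultimately show "generating n m (x, y1, y2, v, u) \<and> cogenerating n m (x, y1, y2, v, u)" ..
 next
  assume gc: "generating n m (x, y1, y2, v, u) \<and> cogenerating n m (x, y1, y2, v, u)"
  show "det ?G \<noteq> 0"
  proof
   assume d: "det ?G = 0"
   have "det (transpose_mat ?G) = 0" using det_transpose[OF frame_carrier(1)] d by metis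
   then obtain l0 where l0: "l0 \<in> carrier_vec n" "l0 \<noteq> 0\<^sub>v n" "transpose_mat ?G *\<^sub>v l0 = 0\<^sub>v n"
    using det_0_iff_vec_prod_zero[of "transpose_mat ?G" n] by auto
   define l where "l = transpose_mat (vec_mat l0)"
   have l: "l \<in> carrier_mat 1 n" unfolding l_def using l0(1) by simp
   have lne: "l \<noteq> 0\<^sub>m 1 n"
    using vec_mat_zero[OF l0(1)] l0(2) unfolding l_def by (metis transpose_transpose transpose_zero)
   have lG: "(l * ?G) $$ (0, j) = 0" if j: "j < n" for j
   proof -
    have "(l * ?G) $$ (0, j) = (\<Sum>i<n. l0 $ i * ?G $$ (i, j))"
     using l j l0(1) by (subst mult_mat_entry) (auto simp: l_def)
    also have "\<dots> = (transpose_mat ?G *\<^sub>v l0) $ j"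
     using j l0(1) by (simp add: scalar_prod_def atLeast0LessThan mult.commute)
    finally show ?thesis using l0(3) j by simp
   qed
   have lx: "l * x = 0\<^sub>m 1 m"
   proof (rule eq_matI)
    fix i j assume "i < dim_row (0\<^sub>m 1 m :: complex mat)" "j < dim_col (0\<^sub>m 1 m :: complex mat)"
    then have ij: "i = 0" "j < m" by auto
    then show "(l * x) $$ (i, j) = 0\<^sub>m 1 m $$ (i, j)"
     using lG[of j] frame_row[OF zq l, of j] mn by (simp del: index_mult_mat(1))
   qed (use l z' in auto)
   define nu where "nu k = (l * (y1 ^\<^sub>m k * v)) $$ (0, 0)" for k
   have nu0: "nu k = 0" if "k < n - m" for k
    using lG[of "k + m"] frame_row[OF zq l, of "k + m"] that unfolding nu_def by (simp del: index_mult_mat(1))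
   have lkx: "l * y1 ^\<^sub>m k * x = 0\<^sub>m 1 m" if "\<And>i. i < k \<Longrightarrow> nu i = 0" for k
    using that
   proof (induction k)
    case 0
    then show ?case using lx l z'(2) by simp
   next
    case (Suc k)
    have r: "l * y1 ^\<^sub>m k \<in> carrier_mat 1 n" by (rule mult_carrier_mat[OF l yk])
    have IH: "l * y1 ^\<^sub>m k * x = 0\<^sub>m 1 m" using Suc by simp
    have lv: "l * y1 ^\<^sub>m k * v = 0\<^sub>m 1 1"
     using Suc.prems[of k] mat_1_1[OF mult_carrier_mat[OF l ykv]] assoc_mult_mat[OF l yk z'(4)] unfolding nu_def by simp
    have "l * y1 ^\<^sub>m k * (y1 * (x * 1\<^sub>m m)) + l * y1 ^\<^sub>m k * (v * (u * 1\<^sub>m m)) = l * y1 ^\<^sub>m k * (x * (y2 * 1\<^sub>m m))"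
     by (rule moment_row[OF zq zm r one_carrier_mat])
    then have e: "l * y1 ^\<^sub>m k * (y1 * x) + l * y1 ^\<^sub>m k * (v * u) = l * y1 ^\<^sub>m k * (x * y2)"
     using z' by simp
    have "l * y1 ^\<^sub>m k * (v * u) = 0\<^sub>m 1 m"
     using assoc_mult_mat[OF r z'(4,5)] lv z'(5) by simp
    moreover have "l * y1 ^\<^sub>m k * (x * y2) = 0\<^sub>m 1 m"
     using assoc_mult_mat[OF r z'(1,3)] IH z'(3) by simp
    moreover have "l * y1 ^\<^sub>m k * (y1 * x) \<in> carrier_mat 1 m"
     by (rule mult_carrier_mat[OF r mult_carrier_mat[OF z'(2,1)]])
    ultimately have "l * y1 ^\<^sub>m k * (y1 * x) = 0\<^sub>m 1 m" using e by simp
    moreover have "l * y1 ^\<^sub>m Suc k * x = l * y1 ^\<^sub>m k * (y1 * x)"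
     using l z'(1,2) by (simp add: mat_assoc)
    ultimately show ?case by simp
   qed
   have "\<exists>k. nu k \<noteq> 0"
   proof (rule ccontr)
    assume "\<not> ?thesis"
    then have z: "nu k = 0" for k by blast
    have "l * (y1 ^\<^sub>m k * x) = 0\<^sub>m 1 m \<and> l * (y1 ^\<^sub>m k * v) = 0\<^sub>m 1 1" for k
     using lkx[of k] z assoc_mult_mat[OF l yk z'(1), of k] mat_1_1[OF mult_carrier_mat[OF l ykv], of k] z[of k]
     unfolding nu_def by simp
    then have "l = 0\<^sub>m 1 n" using gc l unfolding generating.simps by blast
    with lne show False by simp
   qed
   then obtain K where K: "nu K \<noteq> 0" "\<And>i. i < K \<Longrightarrow> nu i = 0"
    using exists_least_iff[of "\<lambda>k. nu k \<noteq> 0"] by blast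
   have KN: "n - m \<le> K" using nu0 K(1) by (meson not_le)
   define e where "e = K - (n - m)"
   obtain c where c: "c \<in> carrier_vec n" "c \<noteq> 0\<^sub>v n" "?G *\<^sub>v c = 0\<^sub>v n"
    using det_0_iff_vec_prod_zero[OF frame_carrier(1)] d by blast
   have Gc: "(\<Sum>j<n. (r * ?G) $$ (0, j) * c $ j) = 0" if r: "r \<in> carrier_mat 1 n" for r
   proof -
    have "(\<Sum>j<n. (r * ?G) $$ (0, j) * c $ j) = (\<Sum>j<n. \<Sum>i<n. r $$ (0, i) * (?G $$ (i, j) * c $ j))"
     using r by (intro sum.cong refl) (simp add: mult_mat_entry sum_distrib_right mult.assoc del: index_mult_mat(1))
    also have "\<dots> = (\<Sum>i<n. \<Sum>j<n. r $$ (0, i) * (?G $$ (i, j) * c $ j))" by (rule sum.swap)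
    also have "\<dots> = (\<Sum>i<n. r $$ (0, i) * (?G *\<^sub>v c) $ i)"
     using c(1) by (intro sum.cong refl) (simp add: scalar_prod_def atLeast0LessThan sum_distrib_left)
    finally show ?thesis using c(3) by simp
   qed
   have c_high: "c $ j = 0" if "m \<le> j" "j < n" for j
    using that
   proof (induction "n - 1 - j" arbitrary: j rule: less_induct)
    case less
    define k where "k = e + (n - j)"
    let ?r = "l * y1 ^\<^sub>m k"
    have r: "?r \<in> carrier_mat 1 n" by (rule mult_carrier_mat[OF l yk])
    have kK: "k \<le> K" using less.prems KN unfolding k_def e_def by simp
    have rx: "?r * x = 0\<^sub>m 1 m" by (rule lkx) (use K(2) kK in simp)
    have rv: "(?r * (y1 ^\<^sub>m i * v)) $$ (0, 0) = nu (k + i)" for i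
    proof -
     have "?r * (y1 ^\<^sub>m i * v) = l * (y1 ^\<^sub>m (k + i) * v)"
      using l z'(2,4) by (simp add: pow_mat_add[OF z'(2)] mat_assoc)
     then show ?thesis unfolding nu_def by simp
    qed
    have entry: "(?r * ?G) $$ (0, i) * c $ i = (if i = j then nu K * c $ j else 0)" if i: "i < n" for i
    proof -
     consider "i < m" | "m \<le> i" "i < j" | "i = j" | "j < i" using less.prems by linarith
     then show ?thesis
     proof cases
      case 1
      then show ?thesis using frame_row[OF zq r i] rx less.prems by (simp del: index_mult_mat(1))
     next
      case 2
      then have "k + (i - m) < K" using less.prems KN unfolding k_def e_def by simp
      then show ?thesis using frame_row[OF zq r i] rv K(2) 2 by (simp del: index_mult_mat(1))
     next
      case 3
      then have "k + (j - m) = K" using less.prems KN unfolding k_def e_def by simp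
      then show ?thesis using frame_row[OF zq r i] rv 3 less.prems by (simp del: index_mult_mat(1))
     next
      case 4
      then have "c $ i = 0" using less.hyps[of i] less.prems i by simp
      then show ?thesis using 4 by simp
     qed
    qed
    have "(\<Sum>i<n. (?r * ?G) $$ (0, i) * c $ i) = nu K * c $ j"
     using entry less.prems by (simp del: index_mult_mat(1))
    then show ?case using Gc[OF r] K(1) by simp
   qed
   define s where "s = mat m 1 (\<lambda>(j, _). c $ j)"
   have s: "s \<in> carrier_mat m 1" unfolding s_def by simp
   have xs: "x * s = 0\<^sub>m n 1"
   proof (rule eq_matI)
    fix i j assume "i < dim_row (0\<^sub>m n 1 :: complex mat)" "j < dim_col (0\<^sub>m n 1 :: complex mat)"
    then have ij: "i < n" "j = 0" by auto
    have "(x * s) $$ (i, 0) = (\<Sum>l<m. x $$ (i, l) * c $ l)" using z'(1) s ij by (subst mult_mat_entry) (auto simp: s_def)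
    also have "\<dots> = (\<Sum>l<m. ?G $$ (i, l) * c $ l)" using mn ij by (intro sum.cong refl) (simp add: frame_def)
    also have "\<dots> = (\<Sum>l<n. ?G $$ (i, l) * c $ l)" using mn c_high by (intro sum.mono_neutral_left) auto
    also have "\<dots> = (?G *\<^sub>v c) $ i" using c(1) ij by (simp add: scalar_prod_def atLeast0LessThan)
    finally show "(x * s) $$ (i, j) = 0\<^sub>m n 1 $$ (i, j)" using c(3) ij by simp
   qed (use z' s in auto)
   have sne: "s \<noteq> 0\<^sub>m m 1"
   proof
    assume s0: "s = 0\<^sub>m m 1"
    have "c $ j = 0" if "j < n" for j
    proof (cases "j < m")
     case True
     then show ?thesis using arg_cong[OF s0, of "\<lambda>A. A $$ (j, 0)"] unfolding s_def by simp
    qed (use c_high that in simp)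
    then show False using c(1,2) by (auto intro!: eq_vecI)
   qed
   have "\<exists>t\<in>carrier_mat m 1. x * t = 0\<^sub>m n 1 \<and> u * t \<noteq> 0\<^sub>m 1 1"
   proof (rule ccontr)
    assume "\<not> ?thesis"
    then have no: "\<And>t. t \<in> carrier_mat m 1 \<Longrightarrow> x * t = 0\<^sub>m n 1 \<Longrightarrow> u * t = 0\<^sub>m 1 1" by blast
    have st: "y2 ^\<^sub>m k * s \<in> carrier_mat m 1" for k using z'(3) s by (intro mult_carrier_mat[of _ m m]) auto
    have "x * (y2 ^\<^sub>m k * s) = 0\<^sub>m n 1" for k
    proof (induction k)
     case 0
     then show ?case using xs z'(3) s by simp
    next
     case (Suc k)
     have "1\<^sub>m n * (y1 * (x * (y2 ^\<^sub>m k * s))) + 1\<^sub>m n * (v * (u * (y2 ^\<^sub>m k * s))) = 1\<^sub>m n * (x * (y2 * (y2 ^\<^sub>m k * s)))"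
      by (rule moment_row[OF zq zm one_carrier_mat st])
     then have "x * (y2 * (y2 ^\<^sub>m k * s)) = 0\<^sub>m n 1"
      using Suc no[OF st Suc] z' s by simp
     moreover have "y2 ^\<^sub>m Suc k * s = y2 * (y2 ^\<^sub>m k * s)"
      using z'(3) s pow_mat_commute[OF z'(3), of k] by (simp add: mat_assoc)
     ultimately show ?case by simp
    qed
    then have "s = 0\<^sub>m m 1" using no st gc s unfolding cogenerating.simps by blast
    with sne show False by simp
   qed
   then obtain t where t: "t \<in> carrier_mat m 1" "x * t = 0\<^sub>m n 1" "u * t \<noteq> 0\<^sub>m 1 1" by blast
   let ?r = "l * y1 ^\<^sub>m K"
   have r: "?r \<in> carrier_mat 1 n" by (rule mult_carrier_mat[OF l yk])
   have ut: "u * t \<in> carrier_mat 1 1" using z'(5) t(1) by auto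
   have yt: "y2 * t \<in> carrier_mat m 1" using z'(3) t(1) by auto
   have "?r * (y1 * (x * t)) + ?r * (v * (u * t)) = ?r * (x * (y2 * t))" by (rule moment_row[OF zq zm r t(1)])
   moreover have "?r * (y1 * (x * t)) = 0\<^sub>m 1 1" unfolding t(2) using mult_carrier_mat[OF r z'(2)] l yk z'(2) by simp
   moreover have "?r * (x * (y2 * t)) = (?r * x) * (y2 * t)" by (rule assoc_mult_mat[OF r z'(1) yt, symmetric])
   moreover have "?r * x = 0\<^sub>m 1 m" by (rule lkx[OF K(2)])
   moreover have "?r * (v * (u * t)) = (?r * v) * (u * t)" by (rule assoc_mult_mat[OF r z'(4) ut, symmetric])
   moreover have rv: "?r * v \<in> carrier_mat 1 1" by (rule mult_carrier_mat[OF r z'(4)])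
   ultimately have "(?r * v) * (u * t) = 0\<^sub>m 1 1"
    using left_mult_zero_mat[OF yt, of 1] left_add_zero_mat[OF mult_carrier_mat[OF rv ut]] by metis
   then have "((?r * v) * (u * t)) $$ (0, 0) = 0" by simp
   moreover have "((?r * v) * (u * t)) $$ (0, 0) = (?r * v) $$ (0, 0) * (u * t) $$ (0, 0)"
    by (subst mult_mat_entry[of 0 "?r * v" 0 "u * t"]) (use rv ut z'(4,5) t(1) l in auto)
   moreover have "(?r * v) $$ (0, 0) \<noteq> 0" using K(1) assoc_mult_mat[OF l yk z'(4), of K] unfolding nu_def by simp
   moreover have "(u * t) $$ (0, 0) \<noteq> 0" using t(3) mat_1_1[OF ut] by simp
   ultimately show False by simp
  qed
 qed
qed

text \<open>For \<open>n < m\<close> the frame is formed for the dual quintuple.\<close>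

definition stab_det :: "nat \<Rightarrow> nat \<Rightarrow> quintuple \<Rightarrow> complex" where
 "stab_det n m z = (if m \<le> n then det (frame n m z) else det (frame m n (dual z)))"

lemma triangle_points_stab:
 "z \<in> triangle_points m n \<longleftrightarrow> z \<in> quint_space n m \<and> moment_eq n m z \<and> stab_det n m z \<noteq> 0"
proof (cases "z \<in> quint_space n m")
 case z: True
 show ?thesis
 proof (cases "m \<le> n")
  case True
  then show ?thesis using frame_nonsingular_iff[OF True z] z unfolding triangle_points_iff stab_det_def by auto
 next
  case False
  then have nm: "n \<le> m" by simp
  have mom: "moment_eq m n (dual z) \<longleftrightarrow> moment_eq n m z"
   using dual_moment[OF z] dual_moment[OF dual_quint[OF z]] dual_dual[OF z] by auto
  show ?thesis
   unfolding dual_points_iff[OF z] using frame_nonsingular_iff[OF nm dual_quint[OF z]] False z dual_quint[OF z] mom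
   unfolding triangle_points_iff stab_det_def by auto
 qed
qed (simp add: triangle_points_iff)

abbreviation (input) quint_coords :: "nat \<Rightarrow> nat \<Rightarrow> (quintuple \<Rightarrow> complex) set" where
 "quint_coords n m \<equiv> coords (triangle_variety m n)"

abbreviation (input) quint_regs :: "nat \<Rightarrow> nat \<Rightarrow> (quintuple \<Rightarrow> complex) set" where
 "quint_regs n m \<equiv> regs (quint_coords n m) (triangle_points m n)"

lemma finite_entries: "finite (entries r c \<pi>)"
proof -
 have "entries r c \<pi> = (\<lambda>(i, j) x. \<pi> x $$ (i, j)) ` ({..<r} \<times> {..<c})"
  unfolding entries_def by auto
 then show ?thesis by simp
qed

lemma quint_coords_countable: "countable (quint_coords n m)"
 unfolding triangle_variety_def by (simp add: finite_entries countable_finite)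

lemma quint_coords_free: "free_coords (quint_coords n m) (quint_space n m)"
 unfolding free_coords_def
proof
 fix val :: "(quintuple \<Rightarrow> complex) \<Rightarrow> complex"
 let ?z = "(mat n m (\<lambda>(i, j). val (\<lambda>z. (case z of (x, y1, y2, v, u) \<Rightarrow> x) $$ (i, j))),
  mat n n (\<lambda>(i, j). val (\<lambda>z. (case z of (x, y1, y2, v, u) \<Rightarrow> y1) $$ (i, j))),
  mat m m (\<lambda>(i, j). val (\<lambda>z. (case z of (x, y1, y2, v, u) \<Rightarrow> y2) $$ (i, j))),
  mat n 1 (\<lambda>(i, j). val (\<lambda>z. (case z of (x, y1, y2, v, u) \<Rightarrow> v) $$ (i, j))),
  mat 1 m (\<lambda>(i, j). val (\<lambda>z. (case z of (x, y1, y2, v, u) \<Rightarrow> u) $$ (i, j))))"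
 show "\<exists>z\<in>quint_space n m. \<forall>k\<in>quint_coords n m. k z = val k"
  by (rule bexI[of _ ?z]) (auto simp: triangle_variety_def entries_def quint_space_def case_prod_unfold)
qed

lemma (in function_ring) mats_quint:
 assumes Q: "\<And>x. x \<in> U \<Longrightarrow> \<phi> x \<in> quint_space n m" and K: "\<And>k. k \<in> quint_coords n m \<Longrightarrow> (\<lambda>x. k (\<phi> x)) \<in> R"
 shows "mats n m (\<lambda>x. fst (\<phi> x))" "mats n n (\<lambda>x. fst (snd (\<phi> x)))" "mats m m (\<lambda>x. fst (snd (snd (\<phi> x))))"
  "mats n 1 (\<lambda>x. fst (snd (snd (snd (\<phi> x)))))" "mats 1 m (\<lambda>x. snd (snd (snd (snd (\<phi> x)))))"
proof -
 have q: "fst (\<phi> x) \<in> carrier_mat n m" "fst (snd (\<phi> x)) \<in> carrier_mat n n" "fst (snd (snd (\<phi> x))) \<in> carrier_mat m m"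
  "fst (snd (snd (snd (\<phi> x)))) \<in> carrier_mat n 1" "snd (snd (snd (snd (\<phi> x)))) \<in> carrier_mat 1 m" if "x \<in> U" for x
  using Q[OF that] unfolding quint_space_def by auto
 have k: "(\<lambda>z. \<pi> z $$ (i, j)) \<in> entries r c \<pi>" if "i < r" "j < c" for i j r c and \<pi> :: "quintuple \<Rightarrow> complex mat"
  using that unfolding entries_def by blast
 show "mats n m (\<lambda>x. fst (\<phi> x))"
  by (rule matsI[OF q(1)], assumption)
   (use K[of "\<lambda>z. (case z of (x, y1, y2, v, u) \<Rightarrow> x) $$ (i, j)" for i j] k in \<open>simp add: triangle_variety_def case_prod_unfold\<close>)
 show "mats n n (\<lambda>x. fst (snd (\<phi> x)))"
  by (rule matsI[OF q(2)], assumption)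
   (use K[of "\<lambda>z. (case z of (x, y1, y2, v, u) \<Rightarrow> y1) $$ (i, j)" for i j] k in \<open>simp add: triangle_variety_def case_prod_unfold\<close>)
 show "mats m m (\<lambda>x. fst (snd (snd (\<phi> x))))"
  by (rule matsI[OF q(3)], assumption)
   (use K[of "\<lambda>z. (case z of (x, y1, y2, v, u) \<Rightarrow> y2) $$ (i, j)" for i j] k in \<open>simp add: triangle_variety_def case_prod_unfold\<close>)
 show "mats n 1 (\<lambda>x. fst (snd (snd (snd (\<phi> x)))))"
  by (rule matsI[OF q(4)], assumption)
   (use K[of "\<lambda>z. (case z of (x, y1, y2, v, u) \<Rightarrow> v) $$ (i, j)" for i j] k in \<open>simp add: triangle_variety_def case_prod_unfold\<close>)
 show "mats 1 m (\<lambda>x. snd (snd (snd (snd (\<phi> x)))))"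
  by (rule matsI[OF q(5)], assumption)
   (use K[of "\<lambda>z. (case z of (x, y1, y2, v, u) \<Rightarrow> u) $$ (i, j)" for i j] k in \<open>simp add: triangle_variety_def case_prod_unfold\<close>)
qed

lemma (in function_ring) mats_quint_coords:
 assumes "mats n m (\<lambda>x. fst (\<phi> x))" "mats n n (\<lambda>x. fst (snd (\<phi> x)))" "mats m m (\<lambda>x. fst (snd (snd (\<phi> x))))"
  "mats n 1 (\<lambda>x. fst (snd (snd (snd (\<phi> x)))))" "mats 1 m (\<lambda>x. snd (snd (snd (snd (\<phi> x)))))"
  and k: "k \<in> quint_coords n m"
 shows "(\<lambda>x. k (\<phi> x)) \<in> R"
 using k matsD(4)[OF assms(1)] matsD(4)[OF assms(2)] matsD(4)[OF assms(3)] matsD(4)[OF assms(4)] matsD(4)[OF assms(5)]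
 unfolding triangle_variety_def entries_def by (auto simp: case_prod_unfold)

lemma (in function_ring) mats_krylov:
 assumes Y: "mats n n Y" and V: "mats n 1 V"
 shows "mats n n (\<lambda>x. krylov n (Y x) (V x))"
 unfolding krylov_def
 by (rule mats_mat) (simp del: index_mult_mat(1) add: matsD(4)[OF mats_mult[OF mats_power[OF Y] V]])

lemma (in function_ring) mats_frame:
 assumes X: "mats n m (\<lambda>x. fst (\<phi> x))" and Y: "mats n n (\<lambda>x. fst (snd (\<phi> x)))"
  and V: "mats n 1 (\<lambda>x. fst (snd (snd (snd (\<phi> x)))))"
 shows "mats n n (\<lambda>x. frame n m (\<phi> x))"
 unfolding frame_def
proof (rule mats_mat)
 fix i j assume ij: "i < n" "j < n"
 show "(\<lambda>x. case (i, j) of (i, j) \<Rightarrow> if j < m then fst (\<phi> x) $$ (i, j)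
   else (fst (snd (\<phi> x)) ^\<^sub>m (j - m) * fst (snd (snd (snd (\<phi> x))))) $$ (i, 0)) \<in> R"
  using ij matsD(4)[OF X, of i j] matsD(4)[OF mats_mult[OF mats_power[OF Y] V], of i 0 "j - m"]
  by (cases "j < m") (simp_all del: index_mult_mat(1))
qed

lemma coord_polys: "k \<in> K \<Longrightarrow> k \<in> polys_on K U"
 unfolding polys_on_def using poly_funs.coord by blast

lemma dual_sel: "fst (dual z) = - transpose_mat (fst z)" "fst (snd (dual z)) = transpose_mat (fst (snd (snd z)))"
 "fst (snd (snd (dual z))) = transpose_mat (fst (snd z))"
 "fst (snd (snd (snd (dual z)))) = transpose_mat (snd (snd (snd (snd z))))"
 "snd (snd (snd (snd (dual z)))) = transpose_mat (fst (snd (snd (snd z))))"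
 by (cases z, simp)+

lemma triangle_affine:
 obtains D where "affine_set (quint_coords n m) (quint_space n m) D (triangle_points m n)"
  "\<And>z. z \<in> quint_space n m \<Longrightarrow> D z = stab_det n m z"
proof -
 let ?K = "quint_coords n m" and ?Q = "quint_space n m"
 interpret function_ring ?Q "polys_on ?K ?Q" by (rule polys_on)
 have Q: "z \<in> ?Q \<Longrightarrow> z \<in> ?Q" for z .
 note M = mats_quint[of "\<lambda>z. z" n m, OF Q coord_polys]
 have "stab_det n m \<in> polys_on ?K ?Q"
 proof (cases "m \<le> n")
  case True
  then show ?thesis using mats_det[OF mats_frame[where \<phi> = "\<lambda>z. z", OF M(1,2,4)]] unfolding stab_det_def by simp
 next
  case False
  have "mats m n (\<lambda>z. fst (dual z))" "mats m m (\<lambda>z. fst (snd (dual z)))" "mats m 1 (\<lambda>z. fst (snd (snd (snd (dual z)))))"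
   unfolding dual_sel using mats_uminus[OF mats_transpose[OF M(1)]] mats_transpose[OF M(3)] mats_transpose[OF M(5)] by auto
  from mats_det[OF mats_frame[where \<phi> = dual, OF this]] show ?thesis using False unfolding stab_det_def by simp
 qed
 then have "\<exists>D\<in>poly_funs ?K. \<forall>z\<in>?Q. stab_det n m z = D z" unfolding polys_on_def mem_Collect_eq .
 then obtain D where D: "D \<in> poly_funs ?K" "\<forall>z\<in>?Q. stab_det n m z = D z" ..
 let ?f = "\<lambda>i j z. (fst (snd z) * fst z - fst z * fst (snd (snd z)) + fst (snd (snd (snd z))) * snd (snd (snd (snd z)))) $$ (i, j)"
 have "mats n m (\<lambda>z. fst (snd z) * fst z - fst z * fst (snd (snd z)) + fst (snd (snd (snd z))) * snd (snd (snd (snd z))))"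
  by (intro mats_add mats_diff mats_mult[OF M(2) M(1)] mats_mult[OF M(1) M(3)] mats_mult[OF M(4) M(5)])
 then have f: "?f i j \<in> polys_on ?K ?Q" if "i < n" "j < m" for i j by (rule matsD(4)) (use that in auto)
 have "\<forall>p\<in>{..<n} \<times> {..<m}. \<exists>a. a \<in> poly_funs ?K \<and> (\<forall>z\<in>?Q. ?f (fst p) (snd p) z = a z)"
 proof
  fix p assume "p \<in> {..<n} \<times> {..<m}"
  then have "?f (fst p) (snd p) \<in> polys_on ?K ?Q" by (intro f) auto
  then show "\<exists>a. a \<in> poly_funs ?K \<and> (\<forall>z\<in>?Q. ?f (fst p) (snd p) z = a z)"
   unfolding polys_on_def mem_Collect_eq Bex_def .
 qed
 from bchoice[OF this] obtain a where a': "\<forall>p\<in>{..<n} \<times> {..<m}. a p \<in> poly_funs ?K \<and> (\<forall>z\<in>?Q. ?f (fst p) (snd p) z = a p z)" ..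
 have a: "a (i, j) \<in> poly_funs ?K" "z \<in> ?Q \<Longrightarrow> ?f i j z = a (i, j) z" if "i < n" "j < m" for i j z
  using bspec[OF a', of "(i, j)"] that by auto
 let ?S = "a ` ({..<n} \<times> {..<m})"
 have mom: "moment_eq n m z \<longleftrightarrow> (\<forall>f\<in>?S. f z = 0)" if z: "z \<in> ?Q" for z
 proof -
  obtain x y1 y2 v u where z_eq: "z = (x, y1, y2, v, u)" by (cases z)
  note z' = quint_spaceD[OF z[unfolded z_eq]]
  have c: "y1 * x - x * y2 + v * u \<in> carrier_mat n m" using z' by auto
  have "moment_eq n m z \<longleftrightarrow> (\<forall>i<n. \<forall>j<m. (y1 * x - x * y2 + v * u) $$ (i, j) = 0)"
  proof
   assume "\<forall>i<n. \<forall>j<m. (y1 * x - x * y2 + v * u) $$ (i, j) = 0"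
   then show "moment_eq n m z" unfolding z_eq moment_eq.simps using c by (intro eq_matI) auto
  qed (simp add: z_eq)
  also have "\<dots> \<longleftrightarrow> (\<forall>i<n. \<forall>j<m. a (i, j) z = 0)" using a(2)[OF _ _ z] unfolding z_eq by simp
  finally show ?thesis by auto
 qed
 have "triangle_points m n = {z \<in> ?Q. (\<forall>f\<in>?S. f z = 0) \<and> D z \<noteq> 0}"
  using mom D(2) by (auto simp: triangle_points_stab)
 moreover have "?S \<subseteq> poly_funs ?K" using a(1) by auto
 ultimately have "affine_set ?K ?Q D (triangle_points m n)"
  unfolding affine_set_def
  by (intro conjI exI[of _ ?S] D(1) quint_coords_countable quint_coords_free)
 then show thesis by (rule that) (use D(2) in simp)
qed

section \<open>Polynomials in two variables\<close>

text \<open>Polynomials in two variables are polynomials in \<open>s\<close> with coefficients in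
 \<open>\<complex>[\<tau>]\<close>; here \<open>\<tau>\<close> is given a value.\<close>

definition spec0 :: "complex \<Rightarrow> complex poly poly \<Rightarrow> complex poly" where
 "spec0 \<tau> P = map_poly (\<lambda>c. poly c \<tau>) P"

lemma coeff_spec0: "coeff (spec0 \<tau> P) i = poly (coeff P i) \<tau>"
 unfolding spec0_def by (simp add: coeff_map_poly)

lemma spec0_mult: "spec0 \<tau> (P * Q) = spec0 \<tau> P * spec0 \<tau> Q"
 by (rule poly_eqI) (simp add: coeff_spec0 coeff_mult poly_sum)

lemma spec0_one: "spec0 \<tau> 1 = 1"
 by (rule poly_eqI) (simp add: coeff_spec0 coeff_1)

lemma spec0_power: "spec0 \<tau> (P ^ k) = spec0 \<tau> P ^ k"
 by (induction k) (auto simp: spec0_mult spec0_one)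

lemma poly_spec0: "poly (spec0 \<tau> P) s = poly (poly P [:s:]) \<tau>"
proof (induction P)
 case 0
 then show ?case by (simp add: spec0_def)
next
 case (pCons a P)
 have "spec0 \<tau> (pCons a P) = pCons (poly a \<tau>) (spec0 \<tau> P)"
  by (rule poly_eqI) (simp add: coeff_spec0 coeff_pCons split: nat.split)
 then show ?case using pCons by simp
qed

lemma poly2_eqI:
 fixes P Q :: "complex poly poly"
 assumes "\<And>s \<tau>. poly (poly P [:s:]) \<tau> = poly (poly Q [:s:]) \<tau>"
 shows "P = Q"
proof (rule poly_eqI)
 fix i
 have "spec0 \<tau> P = spec0 \<tau> Q" for \<tau>
  unfolding poly_eq_poly_eq_iff[symmetric] by (rule ext) (simp add: poly_spec0 assms)
 then have "poly (coeff P i) \<tau> = poly (coeff Q i) \<tau>" for \<tau> by (metis coeff_spec0)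
 then show "coeff P i = coeff Q i" unfolding poly_eq_poly_eq_iff[symmetric] by (rule ext)
qed

text \<open>A common divisor of \<open>E\<close> and \<open>D\<close> has an invertible leading coefficient,
 since \<open>E\<close> is monic, and becomes a unit for \<open>\<tau> = 0\<close>, where \<open>D\<close> is
 \<open>1\<close>. Its degree in \<open>s\<close> does not drop at \<open>\<tau> = 0\<close>, so that it is a
 unit.\<close>

lemma monic_coprime_specialised:
 fixes E D :: "complex poly poly"
 assumes E: "lead_coeff E = 1" and D: "spec0 0 D = 1"
 shows "coprime E D"
proof (rule coprimeI)
 fix C assume CE: "C dvd E" and CD: "C dvd D"
 obtain E' where E': "E = C * E'" using CE by blast
 obtain D' where D': "D = C * D'" using CD by blast
 have "lead_coeff C * lead_coeff E' = 1" using E unfolding E' by (simp add: lead_coeff_mult)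
 then have "lead_coeff C dvd 1" by (metis dvdI)
 then obtain c where c': "lead_coeff C = [:c:]" "is_unit c" unfolding is_unit_poly_iff by blast
 have "c \<noteq> 0" using c'(2) by (metis not_is_unit_0)
 note c = c'(1) this
 have "spec0 0 C * spec0 0 D' = 1" using D unfolding D' spec0_mult .
 then have "spec0 0 C dvd 1" by (metis dvdI)
 then have "degree (spec0 0 C) = 0" by (auto simp: is_unit_poly_iff)
 moreover have "coeff (spec0 0 C) (degree C) \<noteq> 0" using c by (simp add: coeff_spec0)
 then have "degree C \<le> degree (spec0 0 C)" by (rule le_degree)
 ultimately have "degree C = 0" by simp
 then obtain b where "C = [:b:]" by (rule degree_eq_zeroE)
 then have "C = [:[:c:]:]" using c by simp
 then show "is_unit C" using c'(2) by (simp add: is_unit_const_poly_iff)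
qed

lemma monic_dvd:
 fixes P H E D :: "complex poly poly"
 assumes E: "lead_coeff E = 1" and D: "spec0 0 D = 1" and eq: "P * D ^ l = H * E ^ k"
 shows "E ^ k dvd P"
proof -
 have "coprime (E ^ k) (D ^ l)"
  using monic_coprime_specialised[OF E D] by simp
 moreover have "E ^ k dvd P * D ^ l" unfolding eq by simp
 ultimately show ?thesis by (simp add: coprime_dvd_mult_left_iff)
qed

definition bipolys :: "(complex \<times> complex \<Rightarrow> complex) set" where
 "bipolys = {f. \<exists>P. \<forall>s \<tau>. f (s, \<tau>) = poly (poly P [:s:]) \<tau>}"

lemma bipolysI: "(\<And>s \<tau>. f (s, \<tau>) = poly (poly P [:s:]) \<tau>) \<Longrightarrow> f \<in> bipolys"
 unfolding bipolys_def by blast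

lemma bipolysD: "f \<in> bipolys \<Longrightarrow> \<exists>P. \<forall>s \<tau>. f (s, \<tau>) = poly (poly P [:s:]) \<tau>"
 unfolding bipolys_def by blast

lemma bipolys: "function_ring UNIV bipolys"
proof
 fix f g :: "complex \<times> complex \<Rightarrow> complex" and c
 show "(\<lambda>_. c) \<in> bipolys" by (rule bipolysI[of _ "[:[:c:]:]"]) simp
 { assume f: "f \<in> bipolys" and g: "g \<in> bipolys"
  obtain P where P: "\<And>s \<tau>. f (s, \<tau>) = poly (poly P [:s:]) \<tau>" using bipolysD[OF f] by blast
  obtain Q where Q: "\<And>s \<tau>. g (s, \<tau>) = poly (poly Q [:s:]) \<tau>" using bipolysD[OF g] by blast
  show "(\<lambda>x. f x + g x) \<in> bipolys" by (rule bipolysI[of _ "P + Q"]) (simp add: P Q)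
  show "(\<lambda>x. f x * g x) \<in> bipolys" by (rule bipolysI[of _ "P * Q"]) (simp add: P Q) }
 { assume f: "f \<in> bipolys" and "\<And>x. x \<in> UNIV \<Longrightarrow> g x = f x"
  then have "g = f" by auto
  with f show "g \<in> bipolys" by simp }
qed

lemma bipolys_vars: "fst \<in> bipolys" "snd \<in> bipolys"
 by (rule bipolysI[of _ "[:0, 1:]"], simp, rule bipolysI[of _ "[:[:0, 1:]:]"], simp)

section \<open>Families of polynomials in one variable with regular coefficients\<close>

text \<open>Families of polynomials of bounded degree whose coefficients are functions in
 \<open>R\<close>.\<close>

definition poly_families :: "'z set \<Rightarrow> ('z \<Rightarrow> complex) set \<Rightarrow> ('z \<Rightarrow> complex poly) set" where
 "poly_families U R = {p. (\<forall>i. (\<lambda>z. coeff (p z) i) \<in> R) \<and> (\<exists>N. \<forall>z\<in>U. \<forall>i\<ge>N. coeff (p z) i = 0)}"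

definition fibre_polys :: "'z set \<Rightarrow> ('z \<Rightarrow> complex) set \<Rightarrow> ('z \<times> complex \<Rightarrow> complex) set" where
 "fibre_polys U R = {F. \<exists>p\<in>poly_families U R. \<forall>z\<in>U. \<forall>s. F (z, s) = poly (p z) s}"

context function_ring
begin

lemma poly_families_add:
 assumes "p \<in> poly_families U R" "q \<in> poly_families U R"
 shows "(\<lambda>z. p z + q z) \<in> poly_families U R"
proof -
 obtain M N where M: "\<forall>z\<in>U. \<forall>i\<ge>M. coeff (p z) i = 0" and N: "\<forall>z\<in>U. \<forall>i\<ge>N. coeff (q z) i = 0"
  using assms unfolding poly_families_def by blast
 have "\<forall>z\<in>U. \<forall>i\<ge>max M N. coeff (p z + q z) i = 0" using M N by simp
 moreover have "(\<lambda>z. coeff (p z + q z) i) \<in> R" for i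
  using assms add unfolding poly_families_def by simp
 ultimately show ?thesis unfolding poly_families_def by blast
qed

lemma poly_families_mult:
 assumes "p \<in> poly_families U R" "q \<in> poly_families U R"
 shows "(\<lambda>z. p z * q z) \<in> poly_families U R"
proof -
 obtain M N where M: "\<forall>z\<in>U. \<forall>i\<ge>M. coeff (p z) i = 0" and N: "\<forall>z\<in>U. \<forall>i\<ge>N. coeff (q z) i = 0"
  using assms unfolding poly_families_def by blast
 have "coeff (p z * q z) i = 0" if "z \<in> U" "i \<ge> M + N" for z i
  unfolding coeff_mult
 proof (rule sum.neutral, rule ballI)
  fix j
  have "j \<ge> M \<or> i - j \<ge> N" using that(2) by linarith
  then show "coeff (p z) j * coeff (q z) (i - j) = 0" using M N that(1) by auto
 qed
 moreover have "(\<lambda>z. coeff (p z * q z) i) \<in> R" for i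
  unfolding coeff_mult using assms unfolding poly_families_def by (intro sum mult) auto
 ultimately show ?thesis unfolding poly_families_def by blast
qed

lemma poly_families_monom: "c \<in> R \<Longrightarrow> (\<lambda>z. monom (c z) k) \<in> poly_families U R"
 unfolding poly_families_def
proof (intro CollectI conjI allI exI[of _ "Suc k"] ballI impI)
 show "c \<in> R \<Longrightarrow> (\<lambda>z. coeff (monom (c z) k) i) \<in> R" for i by (cases "i = k") (simp_all add: const)
qed simp

lemma poly_families_power:
 assumes "p \<in> poly_families U R"
 shows "(\<lambda>z. p z ^ k) \<in> poly_families U R"
proof (induction k)
 case 0
 show ?case using poly_families_monom[OF const[of 1], of 0] by (simp add: monom_0 one_pCons)
next
 case (Suc k)
 then show ?case using poly_families_mult[OF assms] by simp
qed

text \<open>The coefficients of the quotient by a monic polynomial of constant degree are polynomials in the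
 coefficients of dividend and divisor.\<close>

lemma poly_families_div:
 assumes e: "e \<in> poly_families U R" and monic: "\<And>z. z \<in> U \<Longrightarrow> degree (e z) = r \<and> lead_coeff (e z) = 1"
  and p: "p \<in> poly_families U R"
 shows "(\<lambda>z. coeff (p z div e z) i) \<in> R"
proof -
 have e0: "e z \<noteq> 0" if "z \<in> U" for z using monic[OF that] by auto
 obtain N where "\<forall>z\<in>U. \<forall>i\<ge>N. coeff (p z) i = 0" using p unfolding poly_families_def by blast
 with p show ?thesis
 proof (induction N arbitrary: p)
  case 0
  then have "p z = 0" if "z \<in> U" for z using that by (intro poly_eqI) simp
  then show ?case by (intro cong[OF const[of 0]]) simp
 next
  case (Suc N)
  show ?case
  proof (cases "N < r")
   case True
   have "p z div e z = 0" if "z \<in> U" for z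
   proof (cases "p z = 0")
    case False
    have "degree (p z) < Suc N"
     using Suc.prems(2) that leading_coeff_0_iff[of "p z"] False by (meson not_le)
    then show ?thesis using True monic[OF that] by (intro div_poly_less) simp
   qed simp
   then show ?thesis by (intro cong[OF const[of 0]]) simp
  next
   case False
   let ?m = "\<lambda>z. monom (coeff (p z) N) (N - r)"
   let ?q = "\<lambda>z. p z + monom (- coeff (p z) N) (N - r) * e z"
   have cN: "(\<lambda>z. coeff (p z) N) \<in> R" using Suc.prems(1) unfolding poly_families_def by blast
   have q: "?q \<in> poly_families U R"
    by (intro poly_families_add Suc.prems(1) poly_families_mult e poly_families_monom uminus cN)
   have "\<forall>z\<in>U. \<forall>i\<ge>N. coeff (?q z) i = 0"
   proof (intro ballI allI impI)
    fix z i assume z: "z \<in> U" and i: "N \<le> i"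
    have ce: "coeff (e z) r = 1" "degree (e z) = r" using monic[OF z] by auto
    show "coeff (?q z) i = 0"
    proof (cases "i = N")
     case True
     then show ?thesis using ce False by (simp add: coeff_monom_mult)
    next
     case neq: False
     then have "coeff (p z) i = 0" using Suc.prems(2) z i by simp
     moreover have "coeff (e z) (i - (N - r)) = 0" by (rule coeff_eq_0) (use ce i neq False in linarith)
     ultimately show ?thesis using i by (simp add: coeff_monom_mult)
    qed
   qed
   from Suc.IH[OF q this] have IH: "(\<lambda>z. coeff (?q z div e z) i) \<in> R" .
   have "p z div e z = ?m z + ?q z div e z" if z: "z \<in> U" for z
   proof -
    have "monom (- coeff (p z) N) (N - r) = - ?m z" by (simp add: minus_monom)
    then have "p z = ?m z * e z + ?q z" by simp
    then have "p z div e z = (?m z * e z + ?q z) div e z" by (rule arg_cong)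
    also have "\<dots> = ?m z + ?q z div e z" by (rule div_mult_self3[OF e0[OF z]])
    finally show ?thesis .
   qed
   then have eq: "coeff (p z div e z) i = (if i = N - r then coeff (p z) N else 0) + coeff (?q z div e z) i" if "z \<in> U" for z
    using that by simp
   have "(\<lambda>z. (if i = N - r then coeff (p z) N else 0) + coeff (?q z div e z) i) \<in> R"
    by (rule add[OF _ IH]) (use cN const[of 0] in \<open>cases "i = N - r"; simp\<close>)
   then show ?thesis by (rule cong) (rule eq)
  qed
 qed
qed

lemma fibre_polys: "function_ring (U \<times> UNIV) (fibre_polys U R)"
proof
 fix f g :: "'a \<times> complex \<Rightarrow> complex" and c
 show "(\<lambda>_. c) \<in> fibre_polys U R" unfolding fibre_polys_def
  by (intro CollectI bexI[OF _ poly_families_monom[OF const[of c], of 0]]) (simp add: poly_monom)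
 { assume "f \<in> fibre_polys U R" "g \<in> fibre_polys U R"
  then obtain p q where p: "p \<in> poly_families U R" "\<forall>z\<in>U. \<forall>s. f (z, s) = poly (p z) s"
   and q: "q \<in> poly_families U R" "\<forall>z\<in>U. \<forall>s. g (z, s) = poly (q z) s" unfolding fibre_polys_def by blast
  show "(\<lambda>x. f x + g x) \<in> fibre_polys U R" unfolding fibre_polys_def
   by (intro CollectI bexI[OF _ poly_families_add[OF p(1) q(1)]]) (simp add: p(2) q(2))
  show "(\<lambda>x. f x * g x) \<in> fibre_polys U R" unfolding fibre_polys_def
   by (intro CollectI bexI[OF _ poly_families_mult[OF p(1) q(1)]]) (simp add: p(2) q(2)) }
 { assume "f \<in> fibre_polys U R" "\<And>x. x \<in> U \<times> UNIV \<Longrightarrow> g x = f x"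
  then show "g \<in> fibre_polys U R" unfolding fibre_polys_def by simp }
qed

lemma fibre_polys_const: "f \<in> R \<Longrightarrow> (\<lambda>x. f (fst x)) \<in> fibre_polys U R"
 unfolding fibre_polys_def
 by (intro CollectI bexI[OF _ poly_families_monom[of f 0]]) (simp_all add: poly_monom)

lemma fibre_polys_var: "snd \<in> fibre_polys U R"
 unfolding fibre_polys_def
 by (intro CollectI bexI[OF _ poly_families_monom[OF const[of 1], of 1]]) (simp add: poly_monom)

end

section \<open>A Hartogs principle along surfaces\<close>

text \<open>Along each surface the power of the monic polynomial of \<open>d1\<close> divides the numerator by
 \<open>monic_dvd\<close>. The quotient is computed by polynomial division on the curve \<open>\<tau> =
 1\<close>, where its coefficients depend regularly on \<open>z\<close>, and evaluated at \<open>s =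
 0\<close>.\<close>

lemma hartogs_division:
 assumes "function_ring U R"
  and \<Gamma>1: "\<And>z s. z \<in> U \<Longrightarrow> \<Gamma> z (0, 1) = z"
  and \<Gamma>U: "\<And>z x. z \<in> U \<Longrightarrow> \<Gamma> z x \<in> U"
  and A: "(\<lambda>x. A (\<Gamma> (fst x) (snd x, 1))) \<in> fibre_polys U R"
  and d1: "(\<lambda>x. d1 (\<Gamma> (fst x) (snd x, 1))) \<in> fibre_polys U R"
  and A2: "\<And>z. z \<in> U \<Longrightarrow> (\<lambda>x. A (\<Gamma> z x)) \<in> bipolys"
  and B2: "\<And>z. z \<in> U \<Longrightarrow> (\<lambda>x. B (\<Gamma> z x)) \<in> bipolys"
  and d12: "\<And>z. z \<in> U \<Longrightarrow> \<exists>E. lead_coeff E = 1 \<and> degree E = r \<and> (\<forall>s \<tau>. d1 (\<Gamma> z (s, \<tau>)) = poly (poly E [:s:]) \<tau>)"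
  and d22: "\<And>z. z \<in> U \<Longrightarrow> (\<lambda>x. d2 (\<Gamma> z x)) \<in> bipolys"
  and d20: "\<And>z s. z \<in> U \<Longrightarrow> d2 (\<Gamma> z (s, 0)) = 1"
  and eq: "\<And>z. z \<in> U \<Longrightarrow> A z * d2 z ^ l = B z * d1 z ^ k"
 shows "\<exists>Q\<in>R. \<forall>z\<in>U. A z = Q z * d1 z ^ k"
proof -
 interpret function_ring U R by fact
 obtain p where p: "p \<in> poly_families U R" "\<And>z s. z \<in> U \<Longrightarrow> A (\<Gamma> z (s, 1)) = poly (p z) s"
  using A unfolding fibre_polys_def by auto
 obtain e where e: "e \<in> poly_families U R" "\<And>z s. z \<in> U \<Longrightarrow> d1 (\<Gamma> z (s, 1)) = poly (e z) s"
  using d1 unfolding fibre_polys_def by auto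
 have main: "degree (e z) = r \<and> lead_coeff (e z) = 1 \<and> e z ^ k dvd p z" if z: "z \<in> U" for z
 proof -
  obtain E where E: "lead_coeff E = 1" "degree E = r" "\<And>s \<tau>. d1 (\<Gamma> z (s, \<tau>)) = poly (poly E [:s:]) \<tau>"
   using d12[OF z] by blast
  obtain P where P: "\<And>s \<tau>. A (\<Gamma> z (s, \<tau>)) = poly (poly P [:s:]) \<tau>" using bipolysD[OF A2[OF z]] by blast
  obtain H where H: "\<And>s \<tau>. B (\<Gamma> z (s, \<tau>)) = poly (poly H [:s:]) \<tau>" using bipolysD[OF B2[OF z]] by blast
  obtain D where D: "\<And>s \<tau>. d2 (\<Gamma> z (s, \<tau>)) = poly (poly D [:s:]) \<tau>" using bipolysD[OF d22[OF z]] by blast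
  have "spec0 0 D = 1"
   unfolding poly_eq_poly_eq_iff[symmetric] by (rule ext) (simp add: poly_spec0 D[symmetric] d20[OF z])
  moreover have "P * D ^ l = H * E ^ k"
  proof (rule poly2_eqI)
   fix s \<tau>
   show "poly (poly (P * D ^ l) [:s:]) \<tau> = poly (poly (H * E ^ k) [:s:]) \<tau>"
    using eq[OF \<Gamma>U[OF z, of "(s, \<tau>)"]] by (simp add: P H D E(3) poly_power)
  qed
  ultimately obtain W where W: "P = E ^ k * W" using monic_dvd[OF E(1)] by blast
  have eE: "e z = spec0 1 E"
   unfolding poly_eq_poly_eq_iff[symmetric] by (rule ext) (simp add: poly_spec0 E(3)[symmetric] e(2)[OF z])
  have "p z = spec0 1 P"
   unfolding poly_eq_poly_eq_iff[symmetric] by (rule ext) (simp add: poly_spec0 P[symmetric] p(2)[OF z])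
  then have dvd: "e z ^ k dvd p z" unfolding W spec0_mult spec0_power eE by simp
  have c: "coeff (e z) r = 1" unfolding eE coeff_spec0 using E(1,2) by simp
  have "degree (e z) \<le> r"
   by (rule degree_le) (simp add: eE coeff_spec0 E(2)[symmetric] coeff_eq_0)
  then have "degree (e z) = r" using le_degree[of "e z" r] c by simp
  then show ?thesis using c dvd by simp
 qed
 let ?Q = "\<lambda>z. coeff (p z div e z ^ k) 0"
 have "?Q \<in> R"
 proof (rule poly_families_div[OF poly_families_power[OF e(1)] _ p(1)])
  show "degree (e z ^ k) = k * r \<and> lead_coeff (e z ^ k) = 1" if "z \<in> U" for z
  proof -
   have r: "degree (e z) = r" and l: "lead_coeff (e z) = 1" using conjunct1[OF main[OF that]] conjunct1[OF conjunct2[OF main[OF that]]] by this+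
   have "e z \<noteq> 0" using l by (intro notI) simp
   then have "degree (e z ^ k) = k * r" unfolding r[symmetric] by (rule degree_power_eq)
   moreover have "lead_coeff (e z ^ k) = 1" by (rule trans[OF lead_coeff_power]) (simp only: l power_one)
   ultimately show ?thesis by (rule conjI)
  qed
 qed
 moreover have "A z = ?Q z * d1 z ^ k" if z: "z \<in> U" for z
 proof -
  have "p z = (p z div e z ^ k) * e z ^ k" using main[OF z] by simp
  then have "poly (p z) 0 = poly (p z div e z ^ k) 0 * poly (e z) 0 ^ k" by (metis poly_mult poly_power)
  then show ?thesis using p(2)[OF z, of 0] e(2)[OF z, of 0] \<Gamma>1[OF z] by (simp add: poly_0_coeff_0)
 qed
 ultimately show ?thesis by (intro bexI[of _ ?Q] ballI)
qed

section \<open>A monic determinant\<close>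

text \<open>The Krylov matrix of a matrix \<open>Y + s J\<close> and a vector \<open>c + s e\<close>, where \<open>J\<close> is the nilpotent
 Jordan block and \<open>e\<close> the first unit vector, has a determinant which is monic in \<open>s\<close>.\<close>

primrec krylov_pencil :: "nat \<Rightarrow> (nat \<Rightarrow> nat \<Rightarrow> 'c :: comm_ring_1) \<Rightarrow> (nat \<Rightarrow> 'c) \<Rightarrow> nat \<Rightarrow> nat \<Rightarrow> 'c poly" where
 "krylov_pencil m Y c 0 i = [:c i, if i = 0 then 1 else 0:]"
| "krylov_pencil m Y c (Suc j) i =
   (\<Sum>l<m. Polynomial.smult (Y i l) (krylov_pencil m Y c j l)) + (if i = 0 then 0 else pCons 0 (krylov_pencil m Y c j (i - 1)))"

lemma krylov_pencil_degree:
 "degree (krylov_pencil m Y c j i) \<le> Suc j \<and> coeff (krylov_pencil m Y c j i) (Suc j) = (if i = j then 1 else 0)"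
proof (induction j arbitrary: i)
 case 0
 show ?case by (auto simp: degree_pCons_eq_if)
next
 case (Suc j)
 have 1: "degree (\<Sum>l<m. Polynomial.smult (Y i l) (krylov_pencil m Y c j l)) \<le> Suc j"
  by (rule degree_sum_le) (use Suc degree_smult_le order_trans in blast)+
 have 2: "degree (pCons 0 (krylov_pencil m Y c j (i - 1))) \<le> Suc (Suc j)"
  using Suc[of "i - 1"] by (simp add: degree_pCons_eq_if)
 have "degree (krylov_pencil m Y c (Suc j) i) \<le> Suc (Suc j)"
  using 1 2 by (auto intro!: degree_add_le)
 moreover have "coeff (\<Sum>l<m. Polynomial.smult (Y i l) (krylov_pencil m Y c j l)) (Suc (Suc j)) = 0"
  by (rule coeff_eq_0) (use 1 in simp)
 then have "coeff (krylov_pencil m Y c (Suc j) i) (Suc (Suc j)) = (if i = Suc j then 1 else 0)"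
  using Suc[of "i - 1"] by auto
 ultimately show ?case ..
qed

lemma coeff_mult_bound:
 fixes p q :: "'c :: comm_ring_1 poly"
 assumes "degree p \<le> a" "degree q \<le> b"
 shows "degree (p * q) \<le> a + b \<and> coeff (p * q) (a + b) = coeff p a * coeff q b"
proof
 show "degree (p * q) \<le> a + b" using degree_mult_le[of p q] assms by simp
 have "coeff (p * q) (a + b) = (\<Sum>i\<le>a + b. if i = a then coeff p a * coeff q b else 0)"
  unfolding coeff_mult
 proof (rule sum.cong[OF refl])
  fix i assume "i \<in> {..a + b}"
  consider "i < a" | "i = a" | "a < i" by linarith
  then show "coeff p i * coeff q (a + b - i) = (if i = a then coeff p a * coeff q b else 0)"
  proof cases
   case 1
   then have "coeff q (a + b - i) = 0" using assms(2) by (intro coeff_eq_0) simp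
   then show ?thesis using 1 by simp
  next
   case 3
   then have "coeff p i = 0" using assms(1) by (intro coeff_eq_0) simp
   then show ?thesis using 3 by simp
  qed simp
 qed
 then show "coeff (p * q) (a + b) = coeff p a * coeff q b" by simp
qed

lemma coeff_prod_bound:
 fixes p :: "'i \<Rightarrow> 'c :: comm_ring_1 poly"
 assumes "finite I" "\<And>i. i \<in> I \<Longrightarrow> degree (p i) \<le> d i"
 shows "degree (\<Prod>i\<in>I. p i) \<le> (\<Sum>i\<in>I. d i) \<and> coeff (\<Prod>i\<in>I. p i) (\<Sum>i\<in>I. d i) = (\<Prod>i\<in>I. coeff (p i) (d i))"
 using assms
proof (induction I)
 case (insert i I)
 then show ?case using coeff_mult_bound[of "p i" "d i" "\<Prod>i\<in>I. p i" "\<Sum>i\<in>I. d i"] by simp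
qed simp

definition pencil_det :: "nat \<Rightarrow> (nat \<Rightarrow> nat \<Rightarrow> 'c :: comm_ring_1) \<Rightarrow> (nat \<Rightarrow> 'c) \<Rightarrow> 'c poly" where
 "pencil_det m Y c = (\<Sum>p\<in>{p. p permutes {0..<m}}. of_int (sign p) * (\<Prod>i = 0..<m. krylov_pencil m Y c (p i) i))"

text \<open>In the Leibniz expansion the factor for column \<open>j\<close> has degree at most \<open>j +
 1\<close> in \<open>s\<close>, and reaches this degree only in row \<open>j\<close>: the coefficient of top
 degree comes from the identity permutation alone.\<close>

lemma pencil_det_monic:
 "lead_coeff (pencil_det m Y c :: 'c :: comm_ring_1 poly) = 1 \<and> degree (pencil_det m Y c) = (\<Sum>i = 0..<m. Suc i)"
proof -
 let ?N = "\<Sum>i = 0..<m. Suc i"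
 let ?P = "\<lambda>p. \<Prod>i = 0..<m. krylov_pencil m Y c (p i) i"
 have perm: "(\<Sum>i = 0..<m. Suc (p i)) = ?N" if "p permutes {0..<m}" for p
  using sum.permute[OF that, of Suc] by (simp add: comp_def)
 have b: "degree (?P p) \<le> ?N \<and> coeff (?P p) ?N = (\<Prod>i = 0..<m. if i = p i then 1 else 0)" if p: "p permutes {0..<m}" for p
  using coeff_prod_bound[of "{0..<m}" "\<lambda>i. krylov_pencil m Y c (p i) i" "\<lambda>i. Suc (p i)"]
   krylov_pencil_degree[of m Y c] by (simp add: perm[OF p])
 have prod: "(\<Prod>i = 0..<m. if i = p i then 1 else 0 :: 'c) = (if p = id then 1 else 0)" if p: "p permutes {0..<m}" for p
 proof (cases "p = id")
  case False
  then obtain i where "p i \<noteq> i" by (auto simp: fun_eq_iff)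
  then have "i \<in> {0..<m}" using p by (metis permutes_not_in)
  then have "(\<Prod>i = 0..<m. if i = p i then 1 else 0 :: 'c) = 0" using \<open>p i \<noteq> i\<close> by (intro prod_zero bexI[of _ i]) auto
  then show ?thesis using False by simp
 qed simp
 have si: "of_int (sign p) = ([:of_int (sign p):] :: 'c poly)" for p :: "nat \<Rightarrow> nat"
  by (simp add: of_int_poly)
 have fin: "finite {p. p permutes {0..<m}}" by (rule finite_permutations) simp
 have "coeff (pencil_det m Y c) ?N = (\<Sum>p\<in>{p. p permutes {0..<m}}. if p = id then 1 else 0)"
  unfolding pencil_det_def coeff_sum
  by (rule sum.cong) (use b prod in \<open>auto simp: si\<close>)
 also have "\<dots> = 1" using fin permutes_id[of "{0..<m}"] by (simp add: sum.delta)
 finally have 1: "coeff (pencil_det m Y c) ?N = 1" .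
 have "degree (pencil_det m Y c) \<le> ?N"
  unfolding pencil_det_def
 proof (rule degree_sum_le[OF fin])
  fix p assume "p \<in> {p. p permutes {0..<m}}"
  then show "degree (of_int (sign p) * ?P p) \<le> ?N"
   using b[of p] degree_smult_le[of "of_int (sign p)" "?P p"] by (simp add: si)
 qed
 then have "degree (pencil_det m Y c) = ?N" using le_degree[of "pencil_det m Y c" ?N] 1 by simp
 with 1 show ?thesis by simp
qed

text \<open>The same recursion over the complex numbers, for the comparison of values.\<close>

primrec krylov_num :: "nat \<Rightarrow> (nat \<Rightarrow> nat \<Rightarrow> complex) \<Rightarrow> (nat \<Rightarrow> complex) \<Rightarrow> complex \<Rightarrow> nat \<Rightarrow> nat \<Rightarrow> complex" where
 "krylov_num m Y c s 0 i = c i + (if i = 0 then s else 0)"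
| "krylov_num m Y c s (Suc j) i =
   (\<Sum>l<m. Y i l * krylov_num m Y c s j l) + (if i = 0 then 0 else s * krylov_num m Y c s j (i - 1))"

lemma poly_krylov_pencil2:
 "poly (poly (krylov_pencil m Y c j i) [:s:]) \<tau> = krylov_num m (\<lambda>i l. poly (Y i l) \<tau>) (\<lambda>i. poly (c i) \<tau>) s j i"
 by (induction j arbitrary: i) (auto simp: poly_sum)

lemma poly_pencil_det2:
 "poly (poly (pencil_det m Y c) [:s:]) \<tau> =
  det (mat m m (\<lambda>(i, j). krylov_num m (\<lambda>i l. poly (Y i l) \<tau>) (\<lambda>i. poly (c i) \<tau>) s j i))"
proof -
 let ?M = "mat m m (\<lambda>(i, j). krylov_num m (\<lambda>i l. poly (Y i l) \<tau>) (\<lambda>i. poly (c i) \<tau>) s j i)"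
 have "det ?M = (\<Sum>p\<in>{p. p permutes {0..<m}}. of_int (sign p) * (\<Prod>i = 0..<m. ?M $$ (i, p i)))"
  by (subst det_def'[of _ m]) auto
 also have "\<dots> = (\<Sum>p\<in>{p. p permutes {0..<m}}. of_int (sign p) *
   (\<Prod>i = 0..<m. krylov_num m (\<lambda>i l. poly (Y i l) \<tau>) (\<lambda>i. poly (c i) \<tau>) s (p i) i))"
 proof (intro sum.cong refl arg_cong2[where f = "(*)"] prod.cong)
  fix p i assume "p \<in> {p. p permutes {0..<m}}" "i \<in> {0..<m}"
  then have "p i < m" using permutes_in_image[of p "{0..<m}" i] by auto
  then show "?M $$ (i, p i) = krylov_num m (\<lambda>i l. poly (Y i l) \<tau>) (\<lambda>i. poly (c i) \<tau>) s (p i) i"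
   using \<open>i \<in> {0..<m}\<close> by simp
 qed
 finally show ?thesis
  unfolding pencil_det_def by (simp add: poly_sum poly_prod poly_krylov_pencil2 of_int_poly)
qed

section \<open>Coordinates on the triangle part\<close>

text \<open>The image of \<open>v\<close> under the powers of \<open>y1\<close> in the frame: unit vectors up
 to the end of the frame, and then the vector \<open>c\<close>.\<close>

definition chain_vec :: "nat \<Rightarrow> complex mat \<Rightarrow> nat \<Rightarrow> complex mat" where
 "chain_vec n c k = mat n 1 (\<lambda>(i, j). if k < n then (if i = k then 1 else 0) else c $$ (i, 0))"

text \<open>The matrix of \<open>y1\<close> in the frame. On the columns of \<open>x\<close> it is given by
 the moment map equation, on the others it is a shift.\<close>

definition chain_mat :: "nat \<Rightarrow> nat \<Rightarrow> complex mat \<Rightarrow> complex mat \<Rightarrow> complex mat \<Rightarrow> complex mat" where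
 "chain_mat n m y u c = mat n n (\<lambda>(i, j).
   if j < m then (if i < m then y $$ (i, j) else 0) - u $$ (0, j) * chain_vec n c m $$ (i, 0)
   else chain_vec n c (Suc j) $$ (i, 0))"

definition incl_mat :: "nat \<Rightarrow> nat \<Rightarrow> complex mat" where
 "incl_mat n m = mat n m (\<lambda>(i, j). if i = j then 1 else 0)"

text \<open>The quintuple with frame \<open>G\<close>; the remaining parameters \<open>y\<close>,
 \<open>u\<close> and \<open>c\<close> are free, so that these are global coordinates on the triangle
 part.\<close>

definition from_frame ::
 "nat \<Rightarrow> nat \<Rightarrow> complex mat \<Rightarrow> complex mat \<Rightarrow> complex mat \<Rightarrow> complex mat \<Rightarrow> quintuple" where
 "from_frame n m G y u c =
   (G * incl_mat n m, G * chain_mat n m y u c * inv_mat G, y, G * chain_vec n c m, u)"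

definition tail_vec :: "nat \<Rightarrow> nat \<Rightarrow> quintuple \<Rightarrow> complex mat" where
 "tail_vec n m z = inv_mat (frame n m z) * (fst (snd z) ^\<^sub>m (n - m) * fst (snd (snd (snd z))))"

lemma chain_carrier [simp]: "chain_vec n c k \<in> carrier_mat n 1" "chain_vec n c k \<in> carrier_mat n (Suc 0)"
 "chain_mat n m y u c \<in> carrier_mat n n" "incl_mat n m \<in> carrier_mat n m"
 "dim_row (chain_vec n c k) = n" "dim_col (chain_vec n c k) = 1"
 "dim_row (chain_mat n m y u c) = n" "dim_col (chain_mat n m y u c) = n"
 "dim_row (incl_mat n m) = n" "dim_col (incl_mat n m) = m"
 unfolding chain_vec_def chain_mat_def incl_mat_def by simp_all

lemma chain_vec_unit: "i < n \<Longrightarrow> k < n \<Longrightarrow> chain_vec n c k $$ (i, 0) = (if i = k then 1 else 0)"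
 unfolding chain_vec_def by simp

lemma chain_vec_last: "c \<in> carrier_mat n 1 \<Longrightarrow> chain_vec n c n = c"
 by (rule eq_matI) (auto simp: chain_vec_def)

lemma mult_chain_vec:
 assumes A: "A \<in> carrier_mat r n" and k: "k < n" and i: "i < r"
 shows "(A * chain_vec n c k) $$ (i, 0) = A $$ (i, k)"
proof -
 have "(A * chain_vec n c k) $$ (i, 0) = (\<Sum>l<n. A $$ (i, l) * chain_vec n c k $$ (l, 0))"
  using A i by (subst mult_mat_entry) auto
 also have "\<dots> = (\<Sum>l<n. if l = k then A $$ (i, l) else 0)"
  using k by (intro sum.cong refl) (simp add: chain_vec_unit)
 finally show ?thesis using k by simp
qed

lemma chain_mat_step:
 assumes k: "m \<le> k" "k < n"
 shows "chain_mat n m y u c * chain_vec n c k = chain_vec n c (Suc k)"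
proof (rule eq_matI)
 fix i j assume "i < dim_row (chain_vec n c (Suc k))" "j < dim_col (chain_vec n c (Suc k))"
 then have ij: "i < n" "j = 0" by auto
 then show "(chain_mat n m y u c * chain_vec n c k) $$ (i, j) = chain_vec n c (Suc k) $$ (i, j)"
  using mult_chain_vec[OF chain_carrier(3) k(2) ij(1)] k by (simp add: chain_mat_def del: index_mult_mat)
qed auto

lemma chain_mat_pow:
 "m + k \<le> n \<Longrightarrow> chain_mat n m y u c ^\<^sub>m k * chain_vec n c m = chain_vec n c (m + k)"
proof (induction k)
 case 0
 show ?case by (simp add: left_mult_one_mat[OF chain_carrier(1)])
next
 case (Suc k)
 let ?Y = "chain_mat n m y u c"
 have "?Y ^\<^sub>m Suc k * chain_vec n c m = ?Y * (?Y ^\<^sub>m k * chain_vec n c m)"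
  using pow_mat_commute[OF chain_carrier(3), of n m y u c k] by (simp add: mat_assoc)
 also have "\<dots> = ?Y * chain_vec n c (m + k)" using Suc by simp
 also have "\<dots> = chain_vec n c (Suc (m + k))" by (rule chain_mat_step) (use Suc.prems in auto)
 finally show ?case by simp
qed

lemma from_frame_facts:
 assumes mn: "m \<le> n" and G: "G \<in> carrier_mat n n" "det G \<noteq> 0" and y: "y \<in> carrier_mat m m"
  and u: "u \<in> carrier_mat 1 m" and c: "c \<in> carrier_mat n 1"
 defines "z \<equiv> from_frame n m G y u c"
 shows "z \<in> triangle_points m n" "frame n m z = G" "tail_vec n m z = c"
proof -
 let ?Y = "chain_mat n m y u c" and ?y1 = "G * chain_mat n m y u c * inv_mat G"
 note C = conj_eq[OF G chain_carrier(3)[of n m y u c]]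
 have pow: "?y1 ^\<^sub>m k * (G * chain_vec n c m) = G * chain_vec n c (m + k)" if "m + k \<le> n" for k
 proof -
  have yk: "?y1 ^\<^sub>m k \<in> carrier_mat n n" "?Y ^\<^sub>m k \<in> carrier_mat n n"
   using C(1) pow_carrier_mat[OF chain_carrier(3)] by (auto simp del: pow_carrier_mat intro!: pow_carrier_mat)
  have "?y1 ^\<^sub>m k * (G * chain_vec n c m) = (?y1 ^\<^sub>m k * G) * chain_vec n c m"
   by (rule assoc_mult_mat[OF yk(1) G(1) chain_carrier(1), symmetric])
  also have "\<dots> = G * (?Y ^\<^sub>m k * chain_vec n c m)"
   unfolding pow_mat_intertwine[OF C(1) G(1) chain_carrier(3) C(2)]
   by (rule assoc_mult_mat[OF G(1) yk(2) chain_carrier(1)])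
  finally show ?thesis unfolding chain_mat_pow[OF that] .
 qed
 have z: "z = (G * incl_mat n m, ?y1, y, G * chain_vec n c m, u)" unfolding z_def from_frame_def ..
 have zq: "z \<in> quint_space n m"
  unfolding z quint_space_def using G(1) C(1) y u by auto
 show fr: "frame n m z = G"
 proof (rule eq_matI)
  fix i j assume "i < dim_row G" "j < dim_col G"
  then have ij: "i < n" "j < n" using G by auto
  show "frame n m z $$ (i, j) = G $$ (i, j)"
  proof (cases "j < m")
   case True
   have "(G * incl_mat n m) $$ (i, j) = (\<Sum>l<n. G $$ (i, l) * (if l = j then 1 else 0))"
    using G(1) ij True by (subst mult_mat_entry) (auto simp: incl_mat_def)
   also have "\<dots> = (\<Sum>l<n. if l = j then G $$ (i, l) else 0)" by (intro sum.cong) auto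
   finally show ?thesis using True ij by (simp add: frame_def z del: index_mult_mat(1))
  next
   case False
   then show ?thesis using ij pow[of "j - m"] mult_chain_vec[OF G(1) ij(2,1)]
    by (simp add: frame_def z del: index_mult_mat(1))
  qed
 qed (use G in auto)
 note I = inv_mat[OF G]
 have "tail_vec n m z = inv_mat G * (G * chain_vec n c n)"
  unfolding tail_vec_def fr using pow[of "n - m"] mn by (simp add: z)
 also have "\<dots> = chain_vec n c n" using I G by (simp flip: mat_assoc)
 finally show "tail_vec n m z = c" using chain_vec_last[OF c] by simp
 have "?Y * incl_mat n m - incl_mat n m * y + chain_vec n c m * u = 0\<^sub>m n m"
 proof (rule eq_matI)
  fix i j assume "i < dim_row (0\<^sub>m n m :: complex mat)" "j < dim_col (0\<^sub>m n m :: complex mat)"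
  then have ij: "i < n" "j < m" by auto
  have "(?Y * incl_mat n m) $$ (i, j) = (\<Sum>l<n. ?Y $$ (i, l) * (if l = j then 1 else 0))"
   using ij by (subst mult_mat_entry) (auto simp: incl_mat_def)
  also have "\<dots> = (\<Sum>l<n. if l = j then ?Y $$ (i, l) else 0)" by (intro sum.cong) auto
  also have "\<dots> = ?Y $$ (i, j)" using ij mn by simp
  finally have 1: "(?Y * incl_mat n m) $$ (i, j) = ?Y $$ (i, j)" .
  have "(incl_mat n m * y) $$ (i, j) = (\<Sum>l<m. (if i = l then 1 else 0) * y $$ (l, j))"
   using ij y by (subst mult_mat_entry) (auto simp: incl_mat_def)
  also have "\<dots> = (\<Sum>l<m. if l = i then y $$ (l, j) else 0)" by (intro sum.cong) auto
  also have "\<dots> = (if i < m then y $$ (i, j) else 0)" by simp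
  finally have 2: "(incl_mat n m * y) $$ (i, j) = (if i < m then y $$ (i, j) else 0)" .
  have 3: "(chain_vec n c m * u) $$ (i, j) = chain_vec n c m $$ (i, 0) * u $$ (0, j)"
   using ij u by (subst mult_mat_entry) auto
  have "(?Y * incl_mat n m - incl_mat n m * y + chain_vec n c m * u) $$ (i, j) =
    (?Y * incl_mat n m) $$ (i, j) - (incl_mat n m * y) $$ (i, j) + (chain_vec n c m * u) $$ (i, j)"
   using ij y u by (simp del: index_mult_mat(1))
  also have "\<dots> = 0" unfolding 1 2 3 using ij mn by (simp add: chain_mat_def)
  finally show "(?Y * incl_mat n m - incl_mat n m * y + chain_vec n c m * u) $$ (i, j) = 0\<^sub>m n m $$ (i, j)"
   using ij by simp
 qed (use y u in auto)
 then have "moment_eq n m z" unfolding z moment_eq.simps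
  using moment_chart[OF G chain_carrier(3) chain_carrier(4) C(1) y chain_carrier(1) u C(2)] by blast
 then show "z \<in> triangle_points m n"
  unfolding triangle_points_stab stab_det_def fr using zq G(2) mn by simp
qed

lemma from_frame_surj:
 assumes mn: "m \<le> n" and z: "(x, y1, y2, v, u) \<in> triangle_points m n"
 defines "G \<equiv> frame n m (x, y1, y2, v, u)" and "c \<equiv> tail_vec n m (x, y1, y2, v, u)"
 shows "det G \<noteq> 0" "c \<in> carrier_mat n 1" "from_frame n m G y2 u c = (x, y1, y2, v, u)"
  "y1 * G = G * chain_mat n m y2 u c" "v = G * chain_vec n c m"
proof -
 have zt: "(x, y1, y2, v, u) \<in> quint_space n m" "moment_eq n m (x, y1, y2, v, u)" "det G \<noteq> 0"
  using z mn unfolding triangle_points_stab stab_det_def G_def by auto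
 show "det G \<noteq> 0" by (rule zt(3))
 note z' = quint_spaceD[OF zt(1)]
 have G: "G \<in> carrier_mat n n" unfolding G_def by simp
 note I = inv_mat[OF G zt(3)]
 have yk: "y1 ^\<^sub>m k \<in> carrier_mat n n" "y1 ^\<^sub>m k * v \<in> carrier_mat n 1" for k
  using z' by (auto intro: mult_carrier_mat[of _ n n])
 have c_def': "c = inv_mat G * (y1 ^\<^sub>m (n - m) * v)" unfolding c_def tail_vec_def G_def by simp
 show c: "c \<in> carrier_mat n 1" unfolding c_def' by (rule mult_carrier_mat[OF I(1) yk(2)])
 let ?Y = "chain_mat n m y2 u c"
 have ch: "G * chain_vec n c k = y1 ^\<^sub>m (k - m) * v" if k: "m \<le> k" "k \<le> n" for k
 proof (cases "k < n")
  case True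
  show ?thesis
  proof (rule eq_matI)
   fix i j assume "i < dim_row (y1 ^\<^sub>m (k - m) * v)" "j < dim_col (y1 ^\<^sub>m (k - m) * v)"
   then have ij: "i < n" "j = 0" using yk(2)[of "k - m"] by auto
   show "(G * chain_vec n c k) $$ (i, j) = (y1 ^\<^sub>m (k - m) * v) $$ (i, j)"
    using mult_chain_vec[OF G True ij(1)] ij True k by (simp add: G_def frame_def del: index_mult_mat(1))
  qed (use G yk(2)[of "k - m"] in auto)
 next
  case False
  then have "k = n" using k by simp
  moreover have "G * c = y1 ^\<^sub>m (n - m) * v"
   unfolding c_def' using assoc_mult_mat[OF G I(1) yk(2)] I(2) left_mult_one_mat[OF yk(2)] by metis
  ultimately show ?thesis using chain_vec_last[OF c] by simp
 qed
 show v: "v = G * chain_vec n c m" using ch[of m] mn z' by simp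
 show YG: "y1 * G = G * ?Y"
 proof (rule eq_matI)
  fix i j assume "i < dim_row (G * ?Y)" "j < dim_col (G * ?Y)"
  then have ij: "i < n" "j < n" using G by auto
  have GY: "(G * ?Y) $$ (i, j) = (\<Sum>l<n. G $$ (i, l) * ?Y $$ (l, j))" using G ij by (subst mult_mat_entry) auto
  have yG: "(y1 * G) $$ (i, j) = (\<Sum>l<n. y1 $$ (i, l) * G $$ (l, j))" using G z' ij by (subst mult_mat_entry) auto
  show "(y1 * G) $$ (i, j) = (G * ?Y) $$ (i, j)"
  proof (cases "j < m")
   case True
   have "(y1 * G) $$ (i, j) = (\<Sum>l<n. y1 $$ (i, l) * x $$ (l, j))"
    unfolding yG using ij True by (intro sum.cong refl) (simp add: G_def frame_def)
   also have "\<dots> = (y1 * x) $$ (i, j)" using z' ij True by (subst mult_mat_entry) auto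
   also have "\<dots> = (x * y2) $$ (i, j) - (v * u) $$ (i, j)"
   proof -
    have e0: "(y1 * x - x * y2 + v * u) $$ (i, j) = 0" using zt(2) ij True by simp
    have e: "(y1 * x - x * y2 + v * u) $$ (i, j) = (y1 * x) $$ (i, j) - (x * y2) $$ (i, j) + (v * u) $$ (i, j)"
     using z' ij True by (simp del: index_mult_mat(1))
    have "b - c + d = 0 \<Longrightarrow> b = c - d" for b c d :: complex by (simp add: algebra_simps)
    from this[OF e0[unfolded e]] show ?thesis .
   qed
   finally have L: "(y1 * G) $$ (i, j) = (x * y2) $$ (i, j) - (v * u) $$ (i, j)" .
   have "(G * ?Y) $$ (i, j) = (\<Sum>l<n. G $$ (i, l) * (if l < m then y2 $$ (l, j) else 0)) -
     (\<Sum>l<n. G $$ (i, l) * chain_vec n c m $$ (l, 0)) * u $$ (0, j)"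
    unfolding GY sum_distrib_right sum_subtractf[symmetric] using ij True
    by (intro sum.cong refl) (simp add: chain_mat_def algebra_simps)
   also have "(\<Sum>l<n. G $$ (i, l) * (if l < m then y2 $$ (l, j) else 0)) = (\<Sum>l<m. x $$ (i, l) * y2 $$ (l, j))"
    using mn ij by (intro sum.mono_neutral_cong_right) (auto simp: G_def frame_def)
   also have "\<dots> = (x * y2) $$ (i, j)" using z' ij True by (subst mult_mat_entry) auto
   also have "(\<Sum>l<n. G $$ (i, l) * chain_vec n c m $$ (l, 0)) = (G * chain_vec n c m) $$ (i, 0)"
    using G ij by (subst mult_mat_entry) auto
   also have "\<dots> = v $$ (i, 0)" using v by simp
   also have "v $$ (i, 0) * u $$ (0, j) = (v * u) $$ (i, j)" using z' ij True by (subst mult_mat_entry) auto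
   finally show ?thesis using L by simp
  next
   case False
   have "(y1 * G) $$ (i, j) = (\<Sum>l<n. y1 $$ (i, l) * (y1 ^\<^sub>m (j - m) * v) $$ (l, 0))"
    unfolding yG using ij False by (intro sum.cong refl) (simp add: G_def frame_def del: index_mult_mat(1))
   also have "\<dots> = (y1 * (y1 ^\<^sub>m (j - m) * v)) $$ (i, 0)"
    using z' yk(2)[of "j - m"] ij by (subst mult_mat_entry[of i y1]) auto
   also have "y1 * (y1 ^\<^sub>m (j - m) * v) = y1 ^\<^sub>m Suc (j - m) * v"
    using z' pow_mat_commute[OF z'(2), of "j - m"] by (simp flip: mat_assoc)
   also have "\<dots> = G * chain_vec n c (Suc j)" using ch[of "Suc j"] False ij by (simp add: Suc_diff_le)
   also have "(G * chain_vec n c (Suc j)) $$ (i, 0) = (\<Sum>l<n. G $$ (i, l) * chain_vec n c (Suc j) $$ (l, 0))"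
    using G ij by (subst mult_mat_entry) auto
   also have "\<dots> = (G * ?Y) $$ (i, j)" unfolding GY using ij False by (intro sum.cong refl) (simp add: chain_mat_def)
   finally show ?thesis .
  qed
 qed (use G z' in auto)
 have "G * incl_mat n m = x"
 proof (rule eq_matI)
  fix i j assume "i < dim_row x" "j < dim_col x"
  then have ij: "i < n" "j < m" using z' by auto
  have "(G * incl_mat n m) $$ (i, j) = (\<Sum>l<n. G $$ (i, l) * (if l = j then 1 else 0))"
   using G ij by (subst mult_mat_entry) (auto simp: incl_mat_def)
  also have "\<dots> = (\<Sum>l<n. if l = j then G $$ (i, l) else 0)" by (intro sum.cong) auto
  finally show "(G * incl_mat n m) $$ (i, j) = x $$ (i, j)" using ij mn by (simp add: G_def frame_def)
 qed (use G z' in auto)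
 then show "from_frame n m G y2 u c = (x, y1, y2, v, u)"
  unfolding from_frame_def using v conj_unique(1)[OF G zt(3) z'(2) chain_carrier(3) YG] by simp
qed

definition truncate :: "nat \<Rightarrow> complex mat \<Rightarrow> complex mat" where
 "truncate m c = mat m 1 (\<lambda>(i, j). c $$ (i, 0))"

text \<open>A function defined in the frame coordinates, whose nonvanishing implies that \<open>v\<close> is
 cyclic. It replaces \<open>cyclic_det\<close> because it has a constant leading coefficient along the
 surfaces below.\<close>

definition slice_det :: "nat \<Rightarrow> nat \<Rightarrow> quintuple \<Rightarrow> complex" where
 "slice_det n m z = det (krylov m (fst (snd (snd z))) (truncate m (tail_vec n m z)))"

lemma truncate_carrier [simp]: "truncate m c \<in> carrier_mat m 1" "truncate m c \<in> carrier_mat m (Suc 0)"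
 unfolding truncate_def by simp_all

text \<open>A covector \<open>l\<close> that annihilates all \<open>y1\<^sup>k v\<close> vanishes, in the
 frame, on all but the first \<open>m\<close> basis vectors. There \<open>y1\<close> acts as \<open>y2\<close>
 up to multiples of \<open>v\<close>, so that the restriction of \<open>l\<close> annihilates the images under
 the powers of \<open>y2\<close> of the vector formed by the first \<open>m\<close> entries of
 \<open>c\<close>, hence is zero.\<close>

lemma slice_det_cyclic:
 assumes mn: "m \<le> n" and z: "z \<in> triangle_points m n" and d: "slice_det n m z \<noteq> 0"
 shows "cyclic_det n z \<noteq> 0"
proof -
 obtain x y1 y2 v u where z_eq: "z = (x, y1, y2, v, u)" by (cases z)
 note zz = z[unfolded z_eq]
 have zq: "(x, y1, y2, v, u) \<in> quint_space n m" using zz unfolding triangle_points_iff by blast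
 note z' = quint_spaceD[OF zq]
 define G where "G = frame n m (x, y1, y2, v, u)"
 define c where "c = tail_vec n m (x, y1, y2, v, u)"
 note S = from_frame_surj[OF mn zz, folded G_def, folded c_def]
 have G: "G \<in> carrier_mat n n" unfolding G_def by simp
 let ?Y = "chain_mat n m y2 u c"
 have Yk: "?Y ^\<^sub>m k \<in> carrier_mat n n" for k by (rule pow_carrier_mat[OF chain_carrier(3)])
 have "det (krylov n y1 v) \<noteq> 0"
  unfolding krylov_nonsingular_iff[OF z'(2,4)]
 proof (intro ballI impI)
  fix l0 :: "complex mat" assume l0: "l0 \<in> carrier_mat 1 n" and k0: "\<forall>k. l0 * (y1 ^\<^sub>m k * v) = 0\<^sub>m 1 1"
  define l where "l = l0 * G"
  have l: "l \<in> carrier_mat 1 n" unfolding l_def using l0 G by auto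
  have lY: "l * ?Y ^\<^sub>m k \<in> carrier_mat 1 n" for k by (rule mult_carrier_mat[OF l Yk])
  have kill: "l * ?Y ^\<^sub>m k * chain_vec n c m = 0\<^sub>m 1 1" for k
  proof -
   have yk: "y1 ^\<^sub>m k \<in> carrier_mat n n" using z'(2) by simp
   have "y1 ^\<^sub>m k * v = (y1 ^\<^sub>m k * G) * chain_vec n c m"
    by (subst S(5)) (rule assoc_mult_mat[OF yk G chain_carrier(1), symmetric])
   also have "\<dots> = G * (?Y ^\<^sub>m k * chain_vec n c m)"
    unfolding pow_mat_intertwine[OF z'(2) G chain_carrier(3) S(4)]
    by (rule assoc_mult_mat[OF G Yk chain_carrier(1)])
   finally have eq: "y1 ^\<^sub>m k * v = G * (?Y ^\<^sub>m k * chain_vec n c m)" .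
   have "l * ?Y ^\<^sub>m k * chain_vec n c m = l * (?Y ^\<^sub>m k * chain_vec n c m)"
    by (rule assoc_mult_mat[OF l Yk chain_carrier(1)])
   also have "\<dots> = l0 * (G * (?Y ^\<^sub>m k * chain_vec n c m))"
    unfolding l_def by (rule assoc_mult_mat[OF l0 G mult_carrier_mat[OF Yk chain_carrier(1)]])
   also have "\<dots> = 0\<^sub>m 1 1" unfolding eq[symmetric] by (rule spec[OF k0])
   finally show ?thesis .
  qed
  have kill': "l * ?Y ^\<^sub>m k * chain_vec n c j = 0\<^sub>m 1 1" if "m \<le> j" "j \<le> n" for k j
  proof -
   have "l * ?Y ^\<^sub>m k * chain_vec n c j = l * ?Y ^\<^sub>m k * (?Y ^\<^sub>m (j - m) * chain_vec n c m)"
    using chain_mat_pow[of m "j - m" n y2 u c] that by simp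
   also have "\<dots> = l * ?Y ^\<^sub>m (k + (j - m)) * chain_vec n c m"
    unfolding pow_mat_add[OF chain_carrier(3)]
    using assoc_mult_mat[OF lY Yk chain_carrier(1)] assoc_mult_mat[OF l Yk Yk] by simp
   finally show ?thesis using kill by simp
  qed
  have high: "(l * ?Y ^\<^sub>m k) $$ (0, j) = 0" if "m \<le> j" "j < n" for k j
   using mult_chain_vec[OF lY that(2), of 0 k c] kill'[of j k] that by simp
  define r where "r = mat 1 m (\<lambda>(i, j). l $$ (0, j))"
  have r: "r \<in> carrier_mat 1 m" unfolding r_def by simp
  have ryk: "r * y2 ^\<^sub>m k \<in> carrier_mat 1 m" for k using r z'(3) by (intro mult_carrier_mat[of _ 1 m]) auto
  have low: "(l * ?Y ^\<^sub>m k) $$ (0, j) = (r * y2 ^\<^sub>m k) $$ (0, j)" if "j < m" for k j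
   using that
  proof (induction k arbitrary: j)
   case 0
   then show ?case using l r z'(3) mn by (simp add: r_def)
  next
   case (Suc k)
   have "(l * ?Y ^\<^sub>m Suc k) $$ (0, j) = (l * ?Y ^\<^sub>m k * ?Y) $$ (0, j)"
    using assoc_mult_mat[OF l Yk chain_carrier(3)] by simp
   also have "\<dots> = (\<Sum>i<n. (l * ?Y ^\<^sub>m k) $$ (0, i) * ?Y $$ (i, j))"
    using lY[of k] Suc.prems mn l by (subst mult_mat_entry) auto
   also have "\<dots> = (\<Sum>i<n. (l * ?Y ^\<^sub>m k) $$ (0, i) * (if i < m then y2 $$ (i, j) else 0)) -
     (\<Sum>i<n. (l * ?Y ^\<^sub>m k) $$ (0, i) * chain_vec n c m $$ (i, 0)) * u $$ (0, j)"
    unfolding sum_distrib_right sum_subtractf[symmetric] using Suc.prems mn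
    by (intro sum.cong refl) (simp add: chain_mat_def algebra_simps del: index_mult_mat(1))
   also have "(\<Sum>i<n. (l * ?Y ^\<^sub>m k) $$ (0, i) * chain_vec n c m $$ (i, 0)) = (l * ?Y ^\<^sub>m k * chain_vec n c m) $$ (0, 0)"
    using lY[of k] l by (subst mult_mat_entry[of 0 "l * ?Y ^\<^sub>m k"]) auto
   also have "\<dots> = 0" unfolding kill by simp
   also have "(\<Sum>i<n. (l * ?Y ^\<^sub>m k) $$ (0, i) * (if i < m then y2 $$ (i, j) else 0)) =
     (\<Sum>i<m. (r * y2 ^\<^sub>m k) $$ (0, i) * y2 $$ (i, j))"
    using mn Suc.IH by (intro sum.mono_neutral_cong_right) auto
   also have "\<dots> = (r * y2 ^\<^sub>m k * y2) $$ (0, j)"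
    using ryk[of k] r z'(3) Suc.prems by (subst mult_mat_entry[of 0 "r * y2 ^\<^sub>m k"]) auto
   also have "r * y2 ^\<^sub>m k * y2 = r * y2 ^\<^sub>m Suc k" using r z'(3) by (simp add: mat_assoc)
   finally show ?case by simp
  qed
  have tz: "truncate m (tail_vec n m z) = truncate m c" unfolding z_eq c_def ..
  have "r * (y2 ^\<^sub>m k * truncate m c) = 0\<^sub>m 1 1" for k
  proof -
   have "(r * y2 ^\<^sub>m k * truncate m c) $$ (0, 0) = (\<Sum>i<m. (r * y2 ^\<^sub>m k) $$ (0, i) * c $$ (i, 0))"
    using ryk[of k] r by (subst mult_mat_entry[of 0 "r * y2 ^\<^sub>m k"]) (auto simp: truncate_def)
   also have "\<dots> = (\<Sum>i<n. (l * ?Y ^\<^sub>m k) $$ (0, i) * c $$ (i, 0))"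
    using mn high low by (intro sum.mono_neutral_cong_left) auto
   also have "\<dots> = (l * ?Y ^\<^sub>m k * c) $$ (0, 0)" using lY[of k] S(2) l by (subst mult_mat_entry[of 0 "l * ?Y ^\<^sub>m k"]) auto
   also have "\<dots> = 0" using kill'[of n k] mn chain_vec_last[OF S(2)] by simp
   finally have 0: "(r * y2 ^\<^sub>m k * truncate m c) $$ (0, 0) = 0" .
   have "r * y2 ^\<^sub>m k * truncate m c = r * (y2 ^\<^sub>m k * truncate m c)"
    by (rule assoc_mult_mat[OF r pow_carrier_mat[OF z'(3)] truncate_carrier(1)])
   moreover have "r * y2 ^\<^sub>m k * truncate m c \<in> carrier_mat 1 1"
    by (rule mult_carrier_mat[OF ryk truncate_carrier(1)])
   ultimately show ?thesis using 0 mat_1_1 by metis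
  qed
  moreover have "det (krylov m y2 (truncate m c)) \<noteq> 0" using d unfolding slice_det_def tz by (simp add: z_eq)
  ultimately have r0: "r = 0\<^sub>m 1 m"
   using r unfolding krylov_nonsingular_iff[OF z'(3) truncate_carrier(1)] by blast
  have "l = 0\<^sub>m 1 n"
  proof (rule eq_matI)
   fix i j assume "i < dim_row (0\<^sub>m 1 n :: complex mat)" "j < dim_col (0\<^sub>m 1 n :: complex mat)"
   then have ij: "i = 0" "j < n" by auto
   show "l $$ (i, j) = 0\<^sub>m 1 n $$ (i, j)"
   proof (cases "j < m")
    case True
    then show ?thesis using arg_cong[OF r0, of "\<lambda>A. A $$ (0, j)"] ij unfolding r_def by simp
   next
    case False
    then show ?thesis using high[of j 0] ij l by simp
   qed
  qed (use l in auto)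
  then show "l0 = 0\<^sub>m 1 n" using mult_right_cancel_zero[OF G S(1) l0] unfolding l_def by simp
 qed
 then show ?thesis unfolding z_eq by simp
qed

section \<open>Surfaces in the triangle part\<close>

text \<open>At \<open>\<tau> = 0\<close> the pair \<open>(y2, u)\<close> is a tridiagonal matrix with ones
 above the diagonal together with the first unit covector, which is cocyclic for every \<open>s\<close>. The
 terms with \<open>s\<close> are the nilpotent Jordan block and the first unit vector, which make
 \<open>slice_det\<close> monic in \<open>s\<close>.\<close>

definition surface :: "nat \<Rightarrow> nat \<Rightarrow> quintuple \<Rightarrow> complex \<times> complex \<Rightarrow> quintuple" where
 "surface n m z = (\<lambda>(s, \<tau>). from_frame n m (frame n m z)
   (mat m m (\<lambda>(i, l). (1 - \<tau>) * (if l = Suc i then 1 else 0) + \<tau> * fst (snd (snd z)) $$ (i, l) + s * (if i = Suc l then 1 else 0)))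
   (mat 1 m (\<lambda>(i, j). (1 - \<tau>) * (if j = 0 then 1 else 0) + \<tau> * snd (snd (snd (snd z))) $$ (0, j)))
   (mat n 1 (\<lambda>(i, j). \<tau> * tail_vec n m z $$ (i, 0) + s * (if i = 0 then 1 else 0))))"

lemma surface_points:
 assumes mn: "m \<le> n" and z: "z \<in> triangle_points m n"
 shows "surface n m z x \<in> triangle_points m n" "frame n m (surface n m z x) = frame n m z" "surface n m z (0, 1) = z"
  "det (frame n m z) \<noteq> 0"
  "tail_vec n m (surface n m z (s, \<tau>)) = mat n 1 (\<lambda>(i, j). \<tau> * tail_vec n m z $$ (i, 0) + s * (if i = 0 then 1 else 0))"
proof -
 obtain xx y1 y2 v u where z_eq: "z = (xx, y1, y2, v, u)" by (cases z)
 note S = from_frame_surj[OF mn z[unfolded z_eq], folded z_eq]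
 have zq: "(xx, y1, y2, v, u) \<in> quint_space n m" using z unfolding z_eq triangle_points_iff by blast
 note z' = quint_spaceD[OF zq]
 obtain a b where x: "x = (a, b)" by (cases x)
 show d: "det (frame n m z) \<noteq> 0" by (rule S(1))
 note F = from_frame_facts[OF mn frame_carrier(1) d mat_carrier mat_carrier mat_carrier]
 show "surface n m z x \<in> triangle_points m n" unfolding surface_def x prod.case by (rule F(1))
 show "frame n m (surface n m z x) = frame n m z" unfolding surface_def x prod.case by (rule F(2))
 show "tail_vec n m (surface n m z (s, \<tau>)) = mat n 1 (\<lambda>(i, j). \<tau> * tail_vec n m z $$ (i, 0) + s * (if i = 0 then 1 else 0))"
  unfolding surface_def prod.case by (rule F(3))
 have "mat m m (\<lambda>(i, l). (1 - 1) * (if l = Suc i then 1 else 0) + 1 * y2 $$ (i, l) + 0 * (if i = Suc l then 1 else 0)) = y2"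
  by (rule eq_matI) (use z' in auto)
 moreover have "mat 1 m (\<lambda>(i, j). (1 - 1) * (if j = 0 then 1 else 0) + 1 * u $$ (0, j)) = u"
  by (rule eq_matI) (use z' in auto)
 moreover have "mat n 1 (\<lambda>(i, j). 1 * tail_vec n m z $$ (i, 0) + 0 * (if i = 0 then 1 else 0)) = tail_vec n m z"
  by (rule eq_matI) (use S(2) in auto)
 moreover have "fst (snd (snd z)) = y2" "snd (snd (snd (snd z))) = u" unfolding z_eq by simp_all
 ultimately show "surface n m z (0, 1) = z"
  unfolding surface_def prod.case using S(3) z_eq by (simp only:)
qed

lemma surface_slice_det:
 assumes mn: "m \<le> n" and z: "z \<in> triangle_points m n" and m: "0 < m"
 shows "\<exists>E. lead_coeff E = 1 \<and> degree E = (\<Sum>i = 0..<m. Suc i) \<and>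
  (\<forall>s \<tau>. slice_det n m (surface n m z (s, \<tau>)) = poly (poly E [:s:]) \<tau>)"
proof -
 obtain x y1 y2 v u where z_eq: "z = (x, y1, y2, v, u)" by (cases z)
 let ?c = "tail_vec n m z"
 define Yp where "Yp i l = [:if l = Suc i then 1 else 0, y2 $$ (i, l) - (if l = Suc i then 1 else 0):]" for i l
 define cp where "cp i = [:0, ?c $$ (i, 0):]" for i
 have "slice_det n m (surface n m z (s, \<tau>)) = poly (poly (pencil_det m Yp cp) [:s:]) \<tau>" for s \<tau>
 proof -
  let ?Y = "mat m m (\<lambda>(i, l). (1 - \<tau>) * (if l = Suc i then 1 else 0) + \<tau> * y2 $$ (i, l) + s * (if i = Suc l then 1 else 0))"
  let ?v = "truncate m (mat n 1 (\<lambda>(i, j). \<tau> * ?c $$ (i, 0) + s * (if i = 0 then 1 else 0)))"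
  let ?num = "krylov_num m (\<lambda>i l. poly (Yp i l) \<tau>) (\<lambda>i. poly (cp i) \<tau>) s"
  have Yc: "?Y \<in> carrier_mat m m" by simp
  have kr: "(?Y ^\<^sub>m j * ?v) $$ (i, 0) = ?num j i" if "i < m" for i j
   using that
  proof (induction j arbitrary: i)
   case 0
   have "?Y ^\<^sub>m 0 * ?v = ?v" using left_mult_one_mat[OF truncate_carrier(1)] by simp
   then show ?case using 0 mn by (simp add: truncate_def cp_def)
  next
   case (Suc j)
   have Yj: "?Y ^\<^sub>m j \<in> carrier_mat m m" by (rule pow_carrier_mat[OF Yc])
   have yv: "?Y ^\<^sub>m j * ?v \<in> carrier_mat m 1" by (rule mult_carrier_mat[OF Yj truncate_carrier(1)])
   have "?Y ^\<^sub>m Suc j * ?v = (?Y * ?Y ^\<^sub>m j) * ?v" using pow_mat_commute[OF Yc, of j] by simp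
   also have "\<dots> = ?Y * (?Y ^\<^sub>m j * ?v)" by (rule assoc_mult_mat[OF Yc Yj truncate_carrier(1)])
   finally have "(?Y ^\<^sub>m Suc j * ?v) $$ (i, 0) = (?Y * (?Y ^\<^sub>m j * ?v)) $$ (i, 0)" by simp
   also have "\<dots> = (\<Sum>l<m. ?Y $$ (i, l) * (?Y ^\<^sub>m j * ?v) $$ (l, 0))"
    using Suc.prems yv by (subst mult_mat_entry[of i ?Y]) auto
   also have "\<dots> = (\<Sum>l<m. poly (Yp i l) \<tau> * ?num j l + (if i = Suc l then s * ?num j l else 0))"
    using Suc by (intro sum.cong refl) (simp add: Yp_def algebra_simps del: index_mult_mat(1))
   also have "\<dots> = (\<Sum>l<m. poly (Yp i l) \<tau> * ?num j l) + (\<Sum>l<m. if i = Suc l then s * ?num j l else 0)"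
    by (rule sum.distrib)
   also have "(\<Sum>l<m. if i = Suc l then s * ?num j l else 0) = (if i = 0 then 0 else s * ?num j (i - 1))"
    using Suc.prems by (cases i) (auto simp: sum.delta)
   finally show ?case by simp
  qed
  have "krylov m ?Y ?v = mat m m (\<lambda>(i, j). ?num j i)"
   by (rule eq_matI) (simp_all add: krylov_entry kr[unfolded One_nat_def] del: index_mult_mat(1))
  then show ?thesis
   unfolding slice_det_def surface_points(5)[OF mn z] poly_pencil_det2
   by (simp add: surface_def from_frame_def z_eq)
 qed
 then show ?thesis using pencil_det_monic[of m Yp cp] by blast
qed

text \<open>The Krylov matrix is triangular with ones on the diagonal.\<close>

lemma surface_cocyclic_det:
 assumes m: "0 < m"
 shows "cocyclic_det m (surface n m z (s, 0)) = 1"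
proof -
 let ?Y = "mat m m (\<lambda>(i, l). (1 - 0) * (if l = Suc i then 1 else 0) + 0 * fst (snd (snd z)) $$ (i, l) + s * (if i = Suc l then 1 else (0 :: complex)))"
 let ?u = "mat 1 m (\<lambda>(i, j). (1 - 0) * (if j = 0 then 1 else 0) + 0 * snd (snd (snd (snd z))) $$ (0, j)) :: complex mat"
 let ?T = "transpose_mat ?Y" and ?v = "transpose_mat ?u"
 have Tc: "?T \<in> carrier_mat m m" and vc: "?v \<in> carrier_mat m 1" by auto
 have kr: "(j < i \<longrightarrow> (?T ^\<^sub>m j * ?v) $$ (i, 0) = 0) \<and> (i = j \<longrightarrow> (?T ^\<^sub>m j * ?v) $$ (i, 0) = 1)" if "i < m" for i j
  using that
 proof (induction j arbitrary: i)
  case 0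
  have "?T ^\<^sub>m 0 * ?v = ?v" using left_mult_one_mat[OF vc] Tc by simp
  then show ?case using 0 by simp
 next
  case (Suc j)
  have Tj: "?T ^\<^sub>m j \<in> carrier_mat m m" by (rule pow_carrier_mat[OF Tc])
  have tv: "?T ^\<^sub>m j * ?v \<in> carrier_mat m 1" by (rule mult_carrier_mat[OF Tj vc])
  have "?T ^\<^sub>m Suc j * ?v = (?T * ?T ^\<^sub>m j) * ?v" using pow_mat_commute[OF Tc, of j] by simp
  also have "\<dots> = ?T * (?T ^\<^sub>m j * ?v)" by (rule assoc_mult_mat[OF Tc Tj vc])
  finally have "(?T ^\<^sub>m Suc j * ?v) $$ (i, 0) = (?T * (?T ^\<^sub>m j * ?v)) $$ (i, 0)" by simp
  also have "\<dots> = (\<Sum>l<m. ?T $$ (i, l) * (?T ^\<^sub>m j * ?v) $$ (l, 0))"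
   using Suc.prems tv by (subst mult_mat_entry[of i ?T]) auto
  also have "\<dots> = (\<Sum>l<m. (if i = Suc l then (?T ^\<^sub>m j * ?v) $$ (l, 0) else 0) + (if l = Suc i then s * (?T ^\<^sub>m j * ?v) $$ (l, 0) else 0))"
   using Suc.prems by (intro sum.cong refl) (auto simp del: index_mult_mat(1))
  also have "\<dots> = (\<Sum>l<m. if i = Suc l then (?T ^\<^sub>m j * ?v) $$ (l, 0) else 0) +
    (\<Sum>l<m. if l = Suc i then s * (?T ^\<^sub>m j * ?v) $$ (l, 0) else 0)" by (rule sum.distrib)
  also have "(\<Sum>l<m. if i = Suc l then (?T ^\<^sub>m j * ?v) $$ (l, 0) else 0) = (if i = 0 then 0 else (?T ^\<^sub>m j * ?v) $$ (i - 1, 0))"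
   using Suc.prems by (cases i) (auto simp: sum.delta simp del: index_mult_mat(1))
  also have "(\<Sum>l<m. if l = Suc i then s * (?T ^\<^sub>m j * ?v) $$ (l, 0) else 0) = (if Suc i < m then s * (?T ^\<^sub>m j * ?v) $$ (Suc i, 0) else 0)"
   by (simp add: sum.delta del: index_mult_mat(1))
  finally have e: "(?T ^\<^sub>m Suc j * ?v) $$ (i, 0) = (if i = 0 then 0 else (?T ^\<^sub>m j * ?v) $$ (i - 1, 0)) +
    (if Suc i < m then s * (?T ^\<^sub>m j * ?v) $$ (Suc i, 0) else 0)" .
  show ?case
  proof (cases i)
   case (Suc i')
   then show ?thesis unfolding e using Suc.IH[of "Suc i"] Suc.IH[of i'] Suc.prems by (auto simp del: index_mult_mat(1))
  qed simp
 qed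
 have ut: "upper_triangular (krylov m ?T ?v)"
  by (rule upper_triangularI) (use kr in \<open>simp add: krylov_entry del: index_mult_mat(1)\<close>)
 have "det (krylov m ?T ?v) = prod_list (diag_mat (krylov m ?T ?v))"
  by (rule det_upper_triangular[OF ut krylov_carrier(1)])
 also have "diag_mat (krylov m ?T ?v) = map (\<lambda>_. 1) [0..<m]"
  unfolding diag_mat_def by (intro map_cong) (use kr in \<open>auto simp: krylov_entry simp del: index_mult_mat(1)\<close>)
 also have "prod_list (map (\<lambda>_. 1 :: complex) [0..<m]) = 1" by (induction m) auto
 finally show ?thesis unfolding surface_def from_frame_def prod.case cocyclic_det.simps .
qed

section \<open>Regular functions along the surfaces\<close>

lemma regs_ring: "function_ring U (regs K U)"
 using regs by (rule function_ring_inv.axioms(1))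

lemma (in function_ring) from_frame_coords:
 assumes G: "mats n n G" and Gi: "mats n n (\<lambda>x. inv_mat (G x))" and y: "mats m m y" and u: "mats 1 m u"
  and c: "mats n 1 c" and k: "k \<in> quint_coords n m"
 shows "(\<lambda>x. k (from_frame n m (G x) (y x) (u x) (c x))) \<in> R"
proof -
 have cv: "mats n 1 (\<lambda>x. chain_vec n (c x) k)" for k
  unfolding chain_vec_def
 proof (rule mats_mat)
  fix i j assume "i < n" "j < 1"
  then show "(\<lambda>x. case (i, j) of (i, j) \<Rightarrow> if k < n then if i = k then 1 else 0 else c x $$ (i, 0)) \<in> R"
   using matsD(4)[OF c, of i 0] const by (cases "k < n"; cases "i = k") simp_all
 qed
 have cm: "mats n n (\<lambda>x. chain_mat n m (y x) (u x) (c x))"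
  unfolding chain_mat_def
 proof (rule mats_mat)
  fix i j assume ij: "i < n" "j < n"
  have v: "(\<lambda>x. chain_vec n (c x) k $$ (i, 0)) \<in> R" for k by (rule matsD(4)[OF cv]) (use ij in auto)
  show "(\<lambda>x. case (i, j) of (i, j) \<Rightarrow> if j < m
    then (if i < m then y x $$ (i, j) else 0) - u x $$ (0, j) * chain_vec n (c x) m $$ (i, 0)
    else chain_vec n (c x) (Suc j) $$ (i, 0)) \<in> R"
  proof (cases "j < m")
   case True
   have "(\<lambda>x. if i < m then y x $$ (i, j) else 0) \<in> R"
    using matsD(4)[OF y, of i j] const[of 0] True by (cases "i < m") simp_all
   from diff[OF this mult[OF matsD(4)[OF u, of 0 j] v]] True show ?thesis by simp
  qed (use v in simp)
 qed
 note im = mats_const[OF chain_carrier(4)[of n m]]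
 show ?thesis
  by (rule mats_quint_coords[OF _ _ _ _ _ k]; unfold from_frame_def fst_conv snd_conv)
   (rule mats_mult[OF G im] mats_mult[OF mats_mult[OF G cm] Gi] y mats_mult[OF G cv] u)+
qed

lemma quint_mats:
 assumes U: "U \<subseteq> quint_space n m"
 defines "R \<equiv> regs (quint_coords n m) U"
 shows "function_ring.mats U R n m (\<lambda>z. fst z)" "function_ring.mats U R n n (\<lambda>z. fst (snd z))"
  "function_ring.mats U R m m (\<lambda>z. fst (snd (snd z)))" "function_ring.mats U R n 1 (\<lambda>z. fst (snd (snd (snd z))))"
  "function_ring.mats U R 1 m (\<lambda>z. snd (snd (snd (snd z))))"
proof -
 interpret function_ring U R unfolding R_def by (rule regs_ring)
 have K: "(\<lambda>z. k z) \<in> R" if "k \<in> quint_coords n m" for k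
  unfolding R_def by (rule polys_on_regs[OF coord_polys[OF that]])
 show "mats n m (\<lambda>z. fst z)" "mats n n (\<lambda>z. fst (snd z))" "mats m m (\<lambda>z. fst (snd (snd z)))"
  "mats n 1 (\<lambda>z. fst (snd (snd (snd z))))" "mats 1 m (\<lambda>z. snd (snd (snd (snd z))))"
  by (rule mats_quint[of "\<lambda>z. z" n m, OF subsetD[OF U] K]; assumption)+
qed

lemma triangle_points_quint: "triangle_points m n \<subseteq> quint_space n m" "{z \<in> triangle_points m n. P z} \<subseteq> quint_space n m"
 by (auto simp: triangle_points_iff)

text \<open>The frame is constant along the surface, so that the denominator of \<open>f\<close>, a power of
 its determinant, is invertible in any ring that contains the inverse at the base point.\<close>

lemma (in function_ring) surface_regs:
 assumes mn: "m \<le> n" and \<zeta>: "\<And>x. x \<in> U \<Longrightarrow> \<zeta> x \<in> triangle_points m n"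
  and K: "\<And>k. k \<in> quint_coords n m \<Longrightarrow> (\<lambda>x. k (\<zeta> x)) \<in> R"
  and D: "(\<lambda>x. 1 / det (frame n m (\<zeta> x))) \<in> R" and s: "s \<in> R" and \<tau>: "\<tau> \<in> R"
  and f: "f \<in> quint_regs n m"
 shows "(\<lambda>x. f (surface n m (\<zeta> x) (s x, \<tau> x))) \<in> R"
proof -
 have \<zeta>q: "\<zeta> x \<in> quint_space n m" if "x \<in> U" for x using \<zeta>[OF that] unfolding triangle_points_iff by blast
 have M: "mats n m (\<lambda>x. fst (\<zeta> x))" "mats n n (\<lambda>x. fst (snd (\<zeta> x)))" "mats m m (\<lambda>x. fst (snd (snd (\<zeta> x))))"
  "mats n 1 (\<lambda>x. fst (snd (snd (snd (\<zeta> x)))))" "mats 1 m (\<lambda>x. snd (snd (snd (snd (\<zeta> x)))))"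
  by (rule mats_quint[of \<zeta> n m, OF \<zeta>q K]; assumption)+
 have lt: "(0 :: nat) < 1" by simp
 note G = mats_frame[where \<phi> = \<zeta>, OF M(1,2,4)]
 have Gi: "mats n n (\<lambda>x. inv_mat (frame n m (\<zeta> x)))"
 proof (rule mats_cong[OF mats_smult[OF D mats_adj[OF G]]])
  show "inv_mat (frame n m (\<zeta> x)) = (1 / det (frame n m (\<zeta> x))) \<cdot>\<^sub>m adj_mat (frame n m (\<zeta> x))" if "x \<in> U" for x
   by (rule inv_mat_adj[OF frame_carrier(1) surface_points(4)[OF mn \<zeta>[OF that]]])
 qed
 have c: "mats n 1 (\<lambda>x. tail_vec n m (\<zeta> x))"
  unfolding tail_vec_def by (rule mats_mult[OF Gi mats_mult[OF mats_power[OF M(2)] M(4)]])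
 let ?Y = "\<lambda>x. mat m m (\<lambda>(i, l). (1 - \<tau> x) * (if l = Suc i then 1 else 0) + \<tau> x * fst (snd (snd (\<zeta> x))) $$ (i, l) +
   s x * (if i = Suc l then 1 else 0))"
 let ?u = "\<lambda>x. mat 1 m (\<lambda>(i, j). (1 - \<tau> x) * (if j = 0 then 1 else 0) + \<tau> x * snd (snd (snd (snd (\<zeta> x)))) $$ (0, j))"
 let ?c = "\<lambda>x. mat n 1 (\<lambda>(i, j). \<tau> x * tail_vec n m (\<zeta> x) $$ (i, 0) + s x * (if i = 0 then 1 else 0))"
 have Y: "mats m m ?Y"
 proof (rule mats_mat)
  fix i j assume "i < m" "j < m"
  from add[OF add[OF mult[OF diff[OF const \<tau>] const] mult[OF \<tau> matsD(4)[OF M(3) this]]] mult[OF s const]]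
  show "(\<lambda>x. case (i, j) of (i, l) \<Rightarrow> (1 - \<tau> x) * (if l = Suc i then 1 else 0) +
    \<tau> x * fst (snd (snd (\<zeta> x))) $$ (i, l) + s x * (if i = Suc l then 1 else 0)) \<in> R"
   unfolding prod.case .
 qed
 have u: "mats 1 m ?u"
 proof (rule mats_mat)
  fix i j assume "i < 1" "j < m"
  from add[OF mult[OF diff[OF const \<tau>] const] mult[OF \<tau> matsD(4)[OF M(5) lt this(2)]]]
  show "(\<lambda>x. case (i, j) of (i, j) \<Rightarrow> (1 - \<tau> x) * (if j = 0 then 1 else 0) +
    \<tau> x * snd (snd (snd (snd (\<zeta> x)))) $$ (0, j)) \<in> R"
   unfolding prod.case .
 qed
 have c': "mats n 1 ?c"
 proof (rule mats_mat)
  fix i j :: nat assume "i < n" "j < 1"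
  from add[OF mult[OF \<tau> matsD(4)[OF c this(1) lt]] mult[OF s const]]
  show "(\<lambda>x. case (i, j) of (i, j) \<Rightarrow> \<tau> x * tail_vec n m (\<zeta> x) $$ (i, 0) + s x * (if i = 0 then 1 else 0)) \<in> R"
   unfolding prod.case .
 qed
 have kc: "(\<lambda>x. k (surface n m (\<zeta> x) (s x, \<tau> x))) \<in> R" if k: "k \<in> quint_coords n m" for k
  unfolding surface_def prod.case by (rule from_frame_coords[OF G Gi Y u c' k])
 obtain E where E: "affine_set (quint_coords n m) (quint_space n m) E (triangle_points m n)"
  "\<And>z. z \<in> quint_space n m \<Longrightarrow> E z = stab_det n m z"
  by (rule triangle_affine[of m n]) (rule that)
 obtain a e where a: "a \<in> poly_funs (quint_coords n m)" "\<And>z. z \<in> triangle_points m n \<Longrightarrow> f z = a z / E z ^ e"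
  by (rule regs_affine[OF E(1) f]) (rule that)
 have "(\<lambda>x. a (surface n m (\<zeta> x) (s x, \<tau> x)) * (1 / det (frame n m (\<zeta> x))) ^ e) \<in> R"
  by (rule mult[OF poly_funs_comp[OF a(1) kc] power[OF D]])
 then show ?thesis
 proof (rule cong)
  fix x assume x: "x \<in> U"
  note P = surface_points[OF mn \<zeta>[OF x]]
  have "E (surface n m (\<zeta> x) (s x, \<tau> x)) = stab_det n m (surface n m (\<zeta> x) (s x, \<tau> x))"
   by (rule E(2)) (use P(1) in \<open>simp add: triangle_points_iff\<close>)
  also have "\<dots> = det (frame n m (\<zeta> x))" unfolding stab_det_def P(2) using mn by simp
  finally show "f (surface n m (\<zeta> x) (s x, \<tau> x)) =
    a (surface n m (\<zeta> x) (s x, \<tau> x)) * (1 / det (frame n m (\<zeta> x))) ^ e"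
   unfolding a(2)[OF P(1)] by (simp add: power_one_over field_simps)
 qed
qed

lemma surface_bipolys:
 assumes mn: "m \<le> n" and z: "z \<in> triangle_points m n"
  and f: "f \<in> quint_regs n m"
 shows "(\<lambda>x. f (surface n m z x)) \<in> bipolys"
proof -
 interpret function_ring UNIV bipolys by (rule bipolys)
 have "(\<lambda>x. f (surface n m z (fst x, snd x))) \<in> bipolys"
  by (rule surface_regs[where \<zeta> = "\<lambda>_. z", OF mn z const const bipolys_vars f])
 then show ?thesis by simp
qed

lemma regs_det_frame:
 assumes mn: "m \<le> n"
 shows "(\<lambda>z. 1 / det (frame n m z)) \<in> quint_regs n m"
  "slice_det n m \<in> quint_regs n m"
proof -
 let ?T = "triangle_points m n" and ?K = "quint_coords n m"
 interpret function_ring_inv ?T "regs ?K ?T" by (rule regs)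
 note M = quint_mats[OF triangle_points_quint(1)[of m n]]
 note G = mats_frame[where \<phi> = "\<lambda>z. z", OF M(1,2,4)]
 show "(\<lambda>z. 1 / det (frame n m z)) \<in> regs ?K ?T"
  by (rule inverse[OF mats_det[OF G]]) (rule surface_points(4)[OF mn])
 have Gi: "mats n n (\<lambda>z. inv_mat (frame n m z))" by (rule mats_inv[OF G surface_points(4)[OF mn]])
 have "mats n 1 (\<lambda>z. tail_vec n m z)"
  unfolding tail_vec_def by (rule mats_mult[OF Gi mats_mult[OF mats_power[OF M(2)] M(4)]])
 then have "mats m 1 (\<lambda>z. truncate m (tail_vec n m z))"
  unfolding truncate_def by (intro mats_mat) (use mn in \<open>simp add: matsD(4)\<close>)
 from mats_det[OF mats_krylov[OF M(3) this]] show "slice_det n m \<in> regs ?K ?T"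
  unfolding slice_det_def .
qed

lemma regs_cyclic_dets:
 assumes U: "U \<subseteq> quint_space n m"
 shows "cyclic_det n \<in> regs (quint_coords n m) U" "cocyclic_det m \<in> regs (quint_coords n m) U"
proof -
 interpret function_ring U "regs (quint_coords n m) U" by (rule regs_ring)
 note M = quint_mats[OF U]
 have "(\<lambda>z. cyclic_det n z) = (\<lambda>z. det (krylov n (fst (snd z)) (fst (snd (snd (snd z))))))"
  "(\<lambda>z. cocyclic_det m z) = (\<lambda>z. det (krylov m (transpose_mat (fst (snd (snd z)))) (transpose_mat (snd (snd (snd (snd z)))))))"
  by (rule ext, case_tac z, simp)+
 then show "cyclic_det n \<in> regs (quint_coords n m) U" "cocyclic_det m \<in> regs (quint_coords n m) U"
  using mats_det[OF mats_krylov[OF M(2,4)]] mats_det[OF mats_krylov[OF mats_transpose[OF M(3)] mats_transpose[OF M(5)]]]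
  by simp_all
qed

lemma surface_fibre_polys:
 assumes mn: "m \<le> n" and f: "f \<in> quint_regs n m"
 shows "(\<lambda>x. f (surface n m (fst x) (snd x, 1))) \<in>
  fibre_polys (triangle_points m n) (quint_regs n m)"
proof -
 let ?T = "triangle_points m n" and ?R = "quint_regs n m"
 interpret T: function_ring ?T ?R by (rule regs_ring)
 interpret function_ring "?T \<times> UNIV" "fibre_polys ?T ?R" by (rule T.fibre_polys)
 show ?thesis
 proof (rule surface_regs[where \<zeta> = fst and s = snd and \<tau> = "\<lambda>_. 1", OF mn _ _ _ T.fibre_polys_var const f])
  show "fst x \<in> ?T" if "x \<in> ?T \<times> UNIV" for x using that by auto
  show "(\<lambda>x. k (fst x)) \<in> fibre_polys ?T ?R" if "k \<in> quint_coords n m" for k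
   by (rule T.fibre_polys_const[OF polys_on_regs[OF coord_polys[OF that]]])
  show "(\<lambda>x. 1 / det (frame n m (fst x))) \<in> fibre_polys ?T ?R"
   by (rule T.fibre_polys_const[OF regs_det_frame(1)[OF mn]])
 qed
qed

section \<open>Functions on the union of the two charts extend\<close>

lemma regs_basic_open:
 assumes U: "affine_set K E D U" and d: "d \<in> regs K U" and f: "f \<in> regs K {z \<in> U. d z \<noteq> 0}"
 obtains A k where "A \<in> regs K U" "\<And>z. z \<in> U \<Longrightarrow> d z \<noteq> 0 \<Longrightarrow> f z = A z / d z ^ k"
proof -
 interpret function_ring_inv U "regs K U" by (rule regs)
 have D: "D \<in> poly_funs K" and D0: "\<And>x. x \<in> U \<Longrightarrow> D x \<noteq> 0" using U unfolding affine_set_def by auto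
 obtain b e where b: "b \<in> poly_funs K" "\<And>z. z \<in> U \<Longrightarrow> d z = b z / D z ^ e" using regs_affine[OF U d] by blast
 have "{z \<in> U. d z \<noteq> 0} = {z \<in> U. b z \<noteq> 0}" using b(2) D0 by auto
 with f have "f \<in> regs K {z \<in> U. b z \<noteq> 0}" by simp
 from regs_affine[OF affine_set_basic_open[OF U b(1)] this] obtain a k where
  a: "a \<in> poly_funs K" "\<And>z. z \<in> {z \<in> U. b z \<noteq> 0} \<Longrightarrow> f z = a z / (D z * b z) ^ k" by blast
 show thesis
 proof (rule that)
  show "(\<lambda>z. a z / (D z ^ Suc e) ^ k) \<in> regs K U"
   by (rule divide[OF poly_funs_regs[OF a(1)] power[OF power[OF poly_funs_regs[OF D]]]]) (use D0 in simp)
  fix z assume z: "z \<in> U" "d z \<noteq> 0"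
  have bz: "b z = d z * D z ^ e" using b(2)[OF z(1)] D0[OF z(1)] by simp
  have "f z = a z / (D z * b z) ^ k" by (rule a(2)) (use z bz D0[OF z(1)] in simp)
  also have "D z * b z = D z ^ Suc e * d z" unfolding bz by simp
  finally show "f z = a z / (D z ^ Suc e) ^ k / d z ^ k" by (simp only: power_mult_distrib divide_divide_eq_left)
 qed
qed

text \<open>Along the surface through \<open>z\<close> the three functions are polynomials whose product is
 zero, and two of them are not zero.\<close>

lemma slice_dense:
 assumes mn: "m \<le> n" and m: "0 < m" and F: "F \<in> quint_regs n m"
  and vanish: "\<And>z. z \<in> triangle_points m n \<Longrightarrow> slice_det n m z \<noteq> 0 \<Longrightarrow> cocyclic_det m z \<noteq> 0 \<Longrightarrow> F z = 0"
  and z: "z \<in> triangle_points m n"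
 shows "F z = 0"
proof -
 have "triangle_points m n \<subseteq> quint_space n m" by (auto simp: triangle_points_iff)
 note c = regs_cyclic_dets(2)[OF this]
 obtain P where P: "\<And>s \<tau>. F (surface n m z (s, \<tau>)) = poly (poly P [:s:]) \<tau>"
  using bipolysD[OF surface_bipolys[OF mn z F]] by blast
 obtain H where H: "\<And>s \<tau>. cocyclic_det m (surface n m z (s, \<tau>)) = poly (poly H [:s:]) \<tau>"
  using bipolysD[OF surface_bipolys[OF mn z c]] by blast
 obtain E where E: "lead_coeff E = 1" "\<And>s \<tau>. slice_det n m (surface n m z (s, \<tau>)) = poly (poly E [:s:]) \<tau>"
  using surface_slice_det[OF mn z m] by blast
 have "P * (E * H) = 0"
 proof (rule poly2_eqI)
  fix s \<tau>
  show "poly (poly (P * (E * H)) [:s:]) \<tau> = poly (poly 0 [:s:]) \<tau>"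
   using vanish[OF surface_points(1)[OF mn z], of "(s, \<tau>)"] unfolding P H E(2) poly_mult by auto
 qed
 moreover have "E \<noteq> 0" using E(1) by auto
 moreover have "H \<noteq> 0" using H[of 0 0] surface_cocyclic_det[OF m, of n z 0] by auto
 ultimately have "P = 0" by simp
 then show ?thesis using P[of 0 1] surface_points(3)[OF mn z] by simp
qed

text \<open>The numerators are multiplied by one more power of the denominators, so that the identity between
 the two fractions holds everywhere on the triangle part and not only on the overlap. The extension agrees
 with the given functions where \<open>slice_det\<close> does not vanish, and then on the charts by
 \<open>slice_dense\<close>.\<close>

lemma hartogs_le:
 assumes mn: "m \<le> n" and m: "0 < m"
  and f1: "f1 \<in> regs (quint_coords n m) {z \<in> triangle_points m n. cyclic_det n z \<noteq> 0}"
  and f2: "f2 \<in> regs (quint_coords n m) {z \<in> triangle_points m n. cocyclic_det m z \<noteq> 0}"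
  and agree: "\<And>z. z \<in> triangle_points m n \<Longrightarrow> cyclic_det n z \<noteq> 0 \<Longrightarrow> cocyclic_det m z \<noteq> 0 \<Longrightarrow> f1 z = f2 z"
 shows "\<exists>Q\<in>quint_regs n m. \<forall>z\<in>triangle_points m n.
  (cyclic_det n z \<noteq> 0 \<longrightarrow> Q z = f1 z) \<and> (cocyclic_det m z \<noteq> 0 \<longrightarrow> Q z = f2 z)"
proof -
 let ?T = "triangle_points m n" and ?K = "quint_coords n m"
 let ?d = "slice_det n m" and ?c = "cyclic_det n" and ?e = "cocyclic_det m"
 interpret function_ring_inv ?T "regs ?K ?T" by (rule regs)
 obtain D where D: "affine_set ?K (quint_space n m) D ?T" by (rule triangle_affine[of m n]) (rule that)
 note T = triangle_points_quint(1)[of m n]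
 note cR = regs_cyclic_dets(1)[OF T] and eR = regs_cyclic_dets(2)[OF T] and dR = regs_det_frame(2)[OF mn]
 note dc = slice_det_cyclic[OF mn]
 have sub: "{z \<in> ?T. ?d z \<noteq> 0} \<subseteq> {z \<in> ?T. ?c z \<noteq> 0}"
 proof
  fix z assume "z \<in> {z \<in> ?T. ?d z \<noteq> 0}"
  then show "z \<in> {z \<in> ?T. ?c z \<noteq> 0}" using dc[of z] by simp
 qed
 obtain A k where A: "A \<in> regs ?K ?T" "\<And>z. z \<in> ?T \<Longrightarrow> ?d z \<noteq> 0 \<Longrightarrow> f1 z = A z / ?d z ^ k"
  by (rule regs_basic_open[OF D dR regs_subset[OF f1 sub]]) (rule that)
 obtain B l where B: "B \<in> regs ?K ?T" "\<And>z. z \<in> ?T \<Longrightarrow> ?e z \<noteq> 0 \<Longrightarrow> f2 z = B z / ?e z ^ l"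
  by (rule regs_basic_open[OF D eR f2]) (rule that)
 obtain C j where C: "C \<in> regs ?K ?T" "\<And>z. z \<in> ?T \<Longrightarrow> ?c z \<noteq> 0 \<Longrightarrow> f1 z = C z / ?c z ^ j"
  by (rule regs_basic_open[OF D cR f1]) (rule that)
 have Ad: "(\<lambda>z. A z * ?d z) \<in> regs ?K ?T" by (rule mult[OF A(1) dR])
 have Be: "(\<lambda>z. B z * ?e z) \<in> regs ?K ?T" by (rule mult[OF B(1) eR])
 have eq: "A z * ?d z * ?e z ^ Suc l = B z * ?e z * ?d z ^ Suc k" if z: "z \<in> ?T" for z
 proof (cases "?d z = 0 \<or> ?e z = 0")
  case False
  then have "A z / ?d z ^ k = B z / ?e z ^ l" using A(2)[OF z] B(2)[OF z] agree[OF z dc[OF z]] by simp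
  then have "A z * ?e z ^ l = B z * ?d z ^ k" using False by (simp add: frac_eq_eq)
  then have "(A z * ?e z ^ l) * (?d z * ?e z) = (B z * ?d z ^ k) * (?d z * ?e z)" by simp
  then show ?thesis by (simp add: ac_simps)
 qed auto
 have "\<exists>Q\<in>regs ?K ?T. \<forall>z\<in>?T. A z * ?d z = Q z * ?d z ^ Suc k"
  by (rule hartogs_division[OF regs_ring surface_points(3)[OF mn] surface_points(1)[OF mn]
    surface_fibre_polys[OF mn Ad] surface_fibre_polys[OF mn dR] surface_bipolys[OF mn _ Ad] surface_bipolys[OF mn _ Be]
    surface_slice_det[OF mn _ m] surface_bipolys[OF mn _ eR] surface_cocyclic_det[OF m] eq])
 then obtain Q where Q: "Q \<in> regs ?K ?T" "\<forall>z\<in>?T. A z * ?d z = Q z * ?d z ^ Suc k" by (rule bexE)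
 have Q1: "Q z = f1 z" if z: "z \<in> ?T" "?d z \<noteq> 0" for z
 proof -
  have "A z = Q z * ?d z ^ k" using bspec[OF Q(2) z(1)] z(2) by simp
  then show ?thesis using A(2)[OF z] z(2) by simp
 qed
 have 1: "Q z * ?c z ^ j * ?c z - C z * ?c z = 0" if z: "z \<in> ?T" for z
 proof (rule slice_dense[OF mn m _ _ z])
  show "(\<lambda>z. Q z * ?c z ^ j * ?c z - C z * ?c z) \<in> regs ?K ?T"
   by (rule diff[OF mult[OF mult[OF Q(1) power[OF cR]] cR] mult[OF C(1) cR]])
  show "Q z * ?c z ^ j * ?c z - C z * ?c z = 0" if "z \<in> ?T" "?d z \<noteq> 0" for z
   using Q1[OF that] C(2)[OF that(1) dc[OF that]] dc[OF that] by simp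
 qed
 have 2: "Q z * ?e z ^ l * ?e z - B z * ?e z = 0" if z: "z \<in> ?T" for z
 proof (rule slice_dense[OF mn m _ _ z])
  show "(\<lambda>z. Q z * ?e z ^ l * ?e z - B z * ?e z) \<in> regs ?K ?T"
   by (rule diff[OF mult[OF mult[OF Q(1) power[OF eR]] eR] mult[OF B(1) eR]])
  show "Q z * ?e z ^ l * ?e z - B z * ?e z = 0" if "z \<in> ?T" "?d z \<noteq> 0" "?e z \<noteq> 0" for z
   using Q1[OF that(1,2)] agree[OF that(1) dc[OF that(1,2)] that(3)] B(2)[OF that(1,3)] that(3) by simp
 qed
 have Qc: "Q z = f1 z" if z: "z \<in> ?T" "?c z \<noteq> 0" for z
 proof -
  have "Q z * ?c z ^ j = C z" using 1[OF z(1)] z(2) by simp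
  moreover have "f1 z * ?c z ^ j = C z" using C(2)[OF z] z(2) by simp
  ultimately have "Q z * ?c z ^ j = f1 z * ?c z ^ j" by (rule trans[OF _ sym])
  then show ?thesis using z(2) by simp
 qed
 have Qe: "Q z = f2 z" if z: "z \<in> ?T" "?e z \<noteq> 0" for z
 proof -
  have "Q z * ?e z ^ l = B z" using 2[OF z(1)] z(2) by simp
  moreover have "f2 z * ?e z ^ l = B z" using B(2)[OF z] z(2) by simp
  ultimately have "Q z * ?e z ^ l = f2 z * ?e z ^ l" by (rule trans[OF _ sym])
  then show ?thesis using z(2) by simp
 qed
 show ?thesis by (intro bexI[OF _ Q(1)] ballI conjI impI) (simp_all add: Qc Qe)
qed

lemma regs_dual:
 assumes U: "U \<subseteq> quint_space n m" and V: "\<And>z. z \<in> U \<Longrightarrow> dual z \<in> V" and f: "f \<in> regs (quint_coords m n) V"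
 shows "(\<lambda>z. f (dual z)) \<in> regs (quint_coords n m) U"
proof (rule regs_comp[OF f V])
 interpret function_ring U "regs (quint_coords n m) U" by (rule regs_ring)
 note M = quint_mats[OF U]
 show "(\<lambda>z. k (dual z)) \<in> regs (quint_coords n m) U" if "k \<in> quint_coords m n" for k
  by (rule mats_quint_coords[OF _ _ _ _ _ that]; unfold dual_sel)
   (rule mats_uminus[OF mats_transpose[OF M(1)]] mats_transpose[OF M(3)] mats_transpose[OF M(2)]
    mats_transpose[OF M(5)] mats_transpose[OF M(4)])+
qed

theorem hartogs_triangle:
 assumes n: "0 < n" and m: "0 < m"
  and f1: "f1 \<in> regs (quint_coords n m) {z \<in> triangle_points m n. cyclic_det n z \<noteq> 0}"
  and f2: "f2 \<in> regs (quint_coords n m) {z \<in> triangle_points m n. cocyclic_det m z \<noteq> 0}"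
  and agree: "\<And>z. z \<in> triangle_points m n \<Longrightarrow> cyclic_det n z \<noteq> 0 \<Longrightarrow> cocyclic_det m z \<noteq> 0 \<Longrightarrow> f1 z = f2 z"
 shows "\<exists>Q\<in>quint_regs n m. \<forall>z\<in>triangle_points m n.
  (cyclic_det n z \<noteq> 0 \<longrightarrow> Q z = f1 z) \<and> (cocyclic_det m z \<noteq> 0 \<longrightarrow> Q z = f2 z)"
proof (cases "m \<le> n")
 case True
 show ?thesis by (rule hartogs_le[OF True m f1 f2 agree])
next
 case False
 then have nm: "n \<le> m" by simp
 have q: "{z \<in> triangle_points n m. P z} \<subseteq> quint_space m n" "triangle_points m n \<subseteq> quint_space n m" for P
  by (auto simp: triangle_points_iff)
 have "(\<lambda>z. f2 (dual z)) \<in> regs (quint_coords m n) {z \<in> triangle_points n m. cyclic_det m z \<noteq> 0}"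
  by (rule regs_dual[OF q(1) _ f2]) (simp add: dual_points(1) dual_dets)
 moreover have "(\<lambda>z. f1 (dual z)) \<in> regs (quint_coords m n) {z \<in> triangle_points n m. cocyclic_det n z \<noteq> 0}"
  by (rule regs_dual[OF q(1) _ f1]) (simp add: dual_points(1) dual_dets)
 moreover have "f2 (dual z) = f1 (dual z)"
  if "z \<in> triangle_points n m" "cyclic_det m z \<noteq> 0" "cocyclic_det n z \<noteq> 0" for z
  using agree[of "dual z"] dual_points(1)[OF that(1)] that(2,3) by (simp add: dual_dets)
 ultimately obtain Q where Q: "Q \<in> quint_regs m n"
  "\<forall>z\<in>triangle_points n m. (cyclic_det m z \<noteq> 0 \<longrightarrow> Q z = f2 (dual z)) \<and> (cocyclic_det n z \<noteq> 0 \<longrightarrow> Q z = f1 (dual z))"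
  by (rule bexE[OF hartogs_le[OF nm n]])
 show ?thesis
 proof (intro bexI ballI)
  show "(\<lambda>z. Q (dual z)) \<in> quint_regs n m"
   by (rule regs_dual[OF q(2) dual_points(1) Q(1)])
  fix z assume z: "z \<in> triangle_points m n"
  show "(cyclic_det n z \<noteq> 0 \<longrightarrow> Q (dual z) = f1 z) \<and> (cocyclic_det m z \<noteq> 0 \<longrightarrow> Q (dual z) = f2 z)"
   using bspec[OF Q(2) dual_points(1)[OF z]] unfolding dual_dets dual_points(2)[OF z] by blast
 qed
qed

lemma cyclic_dense:
 assumes n: "0 < n" and m: "0 < m" and F: "F \<in> quint_regs n m"
  and vanish: "\<And>z. z \<in> triangle_points m n \<Longrightarrow> cyclic_det n z \<noteq> 0 \<Longrightarrow> F z = 0"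
  and z: "z \<in> triangle_points m n"
 shows "F z = 0"
proof (cases "m \<le> n")
 case True
 show ?thesis by (rule slice_dense[OF True m F vanish[OF _ slice_det_cyclic[OF True]] z])
next
 case False
 then have nm: "n \<le> m" by simp
 have q: "triangle_points n m \<subseteq> quint_space m n" by (auto simp: triangle_points_iff)
 have "F (dual (dual z)) = 0"
 proof (rule slice_dense[OF nm n regs_dual[OF q dual_points(1) F] _ dual_points(1)[OF z]])
  show "F (dual z) = 0" if "z \<in> triangle_points n m" "cocyclic_det n z \<noteq> 0" for z
   using vanish[OF dual_points(1)[OF that(1)]] that(2) by (simp add: dual_dets)
 qed
 then show ?thesis unfolding dual_points(2)[OF z] .
qed

section \<open>The charts are morphisms\<close>

abbreviation (input) Wh_regs :: "nat \<Rightarrow> nat \<Rightarrow> (wh_point \<Rightarrow> complex) set" where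
 "Wh_regs n m \<equiv> regs (coords (Wh n m)) (points (Wh n m))"

lemma (in function_ring) mats_wh:
 assumes W: "\<And>x. x \<in> U \<Longrightarrow> \<phi> x \<in> carrier_mat n n \<times> carrier_mat m m \<times> carrier_mat n n \<times> carrier_mat m m"
  and K: "\<And>k. k \<in> coords (Wh n m) \<Longrightarrow> (\<lambda>x. k (\<phi> x)) \<in> R"
 shows "mats n n (\<lambda>x. fst (\<phi> x))" "mats m m (\<lambda>x. fst (snd (\<phi> x)))"
  "mats n n (\<lambda>x. fst (snd (snd (\<phi> x))))" "mats m m (\<lambda>x. snd (snd (snd (\<phi> x))))"
proof -
 have q: "fst (\<phi> x) \<in> carrier_mat n n" "fst (snd (\<phi> x)) \<in> carrier_mat m m" "fst (snd (snd (\<phi> x))) \<in> carrier_mat n n"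
  "snd (snd (snd (\<phi> x))) \<in> carrier_mat m m" if "x \<in> U" for x
  using W[OF that] by (auto simp: mem_Times_iff)
 have k: "(\<lambda>z. \<pi> z $$ (i, j)) \<in> entries r c \<pi>" if "i < r" "j < c" for i j r c and \<pi> :: "wh_point \<Rightarrow> complex mat"
  using that unfolding entries_def by blast
 show "mats n n (\<lambda>x. fst (\<phi> x))"
  by (rule matsI[OF q(1)], assumption)
   (use K[of "\<lambda>z. (case z of (g, h, a, b) \<Rightarrow> g) $$ (i, j)" for i j] k in \<open>simp add: Wh_def case_prod_unfold\<close>)
 show "mats m m (\<lambda>x. fst (snd (\<phi> x)))"
  by (rule matsI[OF q(2)], assumption)
   (use K[of "\<lambda>z. (case z of (g, h, a, b) \<Rightarrow> h) $$ (i, j)" for i j] k in \<open>simp add: Wh_def case_prod_unfold\<close>)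
 show "mats n n (\<lambda>x. fst (snd (snd (\<phi> x))))"
  by (rule matsI[OF q(3)], assumption)
   (use K[of "\<lambda>z. (case z of (g, h, a, b) \<Rightarrow> a) $$ (i, j)" for i j] k in \<open>simp add: Wh_def case_prod_unfold\<close>)
 show "mats m m (\<lambda>x. snd (snd (snd (\<phi> x))))"
  by (rule matsI[OF q(4)], assumption)
   (use K[of "\<lambda>z. (case z of (g, h, a, b) \<Rightarrow> b) $$ (i, j)" for i j] k in \<open>simp add: Wh_def case_prod_unfold\<close>)
qed

lemma (in function_ring) mats_wh_coords:
 assumes "mats n n (\<lambda>x. fst (\<phi> x))" "mats m m (\<lambda>x. fst (snd (\<phi> x)))"
  "mats n n (\<lambda>x. fst (snd (snd (\<phi> x))))" "mats m m (\<lambda>x. snd (snd (snd (\<phi> x))))"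
  and k: "k \<in> coords (Wh n m)"
 shows "(\<lambda>x. k (\<phi> x)) \<in> R"
 using k matsD(4)[OF assms(1)] matsD(4)[OF assms(2)] matsD(4)[OF assms(3)] matsD(4)[OF assms(4)]
 unfolding Wh_def entries_def by (auto simp: case_prod_unfold)

lemma Wh_pointsD:
 assumes nm: "0 < n" "0 < m" and w: "w \<in> points (Wh n m)"
 shows "w \<in> carrier_mat n n \<times> carrier_mat m m \<times> carrier_mat n n \<times> carrier_mat m m"
  "det (fst w) \<noteq> 0" "det (fst (snd w)) \<noteq> 0"
proof -
 obtain g h a b where "w = (g, h, a, b)" by (cases w)
 with w show "w \<in> carrier_mat n n \<times> carrier_mat m m \<times> carrier_mat n n \<times> carrier_mat m m"
  "det (fst w) \<noteq> 0" "det (fst (snd w)) \<noteq> 0"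
  using Wh_points_iff[OF nm, of g h a b] companions_carrier by auto
qed

lemma wh_mats:
 assumes nm: "0 < n" "0 < m"
 defines "R \<equiv> Wh_regs n m"
 shows "function_ring.mats (points (Wh n m)) R n n (\<lambda>w. fst w)" "function_ring.mats (points (Wh n m)) R m m (\<lambda>w. fst (snd w))"
  "function_ring.mats (points (Wh n m)) R n n (\<lambda>w. fst (snd (snd w)))"
  "function_ring.mats (points (Wh n m)) R m m (\<lambda>w. snd (snd (snd w)))"
proof -
 interpret function_ring "points (Wh n m)" R unfolding R_def by (rule regs_ring)
 have K: "(\<lambda>w. k w) \<in> R" if "k \<in> coords (Wh n m)" for k
  unfolding R_def by (rule polys_on_regs[OF coord_polys[OF that]])
 show "mats n n (\<lambda>w. fst w)" "mats m m (\<lambda>w. fst (snd w))" "mats n n (\<lambda>w. fst (snd (snd w)))"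
  "mats m m (\<lambda>w. snd (snd (snd w)))"
  by (rule mats_wh[of "\<lambda>w. w" n m, OF Wh_pointsD(1)[OF nm] K]; assumption)+
qed

lemma (in function_ring) mats_syl:
 assumes a: "mats n n a" and r: "mats 1 m r" and B: "mats m m B"
 shows "mats n m (\<lambda>x. syl_x n m (a x) (r x) (B x))" "mats 1 m (\<lambda>x. syl_u n m (a x) (r x) (B x))"
proof -
 have h: "(\<lambda>x. horner n (a x) (r x) (B x) i j) \<in> R" if j: "j < m" for i j
  unfolding horner_def
 proof (rule sum)
  fix k assume "k \<in> {i..n}"
  have "(\<lambda>x. ccoeff n (a x) k) \<in> R"
   unfolding ccoeff_def using uminus[OF matsD(4)[OF a, of k "n - 1"]] const
   by (cases "k < n"; cases "k = n") simp_all
  moreover have "(\<lambda>x. (r x * B x ^\<^sub>m (k - i)) $$ (0, j)) \<in> R"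
   by (rule matsD(4)[OF mats_mult[OF r mats_power[OF B]] _ j]) simp
  ultimately show "(\<lambda>x. ccoeff n (a x) k * (r x * B x ^\<^sub>m (k - i)) $$ (0, j)) \<in> R" by (rule mult)
 qed
 show "mats n m (\<lambda>x. syl_x n m (a x) (r x) (B x))" "mats 1 m (\<lambda>x. syl_u n m (a x) (r x) (B x))"
  unfolding syl_x_def syl_u_def by (rule mats_mat; unfold prod.case; rule h; assumption)+
qed

lemma (in function_ring_inv) mats_dual_conj:
 assumes h: "mats m m h" "\<And>x. x \<in> U \<Longrightarrow> det (h x) \<noteq> 0" and b: "mats m m b"
 shows "mats m m (\<lambda>x. dual_conj (h x) (b x))"
proof -
 note ht = mats_transpose[OF h(1)]
 have "det (transpose_mat (h x)) \<noteq> 0" if "x \<in> U" for x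
  using h(2)[OF that] det_transpose[OF matsD(1)[OF h(1) that]] by simp
 then show ?thesis unfolding dual_conj_def by (rule mats_mult[OF mats_mult[OF mats_inv[OF ht] mats_transpose[OF b]] ht])
qed

lemma psi_sel:
 "fst (psi n m w) = fst w * syl_x n m (fst (snd (snd w))) (transpose_mat (fst (snd w) * first_unit m))
   (dual_conj (fst (snd w)) (snd (snd (snd w))))"
 "fst (snd (psi n m w)) = fst w * fst (snd (snd w)) * inv_mat (fst w)"
 "fst (snd (snd (psi n m w))) = dual_conj (fst (snd w)) (snd (snd (snd w)))"
 "fst (snd (snd (snd (psi n m w)))) = fst w * first_unit n"
 "snd (snd (snd (snd (psi n m w)))) = syl_u n m (fst (snd (snd w))) (transpose_mat (fst (snd w) * first_unit m))
   (dual_conj (fst (snd w)) (snd (snd (snd w))))"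
 by (cases w, simp)+

lemma regs_psi:
 assumes nm: "0 < n" "0 < m" and f: "f \<in> quint_regs n m"
 shows "(\<lambda>w. f (psi n m w)) \<in> Wh_regs n m"
proof (rule regs_comp[OF f psi_points(1)[OF nm]], assumption)
 interpret function_ring_inv "points (Wh n m)" "Wh_regs n m" by (rule regs)
 note M = wh_mats[OF nm]
 have r: "mats 1 m (\<lambda>w. transpose_mat (fst (snd w) * first_unit m))"
  by (rule mats_transpose[OF mats_mult[OF M(2) mats_const[OF first_unit_carrier(1)]]])
 note B = mats_dual_conj[OF M(2) Wh_pointsD(3)[OF nm] M(4)]
 show "(\<lambda>w. k (psi n m w)) \<in> Wh_regs n m" if "k \<in> quint_coords n m" for k
  by (rule mats_quint_coords[OF _ _ _ _ _ that]; unfold psi_sel)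
   (rule mats_mult[OF M(1) mats_syl(1)[OF M(3) r B]]
    mats_mult[OF mats_mult[OF M(1,3)] mats_inv[OF M(1) Wh_pointsD(2)[OF nm]]]
    B mats_mult[OF M(1) mats_const[OF first_unit_carrier(1)]] mats_syl(2)[OF M(3) r B] | assumption)+
qed

lemma psi_inv_sel:
 "fst (psi_inv n m z) = krylov n (fst (snd z)) (fst (snd (snd (snd z))))"
 "fst (snd (psi_inv n m z)) = krylov m (transpose_mat (fst (snd (snd z))))
   (transpose_mat (last_row n m (inv_mat (fst (psi_inv n m z)) * fst z)))"
 "fst (snd (snd (psi_inv n m z))) = inv_mat (fst (psi_inv n m z)) * fst (snd z) * fst (psi_inv n m z)"
 "snd (snd (snd (psi_inv n m z))) =
   inv_mat (fst (snd (psi_inv n m z))) * transpose_mat (fst (snd (snd z))) * fst (snd (psi_inv n m z))"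
 by (cases z, simp add: Let_def)+

lemma regs_psi_inv:
 assumes nm: "0 < n" "0 < m" and f: "f \<in> Wh_regs n m"
 shows "(\<lambda>z. f (psi_inv n m z)) \<in> regs (quint_coords n m) {z \<in> triangle_points m n. cyclic_det n z \<noteq> 0}"
proof (rule regs_comp[OF f])
 let ?U = "{z \<in> triangle_points m n. cyclic_det n z \<noteq> 0}"
 interpret function_ring_inv ?U "regs (quint_coords n m) ?U" by (rule regs)
 show W: "psi_inv n m z \<in> points (Wh n m)" if "z \<in> ?U" for z
  using psi_inv_points(1)[OF nm, of z] that by simp
 note M = quint_mats[OF triangle_points_quint(2)[of m n]]
 have g: "mats n n (\<lambda>z. fst (psi_inv n m z))" unfolding psi_inv_sel(1) by (rule mats_krylov[OF M(2,4)])
 have gi: "mats n n (\<lambda>z. inv_mat (fst (psi_inv n m z)))" by (rule mats_inv[OF g Wh_pointsD(2)[OF nm W]])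
 have "mats 1 m (\<lambda>z. last_row n m (inv_mat (fst (psi_inv n m z)) * fst z))"
  unfolding last_row_def
  by (rule mats_mat; unfold prod.case; rule matsD(4)[OF mats_mult[OF gi M(1)]]) (use nm in simp_all)
 from mats_krylov[OF mats_transpose[OF M(3)] mats_transpose[OF this]]
 have h: "mats m m (\<lambda>z. fst (snd (psi_inv n m z)))" unfolding psi_inv_sel(2) .
 have hi: "mats m m (\<lambda>z. inv_mat (fst (snd (psi_inv n m z))))" by (rule mats_inv[OF h Wh_pointsD(3)[OF nm W]])
 have a: "mats n n (\<lambda>z. fst (snd (snd (psi_inv n m z))))"
  unfolding psi_inv_sel(3) by (rule mats_mult[OF mats_mult[OF gi M(2)] g])
 have b: "mats m m (\<lambda>z. snd (snd (snd (psi_inv n m z))))"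
  unfolding psi_inv_sel(4) by (rule mats_mult[OF mats_mult[OF hi mats_transpose[OF M(3)]] h])
 show "(\<lambda>z. k (psi_inv n m z)) \<in> regs (quint_coords n m) ?U" if "k \<in> coords (Wh n m)" for k
  by (rule mats_wh_coords[OF g h a b that])
qed

lemma swap_sel:
 "fst (swap n w) = (-1) ^ n \<cdot>\<^sub>m fst (snd w)" "fst (snd (swap n w)) = fst w"
 "fst (snd (snd (swap n w))) = snd (snd (snd w))" "snd (snd (snd (swap n w))) = fst (snd (snd w))"
 "fst (unswap n w) = fst (snd w)" "fst (snd (unswap n w)) = (-1) ^ n \<cdot>\<^sub>m fst w"
 "fst (snd (snd (unswap n w))) = snd (snd (snd w))" "snd (snd (snd (unswap n w))) = fst (snd (snd w))"
 by (cases w, simp)+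

lemma regs_swap:
 assumes nm: "0 < n" "0 < m"
 shows "f \<in> Wh_regs m n \<Longrightarrow>
   (\<lambda>w. f (swap n w)) \<in> Wh_regs n m"
  "f \<in> Wh_regs n m \<Longrightarrow>
   (\<lambda>w. f (unswap n w)) \<in> Wh_regs m n"
proof -
 assume f: "f \<in> Wh_regs m n"
 interpret function_ring_inv "points (Wh n m)" "Wh_regs n m" by (rule regs)
 note M = wh_mats[OF nm]
 show "(\<lambda>w. f (swap n w)) \<in> Wh_regs n m"
 proof (rule regs_comp[OF f swap_points(1)[OF nm]], assumption)
  show "(\<lambda>w. k (swap n w)) \<in> Wh_regs n m" if "k \<in> coords (Wh m n)" for k
   by (rule mats_wh_coords[OF _ _ _ _ that]; unfold swap_sel)
    (rule mats_smult[OF const M(2)] M(1) M(4) M(3) | assumption)+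
 qed
next
 assume f: "f \<in> Wh_regs n m"
 interpret function_ring_inv "points (Wh m n)" "Wh_regs m n" by (rule regs)
 note M = wh_mats[OF nm(2,1)]
 show "(\<lambda>w. f (unswap n w)) \<in> Wh_regs m n"
 proof (rule regs_comp[OF f swap_points(2)[OF nm]], assumption)
  show "(\<lambda>w. k (unswap n w)) \<in> Wh_regs m n" if "k \<in> coords (Wh n m)" for k
   by (rule mats_wh_coords[OF _ _ _ _ that]; unfold swap_sel)
    (rule M(2) mats_smult[OF const M(1)] M(4) M(3) | assumption)+
 qed
qed

lemma regs_psi':
 assumes nm: "0 < n" "0 < m" and f: "f \<in> quint_regs n m"
 shows "(\<lambda>w. f (psi' n m w)) \<in> Wh_regs n m"
proof -
 have "(\<lambda>z. f (dual z)) \<in> quint_regs m n"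
  by (rule regs_dual[OF _ dual_points(1) f]) (auto simp: triangle_points_iff)
 from regs_swap(1)[OF nm regs_psi[OF nm(2,1) this]] show ?thesis unfolding psi'_def .
qed

lemma regs_psi'_inv:
 assumes nm: "0 < n" "0 < m" and f: "f \<in> Wh_regs n m"
 shows "(\<lambda>z. f (psi'_inv n m z)) \<in> regs (quint_coords n m) {z \<in> triangle_points m n. cocyclic_det m z \<noteq> 0}"
 unfolding psi'_inv_def
proof (rule regs_dual[OF _ _ regs_psi_inv[OF nm(2,1) regs_swap(2)[OF nm f]]])
 show "{z \<in> triangle_points m n. cocyclic_det m z \<noteq> 0} \<subseteq> quint_space n m" by (auto simp: triangle_points_iff)
 show "dual z \<in> {z \<in> triangle_points n m. cyclic_det m z \<noteq> 0}"
  if "z \<in> {z \<in> triangle_points m n. cocyclic_det m z \<noteq> 0}" for z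
  using that dual_points(1)[of z m n] by (simp add: dual_dets)
qed

lemma triangle_act_sel:
 "fst (triangle_act (g, h) z) = g * fst z * transpose_mat h"
 "fst (snd (triangle_act (g, h) z)) = g * fst (snd z) * inv_mat g"
 "fst (snd (snd (triangle_act (g, h) z))) = inv_mat (transpose_mat h) * fst (snd (snd z)) * transpose_mat h"
 "fst (snd (snd (snd (triangle_act (g, h) z)))) = g * fst (snd (snd (snd z)))"
 "snd (snd (snd (snd (triangle_act (g, h) z)))) = snd (snd (snd (snd z))) * transpose_mat h"
 by (cases z, simp)+

lemma regs_triangle_act:
 assumes \<gamma>: "\<gamma> \<in> GL n \<times> GL m" and f: "f \<in> quint_regs n m"
 shows "(\<lambda>z. f (triangle_act \<gamma> z)) \<in> quint_regs n m"
proof (rule regs_comp[OF f triangle_act_points[OF _ \<gamma>]], assumption)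
 obtain g h where gh: "\<gamma> = (g, h)" by (cases \<gamma>)
 with \<gamma> have g: "g \<in> carrier_mat n n" "det g \<noteq> 0" and h: "h \<in> carrier_mat m m" "det h \<noteq> 0" by (auto simp: GL_iff)
 interpret function_ring_inv "triangle_points m n" "quint_regs n m" by (rule regs)
 note M = quint_mats[OF triangle_points_quint(1)[of m n]]
 have th: "transpose_mat h \<in> carrier_mat m m" "det (transpose_mat h) \<noteq> 0" using h det_transpose[OF h(1)] by auto
 note c = mats_const[OF g(1)] mats_const[OF th(1)] mats_const[OF inv_mat(1)[OF g]] mats_const[OF inv_mat(1)[OF th]]
 show "(\<lambda>z. k (triangle_act \<gamma> z)) \<in> quint_regs n m" if "k \<in> quint_coords n m" for k
  unfolding gh
  by (rule mats_quint_coords[OF _ _ _ _ _ that]; unfold triangle_act_sel)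
   (rule mats_mult[OF mats_mult[OF c(1) M(1)] c(2)] mats_mult[OF mats_mult[OF c(1) M(2)] c(3)]
    mats_mult[OF mats_mult[OF c(4) M(3)] c(2)] mats_mult[OF c(1) M(4)] mats_mult[OF M(5) c(2)] | assumption)+
qed

section \<open>The algebra of the birational map\<close>

text \<open>A function \<open>f\<close> of the algebra gives \<open>f\<close> on the first chart and its
 pullback on the second one. By \<open>sigma_charts\<close> the two agree on the overlap.\<close>

lemma A_sigma_carrier:
 assumes nm: "0 < n" "0 < m"
 shows "f \<in> carrier (A_sigma n m) \<longleftrightarrow>
  (\<exists>Q\<in>quint_regs n m. f = (\<lambda>w\<in>points (Wh n m). Q (psi n m w)))"
proof -
 let ?P = "points (Wh n m)" and ?R = "Wh_regs n m"
 let ?T = "triangle_points m n"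
 interpret function_ring ?P ?R by (rule regs_ring)
 have "openin (zariski (Wh n m)) ?P" using openin_topspace[of "zariski (Wh n m)"] unfolding topspace_zariski .
 note reg = regular_funs_iff[OF this]
 have carrier: "f \<in> carrier (A_sigma n m) \<longleftrightarrow> f \<in> regular_funs (Wh n m) ?P \<and>
   (\<exists>F\<in>regular_funs (Wh n m) ?P. \<forall>w\<in>sigma_dom n m. F w = f (sigma_rho n m w))"
  unfolding A_sigma_def fun_algebra_def by simp
 have rs: "(\<lambda>w\<in>?P. F w) \<in> regular_funs (Wh n m) ?P" if "F \<in> ?R" for F
  unfolding reg using cong[OF that, of "\<lambda>w\<in>?P. F w"] by simp
 show ?thesis
 proof
  assume "\<exists>Q\<in>regs (quint_coords n m) ?T. f = (\<lambda>w\<in>?P. Q (psi n m w))"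
  then obtain Q where Q: "Q \<in> regs (quint_coords n m) ?T" and f: "f = (\<lambda>w\<in>?P. Q (psi n m w))" by (elim bexE)
  show "f \<in> carrier (A_sigma n m)"
   unfolding carrier
  proof (intro conjI bexI ballI)
   show "f \<in> regular_funs (Wh n m) ?P" unfolding f by (rule rs[OF regs_psi[OF nm Q]])
   show "(\<lambda>w\<in>?P. Q (psi' n m w)) \<in> regular_funs (Wh n m) ?P" by (rule rs[OF regs_psi'[OF nm Q]])
   show "(\<lambda>w\<in>?P. Q (psi' n m w)) w = f (sigma_rho n m w)" if "w \<in> sigma_dom n m" for w
    unfolding f using sigma_charts[OF nm that] by simp
  qed
 next
  assume "f \<in> carrier (A_sigma n m)"
  then obtain F where f: "f \<in> extensional ?P" "f \<in> ?R" and F: "F \<in> regular_funs (Wh n m) ?P"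
   "\<forall>w\<in>sigma_dom n m. F w = f (sigma_rho n m w)"
   unfolding carrier reg[of f] by (elim conjE bexE) (rule that)
  have F_reg: "F \<in> ?R" using F(1) unfolding reg by (rule conjunct2)
  have "\<exists>Q\<in>regs (quint_coords n m) ?T. \<forall>z\<in>?T.
    (cyclic_det n z \<noteq> 0 \<longrightarrow> Q z = f (psi_inv n m z)) \<and> (cocyclic_det m z \<noteq> 0 \<longrightarrow> Q z = F (psi'_inv n m z))"
  proof (rule hartogs_triangle[OF nm regs_psi_inv[OF nm f(2)] regs_psi'_inv[OF nm F_reg]])
   fix z assume z: "z \<in> ?T" "cyclic_det n z \<noteq> 0" "cocyclic_det m z \<noteq> 0"
   let ?w = "psi'_inv n m z"
   note w = psi'_inv_points[OF nm z(1,3)]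
   have dom: "?w \<in> sigma_dom n m" by (rule overlap_sigma_dom[OF nm w(1)]) (use w(2) z(2) in simp)
   note s = sigma_charts[OF nm dom]
   have "psi_inv n m z = sigma_rho n m ?w" using psi_points(3)[OF nm s(1)] unfolding s(2) w(2) .
   then show "f (psi_inv n m z) = F ?w" using bspec[OF F(2) dom] by simp
  qed
  then obtain Q where Q: "Q \<in> regs (quint_coords n m) ?T"
   "\<forall>z\<in>?T. (cyclic_det n z \<noteq> 0 \<longrightarrow> Q z = f (psi_inv n m z)) \<and> (cocyclic_det m z \<noteq> 0 \<longrightarrow> Q z = F (psi'_inv n m z))"
   by (rule bexE)
  have "f = (\<lambda>w\<in>?P. Q (psi n m w))"
  proof (rule extensionalityI[OF f(1) restrict_extensional])
   show "f w = (\<lambda>w\<in>?P. Q (psi n m w)) w" if w: "w \<in> ?P" for w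
    using bspec[OF Q(2) psi_points(1)[OF nm w]] psi_points(2,3)[OF nm w] w by simp
  qed
  with Q(1) show "\<exists>Q\<in>regs (quint_coords n m) ?T. f = (\<lambda>w\<in>?P. Q (psi n m w))" by (intro bexI[of _ Q])
 qed
qed

lemma psi_dense:
 assumes nm: "0 < n" "0 < m" and Q: "Q \<in> quint_regs n m"
  "Q' \<in> quint_regs n m"
  and eq: "\<And>w. w \<in> points (Wh n m) \<Longrightarrow> Q (psi n m w) = Q' (psi n m w)" and z: "z \<in> triangle_points m n"
 shows "Q z = Q' z"
proof -
 interpret function_ring "triangle_points m n" "quint_regs n m" by (rule regs_ring)
 have "Q z - Q' z = 0"
 proof (rule cyclic_dense[OF nm diff[OF Q] _ z])
  show "Q z - Q' z = 0" if "z \<in> triangle_points m n" "cyclic_det n z \<noteq> 0" for z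
   using eq[OF psi_inv_points(1)[OF nm that]] unfolding psi_inv_points(2)[OF nm that] by simp
 qed
 then show ?thesis by simp
qed

lemma fun_algebra_cring:
 assumes ext: "F \<subseteq> extensional U" and const: "\<And>c. (\<lambda>x\<in>U. c) \<in> F"
  and add: "\<And>f g. f \<in> F \<Longrightarrow> g \<in> F \<Longrightarrow> (\<lambda>x\<in>U. f x + g x) \<in> F"
  and mult: "\<And>f g. f \<in> F \<Longrightarrow> g \<in> F \<Longrightarrow> (\<lambda>x\<in>U. f x * g x) \<in> F"
 shows "cring (fun_algebra U F)"
proof (rule cringI)
 have restr: "(\<lambda>x\<in>U. f x) = f" if "f \<in> F" for f
  using that ext by (intro extensional_restrict) blast
 have uminus: "(\<lambda>x\<in>U. - f x) \<in> F" if "f \<in> F" for f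
  using mult[OF const[of "- 1"] that] by (simp cong: restrict_cong)
 show "abelian_group (fun_algebra U F)"
 proof (rule abelian_groupI; simp only: fun_algebra_def partial_object.simps ring.simps monoid.simps)
  fix f g h assume f: "f \<in> F"
  show "(\<lambda>x\<in>U. f x + g x) \<in> F" if "g \<in> F" by (rule add[OF f that])
  show "(\<lambda>x\<in>U. (\<lambda>x\<in>U. f x + g x) x + h x) = (\<lambda>x\<in>U. f x + (\<lambda>x\<in>U. g x + h x) x)"
   by (rule restrict_ext) simp
  show "(\<lambda>x\<in>U. f x + g x) = (\<lambda>x\<in>U. g x + f x)" by (rule restrict_ext) simp
  show "(\<lambda>x\<in>U. (\<lambda>x\<in>U. 0) x + f x) = f"
   by (subst restr[OF f, symmetric], rule restrict_ext) simp
  show "\<exists>g\<in>F. (\<lambda>x\<in>U. g x + f x) = (\<lambda>x\<in>U. 0)"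
   by (rule bexI[OF _ uminus[OF f]], rule restrict_ext) simp
 qed (rule const)
 show "comm_monoid (fun_algebra U F)"
 proof (rule comm_monoidI; simp only: fun_algebra_def partial_object.simps ring.simps monoid.simps)
  fix f g h assume f: "f \<in> F"
  show "(\<lambda>x\<in>U. f x * g x) \<in> F" if "g \<in> F" by (rule mult[OF f that])
  show "(\<lambda>x\<in>U. (\<lambda>x\<in>U. f x * g x) x * h x) = (\<lambda>x\<in>U. f x * (\<lambda>x\<in>U. g x * h x) x)"
   by (rule restrict_ext) simp
  show "(\<lambda>x\<in>U. (\<lambda>x\<in>U. 1) x * f x) = f"
   by (subst restr[OF f, symmetric], rule restrict_ext) simp
  show "(\<lambda>x\<in>U. f x * g x) = (\<lambda>x\<in>U. g x * f x)" by (rule restrict_ext) simp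
 qed (rule const)
 fix f g h
 show "(f \<oplus>\<^bsub>fun_algebra U F\<^esub> g) \<otimes>\<^bsub>fun_algebra U F\<^esub> h =
   f \<otimes>\<^bsub>fun_algebra U F\<^esub> h \<oplus>\<^bsub>fun_algebra U F\<^esub> g \<otimes>\<^bsub>fun_algebra U F\<^esub> h"
  unfolding fun_algebra_def by (simp, rule restrict_ext) (simp add: algebra_simps)
qed

text \<open>The regular function on the triangle part that corresponds to an element of the algebra; it is
 unique by \<open>psi_dense\<close>.\<close>

definition triangle_fun :: "nat \<Rightarrow> nat \<Rightarrow> (wh_point \<Rightarrow> complex) \<Rightarrow> quintuple \<Rightarrow> complex" where
 "triangle_fun n m f = (SOME Q. Q \<in> quint_regs n m \<and>
   (\<forall>w\<in>points (Wh n m). f w = Q (psi n m w)))"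

context
 fixes n m :: nat
 assumes nm: "0 < n" "0 < m"
begin

lemma triangle_fun:
 assumes "f \<in> carrier (A_sigma n m)"
 shows "triangle_fun n m f \<in> quint_regs n m"
  "w \<in> points (Wh n m) \<Longrightarrow> f w = triangle_fun n m f (psi n m w)"
proof -
 obtain Q where Q: "Q \<in> quint_regs n m" "f = (\<lambda>w\<in>points (Wh n m). Q (psi n m w))"
  using assms unfolding A_sigma_carrier[OF nm] by (elim bexE)
 have "Q \<in> quint_regs n m \<and> (\<forall>w\<in>points (Wh n m). f w = Q (psi n m w))"
  using Q by simp
 then have T: "triangle_fun n m f \<in> quint_regs n m \<and>
   (\<forall>w\<in>points (Wh n m). f w = triangle_fun n m f (psi n m w))"
  unfolding triangle_fun_def
  by (rule someI[of "\<lambda>Q. Q \<in> quint_regs n m \<and> (\<forall>w\<in>points (Wh n m). f w = Q (psi n m w))" Q])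
 show "triangle_fun n m f \<in> quint_regs n m" by (rule conjunct1[OF T])
 show "w \<in> points (Wh n m) \<Longrightarrow> f w = triangle_fun n m f (psi n m w)" by (rule bspec[OF conjunct2[OF T]])
qed

lemma triangle_fun_eqI:
 assumes Q: "Q \<in> quint_regs n m"
  and f: "\<And>w. w \<in> points (Wh n m) \<Longrightarrow> f w = Q (psi n m w)" "f \<in> extensional (points (Wh n m))"
 shows "f \<in> carrier (A_sigma n m)" "z \<in> triangle_points m n \<Longrightarrow> triangle_fun n m f z = Q z"
proof -
 have "f = (\<lambda>w\<in>points (Wh n m). Q (psi n m w))"
  by (rule extensionalityI[OF f(2) restrict_extensional]) (simp add: f(1))
 with Q show A: "f \<in> carrier (A_sigma n m)" unfolding A_sigma_carrier[OF nm] by (intro bexI[of _ Q])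
 show "triangle_fun n m f z = Q z" if "z \<in> triangle_points m n"
  by (rule psi_dense[OF nm triangle_fun(1)[OF A] Q _ that]) (simp add: f(1) flip: triangle_fun(2)[OF A])
qed

lemma A_sigma_extensional: "f \<in> carrier (A_sigma n m) \<Longrightarrow> f \<in> extensional (points (Wh n m))"
 unfolding A_sigma_carrier[OF nm] by (elim bexE) simp

interpretation T: function_ring "triangle_points m n" "quint_regs n m"
 by (rule regs_ring)

lemma triangle_fun_add:
 assumes "f \<in> carrier (A_sigma n m)" "g \<in> carrier (A_sigma n m)"
 shows "(\<lambda>w\<in>points (Wh n m). f w + g w) \<in> carrier (A_sigma n m)"
  "z \<in> triangle_points m n \<Longrightarrow> triangle_fun n m (\<lambda>w\<in>points (Wh n m). f w + g w) z = triangle_fun n m f z + triangle_fun n m g z"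
 by (rule triangle_fun_eqI[OF T.add[OF triangle_fun(1)[OF assms(1)] triangle_fun(1)[OF assms(2)]]];
   simp add: triangle_fun(2)[OF assms(1)] triangle_fun(2)[OF assms(2)])+

lemma triangle_fun_mult:
 assumes "f \<in> carrier (A_sigma n m)" "g \<in> carrier (A_sigma n m)"
 shows "(\<lambda>w\<in>points (Wh n m). f w * g w) \<in> carrier (A_sigma n m)"
  "z \<in> triangle_points m n \<Longrightarrow> triangle_fun n m (\<lambda>w\<in>points (Wh n m). f w * g w) z = triangle_fun n m f z * triangle_fun n m g z"
 by (rule triangle_fun_eqI[OF T.mult[OF triangle_fun(1)[OF assms(1)] triangle_fun(1)[OF assms(2)]]];
   simp add: triangle_fun(2)[OF assms(1)] triangle_fun(2)[OF assms(2)])+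

lemma triangle_fun_const:
 "(\<lambda>w\<in>points (Wh n m). c) \<in> carrier (A_sigma n m)"
 "z \<in> triangle_points m n \<Longrightarrow> triangle_fun n m (\<lambda>w\<in>points (Wh n m). c) z = c"
 by (rule triangle_fun_eqI[OF T.const]; simp)+

lemma triangle_fun_smult:
 assumes "f \<in> carrier (A_sigma n m)"
 shows "(\<lambda>w\<in>points (Wh n m). c * f w) \<in> carrier (A_sigma n m)"
  "z \<in> triangle_points m n \<Longrightarrow> triangle_fun n m (\<lambda>w\<in>points (Wh n m). c * f w) z = c * triangle_fun n m f z"
 by (rule triangle_fun_eqI[OF T.mult[OF T.const[of c] triangle_fun(1)[OF assms]]]; simp add: triangle_fun(2)[OF assms])+

lemma triangle_fun_act:
 assumes f: "f \<in> carrier (A_sigma n m)" and \<gamma>: "\<gamma> \<in> GL n \<times> GL m"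
 shows "(\<lambda>w\<in>points (Wh n m). f (wh_act \<gamma> w)) \<in> carrier (A_sigma n m)"
  "z \<in> triangle_points m n \<Longrightarrow>
   triangle_fun n m (\<lambda>w\<in>points (Wh n m). f (wh_act \<gamma> w)) z = triangle_fun n m f (triangle_act \<gamma> z)"
 by (rule triangle_fun_eqI[OF regs_triangle_act[OF \<gamma> triangle_fun(1)[OF f]]];
   simp add: psi_equivariant[OF nm _ \<gamma>] triangle_fun(2)[OF f])+

lemma A_sigma_cring: "cring (A_sigma n m)"
proof -
 have "cring (fun_algebra (points (Wh n m)) (carrier (A_sigma n m)))"
  by (rule fun_algebra_cring) (use A_sigma_extensional triangle_fun_const(1) triangle_fun_add(1) triangle_fun_mult(1) in auto)
 then show ?thesis unfolding A_sigma_def fun_algebra_def by simp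
qed

lemma A_sigma_ops:
 "f \<oplus>\<^bsub>A_sigma n m\<^esub> g = (\<lambda>w\<in>points (Wh n m). f w + g w)" "f \<otimes>\<^bsub>A_sigma n m\<^esub> g = (\<lambda>w\<in>points (Wh n m). f w * g w)"
 "\<zero>\<^bsub>A_sigma n m\<^esub> = (\<lambda>w\<in>points (Wh n m). 0)" "\<one>\<^bsub>A_sigma n m\<^esub> = (\<lambda>w\<in>points (Wh n m). 1)"
 "c \<odot>\<^bsub>A_sigma n m\<^esub> f = (\<lambda>w\<in>points (Wh n m). c * f w)"
 unfolding A_sigma_def fun_algebra_def by simp_all

lemma A_sigma_model:
 assumes "affine_set (quint_coords n m) (quint_space n m) D (triangle_points m n)"
 shows "function_model (triangle_variety m n) (quint_space n m) D (A_sigma n m) (triangle_fun n m)"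
proof -
 have pts: "points (triangle_variety m n) = triangle_points m n" unfolding triangle_variety_def by simp
 show ?thesis
 proof (rule function_model.intro; (unfold pts A_sigma_ops)?)
  show "f = g" if fg: "f \<in> carrier (A_sigma n m)" "g \<in> carrier (A_sigma n m)"
   and eq: "\<And>z. z \<in> triangle_points m n \<Longrightarrow> triangle_fun n m f z = triangle_fun n m g z" for f g
   by (rule extensionalityI[OF A_sigma_extensional[OF fg(1)] A_sigma_extensional[OF fg(2)]])
    (simp add: triangle_fun(2)[OF fg(1)] triangle_fun(2)[OF fg(2)] eq[OF psi_points(1)[OF nm]])
  show "\<exists>f\<in>carrier (A_sigma n m). \<forall>z\<in>triangle_points m n. triangle_fun n m f z = Q z"
   if Q: "Q \<in> quint_regs n m" for Q
  proof (rule bexI, rule ballI)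
   show "(\<lambda>w\<in>points (Wh n m). Q (psi n m w)) \<in> carrier (A_sigma n m)"
    by (rule triangle_fun_eqI(1)[OF Q]) simp_all
   show "triangle_fun n m (\<lambda>w\<in>points (Wh n m). Q (psi n m w)) z = Q z" if "z \<in> triangle_points m n" for z
    by (rule triangle_fun_eqI(2)[OF Q _ _ that]) simp_all
  qed
 qed (rule assms A_sigma_cring triangle_fun_add(2) triangle_fun_mult(2) triangle_fun_const(2) triangle_fun_smult triangle_fun(1);
   assumption)+
qed

end

theorem theorem2p1:
 fixes m n :: nat
 assumes "0 < m" and "0 < n"
 shows "equivariantly_isomorphic (GL n \<times> GL m)
      (Spec (A_sigma n m)) (spec_act n m)
      (scheme_of (triangle_variety m n))
      (\<lambda>\<gamma>. scheme_map_of (triangle_variety m n) (triangle_variety m n) (triangle_act \<gamma>))"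
proof -
 note nm = assms(2,1)
 have pts: "points (triangle_variety m n) = triangle_points m n" unfolding triangle_variety_def by simp
 obtain D where "affine_set (quint_coords n m) (quint_space n m) D (triangle_points m n)"
  by (rule triangle_affine[of m n]) (rule that)
 then interpret function_model "triangle_variety m n" "quint_space n m" D "A_sigma n m" "triangle_fun n m"
  by (rule A_sigma_model[OF nm])
 have "rs_map_eq (Spec (A_sigma n m)) (scheme_of (triangle_variety m n))
   (rs_comp (Spec (A_sigma n m)) spec_iso (spec_act n m \<gamma>))
   (rs_comp (scheme_of (triangle_variety m n))
    (scheme_map_of (triangle_variety m n) (triangle_variety m n) (triangle_act \<gamma>)) spec_iso)"
  if \<gamma>: "\<gamma> \<in> GL n \<times> GL m" for \<gamma>
  unfolding spec_act_def
 proof (rule spec_iso_equivariant)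
  fix f z assume f: "f \<in> carrier (A_sigma n m)"
  show "(\<lambda>w\<in>points (Wh n m). f (wh_act \<gamma> w)) \<in> carrier (A_sigma n m)"
   by (rule triangle_fun_act(1)[OF nm f \<gamma>])
  assume "z \<in> points (triangle_variety m n)"
  then show "triangle_fun n m (\<lambda>w\<in>points (Wh n m). f (wh_act \<gamma> w)) z = triangle_fun n m f (triangle_act \<gamma> z)"
   unfolding pts by (rule triangle_fun_act(2)[OF nm f \<gamma>])
 next
  fix z assume "z \<in> points (triangle_variety m n)"
  then show "triangle_act \<gamma> z \<in> points (triangle_variety m n)"
   unfolding pts by (rule triangle_act_points[OF _ \<gamma>])
 qed
 with spec_iso show ?thesis unfolding equivariantly_isomorphic_def by (intro exI conjI ballI)
qed

end
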